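(* Let $Q=(-10,10)^n\times(0,10]$, $J_1=(-1,1)^n\times(0,\tfrac12]$ and $J_2=(-1,1)^n\times(9,10]$. Let $q>n+2$, $p_1<p\le q$, $f\in L^p_+(Q)$ and $\mu\in L^q_+(Q)$. There exist constants $\varepsilon_0>0$ and $C_0>0$, depending only on $n,\Lambda,\lambda,p,q,\|\mu\|_{L^q(Q)}$, such that every nonnegative $L^p$-viscosity supersolution $u$ of $$u_t+\mathcal P^+(D^2u)+\mu|Du|+f=0\quad\text{in }Q$$ satisfies $$\left(\int_{J_1}u^{\varepsilon_0}\,dx\,dt\right)^{1/\varepsilon_0}\le C_0\left(\inf_{J_2}u+\|f\|_{L^p(Q)}\right).$$
   Context: Fix $n\in\mathbb N$ and constants $0<\lambda\le\Lambda<\infty$. $\mathbb S^n$ is the set of real symmetric $n\times n$ matrices with the usual order. The Pucci operators are $\mathcal P^+(X)=\max\{-\mathrm{Tr}(AX): A\in\mathbb S^n,\ \lambda I\le A\le\Lambda I\}$ and $\mathcal P^-(X)=\min\{-\mathrm{Tr}(AX): A\in\mathbb S^n,\ \lambda I\le A\le\Lambda I\}$ for $X\in\mathbb S^n$. $Du$, $D^2u$ are the first and second derivatives in the space variable $x$, and $u_t$ is the time derivative. $L^p_+(Q)$ is the set of nonnegative functions in $L^p(Q)$. For $Q=\Omega\times(0,T]$ the parabolic boundary is $\partial_pQ=(\Omega\times\{0\})\cup(\partial\Omega\times[0,T))$. The parabolic distance is $d((x,t),(y,s))=\sqrt{|x-y|^2+|t-s|}$, and $Q'\Subset Q$ means that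 the parabolic distance from $Q'$ to $\partial_pQ$ is positive. $W^{2,1}_p(Q)$ is the set of $f\in L^p(Q)$ with weak derivatives $f_t,f_{x_k},f_{x_kx_\ell}\in L^p(Q)$, with norm the sum of the $L^p$ norms of $f$ and of these derivatives; $W^{2,1}_{p,\mathrm{loc}}(Q)$ consists of functions in $W^{2,1}_p(Q')$ for all $Q'\Subset Q$. Set $Q_r(x,t)=(x,t)+(-r,r)^n\times(-r^2,0]$. $L^p$-viscosity sub/supersolutions: $u\in C(Q)$ is an $L^p$-viscosity subsolution (resp. supersolution) of $u_t+F(x,t,Du,D^2u)=0$ in $Q$ if for every $\phi\in W^{2,1}_{p,\mathrm{loc}}(Q)$ and every $(x,t)\in Q$ such that $u-\phi$ attains a maximum (resp. minimum) at $(x,t)$ over some cylinder $Q_r(x,t)\subset Q$, one has $\lim_{\varepsilon\to0}\operatorname{ess\,inf}_{(y,s)\in Q_\varepsilon(x,t)}\{\phi_t+F(y,s,D\phi,D^2\phi)\}\le0$ (resp. $\lim_{\varepsilon\to0}\operatorname{ess\,sup}_{(y,s)\in Q_\varepsilon(x,t)}\{\phi_t+F(y,s,D\phi,D^2\phi)\}\ge0$). Dependence on $\|\mu\|_{L^q(Q)}$ is meant in the sense that the same constants $\varepsilon_0,C_0$ work for every $\hat\mu\in L^q_+(Q)$ with $\|\hat\mu\|_{L^q(Q)}\le\|\mu\|_{L^q(Q)}$ in place of $\mu$. $p_1=p_1(n,\Lambda/\lambda)\in[\frac{n+2}2,n+1)$ is the constant giving the range $p>p_1$ of exponents for which the Aleksandrov-Bakelman-Pucci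 maximum principle holds, i.e. for every $p>p_1$ there is $C=C(n,\Lambda,\lambda,p)$ such that, with $Q^*=\{|x|<1\}\times(0,1]$, for every $f\in L^p(Q^* )$ there is $u\in C(\overline{Q^*})\cap W^{2,1}_{p,\mathrm{loc}}(Q^* )$ with $u_t+\mathcal P^+(D^2u)=f$ a.e. in $Q^*$, $u=0$ on $\partial_pQ^*$, $-C\|f^-\|_{L^p(Q^* )}\le u\le C\|f^+\|_{L^p(Q^* )}$, and $\|u\|_{W^{2,1}_p(Q')}\le C'\|f\|_{L^p(Q^* )}$ for every $Q'\Subset Q^*$, where $C'$ depends only on $n,\Lambda,\lambda,p$ and the distance of $Q'$ to $\partial_pQ^*$. *)

theory Defs
  imports "HOL-Analysis.Analysis" "HOL-Probability.Essential_Supremum"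
begin

text \<open>Space-time is the type \<open>(real ^ 'n) \<times> real\<close>, with \<open>n = CARD('n)\<close>.  Functions on a subset \<open>Q\<close>
  are total functions of which only the values on \<open>Q\<close> matter.\<close>

definition sym_le :: "real ^ 'n ^ 'n \<Rightarrow> real ^ 'n ^ 'n \<Rightarrow> bool" where
  "sym_le A B \<longleftrightarrow> (\<forall>\<xi>. \<xi> \<bullet> (A *v \<xi>) \<le> \<xi> \<bullet> (B *v \<xi>))"

text \<open>The admissible matrices form a nonempty compact set when \<open>0 < lam \<le> Lam\<close>, so the supremum
  is a maximum.\<close>

definition pucci_plus :: "real \<Rightarrow> real \<Rightarrow> real ^ 'n ^ 'n \<Rightarrow> real" where
  "pucci_plus lam Lam X = Sup {- trace (A ** X) | A :: real ^ 'n ^ 'n.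
     transpose A = A \<and> sym_le (lam *\<^sub>R mat 1) A \<and> sym_le A (Lam *\<^sub>R mat 1)}"

definition in_Lp :: "real \<Rightarrow> 'a :: euclidean_space set \<Rightarrow> ('a \<Rightarrow> real) \<Rightarrow> bool" where
  "in_Lp p Q f \<longleftrightarrow> f \<in> borel_measurable (lebesgue_on Q)
     \<and> integrable (lebesgue_on Q) (\<lambda>z. \<bar>f z\<bar> powr p)"

definition Lp_norm :: "real \<Rightarrow> 'a :: euclidean_space set \<Rightarrow> ('a \<Rightarrow> real) \<Rightarrow> real" where
  "Lp_norm p Q f = (integral\<^sup>L (lebesgue_on Q) (\<lambda>z. \<bar>f z\<bar> powr p)) powr (1 / p)"

definition in_Lp_plus :: "real \<Rightarrow> 'a :: euclidean_space set \<Rightarrow> ('a \<Rightarrow> real) \<Rightarrow> bool" where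
  "in_Lp_plus p Q f \<longleftrightarrow> in_Lp p Q f \<and> (AE z in lebesgue_on Q. 0 \<le> f z)"

definition cylinder :: "(real ^ 'n) set \<Rightarrow> real \<Rightarrow> ((real ^ 'n) \<times> real) set" where
  "cylinder \<Omega> T = \<Omega> \<times> {0<..T}"

definition parabolic_boundary :: "(real ^ 'n) set \<Rightarrow> real \<Rightarrow> ((real ^ 'n) \<times> real) set" where
  "parabolic_boundary \<Omega> T = \<Omega> \<times> {0} \<union> frontier \<Omega> \<times> {0..<T}"

definition pcyl :: "real \<Rightarrow> (real ^ 'n) \<times> real \<Rightarrow> ((real ^ 'n) \<times> real) set" where
  "pcyl r z = (+) z ` (box (vec (- r)) (vec r) \<times> {- (r\<^sup>2)<..0})"

definition parabolic_dist :: "(real ^ 'n) \<times> real \<Rightarrow> (real ^ 'n) \<times> real \<Rightarrow> real" where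
  "parabolic_dist z w = sqrt ((norm (fst z - fst w))\<^sup>2 + \<bar>snd z - snd w\<bar>)"

definition parabolic_setdist ::
    "((real ^ 'n) \<times> real) set \<Rightarrow> ((real ^ 'n) \<times> real) set \<Rightarrow> ereal" where
  "parabolic_setdist A B = (INF z\<in>A. INF w\<in>B. ereal (parabolic_dist z w))"

definition compactly_inside ::
    "((real ^ 'n) \<times> real) set \<Rightarrow> (real ^ 'n) set \<Rightarrow> real \<Rightarrow> bool" where
  "compactly_inside Q' \<Omega> T \<longleftrightarrow> Q' \<in> sets lebesgue \<and> Q' \<subseteq> cylinder \<Omega> T
     \<and> 0 < parabolic_setdist Q' (parabolic_boundary \<Omega> T)"

primrec C_k :: "nat \<Rightarrow> ('a :: euclidean_space \<Rightarrow> real) \<Rightarrow> bool" where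
  "C_k 0 f \<longleftrightarrow> continuous_on UNIV f"
| "C_k (Suc k) f \<longleftrightarrow> (\<forall>z. f differentiable (at z))
     \<and> (\<forall>b\<in>Basis. C_k k (\<lambda>z. frechet_derivative f (at z) b))"

definition test_fun :: "'a :: euclidean_space set \<Rightarrow> ('a \<Rightarrow> real) \<Rightarrow> bool" where
  "test_fun U \<psi> \<longleftrightarrow> (\<forall>k. C_k k \<psi>) \<and> (\<exists>K. compact K \<and> K \<subseteq> U \<and> (\<forall>z. z \<notin> K \<longrightarrow> \<psi> z = 0))"

definition weak_deriv ::
    "'a :: euclidean_space set \<Rightarrow> 'a \<Rightarrow> ('a \<Rightarrow> real) \<Rightarrow> ('a \<Rightarrow> real) \<Rightarrow> bool" where
  "weak_deriv U e f g \<longleftrightarrow> (\<forall>\<psi>. test_fun U \<psi> \<longrightarrow>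
     integral\<^sup>L (lebesgue_on U) (\<lambda>z. f z * frechet_derivative \<psi> (at z) e)
       = - integral\<^sup>L (lebesgue_on U) (\<lambda>z. g z * \<psi> z))"

text \<open>\<open>W21 p Q f ft Df D2f\<close>: \<open>f\<close> belongs to \<open>W\<^sup>2\<^sup>,\<^sup>1\<^sub>p(Q)\<close> with weak derivatives \<open>ft\<close>, \<open>Df\<close>, \<open>D2f\<close>.
  Since parabolic cylinders contain their top face, the weak derivatives are taken in the interior.
  The derivatives are arguments because they are only determined up to null sets.\<close>

definition W21 :: "real \<Rightarrow> ((real ^ 'n) \<times> real) set \<Rightarrow> ((real ^ 'n) \<times> real \<Rightarrow> real)
    \<Rightarrow> ((real ^ 'n) \<times> real \<Rightarrow> real) \<Rightarrow> ((real ^ 'n) \<times> real \<Rightarrow> real ^ 'n)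
    \<Rightarrow> ((real ^ 'n) \<times> real \<Rightarrow> real ^ 'n ^ 'n) \<Rightarrow> bool" where
  "W21 p Q f ft Df D2f \<longleftrightarrow>
     in_Lp p Q f \<and> in_Lp p Q ft
     \<and> (\<forall>k. in_Lp p Q (\<lambda>z. Df z $ k)) \<and> (\<forall>k l. in_Lp p Q (\<lambda>z. D2f z $ k $ l))
     \<and> weak_deriv (interior Q) (0, 1) f ft
     \<and> (\<forall>k. weak_deriv (interior Q) (axis k 1, 0) f (\<lambda>z. Df z $ k))
     \<and> (\<forall>k l. weak_deriv (interior Q) (axis l 1, 0) (\<lambda>z. Df z $ k) (\<lambda>z. D2f z $ k $ l))"

definition W21_norm :: "real \<Rightarrow> ((real ^ 'n) \<times> real) set \<Rightarrow> ((real ^ 'n) \<times> real \<Rightarrow> real)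
    \<Rightarrow> ((real ^ 'n) \<times> real \<Rightarrow> real) \<Rightarrow> ((real ^ 'n) \<times> real \<Rightarrow> real ^ 'n)
    \<Rightarrow> ((real ^ 'n) \<times> real \<Rightarrow> real ^ 'n ^ 'n) \<Rightarrow> real" where
  "W21_norm p Q f ft Df D2f = Lp_norm p Q f + Lp_norm p Q ft
     + (\<Sum>k\<in>UNIV. Lp_norm p Q (\<lambda>z. Df z $ k))
     + (\<Sum>k\<in>UNIV. \<Sum>l\<in>UNIV. Lp_norm p Q (\<lambda>z. D2f z $ k $ l))"

definition W21_loc :: "real \<Rightarrow> (real ^ 'n) set \<Rightarrow> real \<Rightarrow> ((real ^ 'n) \<times> real \<Rightarrow> real)
    \<Rightarrow> ((real ^ 'n) \<times> real \<Rightarrow> real) \<Rightarrow> ((real ^ 'n) \<times> real \<Rightarrow> real ^ 'n)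
    \<Rightarrow> ((real ^ 'n) \<times> real \<Rightarrow> real ^ 'n ^ 'n) \<Rightarrow> bool" where
  "W21_loc p \<Omega> T f ft Df D2f \<longleftrightarrow>
     (\<forall>Q'. compactly_inside Q' \<Omega> T \<longrightarrow> W21 p Q' f ft Df D2f)"

text \<open>\<open>L\<^sup>p\<close>-viscosity supersolutions of \<open>u\<^sub>t + F(x, t, Du, D\<^sup>2u) = 0\<close> in \<open>\<Omega> \<times> (0, T]\<close>.  Touching at a
  point only makes sense for the continuous representative of the test function \<open>\<phi>\<close>, which exists
  for \<open>p > (n + 2) / 2\<close>; hence the explicit continuity requirement.\<close>

definition Lp_viscosity_supersolution :: "real \<Rightarrow> (real ^ 'n) set \<Rightarrow> real
    \<Rightarrow> ((real ^ 'n) \<times> real \<Rightarrow> real ^ 'n \<Rightarrow> real ^ 'n ^ 'n \<Rightarrow> real)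
    \<Rightarrow> ((real ^ 'n) \<times> real \<Rightarrow> real) \<Rightarrow> bool" where
  "Lp_viscosity_supersolution p \<Omega> T F u \<longleftrightarrow>
     continuous_on (cylinder \<Omega> T) u
     \<and> (\<forall>\<phi> \<phi>t D\<phi> D2\<phi>. \<forall>z\<in>cylinder \<Omega> T.
          W21_loc p \<Omega> T \<phi> \<phi>t D\<phi> D2\<phi> \<longrightarrow> continuous_on (cylinder \<Omega> T) \<phi> \<longrightarrow>
          (\<exists>r>0. pcyl r z \<subseteq> cylinder \<Omega> T \<and> (\<forall>w\<in>pcyl r z. u z - \<phi> z \<le> u w - \<phi> w)) \<longrightarrow>
          0 \<le> Lim (at_right 0) (\<lambda>\<epsilon>::real. esssup (lebesgue_on (pcyl \<epsilon> z))
                  (\<lambda>w. ereal (\<phi>t w + F w (D\<phi> w) (D2\<phi> w)))))"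

text \<open>\<open>p1\<close> gives a range \<open>p > p1\<close> of exponents for which the Aleksandrov-Bakelman-Pucci maximum
  principle holds on \<open>Q\<^sup>* = {|x| < 1} \<times> (0, 1]\<close>.  The interior constant \<open>C'\<close> is a function of the
  parabolic distance of \<open>Q'\<close> to the parabolic boundary.\<close>

definition ABP_exponent :: "'n :: finite itself \<Rightarrow> real \<Rightarrow> real \<Rightarrow> real \<Rightarrow> bool" where
  "ABP_exponent _ lam Lam p1 \<longleftrightarrow>
     (real CARD('n) + 2) / 2 \<le> p1 \<and> p1 < real CARD('n) + 1 \<and>
     (let \<Omega> = ball (0 :: real ^ 'n) 1; Q = cylinder \<Omega> 1 in
       \<forall>p>p1. \<exists>C :: real. \<exists>C' :: ereal \<Rightarrow> real. \<forall>f. in_Lp p Q f \<longrightarrow>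
         (\<exists>u ut Du D2u. continuous_on (closure Q) u \<and> W21_loc p \<Omega> 1 u ut Du D2u
            \<and> (AE z in lebesgue_on Q. ut z + pucci_plus lam Lam (D2u z) = f z)
            \<and> (\<forall>z\<in>parabolic_boundary \<Omega> 1. u z = 0)
            \<and> (\<forall>z\<in>Q. - C * Lp_norm p Q (\<lambda>w. max (- f w) 0) \<le> u z
                   \<and> u z \<le> C * Lp_norm p Q (\<lambda>w. max (f w) 0))
            \<and> (\<forall>Q'. compactly_inside Q' \<Omega> 1 \<longrightarrow>
                 W21_norm p Q' u ut Du D2u
                   \<le> C' (parabolic_setdist Q' (parabolic_boundary \<Omega> 1)) * Lp_norm p Q f)))"

end

theory Submission
  imports Defs "HOL-Real_Asymp.Real_Asymp"
begin

text \<open>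
  Only test functions supplied by the maximum principle hypothesis are used; no maximum principle for
  viscosity solutions is needed.  Solving \<open>v\<^sub>t + P(D\<^sup>2v) = - g\<close> and iterating with \<open>g = \<mu> \<bar>Dv\<bar>\<close> gives, for
  small \<open>\<mu>\<close>, strong subsolutions \<open>v\<close> of the equation with drift; the drift term is controlled in \<open>L\<^sup>p\<close> because
  dyadic averages of \<open>Dv\<close> differ by averages of \<open>v\<^sub>t\<close> and \<open>D\<^sup>2v\<close>.  Adding such a \<open>v\<close> to the barrier
  \<open>(c s - \<bar>x\<bar>\<^sup>2)\<^sup>2 exp (- \<kappa> s)\<close> produces a strict subsolution in a paraboloid, outside a set of small measure at
  its tip.  It cannot touch a supersolution from below, so a supersolution that is at least \<open>L\<close> on most of a
  parabolic cube is at least \<open>\<eta> L\<close> later on.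

  A parabolic dyadic cube in which \<open>u > L\<close> has density close to one forces \<open>u \<ge> \<eta>\<^sup>2 L\<close> on a stack above its
  parent; stacking increases measure, so the superlevel sets at the levels \<open>L, \<eta>\<^sup>3 L, \<eta>\<^sup>6 L, \<dots>\<close> grow
  geometrically, unless some dense cube is so large that its lower bound propagates to all of \<open>J2\<close>.
  Hence \<open>\<bar>{u > L} \<inter> J1\<bar>\<close> decays like a power of \<open>L / (inf u + \<parallel>f\<parallel>)\<close>.
\<close>

text \<open>The hypothesis \<open>ABP_exponent\<close> supplies solutions of the driftless equation
  on one cylinder, and all test functions are built from them and one explicit barrier by
  superposition: \<open>pucci_plus\<close> is a supremum of linear functions, hence subadditive and
  positively homogeneous, so sums and positive multiples of strong subsolutions are strong
  subsolutions. The obstacle is the drift. Scaling by R multiplies the norm of \<mu> by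
  \<open>R powr (1 - (n + 2) / q)\<close>; as q > n + 2, \<mu> becomes small below a scale R that
  depends only on its norm, and the same positive exponent makes the dyadic series for the gradient
  converge. Lower bounds are thus available only below a fixed scale. This is why the cubes start at
  a generation \<open>g0\<close>, and why J2 is reached by a chain of a fixed number N of steps of
  that scale. Each round of the covering raises the starting generation by one: the time windows
  then grow by a convergent geometric series and stay below time 2, at the cost of one more factor
  \<eta> besides the three lost in the stacking step.\<close>

abbreviation (input) "borel_fun \<equiv> borel_measurable borel"
abbreviation (input) "vol A \<equiv> emeasure lborel A"

section \<open>Pucci operators\<close>

definition ell :: "real \<Rightarrow> real \<Rightarrow> (real ^ 'n ^ 'n) set" where
  "ell lam Lam = {A. transpose A = A \<and> sym_le (lam *\<^sub>R mat 1) A \<and> sym_le A (Lam *\<^sub>R mat 1)}"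

lemma pucci_plus_ell: "pucci_plus lam Lam X = Sup ((\<lambda>A. - trace (A ** X)) ` ell lam Lam)"
  unfolding pucci_plus_def ell_def by (rule arg_cong[where f=Sup]) blast

lemma inner_scaled_mat1: "\<xi> \<bullet> ((c *\<^sub>R mat 1) *v \<xi>) = c * (norm (\<xi>::real^'n))\<^sup>2"
  by (simp add: scaleR_matrix_vector_assoc[symmetric] dot_square_norm)

lemma ell_lower: "A \<in> ell lam Lam \<Longrightarrow> lam * (norm \<xi>)\<^sup>2 \<le> \<xi> \<bullet> (A *v \<xi>)"
  unfolding ell_def sym_le_def by (auto simp: inner_scaled_mat1)

lemma ell_upper: "A \<in> ell lam Lam \<Longrightarrow> \<xi> \<bullet> (A *v \<xi>) \<le> Lam * (norm \<xi>)\<^sup>2"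
  unfolding ell_def sym_le_def by (auto simp: inner_scaled_mat1)

lemma quad_axis: "axis i 1 \<bullet> ((A::real^'n^'n) *v axis j 1) = A $ i $ j"
  by (simp add: matrix_vector_mult_basis inner_axis' column_def)

lemma ell_diag:
  assumes "A \<in> ell lam Lam" shows "lam \<le> A $ i $ i" "A $ i $ i \<le> Lam"
  using ell_lower[OF assms, of "axis i 1"] ell_upper[OF assms, of "axis i 1"]
  by (simp_all add: quad_axis)

text \<open>Positivity of the quadratic form at e_i + e_j and e_i - e_j gives 2 |A_ij| \<le> A_ii +
  A_jj, and the diagonal is at most \<open>Lam\<close>.\<close>

lemma ell_entry:
  assumes "0 < lam" and A: "A \<in> ell lam Lam" shows "\<bar>A $ i $ j\<bar> \<le> Lam"
proof -
  have sym: "A $ j $ i = A $ i $ j"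
    using A unfolding ell_def transpose_def by (auto simp: vec_eq_iff)
  have e: "0 \<le> \<xi> \<bullet> (A *v \<xi>)" for \<xi>
    using ell_lower[OF A, of \<xi>] assms(1) by (meson mult_nonneg_nonneg less_imp_le order_trans zero_le_power2)
  have 1: "0 \<le> A $ i $ i + A $ j $ j + 2 * A $ i $ j"
    using e[of "axis i 1 + axis j 1"]
    by (simp add: matrix_vector_right_distrib inner_add_left inner_add_right quad_axis sym)
  have 2: "0 \<le> A $ i $ i + A $ j $ j - 2 * A $ i $ j"
    using e[of "axis i 1 - axis j 1"]
    by (simp add: matrix_vector_mult_diff_distrib inner_diff_left inner_diff_right quad_axis sym)
  show ?thesis using 1 2 ell_diag(2)[OF A, of i] ell_diag(2)[OF A, of j] by linarith
qed

lemma mat_in_ell: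
  assumes "lam \<le> Lam" shows "lam *\<^sub>R (mat 1 :: real^'n^'n) \<in> ell lam Lam"
proof -
  have "transpose (lam *\<^sub>R (mat 1 :: real^'n^'n)) = lam *\<^sub>R mat 1"
    by (simp add: transpose_def vec_eq_iff mat_def)
  moreover have "\<xi> \<bullet> ((lam *\<^sub>R mat 1) *v \<xi>) \<le> \<xi> \<bullet> ((Lam *\<^sub>R mat 1) *v \<xi>)" for \<xi> :: "real^'n"
    unfolding inner_scaled_mat1 using assms by (intro mult_right_mono) auto
  ultimately show ?thesis
    unfolding ell_def sym_le_def by simp
qed

lemma trace_matrix_mult: "trace ((A::real^'n^'n) ** X) = (\<Sum>i\<in>UNIV. \<Sum>j\<in>UNIV. A $ i $ j * X $ j $ i)"
  by (simp add: trace_def matrix_matrix_mult_def)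

lemma ell_trace_bound:
  assumes "0 < lam" and A: "A \<in> ell lam Lam"
  shows "\<bar>trace (A ** X)\<bar> \<le> Lam * (\<Sum>i\<in>UNIV. \<Sum>j\<in>UNIV. \<bar>X $ i $ j\<bar>)"
proof -
  have "\<bar>trace (A ** X)\<bar> \<le> (\<Sum>i\<in>UNIV. \<Sum>j\<in>UNIV. \<bar>A $ i $ j * X $ j $ i\<bar>)"
    unfolding trace_matrix_mult by (rule order_trans[OF sum_abs]) (intro sum_mono sum_abs)
  also have "\<dots> \<le> (\<Sum>i\<in>UNIV. \<Sum>j\<in>UNIV. Lam * \<bar>X $ j $ i\<bar>)"
    using ell_entry[OF assms] by (intro sum_mono) (simp add: abs_mult mult_right_mono)
  also have "\<dots> = Lam * (\<Sum>j\<in>UNIV. \<Sum>i\<in>UNIV. \<bar>X $ j $ i\<bar>)"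
    by (subst sum.swap) (simp add: sum_distrib_left)
  finally show ?thesis .
qed

context
  fixes lam Lam :: real
  assumes lam: "0 < lam" "lam \<le> Lam"
begin

lemma pucci_upper: "A \<in> ell lam Lam \<Longrightarrow> - trace (A ** X) \<le> pucci_plus lam Lam X"
  unfolding pucci_plus_ell
  by (rule cSUP_upper, assumption, rule bdd_aboveI2[where M = "Lam * (\<Sum>i\<in>UNIV. \<Sum>j\<in>UNIV. \<bar>X $ i $ j\<bar>)"])
    (use ell_trace_bound[OF lam(1), of _ Lam X] in \<open>auto simp: abs_le_iff\<close>)

lemma pucci_least: "(\<And>A. A \<in> ell lam Lam \<Longrightarrow> - trace (A ** X) \<le> c) \<Longrightarrow> pucci_plus lam Lam X \<le> c"
  unfolding pucci_plus_ell using mat_in_ell[OF lam(2)] by (intro cSup_least) auto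

lemma pucci_add: "pucci_plus lam Lam (X + Y) \<le> pucci_plus lam Lam X + pucci_plus lam Lam Y"
proof (rule pucci_least)
  fix A :: "real^'a^'a" assume A: "A \<in> ell lam Lam"
  have "- trace (A ** (X + Y)) = - trace (A ** X) + - trace (A ** Y)"
    by (simp add: trace_matrix_mult distrib_left sum.distrib)
  then show "- trace (A ** (X + Y)) \<le> pucci_plus lam Lam X + pucci_plus lam Lam Y"
    using pucci_upper[OF A, of X] pucci_upper[OF A, of Y] by linarith
qed

lemma pucci_scale_le: "0 \<le> c \<Longrightarrow> pucci_plus lam Lam (c *\<^sub>R X) \<le> c * pucci_plus lam Lam X"
proof (rule pucci_least)
  fix A :: "real^'a^'a" assume A: "A \<in> ell lam Lam" and c: "0 \<le> c"
  have "- trace (A ** (c *\<^sub>R X)) = c * (- trace (A ** X))"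
    by (simp add: trace_matrix_mult sum_distrib_left mult_ac)
  then show "- trace (A ** (c *\<^sub>R X)) \<le> c * pucci_plus lam Lam X"
    using mult_left_mono[OF pucci_upper[OF A, of X] c] by linarith
qed

lemma pucci_abs_le: "\<bar>pucci_plus lam Lam X\<bar> \<le> Lam * (\<Sum>i\<in>UNIV. \<Sum>j\<in>UNIV. \<bar>X $ i $ j\<bar>)"
proof -
  have "pucci_plus lam Lam X \<le> Lam * (\<Sum>i\<in>UNIV. \<Sum>j\<in>UNIV. \<bar>X $ i $ j\<bar>)"
    by (rule pucci_least) (use ell_trace_bound[OF lam(1), of _ Lam X] in \<open>auto simp: abs_le_iff\<close>)
  moreover have "- (Lam * (\<Sum>i\<in>UNIV. \<Sum>j\<in>UNIV. \<bar>X $ i $ j\<bar>)) \<le> pucci_plus lam Lam X"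
    using pucci_upper[OF mat_in_ell[OF lam(2)], of X] ell_trace_bound[OF lam(1) mat_in_ell[OF lam(2)], of X]
    by (simp add: abs_le_iff)
  ultimately show ?thesis by linarith
qed

text \<open>Subadditivity and homogeneity make the operator convex, and a finite convex function on
  a finite-dimensional space is continuous.\<close>

lemma pucci_borel [measurable]: "(pucci_plus lam Lam :: real^'n^'n \<Rightarrow> real) \<in> borel_fun"
proof -
  have "convex_on UNIV (pucci_plus lam Lam :: real^'n^'n \<Rightarrow> real)"
  proof (rule convex_onI)
    fix t :: real and x y :: "real^'n^'n" assume t: "0 < t" "t < 1"
    show "pucci_plus lam Lam ((1 - t) *\<^sub>R x + t *\<^sub>R y) \<le> (1 - t) * pucci_plus lam Lam x + t * pucci_plus lam Lam y"
      using pucci_add[of "(1 - t) *\<^sub>R x" "t *\<^sub>R y"] pucci_scale_le[of "1 - t" x] pucci_scale_le[of t y] t by linarith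
  qed simp
  then have "continuous_on UNIV (pucci_plus lam Lam :: real^'n^'n \<Rightarrow> real)"
    by (intro convex_on_continuous) auto
  then show ?thesis by (rule borel_measurable_continuous_onI)
qed

text \<open>For each admissible matrix the trace is linear and passes through the series term by
  term; the supremum is taken only afterwards. This carries the inequality from the iterates to
  their sum.\<close>

lemma pucci_sums:
  fixes X :: "nat \<Rightarrow> real^'n^'n"
  assumes s: "\<And>i j. summable (\<lambda>k. X k $ i $ j)" and t: "summable (\<lambda>k. pucci_plus lam Lam (X k))"
  shows "pucci_plus lam Lam (\<chi> i j. \<Sum>k. X k $ i $ j) \<le> (\<Sum>k. pucci_plus lam Lam (X k))"
proof (rule pucci_least)
  fix A :: "real^'n^'n" assume A: "A \<in> ell lam Lam"
  have "(\<lambda>k. - (\<Sum>i\<in>UNIV. \<Sum>j\<in>UNIV. A $ i $ j * X k $ j $ i)) sums - (\<Sum>i\<in>UNIV. \<Sum>j\<in>UNIV. A $ i $ j * (\<Sum>k. X k $ j $ i))"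
    by (intro sums_minus sums_sum sums_mult summable_sums s)
  then have "(\<lambda>k. - trace (A ** X k)) sums - trace (A ** (\<chi> i j. \<Sum>k. X k $ i $ j))"
    by (simp add: trace_matrix_mult)
  then show "- trace (A ** (\<chi> i j. \<Sum>k. X k $ i $ j)) \<le> (\<Sum>k. pucci_plus lam Lam (X k))"
    using sums_le[OF pucci_upper[OF A] _ summable_sums[OF t]] by blast
qed

text \<open>The Hessian of the barrier has this shape. Lower ellipticity is used on the rank-one
  part, which has the helpful sign, and the trace bound on the multiple of the identity.\<close>

lemma pucci_rank_one:
  fixes x :: "real^'n"
  assumes "0 \<le> a" "0 \<le> y"
  shows "pucci_plus lam Lam (\<chi> i j. a * (x $ i * x $ j) - y * (if i = j then 1 else 0))
    \<le> - (a * (lam * (norm x)\<^sup>2)) + y * (Lam * real CARD('n))"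
proof (rule pucci_least)
  fix A :: "real^'n^'n" assume A: "A \<in> ell lam Lam"
  have "trace (A ** (\<chi> i j. a * (x $ i * x $ j) - y * (if i = j then 1 else 0)))
    = a * (x \<bullet> (A *v x)) - y * (\<Sum>i\<in>UNIV. A $ i $ i)"
  proof -
    have "A $ i $ j * (a * (x $ j * x $ i) - y * (if j = i then 1 else 0))
      = a * (x $ i * (A $ i $ j * x $ j)) - (if j = i then y * A $ i $ j else 0)" for i j
      by (simp add: algebra_simps)
    then have "trace (A ** (\<chi> i j. a * (x $ i * x $ j) - y * (if i = j then 1 else 0)))
      = (\<Sum>i\<in>UNIV. \<Sum>j\<in>UNIV. a * (x $ i * (A $ i $ j * x $ j))) - (\<Sum>i\<in>UNIV. y * A $ i $ i)"
      unfolding trace_matrix_mult by (simp add: sum_subtractf)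
    then show ?thesis
      by (simp add: sum_distrib_left inner_vec_def matrix_vector_mult_def)
  qed
  moreover have "y * (\<Sum>i\<in>UNIV. A $ i $ i) \<le> y * (Lam * real CARD('n))"
    using sum_mono[of UNIV "\<lambda>i. A $ i $ i" "\<lambda>i. Lam"] ell_diag(2)[OF A] assms(2)
    by (intro mult_left_mono) (simp_all add: mult.commute)
  moreover have "a * (lam * (norm x)\<^sup>2) \<le> a * (x \<bullet> (A *v x))"
    by (rule mult_left_mono[OF ell_lower[OF A] assms(1)])
  ultimately show "- trace (A ** (\<chi> i j. a * (x $ i * x $ j) - y * (if i = j then 1 else 0)))
    \<le> - (a * (lam * (norm x)\<^sup>2)) + y * (Lam * real CARD('n))"
    by linarith
qed

end

type_synonym 'n pt = "(real, 'n) vec \<times> real"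

section \<open>Smooth functions\<close>

abbreviation pd :: "'a::euclidean_space \<Rightarrow> ('a \<Rightarrow> real) \<Rightarrow> 'a \<Rightarrow> real" where
  "pd e f z \<equiv> frechet_derivative f (at z) e"

definition smooth :: "('a::euclidean_space \<Rightarrow> real) \<Rightarrow> bool" where
  "smooth f \<longleftrightarrow> (\<forall>k. C_k k f)"

lemma pd_eq: "(f has_derivative f') (at z) \<Longrightarrow> pd e f z = f' e"
  by (metis frechet_derivative_at)

lemma pd_eq_real: "(f has_real_derivative d) (at z) \<Longrightarrow> pd 1 f z = d"
  using pd_eq[of f "(*) d" z 1] by (simp add: has_field_derivative_def)

text \<open>\<open>C_k\<close> is phrased with \<open>frechet_derivative\<close>, a choice;
  uniqueness of derivatives allows any explicit derivative in its place.\<close>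

lemma C_k_SucI:
  assumes "\<And>z. (f has_derivative f' z) (at z)" "\<And>b. b \<in> Basis \<Longrightarrow> C_k k (\<lambda>z. f' z b)"
  shows "C_k (Suc k) f"
proof -
  have "pd b f = (\<lambda>z. f' z b)" for b using pd_eq[OF assms(1)] by auto
  then show ?thesis using assms by (auto simp: differentiable_def)
qed

lemma C_k_SucD: "C_k (Suc k) f \<Longrightarrow> C_k k f"
proof (induction k arbitrary: f)
  case 0
  then show ?case
    using differentiable_imp_continuous_within by (auto simp: continuous_on_eq_continuous_within)
qed auto

lemma C_k_mult: "C_k k f \<Longrightarrow> C_k k g \<Longrightarrow> C_k k (\<lambda>z. f z * g z)"
proof (induction k arbitrary: f g)
  case 0 then show ?case by (auto intro: continuous_intros)
next
  case add: (Suc k)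
  have sum: "C_k j f \<Longrightarrow> C_k j g \<Longrightarrow> C_k j (\<lambda>z. f z + g z)" for j and f g :: "'a \<Rightarrow> real"
  proof (induction j arbitrary: f g)
    case 0 then show ?case by (auto intro: continuous_intros)
  next
    case (Suc j)
    then have "(f has_derivative (\<lambda>e. pd e f z)) (at z)" "(g has_derivative (\<lambda>e. pd e g z)) (at z)" for z
      by (simp_all add: frechet_derivative_works[symmetric])
    then have "((\<lambda>z. f z + g z) has_derivative (\<lambda>e. pd e f z + pd e g z)) (at z)" for z
      by (intro has_derivative_add)
    then show ?case
      by (rule C_k_SucI) (use Suc in auto)
  qed
  have "(f has_derivative (\<lambda>e. pd e f z)) (at z)" "(g has_derivative (\<lambda>e. pd e g z)) (at z)" for z
    using add by (simp_all add: frechet_derivative_works[symmetric])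
  then have "((\<lambda>z. f z * g z) has_derivative (\<lambda>e. f z * pd e g z + pd e f z * g z)) (at z)" for z
    by (intro has_derivative_mult)
  then show ?case
    by (rule C_k_SucI) (intro sum add.IH C_k_SucD[OF add.prems(1)] C_k_SucD[OF add.prems(2)], use add.prems in auto)
qed

lemma C_k_add: "C_k j f \<Longrightarrow> C_k j g \<Longrightarrow> C_k j (\<lambda>z. f z + g z)"
proof (induction j arbitrary: f g)
  case 0 then show ?case by (auto intro: continuous_intros)
next
  case (Suc j)
  then have "(f has_derivative (\<lambda>e. pd e f z)) (at z)" "(g has_derivative (\<lambda>e. pd e g z)) (at z)" for z
    by (simp_all add: frechet_derivative_works[symmetric])
  then have "((\<lambda>z. f z + g z) has_derivative (\<lambda>e. pd e f z + pd e g z)) (at z)" for z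
    by (intro has_derivative_add)
  then show ?case
    by (rule C_k_SucI) (use Suc in auto)
qed

lemma C_k_const: "C_k k (\<lambda>z. c)"
  by (induction k arbitrary: c) (simp_all add: frechet_derivative_const)

lemma C_k_compose:
  fixes g :: "real \<Rightarrow> real"
  shows "C_k k g \<Longrightarrow> C_k k f \<Longrightarrow> C_k k (\<lambda>z. g (f z))"
proof (induction k arbitrary: f g)
  case 0 then show ?case
    by (simp add: continuous_on_compose2)
next
  case (Suc k)
  have f: "(f has_derivative (\<lambda>e. pd e f z)) (at z)" and g: "(g has_derivative (\<lambda>e. pd e g y)) (at y)" for z y
    using Suc by (simp_all add: frechet_derivative_works[symmetric])
  have lin: "pd h g y = pd 1 g y * h" for h y
    using linear_scale[OF has_derivative_linear[OF g], of y h 1] by (simp add: mult.commute)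
  have "((\<lambda>z. g (f z)) has_derivative (\<lambda>e. pd 1 g (f z) * pd e f z)) (at z)" for z
  proof -
    have "(\<lambda>e. pd (pd e f z) g (f z)) = (\<lambda>e. pd 1 g (f z) * pd e f z)"
      by (rule ext) (rule lin)
    then show ?thesis using has_derivative_compose[OF f g, of z] by simp
  qed
  then show ?case
    by (rule C_k_SucI, intro C_k_mult Suc.IH[where g = "pd 1 g" and f = f] C_k_SucD[OF Suc.prems(2)])
      (use Suc.prems in auto)
qed

lemma smooth_mult: "smooth f \<Longrightarrow> smooth g \<Longrightarrow> smooth (\<lambda>z. f z * g z)"
  by (simp add: smooth_def C_k_mult)

lemma smooth_add: "smooth f \<Longrightarrow> smooth g \<Longrightarrow> smooth (\<lambda>z. f z + g z)"
  by (simp add: smooth_def C_k_add)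

lemma smooth_const: "smooth (\<lambda>z. c)"
  by (simp add: smooth_def C_k_const)

lemma smooth_uminus: "smooth f \<Longrightarrow> smooth (\<lambda>z. - f z)"
  using smooth_mult[OF smooth_const[of "-1"]] by simp

lemma smooth_diff: "smooth f \<Longrightarrow> smooth g \<Longrightarrow> smooth (\<lambda>z. f z - g z)"
  using smooth_add[OF _ smooth_uminus] by fastforce

lemma smooth_compose: "smooth g \<Longrightarrow> smooth f \<Longrightarrow> smooth (\<lambda>z. g (f z))" for g :: "real \<Rightarrow> real"
  by (simp add: smooth_def C_k_compose)

lemma smooth_prod: "(\<And>i. i \<in> S \<Longrightarrow> smooth (f i)) \<Longrightarrow> smooth (\<lambda>z. \<Prod>i\<in>S. f i z)"
  by (induction S rule: infinite_finite_induct) (simp_all add: smooth_const smooth_mult)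

lemma smooth_sum: "(\<And>i. i \<in> S \<Longrightarrow> smooth (f i)) \<Longrightarrow> smooth (\<lambda>z. \<Sum>i\<in>S. f i z)"
  by (induction S rule: infinite_finite_induct) (simp_all add: smooth_const smooth_add)

lemma smooth_power: "smooth f \<Longrightarrow> smooth (\<lambda>z. f z ^ m)"
  by (induction m) (simp_all add: smooth_const smooth_mult)

lemma smooth_linear: assumes "bounded_linear f" shows "smooth f"
  unfolding smooth_def
proof
  fix k show "C_k k f"
  proof (cases k)
    case 0 then show ?thesis by (simp add: assms linear_continuous_on)
  next
    case (Suc j)
    show ?thesis unfolding Suc
      by (rule C_k_SucI[where f' = "\<lambda>_. f"]) (simp_all add: assms bounded_linear_imp_has_derivative C_k_const)
  qed
qed

lemma smooth_has_derivative: "smooth f \<Longrightarrow> (f has_derivative (\<lambda>e. pd e f z)) (at z)"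
  using C_k.simps(2)[of 0 f] unfolding smooth_def
  by (metis frechet_derivative_works)

lemma smooth_continuous: "smooth f \<Longrightarrow> continuous_on UNIV f"
  using C_k.simps(1)[of f] unfolding smooth_def by blast

lemma smooth_pd: "smooth f \<Longrightarrow> b \<in> Basis \<Longrightarrow> smooth (pd b f)"
  unfolding smooth_def using C_k.simps(2) by blast

lemma smooth_iff_deriv:
  fixes f :: "real \<Rightarrow> real"
  assumes "\<And>x. (f has_real_derivative f' x) (at x)" shows "smooth f \<longleftrightarrow> smooth f'"
proof -
  have "pd 1 f = f'" using pd_eq_real[OF assms] by auto
  moreover have "f differentiable (at x)" for x
    using assms[of x] unfolding has_field_derivative_def differentiable_def by blast
  ultimately have "C_k (Suc k) f \<longleftrightarrow> C_k k f'" for k by simp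
  then show ?thesis unfolding smooth_def using C_k_SucD by blast
qed

lemma smooth_exp: "smooth (exp :: real \<Rightarrow> real)"
proof -
  have "C_k k (exp :: real \<Rightarrow> real)" for k
  proof (induction k)
    case 0 then show ?case by (simp add: continuous_on_exp)
  next
    case (Suc k)
    show ?case
      by (rule C_k_SucI[where f' = "\<lambda>z h. exp z * h"])
        (use Suc DERIV_exp in \<open>auto simp: has_field_derivative_def\<close>)
  qed
  then show ?thesis by (simp add: smooth_def)
qed

section \<open>An explicit smooth bump and its primitive\<close>

definition flat :: "nat \<Rightarrow> real \<Rightarrow> real" where
  "flat m x = (if 0 < x then exp (- (1 / x)) / x ^ m else 0)"

lemma flat_tendsto: "(flat m \<longlongrightarrow> 0) (at 0)"
proof -
  have "((\<lambda>y::real. y ^ m / exp y) \<longlongrightarrow> 0) at_top" by (rule tendsto_power_div_exp_0)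
  moreover have "filterlim (\<lambda>x::real. 1 / x) at_top (at_right 0)" by real_asymp
  ultimately have "((\<lambda>x::real. (1 / x) ^ m / exp (1 / x)) \<longlongrightarrow> 0) (at_right 0)"
    by (rule filterlim_compose)
  moreover have "\<forall>\<^sub>F x in at_right 0. (1 / x) ^ m / exp (1 / x) = flat m x"
    by (auto simp: eventually_at_right_field flat_def exp_minus field_simps intro!: exI[of _ 1])
  ultimately have "(flat m \<longlongrightarrow> 0) (at_right 0)"
    using tendsto_cong by fast
  moreover have "(flat m \<longlongrightarrow> 0) (at_left 0)"
    by (rule tendsto_eventually) (auto simp: eventually_at_left_field flat_def intro!: exI[of _ "-1"])
  ultimately show ?thesis by (simp add: filterlim_at_split)
qed

text \<open>The denominators \<open>x ^ m\<close> make the family closed under differentiation, so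
  one induction on the order of differentiability treats all \<open>m\<close> at once. At 0 the
  difference quotient of \<open>flat m\<close> is \<open>flat (m + 1)\<close>, which tends to
  0.\<close>

lemma flat_deriv: "(flat m has_real_derivative flat (m + 2) x - m * flat (m + 1) x) (at x)"
proof (cases "x = 0")
  case True
  have "((\<lambda>h. (flat m (0 + h) - flat m 0) / h) \<longlongrightarrow> 0) (at 0)"
  proof (rule Lim_transform_eventually[OF flat_tendsto[of "m + 1"]])
    show "\<forall>\<^sub>F h in at 0. flat (m + 1) h = (flat m (0 + h) - flat m 0) / h"
      by (auto simp: eventually_at_filter flat_def)
  qed
  then show ?thesis unfolding True by (simp add: DERIV_def flat_def)
next
  case False
  then consider "x < 0" | "0 < x" by linarith
  then show ?thesis
  proof cases
    case 1
    have "((\<lambda>x. 0) has_real_derivative 0) (at x)" by simp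
    then show ?thesis using 1
      by (subst DERIV_cong_ev[OF refl, of _ "\<lambda>x. 0"])
        (auto simp: flat_def eventually_nhds intro!: exI[of _ "{..<0}"])
  next
    case 2
    have p: "real m * x ^ (m - Suc 0) * x = real m * x ^ m"
      by (cases m) auto
    have "((\<lambda>x. exp (- (1 / x)) / x ^ m) has_real_derivative flat (m + 2) x - m * flat (m + 1) x) (at x)"
      using 2 p by (auto intro!: derivative_eq_intros simp: flat_def field_simps power2_eq_square)
    then show ?thesis using 2
      by (subst DERIV_cong_ev[OF refl, of _ "\<lambda>x. exp (- (1 / x)) / x ^ m"])
        (auto simp: flat_def eventually_nhds intro!: exI[of _ "{0<..}"])
  qed
qed

lemma smooth_flat: "smooth (flat m)"
proof -
  have "C_k k (flat m)" for k
  proof (induction k arbitrary: m)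
    case 0
    show ?case using DERIV_continuous_on[of UNIV "flat m"] flat_deriv by fastforce
  next
    case (Suc k)
    have "C_k k (\<lambda>x. flat (m + 2) x + (- real m) * flat (m + 1) x)"
      by (intro C_k_add C_k_mult C_k_const Suc)
    then show ?case
      by (intro C_k_SucI[where f' = "\<lambda>z h. (flat (m + 2) z - m * flat (m + 1) z) * h"])
        (use flat_deriv[of m] in \<open>auto simp: has_field_derivative_def\<close>)
  qed
  then show ?thesis by (simp add: smooth_def)
qed

definition bump0 :: "real \<Rightarrow> real" where "bump0 x = flat 0 x * flat 0 (1 - x)"

lemma smooth_affine: "smooth (\<lambda>x::real. a + b * x)"
  by (intro smooth_add smooth_mult smooth_const smooth_linear bounded_linear_ident)

lemma smooth_bump0: "smooth bump0"
proof -
  have "smooth (\<lambda>x. flat 0 x * flat 0 (1 + (-1) * x))"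
    by (intro smooth_mult smooth_flat smooth_compose[OF smooth_flat] smooth_affine)
  then show ?thesis by (simp add: bump0_def[abs_def])
qed

lemma bump0_nonneg: "0 \<le> bump0 x" by (simp add: bump0_def flat_def)
lemma bump0_pos: "0 < x \<Longrightarrow> x < 1 \<Longrightarrow> 0 < bump0 x" by (simp add: bump0_def flat_def)
lemma bump0_zero: "x \<le> 0 \<or> 1 \<le> x \<Longrightarrow> bump0 x = 0" by (auto simp: bump0_def flat_def)

text \<open>Starting the integral at -1, outside the support, makes every x \<ge> 0 an interior
  point of an interval of integration, so the fundamental theorem gives a two-sided derivative
  there, 0 included.\<close>

definition ramp0 :: "real \<Rightarrow> real" where "ramp0 x = integral {-1..x} bump0"

lemma ramp0_zero: "x \<le> 0 \<Longrightarrow> ramp0 x = 0"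
proof -
  assume x: "x \<le> 0"
  have "integral {-1..x} bump0 = integral {-1..x} (\<lambda>_. 0)"
    by (rule integral_cong) (use x bump0_zero in auto)
  then show ?thesis by (simp add: ramp0_def)
qed

lemma ramp0_deriv: "(ramp0 has_real_derivative bump0 x) (at x)"
proof (cases "x < 0")
  case True
  have "((\<lambda>x. 0) has_real_derivative bump0 x) (at x)" using bump0_zero[of x] True by simp
  then show ?thesis using True
    by (subst DERIV_cong_ev[OF refl, of _ "\<lambda>x. 0"])
      (auto simp: ramp0_zero eventually_nhds intro!: exI[of _ "{..<0}"])
next
  case False
  have "(ramp0 has_real_derivative bump0 x) (at x within {-1..x+1})"
    unfolding ramp0_def[abs_def]
    by (rule integral_has_real_derivative) (use False continuous_on_subset[OF smooth_continuous[OF smooth_bump0]] in auto)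
  moreover have "at x within {-1..x+1} = at x"
    by (rule at_within_interior) (use False in simp)
  ultimately show ?thesis by simp
qed

lemma ramp0_1_pos: "0 < ramp0 1"
proof -
  have "ramp0 0 < ramp0 1"
    by (rule DERIV_pos_imp_increasing_open)
      (use ramp0_deriv bump0_pos in \<open>auto intro: DERIV_isCont DERIV_continuous_on intro!: continuous_at_imp_continuous_on\<close>)
  then show ?thesis by (simp add: ramp0_zero)
qed

lemma ramp0_mono: "x \<le> y \<Longrightarrow> ramp0 x \<le> ramp0 y"
  by (rule DERIV_nonneg_imp_nondecreasing) (use ramp0_deriv bump0_nonneg in auto)

lemma ramp0_const: "1 \<le> x \<Longrightarrow> ramp0 x = ramp0 1"
proof -
  assume "1 \<le> x"
  have "ramp0 x \<le> ramp0 1"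
  proof (rule DERIV_nonpos_imp_nonincreasing[OF \<open>1 \<le> x\<close>])
    fix y :: real assume "1 \<le> y"
    then show "\<exists>d. (ramp0 has_real_derivative d) (at y) \<and> d \<le> 0"
      using ramp0_deriv[of y] bump0_zero[of y] by auto
  qed
  then show ?thesis using ramp0_mono[OF \<open>1 \<le> x\<close>] by simp
qed

text \<open>Normalised to climb from 0 to 1: ramps of two different scales then agree off a bounded
  interval, and their difference has compact support.\<close>

definition ramp :: "real \<Rightarrow> real" where "ramp x = ramp0 x / ramp0 1"
definition bump :: "real \<Rightarrow> real" where "bump x = bump0 x / ramp0 1"

lemma ramp_deriv: "(ramp has_real_derivative bump x) (at x)"
  unfolding ramp_def[abs_def] bump_def[abs_def] by (intro DERIV_cdivide ramp0_deriv)

lemma smooth_bump: "smooth bump"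
  unfolding bump_def[abs_def] divide_inverse by (intro smooth_mult smooth_bump0 smooth_const)

lemma smooth_ramp: "smooth ramp"
  using smooth_iff_deriv[OF ramp_deriv] smooth_bump by simp

lemma ramp_bounds: "0 \<le> ramp x" "ramp x \<le> 1"
proof -
  show "0 \<le> ramp x" unfolding ramp_def
    using ramp0_mono[of "min x 0" x] ramp0_zero[of "min x 0"] ramp0_1_pos by auto
  show "ramp x \<le> 1" unfolding ramp_def
    using ramp0_mono[of x "max x 1"] ramp0_const[of "max x 1"] ramp0_1_pos by auto
qed

lemma ramp_zero: "x \<le> 0 \<Longrightarrow> ramp x = 0" by (simp add: ramp_def ramp0_zero)
lemma ramp_one: "1 \<le> x \<Longrightarrow> ramp x = 1" using ramp0_const[of x] ramp0_1_pos by (simp add: ramp_def)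
lemma bump_zero: "x \<le> 0 \<or> 1 \<le> x \<Longrightarrow> bump x = 0" by (simp add: bump_def bump0_zero)
lemma bump_nonneg: "0 \<le> bump x" using bump0_nonneg ramp0_1_pos by (simp add: bump_def)

section \<open>Product test functions and their partial derivatives\<close>

definition ptest :: "('n \<Rightarrow> real \<Rightarrow> real) \<Rightarrow> (real \<Rightarrow> real) \<Rightarrow> (real^'n) \<times> real \<Rightarrow> real" where
  "ptest a b w = (\<Prod>l\<in>UNIV. a l (fst w $ l)) * b (snd w)"

lemma smooth_fst_nth: "smooth (\<lambda>w::(real^'n) \<times> real. fst w $ l)"
  by (intro smooth_linear bounded_linear_compose[OF bounded_linear_vec_nth bounded_linear_fst])

lemma smooth_snd: "smooth (\<lambda>w::(real^'n) \<times> real. snd w)"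
  by (intro smooth_linear bounded_linear_snd)

lemma smooth_ptest:
  fixes a :: "'n::finite \<Rightarrow> real \<Rightarrow> real"
  assumes "\<And>l. smooth (a l)" "smooth b" shows "smooth (ptest a b)"
  unfolding ptest_def[abs_def]
proof (rule smooth_mult)
  show "smooth (\<lambda>w::(real^'n) \<times> real. \<Prod>l\<in>UNIV. a l (fst w $ l))"
    by (rule smooth_prod) (rule smooth_compose[OF assms(1) smooth_fst_nth])
  show "smooth (\<lambda>w::'n pt. b (snd w))"
    by (rule smooth_compose[OF assms(2) smooth_snd])
qed

lemma pd_line:
  assumes "(f has_derivative f') (at z)" "((\<lambda>h. f (z + h *\<^sub>R e)) has_real_derivative d) (at 0)"
  shows "pd e f z = d"
proof -
  have "((\<lambda>h. z + h *\<^sub>R e) has_derivative (\<lambda>h. h *\<^sub>R e)) (at 0)"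
    by (auto intro!: derivative_eq_intros)
  then have "((\<lambda>h. f (z + h *\<^sub>R e)) has_derivative (\<lambda>h. f' (h *\<^sub>R e))) (at 0)"
    by (rule has_derivative_compose) (use assms in simp)
  then have "(\<lambda>h. f' (h *\<^sub>R e)) = (*) d"
    using assms(2) has_derivative_unique unfolding has_field_derivative_def by blast
  then have "f' e = d" by (metis mult.right_neutral scaleR_one)
  then show ?thesis using pd_eq[OF assms(1)] by simp
qed

lemma pd_ptest_space:
  fixes a :: "'n::finite \<Rightarrow> real \<Rightarrow> real"
  assumes "\<And>l. smooth (a l)" "smooth b" "\<And>x. (a k has_real_derivative a' x) (at x)"
  shows "pd (axis k 1, 0) (ptest a b) w = ptest (a(k := a')) b w"
proof (rule pd_line[OF smooth_has_derivative[OF smooth_ptest[OF assms(1,2)]]])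
  define C where "C = (\<Prod>l\<in>UNIV-{k}. a l (fst w $ l)) * b (snd w)"
  have 1: "ptest a b (w + h *\<^sub>R (axis k 1, 0)) = a k (fst w $ k + h) * C" for h
  proof -
    have "(\<Prod>l\<in>UNIV. a l (fst w $ l + h * axis k 1 $ l)) = a k (fst w $ k + h) * (\<Prod>l\<in>UNIV-{k}. a l (fst w $ l + h * axis k 1 $ l))"
      by (subst prod.remove[of _ k]) (auto simp: axis_def)
    also have "(\<Prod>l\<in>UNIV-{k}. a l (fst w $ l + h * axis k 1 $ l)) = (\<Prod>l\<in>UNIV-{k}. a l (fst w $ l))"
      by (rule prod.cong) (auto simp: axis_def)
    finally show ?thesis by (simp add: ptest_def C_def)
  qed
  have "(\<Prod>l\<in>UNIV. (a(k := a')) l (fst w $ l)) = a' (fst w $ k) * (\<Prod>l\<in>UNIV-{k}. a l (fst w $ l))"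
    by (subst prod.remove[of _ k]) (auto intro!: prod.cong)
  then have 2: "ptest (a(k := a')) b w = a' (fst w $ k) * C"
    by (simp add: ptest_def C_def)
  show "((\<lambda>h. ptest a b (w + h *\<^sub>R (axis k 1, 0))) has_real_derivative ptest (a(k := a')) b w) (at 0)"
    unfolding 1 2
    by (rule DERIV_cmult_right) (use DERIV_shift[of "a k" "a' (fst w $ k)" 0 "fst w $ k"] assms(3)[of "fst w $ k"] in \<open>simp add: add.commute\<close>)
qed

lemma pd_ptest_time:
  fixes a :: "'n::finite \<Rightarrow> real \<Rightarrow> real"
  assumes "\<And>l. smooth (a l)" "smooth b" "\<And>x. (b has_real_derivative b' x) (at x)"
  shows "pd (0, 1) (ptest a b) w = ptest a b' w"
proof (rule pd_line[OF smooth_has_derivative[OF smooth_ptest[OF assms(1,2)]]])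
  have 1: "ptest a b (w + h *\<^sub>R (0, 1)) = (\<Prod>l\<in>UNIV. a l (fst w $ l)) * b (snd w + h)" for h
    by (simp add: ptest_def)
  show "((\<lambda>h. ptest a b (w + h *\<^sub>R (0, 1))) has_real_derivative ptest a b' w) (at 0)"
    unfolding 1 unfolding ptest_def
    by (rule DERIV_cmult) (use DERIV_shift[of b "b' (snd w)" 0 "snd w"] assms(3)[of "snd w"] in \<open>simp add: add.commute\<close>)
qed

section \<open>Compactly supported test functions\<close>

lemma test_fun_iff: "test_fun U \<psi> \<longleftrightarrow> smooth \<psi> \<and> (\<exists>K. compact K \<and> K \<subseteq> U \<and> (\<forall>z. z \<notin> K \<longrightarrow> \<psi> z = 0))"
  by (simp add: test_fun_def smooth_def)

lemma test_fun_ptest: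
  fixes a :: "'n::finite \<Rightarrow> real \<Rightarrow> real"
  assumes "\<And>l. smooth (a l)" "smooth b"
    and a: "\<And>l x. x < p $ l \<or> q $ l < x \<Longrightarrow> a l x = 0" and b: "\<And>t. t < p0 \<or> q0 < t \<Longrightarrow> b t = 0"
    and U: "cbox p q \<times> {p0..q0} \<subseteq> U"
  shows "test_fun U (ptest a b)"
  unfolding test_fun_iff
proof (intro conjI exI[of _ "cbox p q \<times> {p0..q0}"] allI impI)
  fix z assume z: "z \<notin> cbox p q \<times> {p0..q0}"
  show "ptest a b z = 0"
  proof (cases "snd z \<in> {p0..q0}")
    case True
    then have "fst z \<notin> cbox p q" using z by (auto simp: mem_Times_iff)
    then obtain l where "fst z $ l < p $ l \<or> q $ l < fst z $ l" by (auto simp: mem_box_cart not_le)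
    then have "a l (fst z $ l) = 0" using a by blast
    then show ?thesis by (auto simp: ptest_def intro!: prod_zero bexI[of _ l])
  qed (use b in \<open>auto simp: ptest_def not_le\<close>)
qed (use assms in \<open>auto intro: smooth_ptest compact_Times\<close>)

lemma test_fun_mono: "test_fun U \<psi> \<Longrightarrow> U \<subseteq> V \<Longrightarrow> test_fun V \<psi>"
  unfolding test_fun_def by blast

lemma test_fun_mult: "smooth f \<Longrightarrow> test_fun U \<psi> \<Longrightarrow> test_fun U (\<lambda>z. f z * \<psi> z)"
  unfolding test_fun_iff by (auto intro: smooth_mult)

lemma test_fun_pd:
  assumes "test_fun U \<psi>" "e \<in> Basis" shows "test_fun U (pd e \<psi>)"
proof -
  obtain K where K: "compact K" "K \<subseteq> U" "\<And>z. z \<notin> K \<Longrightarrow> \<psi> z = 0" and s: "smooth \<psi>"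
    using assms unfolding test_fun_iff by blast
  have "pd e \<psi> z = 0" if "z \<notin> K" for z
  proof -
    have "(\<psi> has_derivative (\<lambda>_. 0)) (at z)"
      by (rule has_derivative_transform_within_open[of "\<lambda>_. 0" _ _ _ "- K"])
        (use that K in \<open>auto simp: compact_imp_closed open_Compl\<close>)
    then show ?thesis by (simp add: pd_eq)
  qed
  then show ?thesis unfolding test_fun_iff using K s smooth_pd assms(2) by blast
qed

lemma pd_mult: "smooth f \<Longrightarrow> smooth g \<Longrightarrow> pd e (\<lambda>z. f z * g z) z = f z * pd e g z + pd e f z * g z"
  by (rule pd_eq[of _ "\<lambda>e. f z * pd e g z + pd e f z * g z"]) (intro has_derivative_mult smooth_has_derivative)

lemma test_fun_borel: "test_fun U \<psi> \<Longrightarrow> \<psi> \<in> borel_fun"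
  unfolding test_fun_iff by (auto intro: borel_measurable_continuous_onI smooth_continuous)

lemma cont_compact_support_bounded:
  assumes "continuous_on UNIV (\<psi>::'a::euclidean_space \<Rightarrow> real)" "compact K" "\<And>z. z \<notin> K \<Longrightarrow> \<psi> z = 0"
  shows "\<exists>M. \<forall>z. \<bar>\<psi> z\<bar> \<le> M"
proof -
  have "bounded (\<psi> ` K)"
    by (intro compact_imp_bounded compact_continuous_image continuous_on_subset[OF assms(1)] assms(2)) simp
  then obtain M where "\<forall>x\<in>\<psi> ` K. norm x \<le> M" unfolding bounded_iff by blast
  then have "\<bar>\<psi> z\<bar> \<le> max M 0" for z using assms(3)[of z] by (cases "z \<in> K") fastforce+
  then show ?thesis by blast
qed

lemma test_fun_bounded: "test_fun U \<psi> \<Longrightarrow> \<exists>M. \<forall>z. \<bar>\<psi> z\<bar> \<le> M"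
  unfolding test_fun_iff using cont_compact_support_bounded[OF smooth_continuous] by blast

lemma lborel_integral_translate:
  fixes f :: "'a::euclidean_space \<Rightarrow> real"
  assumes [measurable]: "f \<in> borel_fun"
  shows "(\<integral>z. f (z + c) \<partial>lborel) = (\<integral>z. f z \<partial>lborel)"
proof -
  have "(\<integral>z. f z \<partial>lborel) = (\<integral>z. f z \<partial>(distr lborel borel ((+) c)))"
    by (simp add: lborel_distr_plus)
  also have "\<dots> = (\<integral>z. f (c + z) \<partial>lborel)"
    by (rule integral_distr) auto
  finally show ?thesis by (simp add: add.commute)
qed

lemma compact_emeasure_top: "compact K \<Longrightarrow> vol (K :: 'a::euclidean_space set) < top"
  using emeasure_compact_finite[of K] by simp

lemma integrable_bounded_compact:
  fixes f :: "'a::euclidean_space \<Rightarrow> real"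
  assumes "f \<in> borel_fun" "compact K" "\<And>z. z \<notin> K \<Longrightarrow> f z = 0" "\<And>z. \<bar>f z\<bar> \<le> M"
  shows "integrable lborel f"
proof (rule Bochner_Integration.integrable_bound)
  show "integrable lborel (\<lambda>z. M * indicator K z)"
    using assms(2) by (intro integrable_mult_right integrable_real_indicator)
      (auto simp: compact_imp_closed compact_emeasure_top)
  show "AE z in lborel. norm (f z) \<le> norm (M * indicator K z)"
    using assms(3,4) by (auto simp: indicator_def intro!: AE_I2) (metis abs_ge_self order_trans)
qed (use assms in auto)

lemma test_fun_integrable: "test_fun U \<psi> \<Longrightarrow> integrable lborel \<psi>"
  using integrable_bounded_compact test_fun_borel test_fun_bounded unfolding test_fun_iff
  by (metis test_fun_borel test_fun_bounded test_fun_iff)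

text \<open>Translation invariance makes the integral of every difference quotient vanish; the
  quotients converge to the derivative under a common integrable bound.\<close>

lemma test_fun_integral_pd:
  assumes t: "test_fun U (\<psi>::'a::euclidean_space \<Rightarrow> real)" and e: "e \<in> Basis"
  shows "(\<integral>z. pd e \<psi> z \<partial>lborel) = 0"
proof -
  obtain K where K: "compact K" "\<And>z. z \<notin> K \<Longrightarrow> \<psi> z = 0" and s: "smooth \<psi>"
    using t unfolding test_fun_iff by blast
  obtain M where M: "\<And>z. \<bar>pd e \<psi> z\<bar> \<le> M" using test_fun_bounded[OF test_fun_pd[OF t e]] by blast
  define h :: "nat \<Rightarrow> real" where "h m = inverse (real (Suc m))" for m
  have h: "0 < h m" "h m \<le> 1" for m by (auto simp: h_def field_simps)
  define g where "g m z = (\<psi> (z + h m *\<^sub>R e) - \<psi> z) / h m" for m z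
  \<comment> \<open>The support swept backwards along \<open>e\<close> over unit length contains the
    supports of all difference quotients with step at most 1.\<close>
  define K' where "K' = (\<lambda>(z, s). z - s *\<^sub>R e) ` (K \<times> {0..1})"
  have K': "compact K'" unfolding K'_def
    by (intro compact_continuous_image compact_Times K) (auto intro!: continuous_intros simp: case_prod_unfold)
  have [measurable]: "\<psi> \<in> borel_fun" "pd e \<psi> \<in> borel_fun"
    using t e by (auto intro: test_fun_borel test_fun_pd)
  have line: "((\<lambda>s. \<psi> (z + s *\<^sub>R e)) has_real_derivative pd e \<psi> (z + s *\<^sub>R e)) (at s)" for z s
  proof -
    have lin: "pd (d *\<^sub>R e) \<psi> y = d * pd e \<psi> y" for d y
      using linear_scale[OF has_derivative_linear[OF smooth_has_derivative[OF s]]] by simp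
    have "((\<lambda>s. z + s *\<^sub>R e) has_derivative (\<lambda>d. d *\<^sub>R e)) (at s)"
      by (auto intro!: derivative_eq_intros)
    from has_derivative_compose[OF this smooth_has_derivative[OF s]]
    have "((\<lambda>s. \<psi> (z + s *\<^sub>R e)) has_derivative (\<lambda>d. d * pd e \<psi> (z + s *\<^sub>R e))) (at s)"
      by (simp only: lin)
    then show ?thesis
      by (simp add: has_field_derivative_def mult_commute_abs)
  qed
  have "(\<lambda>m. \<integral>z. g m z \<partial>lborel) \<longlonglongrightarrow> (\<integral>z. pd e \<psi> z \<partial>lborel)"
  proof (rule integral_dominated_convergence)
    show "integrable lborel (\<lambda>z. M * indicator K' z)"
      using K' by (intro integrable_mult_right integrable_real_indicator)
        (auto simp: compact_imp_closed compact_emeasure_top)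
    show "AE z in lborel. (\<lambda>m. g m z) \<longlonglongrightarrow> pd e \<psi> z"
    proof (rule AE_I2)
      fix z
      have "((\<lambda>s. (\<psi> (z + s *\<^sub>R e) - \<psi> z) / s) \<longlongrightarrow> pd e \<psi> z) (at 0)"
        using line[of z 0] by (simp add: DERIV_def)
      moreover have "filterlim h (at 0) sequentially"
        unfolding filterlim_at h_def using LIMSEQ_inverse_real_of_nat by auto
      ultimately show "(\<lambda>m. g m z) \<longlonglongrightarrow> pd e \<psi> z"
        unfolding g_def by (rule filterlim_compose)
    qed
    show "AE z in lborel. norm (g m z) \<le> M * indicator K' z" for m
    proof (rule AE_I2)
      fix z
      obtain s where s: "0 < s" "s < h m" "\<psi> (z + h m *\<^sub>R e) - \<psi> (z + 0 *\<^sub>R e) = (h m - 0) * pd e \<psi> (z + s *\<^sub>R e)"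
        using MVT2[of 0 "h m" "\<lambda>s. \<psi> (z + s *\<^sub>R e)" "\<lambda>s. pd e \<psi> (z + s *\<^sub>R e)"] line h(1)[of m] by blast
      have le: "\<bar>g m z\<bar> \<le> M" using s(3) M h(1)[of m] by (simp add: g_def)
      have "g m z = 0" if "z \<notin> K'"
      proof -
        have "z + r *\<^sub>R e \<notin> K" if "r \<in> {0..1}" for r
        proof
          assume "z + r *\<^sub>R e \<in> K"
          then have "(z + r *\<^sub>R e) - r *\<^sub>R e \<in> K'" unfolding K'_def using that by force
          with \<open>z \<notin> K'\<close> show False by simp
        qed
        from this[of "h m"] this[of 0] h[of m] show ?thesis using K(2) by (simp add: g_def less_imp_le)
      qed
      with le show "norm (g m z) \<le> M * indicator K' z" by (auto simp: indicator_def)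
    qed
  qed (simp_all add: g_def[abs_def])
  moreover have "(\<integral>z. g m z \<partial>lborel) = 0" for m
  proof -
    have i: "integrable lborel \<psi>" by (rule test_fun_integrable[OF t])
    have "integrable lborel (\<lambda>z. \<psi> (h m *\<^sub>R e + z))"
      using i by (subst integrable_distr_eq[of _ _ borel, symmetric]) (auto simp: lborel_distr_plus)
    then show ?thesis unfolding g_def using i
      by (simp add: lborel_integral_translate add.commute)
  qed
  ultimately show ?thesis by (simp add: LIMSEQ_const_iff)
qed

section \<open>Weak derivatives in Lebesgue spaces\<close>

text \<open>The p-th power of the norm, as an extended nonnegative integral over all of space-time.
  Estimates then need no integrability premises, and membership in the Lebesgue space is
  finiteness.\<close>

definition Np :: "real \<Rightarrow> ('a::euclidean_space \<Rightarrow> real) \<Rightarrow> ennreal" where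
  "Np p h = (\<integral>\<^sup>+z. ennreal (\<bar>h z\<bar> powr p) \<partial>lborel)"

abbreviation (input) Np_le :: "real \<Rightarrow> ('a::euclidean_space \<Rightarrow> real) \<Rightarrow> real \<Rightarrow> bool" where
  "Np_le p f W \<equiv> Np p f \<le> ennreal (W powr p)"

lemma Np_cong_AE: "AE z in lborel. f z = g z \<Longrightarrow> Np p f = Np p g"
  unfolding Np_def by (rule nn_integral_cong_AE) auto

lemma Np_mono_AE: "0 \<le> p \<Longrightarrow> AE z in lborel. \<bar>f z\<bar> \<le> \<bar>g z\<bar> \<Longrightarrow> Np p f \<le> Np p g"
  unfolding Np_def by (rule nn_integral_mono_AE) (auto elim!: eventually_mono intro!: ennreal_leI powr_mono2)

lemma Np_mono: "0 \<le> p \<Longrightarrow> (\<And>z. \<bar>f z\<bar> \<le> \<bar>g z\<bar>) \<Longrightarrow> Np p f \<le> Np p g"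
  by (rule Np_mono_AE) auto

lemma Np_cmult: "f \<in> borel_fun \<Longrightarrow> Np p (\<lambda>z. c * f z) = ennreal (\<bar>c\<bar> powr p) * Np p f"
  unfolding Np_def by (subst nn_integral_cmult[symmetric]) (auto simp: abs_mult powr_mult ennreal_mult)

lemma powr_add_le:
  fixes a b :: real assumes "0 \<le> a" "0 \<le> b" "0 \<le> p"
  shows "(a + b) powr p \<le> 2 powr p * (a powr p + b powr p)"
proof -
  have "(a + b) powr p \<le> (2 * max a b) powr p"
    using assms by (intro powr_mono2) auto
  also have "\<dots> = 2 powr p * max a b powr p" using assms by (simp add: powr_mult)
  also have "max a b powr p \<le> a powr p + b powr p" using assms by (auto simp: max_def)
  finally show ?thesis by simp
qed

lemma Np_add:
  assumes [measurable]: "f \<in> borel_fun" "g \<in> borel_fun" and p: "0 \<le> p"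
  shows "Np p (\<lambda>z. f z + g z) \<le> ennreal (2 powr p) * (Np p f + Np p g)"
proof -
  have "\<bar>f z + g z\<bar> powr p \<le> 2 powr p * (\<bar>f z\<bar> powr p + \<bar>g z\<bar> powr p)" for z
    using powr_mono2[OF p, of "\<bar>f z + g z\<bar>" "\<bar>f z\<bar> + \<bar>g z\<bar>"] powr_add_le[OF _ _ p, of "\<bar>f z\<bar>" "\<bar>g z\<bar>"] by force
  then have "Np p (\<lambda>z. f z + g z) \<le> (\<integral>\<^sup>+z. ennreal (2 powr p) * (ennreal (\<bar>f z\<bar> powr p) + ennreal (\<bar>g z\<bar> powr p)) \<partial>lborel)"
    unfolding Np_def by (intro nn_integral_mono) (simp add: ennreal_mult[symmetric] ennreal_plus[symmetric] del: ennreal_plus)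
  then show ?thesis
    by (subst (asm) nn_integral_cmult) (simp_all add: Np_def nn_integral_add)
qed

lemma Np_add_finite:
  assumes "f \<in> borel_fun" "g \<in> borel_fun" "0 \<le> p" "Np p f < top" "Np p g < top"
  shows "Np p (\<lambda>z. f z + g z) < top"
  by (rule le_less_trans[OF Np_add[OF assms(1-3)]]) (use assms in \<open>auto simp: ennreal_mult_less_top\<close>)

lemma test_fun_Np_finite:
  assumes "test_fun U \<psi>" "0 \<le> p" shows "Np p \<psi> < top"
proof -
  obtain K where K: "compact K" "\<And>z. z \<notin> K \<Longrightarrow> \<psi> z = 0"
    using assms unfolding test_fun_iff by blast
  obtain M where M: "\<And>z. \<bar>\<psi> z\<bar> \<le> M" using test_fun_bounded[OF assms(1)] by blast
  have "Np p \<psi> \<le> (\<integral>\<^sup>+z. ennreal (M powr p) * indicator K z \<partial>lborel)"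
    unfolding Np_def using K(2) M assms(2)
    by (intro nn_integral_mono) (auto simp: indicator_def intro!: ennreal_leI powr_mono2)
  also have "\<dots> < top"
    using K(1) by (simp add: nn_integral_cmult_indicator compact_imp_closed compact_emeasure_top ennreal_mult_less_top)
  finally show ?thesis .
qed

text \<open>On the compact set |h| \<le> |h|^p + 1, and both terms have finite integral
  there.\<close>

lemma Np_local_integrable:
  fixes h \<psi> :: "'a::euclidean_space \<Rightarrow> real"
  assumes [measurable]: "h \<in> borel_fun" "\<psi> \<in> borel_fun"
    and p: "1 \<le> p" and fin: "Np p h < top"
    and K: "compact K" "\<And>z. z \<notin> K \<Longrightarrow> \<psi> z = 0" and M: "\<And>z. \<bar>\<psi> z\<bar> \<le> M"
  shows "integrable lborel (\<lambda>z. h z * \<psi> z)"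
proof (rule Bochner_Integration.integrable_bound)
  have M0: "0 \<le> M" using M[of undefined] by linarith
  have "integrable lborel (\<lambda>z. \<bar>h z\<bar> powr p)"
    using fin by (intro integrableI_bounded) (auto simp: Np_def)
  then show "integrable lborel (\<lambda>z. M * (\<bar>h z\<bar> powr p + indicator K z))"
    using K by (intro integrable_mult_right Bochner_Integration.integrable_add integrable_real_indicator)
      (auto simp: compact_imp_closed compact_emeasure_top)
  have le1: "x \<le> x powr p + 1" if "0 \<le> x" for x :: real
    using powr_mono[of 1 p x] p that by (cases "1 \<le> x") (auto simp: add_increasing)
  show "AE z in lborel. norm (h z * \<psi> z) \<le> norm (M * (\<bar>h z\<bar> powr p + indicator K z))"
  proof (rule AE_I2)
    fix z
    show "norm (h z * \<psi> z) \<le> norm (M * (\<bar>h z\<bar> powr p + indicator K z))"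
    proof (cases "z \<in> K")
      case True
      have "\<bar>h z\<bar> * \<bar>\<psi> z\<bar> \<le> (\<bar>h z\<bar> powr p + 1) * M"
        by (intro mult_mono le1 M) auto
      then show ?thesis using True M0 by (simp add: abs_mult mult.commute)
    qed (use K in simp)
  qed
qed auto

lemma Np_test_integrable:
  assumes "h \<in> borel_fun" "1 \<le> p" "Np p h < top" "test_fun U \<psi>"
  shows "integrable lborel (\<lambda>z. h z * \<psi> z)"
  using Np_local_integrable[OF assms(1) test_fun_borel[OF assms(4)] assms(2,3)] assms(4) test_fun_bounded[OF assms(4)]
  unfolding test_fun_iff by metis

text \<open>Test functions and integrals range over the whole space: cut-off functions live there,
  and no domain has to be carried through scalings, sums and limits.\<close>

definition wd :: "'a::euclidean_space \<Rightarrow> ('a \<Rightarrow> real) \<Rightarrow> ('a \<Rightarrow> real) \<Rightarrow> bool" where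
  "wd e f g \<longleftrightarrow> (\<forall>\<psi>. test_fun UNIV \<psi> \<longrightarrow>
     (\<integral>z. f z * pd e \<psi> z \<partial>lborel) = - (\<integral>z. g z * \<psi> z \<partial>lborel))"

lemma intU:
  fixes F F' :: "'a::euclidean_space \<Rightarrow> real"
  assumes U: "open U" and [measurable]: "F' \<in> borel_fun" "\<eta> \<in> borel_fun"
    and ae: "AE z in lborel. z \<in> U \<longrightarrow> F' z = F z" and 0: "\<And>z. z \<notin> U \<Longrightarrow> \<eta> z = 0"
    and [measurable]: "F \<in> borel_measurable (lebesgue_on U)"
  shows "integral\<^sup>L (lebesgue_on U) (\<lambda>z. F z * \<eta> z) = (\<integral>z. F' z * \<eta> z \<partial>lborel)"
proof -
  have "integral\<^sup>L (lebesgue_on U) (\<lambda>z. F z * \<eta> z) = integral\<^sup>L lebesgue (\<lambda>z. indicator U z *\<^sub>R (F z * \<eta> z))"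
    by (rule integral_restrict_space) (use U in auto)
  also have "\<dots> = integral\<^sup>L lebesgue (\<lambda>z. F' z * \<eta> z)"
  proof (rule integral_cong_AE)
    have "(\<lambda>z. F z * \<eta> z) \<in> borel_measurable (lebesgue_on U)"
      by (intro borel_measurable_times assms(6) measurable_restrict_space1 measurable_completion) simp
    then show "(\<lambda>z. indicator U z *\<^sub>R (F z * \<eta> z)) \<in> borel_measurable lebesgue"
      using U by (subst (asm) borel_measurable_restrict_space_iff) auto
    show "(\<lambda>z. F' z * \<eta> z) \<in> borel_measurable lebesgue" by (intro measurable_completion) simp
    show "AE z in lebesgue. indicator U z *\<^sub>R (F z * \<eta> z) = F' z * \<eta> z"
      using ae 0 by (intro AE_completion) (auto elim!: eventually_mono simp: indicator_def)
  qed
  also have "\<dots> = (\<integral>z. F' z * \<eta> z \<partial>lborel)"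
    by (rule integral_completion) simp
  finally show ?thesis .
qed

lemma borel_version:
  fixes f :: "'a::euclidean_space \<Rightarrow> real"
  assumes "f \<in> borel_measurable (lebesgue_on U)" "U \<in> sets lebesgue"
  shows "\<exists>f'\<in>borel_fun. AE z in lborel. f' z = indicator U z * f z"
proof -
  have "(\<lambda>z. indicator U z *\<^sub>R f z) \<in> borel_measurable lebesgue"
    using assms by (subst (asm) borel_measurable_restrict_space_iff) auto
  from completion_ex_borel_measurable_real[OF this] show ?thesis
    by (auto simp: eq_commute)
qed

text \<open>Passage from Lebesgue classes on a set to Borel functions on the whole space, by
  extension with zero and a change on a null set. Fubini's theorem and composition with scalings
  then apply without completions.\<close>

lemma in_Lp_version:
  fixes f :: "'a::euclidean_space \<Rightarrow> real"
  assumes f: "in_Lp p U f" and U: "U \<in> sets lebesgue" and p: "0 < p"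
  shows "\<exists>f'\<in>borel_fun. (AE z in lborel. f' z = indicator U z * f z) \<and> Np p f' = ennreal (Lp_norm p U f powr p)"
proof -
  have m: "f \<in> borel_measurable (lebesgue_on U)" and i: "integrable (lebesgue_on U) (\<lambda>z. \<bar>f z\<bar> powr p)"
    using f by (auto simp: in_Lp_def)
  obtain f' where f': "f' \<in> borel_fun" "AE z in lborel. f' z = indicator U z * f z"
    using borel_version[OF m U] by blast
  have "Np p f' = (\<integral>\<^sup>+z. ennreal (\<bar>f z\<bar> powr p) * indicator U z \<partial>lborel)"
    unfolding Np_def using f'(2) by (intro nn_integral_cong_AE) (auto elim!: eventually_mono simp: indicator_def)
  also have "\<dots> = (\<integral>\<^sup>+z. ennreal (\<bar>f z\<bar> powr p) * indicator U z \<partial>lebesgue)"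
    by (simp add: nn_integral_completion)
  also have "\<dots> = (\<integral>\<^sup>+z. ennreal (\<bar>f z\<bar> powr p) \<partial>lebesgue_on U)"
    by (rule nn_integral_restrict_space[symmetric]) (use U in simp)
  also have "\<dots> = ennreal (integral\<^sup>L (lebesgue_on U) (\<lambda>z. \<bar>f z\<bar> powr p))"
    by (rule nn_integral_eq_integral[OF i]) simp
  also have "integral\<^sup>L (lebesgue_on U) (\<lambda>z. \<bar>f z\<bar> powr p) = Lp_norm p U f powr p"
    unfolding Lp_norm_def using p by (simp add: powr_powr)
  finally show ?thesis using f' by blast
qed

lemma in_Lp_of_Np:
  fixes h :: "'a::euclidean_space \<Rightarrow> real"
  assumes [measurable]: "h \<in> borel_fun" and "Np p h < top" and U: "U \<in> sets lebesgue"
  shows "in_Lp p U h"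
proof -
  have "integrable lborel (\<lambda>z. \<bar>h z\<bar> powr p)"
    using assms(2) by (intro integrableI_bounded) (auto simp: Np_def)
  then have "integrable lebesgue (\<lambda>z. \<bar>h z\<bar> powr p)"
    by (subst integrable_completion) auto
  then have "integrable (lebesgue_on U) (\<lambda>z. \<bar>h z\<bar> powr p)"
    using integrable_mult_indicator[OF U, of "\<lambda>z. \<bar>h z\<bar> powr p"] U
    by (subst integrable_restrict_space) auto
  moreover have "h \<in> borel_measurable (lebesgue_on U)"
    by (intro measurable_restrict_space1 measurable_completion) simp
  ultimately show ?thesis by (simp add: in_Lp_def)
qed

lemma wd_weak_deriv:
  fixes f g :: "'a::euclidean_space \<Rightarrow> real"
  assumes "wd e f g" "e \<in> Basis" and [measurable]: "f \<in> borel_fun" "g \<in> borel_fun" and U: "open U"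
  shows "weak_deriv U e f g"
  unfolding weak_deriv_def
proof (intro allI impI)
  fix \<psi> assume t: "test_fun U \<psi>"
  have z: "\<And>z. z \<notin> U \<Longrightarrow> \<psi> z = 0" "\<And>z. z \<notin> U \<Longrightarrow> pd e \<psi> z = 0"
    using t test_fun_pd[OF t assms(2)] unfolding test_fun_iff by blast+
  have [measurable]: "\<psi> \<in> borel_fun" "pd e \<psi> \<in> borel_fun"
    using t assms(2) by (auto intro: test_fun_borel test_fun_pd)
  have m: "f \<in> borel_measurable (lebesgue_on U)" "g \<in> borel_measurable (lebesgue_on U)"
    by (auto intro!: measurable_restrict_space1 measurable_completion)
  have "test_fun UNIV \<psi>" using test_fun_mono[OF t] by blast
  then show "integral\<^sup>L (lebesgue_on U) (\<lambda>z. f z * pd e \<psi> z) = - integral\<^sup>L (lebesgue_on U) (\<lambda>z. g z * \<psi> z)"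
    using assms(1) intU[OF U, of f "pd e \<psi>" f] intU[OF U, of g \<psi> g] z m by (simp add: wd_def)
qed

text \<open>The weak identity on \<open>U\<close> is tested with \<zeta> \<psi>, which is supported
  inside \<open>U\<close>; the product rule for its derivative yields the lower-order term of the
  weak Leibniz formula.\<close>

lemma cutoff_wd:
  fixes f f' g g' \<zeta> :: "'a::euclidean_space \<Rightarrow> real"
  assumes U: "open U" and e: "e \<in> Basis" and p: "1 \<le> p"
    and wk: "weak_deriv U e f g"
    and mf: "f \<in> borel_measurable (lebesgue_on U)" and mg: "g \<in> borel_measurable (lebesgue_on U)"
    and [measurable]: "f' \<in> borel_fun" "g' \<in> borel_fun"
    and ae: "AE z in lborel. z \<in> U \<longrightarrow> f' z = f z" "AE z in lborel. z \<in> U \<longrightarrow> g' z = g z"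
    and fin: "Np p f' < top" "Np p g' < top"
    and \<zeta>: "test_fun U \<zeta>"
  shows "wd e (\<lambda>z. \<zeta> z * f' z) (\<lambda>z. \<zeta> z * g' z + pd e \<zeta> z * f' z)"
  unfolding wd_def
proof (intro allI impI)
  fix \<psi> :: "'a \<Rightarrow> real" assume t: "test_fun UNIV \<psi>"
  have s: "smooth \<psi>" "smooth \<zeta>" using t \<zeta> by (auto simp: test_fun_iff)
  have t1: "test_fun U (\<lambda>z. \<zeta> z * \<psi> z)" using test_fun_mult[OF s(1) \<zeta>] by (simp add: mult.commute)
  have t2: "test_fun U (\<lambda>z. \<zeta> z * pd e \<psi> z)"
    using test_fun_mult[OF smooth_pd[OF s(1) e] \<zeta>] by (simp add: mult.commute)
  have t3: "test_fun U (\<lambda>z. pd e \<zeta> z * \<psi> z)"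
    using test_fun_mult[OF s(1) test_fun_pd[OF \<zeta> e]] by (simp add: mult.commute)
  have [measurable]: "\<zeta> \<in> borel_fun" "\<psi> \<in> borel_fun"
      "pd e \<psi> \<in> borel_fun" "pd e \<zeta> \<in> borel_fun"
    using \<zeta> t e by (auto intro: test_fun_borel test_fun_pd)
  have pdeq: "pd e (\<lambda>z. \<zeta> z * \<psi> z) z = \<zeta> z * pd e \<psi> z + pd e \<zeta> z * \<psi> z" for z
    using pd_mult[OF s(2,1)] by auto
  have z: "\<zeta> z = 0" "pd e \<zeta> z = 0" if "z \<notin> U" for z
    using that \<zeta> test_fun_pd[OF \<zeta> e] unfolding test_fun_iff by blast+
  have "integral\<^sup>L (lebesgue_on U) (\<lambda>z. f z * pd e (\<lambda>z. \<zeta> z * \<psi> z) z)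
      = - integral\<^sup>L (lebesgue_on U) (\<lambda>z. g z * (\<zeta> z * \<psi> z))"
    using wk t1 unfolding weak_deriv_def by blast
  then have *: "(\<integral>z. f' z * (\<zeta> z * pd e \<psi> z + pd e \<zeta> z * \<psi> z) \<partial>lborel) = - (\<integral>z. g' z * (\<zeta> z * \<psi> z) \<partial>lborel)"
    unfolding pdeq using intU[OF U, of f' "\<lambda>z. \<zeta> z * pd e \<psi> z + pd e \<zeta> z * \<psi> z" f]
      intU[OF U, of g' "\<lambda>z. \<zeta> z * \<psi> z" g] ae z mf mg by simp
  note i = Np_test_integrable[OF _ p fin(1) t2] Np_test_integrable[OF _ p fin(1) t3] Np_test_integrable[OF _ p fin(2) t1]
  have "(\<integral>z. f' z * (\<zeta> z * pd e \<psi> z + pd e \<zeta> z * \<psi> z) \<partial>lborel)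
      = (\<integral>z. f' z * (\<zeta> z * pd e \<psi> z) \<partial>lborel) + (\<integral>z. f' z * (pd e \<zeta> z * \<psi> z) \<partial>lborel)"
    unfolding distrib_left by (intro Bochner_Integration.integral_add i) simp_all
  moreover have "(\<integral>z. (\<zeta> z * g' z + pd e \<zeta> z * f' z) * \<psi> z \<partial>lborel)
      = (\<integral>z. g' z * (\<zeta> z * \<psi> z) + f' z * (pd e \<zeta> z * \<psi> z) \<partial>lborel)"
    by (intro Bochner_Integration.integral_cong) (auto simp: algebra_simps)
  moreover have "\<dots> = (\<integral>z. g' z * (\<zeta> z * \<psi> z) \<partial>lborel) + (\<integral>z. f' z * (pd e \<zeta> z * \<psi> z) \<partial>lborel)"
    by (intro Bochner_Integration.integral_add i) simp_all
  ultimately show "(\<integral>z. \<zeta> z * f' z * pd e \<psi> z \<partial>lborel) = - (\<integral>z. (\<zeta> z * g' z + pd e \<zeta> z * f' z) * \<psi> z \<partial>lborel)"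
    using * by (simp add: mult_ac)
qed

lemma wd_smooth:
  assumes s: "smooth f" and e: "e \<in> Basis" shows "wd e f (pd e f)"
  unfolding wd_def
proof (intro allI impI)
  fix \<psi> :: "'a \<Rightarrow> real" assume t: "test_fun UNIV \<psi>"
  have st: "smooth \<psi>" using t by (simp add: test_fun_iff)
  have 0: "(\<integral>z. pd e (\<lambda>z. f z * \<psi> z) z \<partial>lborel) = 0"
    by (rule test_fun_integral_pd[OF test_fun_mult[OF s t] e])
  have "integrable lborel (\<lambda>z. f z * pd e \<psi> z)" "integrable lborel (\<lambda>z. pd e f z * \<psi> z)"
    using test_fun_integrable[OF test_fun_mult[OF s test_fun_pd[OF t e]]]
      test_fun_integrable[OF test_fun_mult[OF smooth_pd[OF s e] t]] .
  then show "(\<integral>z. f z * pd e \<psi> z \<partial>lborel) = - (\<integral>z. pd e f z * \<psi> z \<partial>lborel)"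
    using 0 unfolding pd_mult[OF s st] by simp
qed

lemma wd_add:
  assumes "wd e f g" "wd e f' g'" "e \<in> Basis" "1 \<le> p"
    "f \<in> borel_fun" "g \<in> borel_fun" "f' \<in> borel_fun" "g' \<in> borel_fun"
    "Np p f < top" "Np p g < top" "Np p f' < top" "Np p g' < top"
  shows "wd e (\<lambda>z. f z + f' z) (\<lambda>z. g z + g' z)"
  unfolding wd_def
proof (intro allI impI)
  fix \<psi> :: "'a \<Rightarrow> real" assume t: "test_fun UNIV \<psi>"
  note i = Np_test_integrable[OF _ assms(4) _ t] Np_test_integrable[OF _ assms(4) _ test_fun_pd[OF t assms(3)]]
  show "(\<integral>z. (f z + f' z) * pd e \<psi> z \<partial>lborel) = - (\<integral>z. (g z + g' z) * \<psi> z \<partial>lborel)"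
    using assms i t unfolding wd_def by (simp add: distrib_right)
qed

lemma wd_cmult: "wd e f g \<Longrightarrow> wd e (\<lambda>z. c * f z) (\<lambda>z. c * g z)"
  unfolding wd_def by (simp add: mult.assoc)

section \<open>Sobolev functions on the whole of space-time\<close>

abbreviation sp :: "'n::finite \<Rightarrow> (real^'n) \<times> real" where "sp k \<equiv> (axis k 1, 0)"
abbreviation tm :: "(real^'n) \<times> real" where "tm \<equiv> (0, 1)"

lemma sp_Basis: "sp k \<in> Basis" by (auto simp: Basis_prod_def axis_in_Basis_iff)
lemma tm_Basis: "tm \<in> Basis" by (auto simp: Basis_prod_def)

definition Sob :: "real \<Rightarrow> ((real^'n) \<times> real \<Rightarrow> real) \<Rightarrow> ('n pt \<Rightarrow> real)
    \<Rightarrow> ('n \<Rightarrow> 'n pt \<Rightarrow> real) \<Rightarrow> ('n \<Rightarrow> 'n \<Rightarrow> 'n pt \<Rightarrow> real) \<Rightarrow> bool" where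
  "Sob p f ft Df D2f \<longleftrightarrow>
     f \<in> borel_fun \<and> ft \<in> borel_fun
     \<and> (\<forall>k. Df k \<in> borel_fun) \<and> (\<forall>k l. D2f k l \<in> borel_fun)
     \<and> Np p f < top \<and> Np p ft < top \<and> (\<forall>k. Np p (Df k) < top) \<and> (\<forall>k l. Np p (D2f k l) < top)
     \<and> wd tm f ft \<and> (\<forall>k. wd (sp k) f (Df k)) \<and> (\<forall>k l. wd (sp l) (Df k) (D2f k l))"

lemma SobD:
  assumes "Sob p f ft Df D2f"
  shows "f \<in> borel_fun" "ft \<in> borel_fun" "Df k \<in> borel_fun"
    "D2f k l \<in> borel_fun" "Np p f < top" "Np p ft < top" "Np p (Df k) < top" "Np p (D2f k l) < top"
    "wd tm f ft" "wd (sp k) f (Df k)" "wd (sp l) (Df k) (D2f k l)"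
  using assms unfolding Sob_def by auto

text \<open>This is what admits the functions constructed below as test functions in the viscosity
  definition, whatever the cylinder.\<close>

lemma Sob_W21_loc:
  fixes f :: "(real^'n) \<times> real \<Rightarrow> real"
  assumes "Sob p f ft Df D2f"
  shows "W21_loc p \<Omega> T f ft (\<lambda>z. \<chi> k. Df k z) (\<lambda>z. \<chi> k l. D2f k l z)"
  unfolding W21_loc_def W21_def
  using SobD[OF assms] sp_Basis tm_Basis
  by (auto simp: compactly_inside_def intro!: in_Lp_of_Np wd_weak_deriv)

lemma Sob_add:
  assumes f: "Sob p f ft Df D2f" and g: "Sob p g gt Dg D2g" and p: "1 \<le> p"
  shows "Sob p (\<lambda>z. f z + g z) (\<lambda>z. ft z + gt z) (\<lambda>k z. Df k z + Dg k z) (\<lambda>k l z. D2f k l z + D2g k l z)"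
  using SobD[OF f] SobD[OF g] p sp_Basis tm_Basis unfolding Sob_def
  by (auto intro!: Np_add_finite wd_add[where p = p])

lemma Sob_cmult:
  assumes f: "Sob p f ft Df D2f"
  shows "Sob p (\<lambda>z. c * f z) (\<lambda>z. c * ft z) (\<lambda>k z. c * Df k z) (\<lambda>k l z. c * D2f k l z)"
  using SobD[OF f] unfolding Sob_def
  by (auto intro!: wd_cmult simp: Np_cmult ennreal_mult_less_top)

lemma Sob_test_fun:
  assumes t: "test_fun UNIV f" and p: "0 \<le> p"
  shows "Sob p f (pd tm f) (\<lambda>k. pd (sp k) f) (\<lambda>k l. pd (sp l) (pd (sp k) f))"
proof -
  have t': "test_fun UNIV (pd e f)" if "e \<in> Basis" for e by (rule test_fun_pd[OF t that])
  show ?thesis unfolding Sob_def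
    using t t' p sp_Basis tm_Basis
    by (auto intro!: test_fun_borel test_fun_Np_finite wd_smooth test_fun_pd intro: test_fun_iff[THEN iffD1, THEN conjunct1])
qed

section \<open>Parabolic scaling\<close>

definition psc :: "real \<Rightarrow> (real^'n) \<times> real \<Rightarrow> 'n pt \<Rightarrow> 'n pt" where
  "psc r w z = (fst w + r *\<^sub>R fst z, snd w + r\<^sup>2 * snd z)"

definition pcoef :: "real \<Rightarrow> (real^'n) \<times> real \<Rightarrow> real" where
  "pcoef r j = (if snd j = 0 then r else r\<^sup>2)"

text \<open>The homogeneous dimension of parabolic space-time: \<open>psc r w\<close> multiplies
  volumes by \<open>r\<close> to this power.\<close>

definition hdim :: "'n::finite itself \<Rightarrow> real" where "hdim _ = real CARD('n) + 2"

lemma psc_inverse': "r \<noteq> 0 \<Longrightarrow> psc (1 / r) (- (1 / r) *\<^sub>R fst w, - (1 / r\<^sup>2) * snd w) (psc r w z) = z"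
  by (simp add: psc_def prod_eq_iff algebra_simps power_divide)

lemma psc_euclid: "psc r w (z :: (real^'n) \<times> real) = w + (\<Sum>j\<in>Basis. (pcoef r j * (z \<bullet> j)) *\<^sub>R j)"
proof (rule euclidean_eqI)
  fix b :: "'n pt" assume b: "b \<in> Basis"
  have "(w + (\<Sum>j\<in>Basis. (pcoef r j * (z \<bullet> j)) *\<^sub>R j)) \<bullet> b = w \<bullet> b + pcoef r b * (z \<bullet> b)"
    using b by (simp add: inner_add_left inner_sum_left inner_Basis if_distrib cong: if_cong)
  also have "\<dots> = psc r w z \<bullet> b"
    using b by (cases z; cases w) (auto simp: psc_def pcoef_def Basis_prod_def inner_add_left)
  finally show "psc r w z \<bullet> b = (w + (\<Sum>j\<in>Basis. (pcoef r j * (z \<bullet> j)) *\<^sub>R j)) \<bullet> b" ..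
qed

lemma prod_pcoef: "(\<Prod>j\<in>(Basis :: ((real^'n) \<times> real) set). \<bar>pcoef r j\<bar>) = \<bar>r\<bar> ^ (CARD('n) + 2)"
proof -
  have "(\<Prod>j\<in>(Basis :: 'n pt set). \<bar>pcoef r j\<bar>)
    = (\<Prod>j\<in>(\<lambda>u. (u, 0)) ` (Basis::(real^'n) set). \<bar>pcoef r j\<bar>) * (\<Prod>j\<in>{(0::real^'n, 1::real)}. \<bar>pcoef r j\<bar>)"
    unfolding Basis_prod_def by (subst prod.union_disjoint) auto
  also have "(\<Prod>j\<in>(\<lambda>u. (u, 0)) ` (Basis::(real^'n) set). \<bar>pcoef r j\<bar>) = \<bar>r\<bar> ^ CARD('n)"
    by (subst prod.reindex) (auto simp: inj_on_def pcoef_def)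
  finally show ?thesis by (simp add: pcoef_def power_add power2_eq_square abs_mult)
qed

lemma lborel_psc:
  assumes "r \<noteq> 0"
  shows "lborel = density (distr lborel borel (psc r w)) (\<lambda>_::(real^'n) \<times> real. ennreal (\<bar>r\<bar> ^ (CARD('n) + 2)))"
proof -
  have "psc r w = (\<lambda>x. w + (\<Sum>j\<in>Basis. (pcoef r j * (x \<bullet> j)) *\<^sub>R j))" using psc_euclid by blast
  then show ?thesis
    using lborel_affine_euclidean[of "pcoef r" w, unfolded prod_pcoef] assms by (simp add: pcoef_def)
qed

lemma psc_continuous: "continuous_on UNIV (psc r w)"
  unfolding psc_def[abs_def] by (intro continuous_intros)

lemma psc_borel [measurable]: "psc r w \<in> borel_fun"
  by (rule borel_measurable_continuous_onI[OF psc_continuous])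

lemma nn_integral_psc:
  fixes f :: "(real^'n) \<times> real \<Rightarrow> ennreal"
  assumes [measurable]: "f \<in> borel_fun" and "r \<noteq> 0"
  shows "(\<integral>\<^sup>+z. f z \<partial>lborel) = ennreal (\<bar>r\<bar> ^ (CARD('n) + 2)) * (\<integral>\<^sup>+z. f (psc r w z) \<partial>lborel)"
  by (subst lborel_psc[OF assms(2), of w]) (simp add: nn_integral_density nn_integral_distr nn_integral_cmult)

lemma integral_psc:
  fixes f :: "(real^'n) \<times> real \<Rightarrow> real"
  assumes [measurable]: "f \<in> borel_fun" and "r \<noteq> 0"
  shows "(\<integral>z. f z \<partial>lborel) = \<bar>r\<bar> ^ (CARD('n) + 2) * (\<integral>z. f (psc r w z) \<partial>lborel)"
  by (subst lborel_psc[OF assms(2), of w]) (simp add: integral_density integral_distr)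

lemma Np_psc:
  fixes f :: "(real^'n) \<times> real \<Rightarrow> real"
  assumes [measurable]: "f \<in> borel_fun" and "r \<noteq> 0"
  shows "Np p f = ennreal (\<bar>r\<bar> ^ (CARD('n) + 2)) * Np p (\<lambda>z. f (psc r w z))"
  unfolding Np_def by (rule nn_integral_psc) (use assms in auto)

lemma AE_psc:
  fixes P :: "(real^'n) \<times> real \<Rightarrow> bool"
  assumes r: "r \<noteq> 0" and ae: "AE z in lborel. P z"
  shows "AE z in lborel. P (psc r w z)"
proof -
  obtain N where N: "{z. \<not> P z} \<subseteq> N" "N \<in> sets borel" "vol N = 0"
    using ae by (auto elim!: AE_E)
  have "(\<integral>\<^sup>+z. indicator N (psc r w z) \<partial>lborel) = 0"
    using nn_integral_psc[of "indicator N" r w] N r by (simp add: nn_integral_indicator)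
  then have "AE z in lborel. (indicator N (psc r w z)::ennreal) = 0"
    using N(2) by (subst (asm) nn_integral_0_iff_AE) auto
  then show ?thesis using N(1) by (auto elim!: eventually_mono simp: indicator_def split: if_splits)
qed

lemma has_derivative_psc: "(psc r w has_derivative (\<lambda>e. (r *\<^sub>R fst e, r\<^sup>2 * snd e))) (at z)"
  unfolding psc_def[abs_def] by (auto intro!: derivative_eq_intros)

lemma pd_psc:
  assumes s: "smooth f" and b: "b \<in> Basis"
  shows "pd b (\<lambda>z. f (psc r w z)) z = pcoef r b * pd b f (psc r w z)"
proof -
  have "pd b (\<lambda>z. f (psc r w z)) z = pd (r *\<^sub>R fst b, r\<^sup>2 * snd b) f (psc r w z)"
    using has_derivative_compose[OF has_derivative_psc smooth_has_derivative[OF s]] by (rule pd_eq)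
  also have "(r *\<^sub>R fst b, r\<^sup>2 * snd b) = pcoef r b *\<^sub>R b"
    using b by (auto simp: pcoef_def Basis_prod_def)
  also have "pd (pcoef r b *\<^sub>R b) f (psc r w z) = pcoef r b * pd b f (psc r w z)"
    using linear_scale[OF has_derivative_linear[OF smooth_has_derivative[OF s]]] by simp
  finally show ?thesis .
qed

lemma smooth_psc: "smooth f \<Longrightarrow> smooth (\<lambda>z. f (psc r w z))"
proof -
  have "smooth f \<Longrightarrow> C_k k (\<lambda>z. f (psc r w z))" for k
  proof (induction k arbitrary: f)
    case 0
    then show ?case using continuous_on_compose2[OF smooth_continuous[OF 0] psc_continuous] by simp
  next
    case (Suc k)
    show ?case
    proof (rule C_k_SucI)
      show "((\<lambda>z. f (psc r w z)) has_derivative (\<lambda>e. pd (r *\<^sub>R fst e, r\<^sup>2 * snd e) f (psc r w z))) (at z)" for z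
        using has_derivative_compose[OF has_derivative_psc smooth_has_derivative[OF Suc.prems]] .
      fix b :: "(real^'a) \<times> real" assume b: "b \<in> Basis"
      have "(\<lambda>z. pd (r *\<^sub>R fst b, r\<^sup>2 * snd b) f (psc r w z)) = (\<lambda>z. pcoef r b * pd b f (psc r w z))"
      proof
        fix z
        show "pd (r *\<^sub>R fst b, r\<^sup>2 * snd b) f (psc r w z) = pcoef r b * pd b f (psc r w z)"
          using pd_psc[OF Suc.prems b, of r w z] pd_eq[OF has_derivative_compose[OF has_derivative_psc smooth_has_derivative[OF Suc.prems]], where e = b and z = z]
          by simp
      qed
      then show "C_k k (\<lambda>z. pd (r *\<^sub>R fst b, r\<^sup>2 * snd b) f (psc r w z))"
        using C_k_mult[OF C_k_const Suc.IH[OF smooth_pd[OF Suc.prems b]]] by simp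
    qed
  qed
  then show "smooth f \<Longrightarrow> smooth (\<lambda>z. f (psc r w z))" by (simp add: smooth_def)
qed

lemma test_fun_psc:
  assumes t: "test_fun UNIV f" and r: "r \<noteq> 0" shows "test_fun UNIV (\<lambda>z. f (psc r w z))"
proof -
  obtain K where K: "compact K" "\<And>z. z \<notin> K \<Longrightarrow> f z = 0" and s: "smooth f"
    using t unfolding test_fun_iff by blast
  let ?g = "psc (1 / r) (- (1 / r) *\<^sub>R fst w, - (1 / r\<^sup>2) * snd w)"
  have "compact (?g ` K)"
    by (intro compact_continuous_image continuous_on_subset[OF psc_continuous] K) simp
  moreover have "f (psc r w z) = 0" if "z \<notin> ?g ` K" for z
  proof (rule K(2), rule notI)
    assume "psc r w z \<in> K"
    then have "?g (psc r w z) \<in> ?g ` K" by blast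
    then show False using that psc_inverse'[OF r, of w z] by simp
  qed
  ultimately show ?thesis using s smooth_psc unfolding test_fun_iff by blast
qed

text \<open>The identity for \<open>f\<close> is tested with \<psi> composed with the inverse
  scaling. The Jacobian is the same on both sides and cancels, and the chain rule leaves the factor
  \<open>pcoef r e\<close>.\<close>

lemma wd_psc:
  fixes f g :: "(real^'n) \<times> real \<Rightarrow> real"
  assumes wd: "wd e f g" and e: "e \<in> Basis" and r: "0 < r"
    and [measurable]: "f \<in> borel_fun" "g \<in> borel_fun"
  shows "wd e (\<lambda>z. f (psc r w z)) (\<lambda>z. pcoef r e * g (psc r w z))"
  unfolding wd_def
proof (intro allI impI)
  fix \<psi> :: "'n pt \<Rightarrow> real" assume t: "test_fun UNIV \<psi>"
  let ?w = "(- (1 / r) *\<^sub>R fst w, - (1 / r\<^sup>2) * snd w)"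
  define \<eta> where "\<eta> z = \<psi> (psc (1 / r) ?w z)" for z
  have st: "smooth \<psi>" using t by (simp add: test_fun_iff)
  have t': "test_fun UNIV \<eta>" unfolding \<eta>_def by (rule test_fun_psc[OF t]) (use r in simp)
  have \<eta>: "\<eta> (psc r w z) = \<psi> z" for z unfolding \<eta>_def using psc_inverse'[of r w z] r by simp
  have pd\<eta>: "pd e \<eta> (psc r w z) = (1 / pcoef r e) * pd e \<psi> z" for z
  proof -
    have "pd e \<eta> (psc r w z) = pcoef (1 / r) e * pd e \<psi> z"
      unfolding \<eta>_def using pd_psc[OF st e, of "1 / r" ?w "psc r w z"] psc_inverse'[of r w z] r by simp
    then show ?thesis by (simp add: pcoef_def power_divide)
  qed
  have c: "pcoef r e \<noteq> 0" using r by (simp add: pcoef_def)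
  have [measurable]: "\<eta> \<in> borel_fun" "pd e \<eta> \<in> borel_fun"
    using t' e by (auto intro: test_fun_borel test_fun_pd)
  have "(\<integral>z. f z * pd e \<eta> z \<partial>lborel) = - (\<integral>z. g z * \<eta> z \<partial>lborel)"
    using wd t' unfolding wd_def by blast
  then have *: "r ^ (CARD('n) + 2) * (\<integral>z. f (psc r w z) * ((1 / pcoef r e) * pd e \<psi> z) \<partial>lborel)
      = - (r ^ (CARD('n) + 2) * (\<integral>z. g (psc r w z) * \<psi> z \<partial>lborel))"
    using integral_psc[of "\<lambda>z. f z * pd e \<eta> z" r w] integral_psc[of "\<lambda>z. g z * \<eta> z" r w] r
    by (simp add: \<eta> pd\<eta>)
  have cancel: "a = - b" if "c * a = - (c * b)" "c \<noteq> 0" for a b c :: real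
    using that by (metis mult_left_cancel mult_minus_right)
  have "(\<integral>z. f (psc r w z) * ((1 / pcoef r e) * pd e \<psi> z) \<partial>lborel) = - (\<integral>z. g (psc r w z) * \<psi> z \<partial>lborel)"
    by (rule cancel[OF *]) (use r in simp)
  moreover have "(\<integral>z. f (psc r w z) * ((1 / pcoef r e) * pd e \<psi> z) \<partial>lborel) = (1 / pcoef r e) * (\<integral>z. f (psc r w z) * pd e \<psi> z \<partial>lborel)"
    by (subst integral_mult_right_zero[symmetric]) (simp add: mult_ac)
  ultimately have "(1 / pcoef r e) * (\<integral>z. f (psc r w z) * pd e \<psi> z \<partial>lborel) = - (\<integral>z. g (psc r w z) * \<psi> z \<partial>lborel)"
    by simp
  then have "(\<integral>z. f (psc r w z) * pd e \<psi> z \<partial>lborel) = pcoef r e * - (\<integral>z. g (psc r w z) * \<psi> z \<partial>lborel)"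
    using c by (simp add: field_simps)
  then show "(\<integral>z. f (psc r w z) * pd e \<psi> z \<partial>lborel) = - (\<integral>z. pcoef r e * g (psc r w z) * \<psi> z \<partial>lborel)"
    by (simp add: mult.assoc)
qed

lemma Sob_psc:
  assumes S: "Sob p f ft Df D2f" and r: "0 < r"
  shows "Sob p (\<lambda>z. f (psc r w z)) (\<lambda>z. r\<^sup>2 * ft (psc r w z)) (\<lambda>k z. r * Df k (psc r w z))
    (\<lambda>k l z. r\<^sup>2 * D2f k l (psc r w z))"
proof -
  have fin: "Np p (\<lambda>z. g (psc r w z)) < top" if "Np p g < top" and [measurable]: "g \<in> borel_fun" for g
    using that Np_psc[of g r p w] r by (auto simp: ennreal_mult_less_top)
  have c: "pcoef r (sp k) = r" "pcoef r tm = r\<^sup>2" for k by (auto simp: pcoef_def)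
  have [measurable]: "f \<in> borel_fun" "ft \<in> borel_fun" "Df k \<in> borel_fun"
    "D2f k l \<in> borel_fun" for k l using SobD[OF S] by auto
  have "wd tm (\<lambda>z. f (psc r w z)) (\<lambda>z. r\<^sup>2 * ft (psc r w z))"
    using wd_psc[OF SobD(9)[OF S] tm_Basis r] by (simp add: c)
  moreover have "wd (sp k) (\<lambda>z. f (psc r w z)) (\<lambda>z. r * Df k (psc r w z))" for k
    using wd_psc[OF SobD(10)[OF S] sp_Basis r] by (simp add: c)
  moreover have "wd (sp l) (\<lambda>z. r * Df k (psc r w z)) (\<lambda>z. r\<^sup>2 * D2f k l (psc r w z))" for k l
    using wd_cmult[OF wd_psc[OF SobD(11)[OF S, of l k] sp_Basis r], of r] by (simp add: c power2_eq_square mult.assoc)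
  ultimately show ?thesis unfolding Sob_def
    using SobD(5-8)[OF S] by (auto simp: Np_cmult ennreal_mult_less_top intro!: fin)
qed

text \<open>The graph of x^p lies above its tangent at s, here by Young's inequality. Being affine
  in x, the bound can be summed or integrated, which gives Jensen inequalities without normalised
  measures.\<close>

lemma powr_tangent:
  fixes x s p :: real assumes "0 \<le> x" "0 \<le> s" "1 \<le> p"
  shows "p * s powr (p - 1) * x \<le> x powr p + (p - 1) * s powr p"
proof (cases "p = 1")
  case True then show ?thesis using assms by auto
next
  case False
  then have p: "1 < p" using assms by simp
  have "x * s powr (p - 1) \<le> x powr p / p + (s powr (p - 1)) powr (p / (p - 1)) / (p / (p - 1))"
    using p assms by (intro Youngs_inequality) (auto simp: field_simps)
  also have "(s powr (p - 1)) powr (p / (p - 1)) = s powr p"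
    using p by (simp add: powr_powr)
  finally have "p * (x * s powr (p - 1)) \<le> p * (x powr p / p + s powr p / (p / (p - 1)))"
    using p by (intro mult_left_mono) auto
  also have "\<dots> = x powr p + (p - 1) * s powr p" using p by (simp add: distrib_left)
  finally show ?thesis by (simp add: mult_ac)
qed

lemma powr_minus_one_mult: "0 \<le> s \<Longrightarrow> s powr (p - 1) * s = s powr p" for s p :: real
  by (cases "s = 0") (simp_all add: powr_diff)

text \<open>Jensen's inequality for the points \<open>a k / w k\<close> with weights
  \<open>w k\<close>: the tangent inequalities at the total sum are weighted and added, and total
  weight at most 1 lets the terms in that sum combine.\<close>

lemma finite_power_sum_le:
  fixes a w :: "nat \<Rightarrow> real"
  assumes a: "\<And>k. 0 \<le> a k" and w: "\<And>k. 0 < w k" "(\<Sum>k<N. w k) \<le> 1" and p: "1 \<le> p"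
  shows "(\<Sum>k<N. a k) powr p \<le> (\<Sum>k<N. w k powr (1 - p) * a k powr p)"
proof -
  define s where "s = (\<Sum>k<N. a k)"
  have s: "0 \<le> s" unfolding s_def by (intro sum_nonneg a)
  have "p * s powr (p - 1) * a k \<le> w k powr (1 - p) * a k powr p + (p - 1) * s powr p * w k" for k
  proof -
    have "p * s powr (p - 1) * (a k / w k) \<le> (a k / w k) powr p + (p - 1) * s powr p"
      using a w s p by (intro powr_tangent) (auto intro: divide_nonneg_nonneg less_imp_le)
    then have "w k * (p * s powr (p - 1) * (a k / w k)) \<le> w k * ((a k / w k) powr p + (p - 1) * s powr p)"
      using w(1)[of k] by (intro mult_left_mono) auto
    moreover have "w k * (a k / w k) powr p = w k powr (1 - p) * a k powr p"
      using w(1)[of k] a[of k] by (simp add: powr_divide powr_diff)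
    ultimately show ?thesis using w(1)[of k] by (simp add: algebra_simps)
  qed
  then have "(\<Sum>k<N. p * s powr (p - 1) * a k) \<le> (\<Sum>k<N. w k powr (1 - p) * a k powr p + (p - 1) * s powr p * w k)"
    by (intro sum_mono)
  then have "p * s powr (p - 1) * s \<le> (\<Sum>k<N. w k powr (1 - p) * a k powr p) + (p - 1) * s powr p * (\<Sum>k<N. w k)"
    by (simp add: sum.distrib sum_distrib_left[symmetric] s_def[symmetric])
  moreover have "(p - 1) * s powr p * (\<Sum>k<N. w k) \<le> (p - 1) * s powr p * 1"
    using w(2) p by (intro mult_left_mono) auto
  moreover have "p * s powr (p - 1) * s = p * s powr p"
    unfolding mult.assoc powr_minus_one_mult[OF s] ..
  ultimately show ?thesis unfolding s_def[symmetric] by (simp add: left_diff_distrib)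
qed

text \<open>The finite inequality bounds all partial sums, which yields summability as well. In this
  way an integral bound on the weighted series of powers becomes pointwise convergence almost
  everywhere.\<close>

lemma power_series_le:
  fixes a w :: "nat \<Rightarrow> real"
  assumes a: "\<And>k. 0 \<le> a k" and w: "\<And>k. 0 < w k" "\<And>N. (\<Sum>k<N. w k) \<le> 1" and p: "1 \<le> p"
    and T: "(\<Sum>k. ennreal (w k powr (1 - p) * a k powr p)) < top"
  shows "summable a" "ennreal ((\<Sum>k. a k) powr p) \<le> (\<Sum>k. ennreal (w k powr (1 - p) * a k powr p))"
proof -
  define b where "b k = w k powr (1 - p) * a k powr p" for k
  have b: "0 \<le> b k" for k by (simp add: b_def)
  have sb: "summable b" by (rule summable_suminf_not_top[OF b]) (use T in \<open>simp add: b_def\<close>)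
  have le: "(\<Sum>k<N. a k) powr p \<le> suminf b" for N
    using finite_power_sum_le[of a w N p, OF a w(1) w(2) p] sum_le_suminf[OF sb, of "{..<N}"] b
    by (simp add: b_def)
  have "(\<Sum>k<N. a k) \<le> suminf b powr (1 / p)" for N
  proof -
    have "(\<Sum>k<N. a k) = ((\<Sum>k<N. a k) powr p) powr (1 / p)"
      using p by (simp add: powr_powr sum_nonneg a)
    also have "\<dots> \<le> suminf b powr (1 / p)" using le p by (intro powr_mono2) auto
    finally show ?thesis .
  qed
  then show sa: "summable a" by (rule summableI_nonneg_bounded[OF a])
  have "(\<lambda>N. (\<Sum>k<N. a k) powr p) \<longlonglongrightarrow> (\<Sum>k. a k) powr p"
    using summable_LIMSEQ[OF sa] p a by (intro tendsto_powr') (auto intro!: sum_nonneg eventuallyI)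
  then have "(\<Sum>k. a k) powr p \<le> suminf b" using le by (intro LIMSEQ_le_const2) auto
  moreover have "(\<Sum>k. ennreal (b k)) = ennreal (suminf b)"
    by (rule suminf_ennreal2[OF b sb])
  ultimately show "ennreal ((\<Sum>k. a k) powr p) \<le> (\<Sum>k. ennreal (w k powr (1 - p) * a k powr p))"
    by (simp add: b_def[symmetric] ennreal_leI)
qed

section \<open>Averages over parabolic boxes\<close>

text \<open>\<open>z\<close> is the upper corner because the kernels are profiles supported on
  [0, 1] and evaluated at the scaled difference \<open>z - w\<close>.\<close>

definition pbox :: "real \<Rightarrow> (real^'n) \<times> real \<Rightarrow> 'n pt set" where
  "pbox r z = cbox (fst z - vec r) (fst z) \<times> {snd z - r\<^sup>2..snd z}"

lemma pbox_cbox: "pbox r z = cbox (fst z - vec r, snd z - r\<^sup>2) z"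
  by (cases z) (simp add: pbox_def cbox_Pair_eq)

lemma pbox_iff: "w \<in> pbox r z \<longleftrightarrow> (\<forall>l. fst z $ l - r \<le> fst w $ l \<and> fst w $ l \<le> fst z $ l) \<and> snd z - r\<^sup>2 \<le> snd w \<and> snd w \<le> snd z"
  by (cases w) (auto simp: pbox_def mem_box_cart)

lemma pbox_borel [measurable]: "pbox r z \<in> sets borel"
  by (simp add: pbox_cbox)

lemma vec_inner_axis: "vec r \<bullet> axis k (1::real) = (r::real)"
  by (simp add: inner_axis)

lemma emeasure_pbox: "0 \<le> r \<Longrightarrow> vol (pbox r (z :: (real^'n) \<times> real)) = ennreal (r ^ (CARD('n) + 2))"
proof -
  assume r: "0 \<le> r"
  have c: "(z - (fst z - vec r, snd z - r\<^sup>2)) \<bullet> j = \<bar>pcoef r j\<bar>" if "j \<in> Basis" for j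
    using that r by (cases z) (auto simp: Basis_prod_def pcoef_def Basis_vec_def vec_inner_axis)
  have "(fst z - vec r, snd z - r\<^sup>2) \<bullet> j \<le> z \<bullet> j" if "j \<in> Basis" for j
    using c[OF that] by (simp add: inner_diff_left)
  then have "vol (pbox r z) = ennreal (\<Prod>j\<in>Basis. (z - (fst z - vec r, snd z - r\<^sup>2)) \<bullet> j)"
    unfolding pbox_cbox by (rule emeasure_lborel_cbox)
  also have "(\<Prod>j\<in>Basis. (z - (fst z - vec r, snd z - r\<^sup>2)) \<bullet> j) = (\<Prod>j\<in>(Basis :: 'n pt set). \<bar>pcoef r j\<bar>)"
    by (rule prod.cong) (use c in auto)
  finally show ?thesis using r by (simp add: prod_pcoef)
qed

lemma pbox_graph_measurable [measurable]: "(\<lambda>(z, w). indicator (pbox r z) w :: ennreal) \<in> borel_measurable (borel \<Otimes>\<^sub>M borel)"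
proof -
  have "{zw. snd zw \<in> pbox r (fst zw)} = {zw. (\<forall>l. fst (fst zw) $ l - r \<le> fst (snd zw) $ l \<and> fst (snd zw) $ l \<le> fst (fst zw) $ l)
     \<and> snd (fst zw) - r\<^sup>2 \<le> snd (snd zw) \<and> snd (snd zw) \<le> snd (fst zw)}" by (simp add: pbox_iff)
  also have "closed \<dots>"
    by (intro closed_Collect_conj closed_Collect_all closed_Collect_le continuous_intros)
  finally have "{zw. snd zw \<in> pbox r (fst zw)} \<in> sets (borel \<Otimes>\<^sub>M borel)"
    unfolding borel_prod by (rule borel_closed)
  then have "(indicator {zw. snd zw \<in> pbox r (fst zw)} :: _ \<Rightarrow> ennreal) \<in> borel_measurable (borel \<Otimes>\<^sub>M borel)"
    by (rule borel_measurable_indicator)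
  moreover have "indicator {zw. snd zw \<in> pbox r (fst zw)} = (\<lambda>(z, w). indicator (pbox r z) w :: ennreal)"
    by (auto simp: indicator_def fun_eq_iff)
  ultimately show ?thesis by (rule subst[rotated])
qed

text \<open>The tangent inequality at s = d / c is integrated over the box; being affine in
  \<open>h\<close>, it sees only the mean of \<open>h\<close>.\<close>

lemma average_jensen:
  fixes h :: "(real^'n) \<times> real \<Rightarrow> real"
  assumes [measurable]: "h \<in> borel_fun" and h: "\<And>w. 0 \<le> h w" and r: "0 < r" and p: "1 \<le> p" and d: "0 \<le> d" and c: "0 < c"
    and le: "ennreal (d * r ^ (CARD('n) + 2)) \<le> ennreal c * (\<integral>\<^sup>+w. ennreal (h w) * indicator (pbox r z) w \<partial>lborel)"
  shows "ennreal (d powr p * r ^ (CARD('n) + 2)) \<le> ennreal (c powr p) * (\<integral>\<^sup>+w. ennreal (h w powr p) * indicator (pbox r z) w \<partial>lborel)"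
proof -
  define m where "m = r ^ (CARD('n) + 2)"
  define s where "s = d / c"
  define I where "I = (\<integral>\<^sup>+w. ennreal (h w powr p) * indicator (pbox r z) w \<partial>lborel)"
  have m: "0 < m" using r by (simp add: m_def)
  have s: "0 \<le> s" using d c by (simp add: s_def)
  have em: "vol (pbox r z) = ennreal m" using emeasure_pbox[of r z] r by (simp add: m_def)
  have 1: "ennreal (s * m) \<le> (\<integral>\<^sup>+w. ennreal (h w) * indicator (pbox r z) w \<partial>lborel)" (is "_ \<le> ?J")
  proof -
    have "ennreal (s * m) = ennreal (1 / c) * ennreal (d * m)" using c d m by (simp add: s_def ennreal_mult[symmetric])
    also have "\<dots> \<le> ennreal (1 / c) * (ennreal c * ?J)" using le by (intro mult_left_mono) (auto simp: m_def)
    also have "\<dots> = ?J" using c by (simp add: mult.assoc[symmetric] ennreal_mult[symmetric])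
    finally show ?thesis .
  qed
  have "ennreal (p * s powr (p - 1)) * ennreal (s * m) \<le> ennreal (p * s powr (p - 1)) * ?J"
    by (intro mult_left_mono 1) simp
  also have "\<dots> = (\<integral>\<^sup>+w. ennreal (p * s powr (p - 1) * h w) * indicator (pbox r z) w \<partial>lborel)"
    using p h by (subst nn_integral_cmult[symmetric]) (auto simp: ennreal_mult mult_ac intro!: nn_integral_cong)
  also have "\<dots> \<le> (\<integral>\<^sup>+w. ennreal (h w powr p) * indicator (pbox r z) w + ennreal ((p - 1) * s powr p) * indicator (pbox r z) w \<partial>lborel)"
    using powr_tangent[OF h s p] p
    by (intro nn_integral_mono) (auto simp: indicator_def ennreal_plus[symmetric] simp del: ennreal_plus)
  also have "\<dots> = I + ennreal ((p - 1) * s powr p * m)"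
    using p m em by (subst nn_integral_add) (auto simp: I_def nn_integral_cmult_indicator ennreal_mult)
  finally have "ennreal (p * s powr (p - 1) * (s * m)) \<le> I + ennreal ((p - 1) * s powr p * m)"
    using p s m by (simp add: ennreal_mult[symmetric])
  moreover have "p * s powr (p - 1) * (s * m) = s powr p * m + (p - 1) * s powr p * m"
  proof -
    have "p * s powr (p - 1) * (s * m) = p * m * (s powr (p - 1) * s)" by simp
    then show ?thesis unfolding powr_minus_one_mult[OF s] by (simp add: algebra_simps)
  qed
  ultimately have "ennreal (s powr p * m) \<le> I"
    using p m by (simp add: add.commute[of I])
  then have "ennreal (c powr p) * ennreal (s powr p * m) \<le> ennreal (c powr p) * I"
    by (intro mult_left_mono) auto
  moreover have "ennreal (c powr p) * ennreal (s powr p * m) = ennreal (d powr p * m)"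
    using c d m by (subst ennreal_mult[symmetric]) (simp_all add: s_def powr_divide)
  ultimately show ?thesis unfolding I_def m_def by simp
qed

text \<open>After Jensen's inequality Fubini's theorem moves the weight inside, so only its mass on
  boxes matters. The weight 1 gives the plain estimates, the weight |\<mu>|^p the drift
  estimate.\<close>

lemma weighted_average:
  fixes h d :: "(real^'n) \<times> real \<Rightarrow> real" and \<omega> :: "'n pt \<Rightarrow> ennreal"
  assumes [measurable]: "h \<in> borel_fun" "d \<in> borel_fun" "\<omega> \<in> borel_fun"
    and h: "\<And>w. 0 \<le> h w" and r: "0 < r" and p: "1 \<le> p" and d: "\<And>z. 0 \<le> d z" and c: "0 < c"
    and le: "\<And>z. ennreal (d z * r ^ (CARD('n) + 2)) \<le> ennreal c * (\<integral>\<^sup>+w. ennreal (h w) * indicator (pbox r z) w \<partial>lborel)"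
    and B: "\<And>w. (\<integral>\<^sup>+z. \<omega> z * indicator (pbox r z) w \<partial>lborel) \<le> ennreal (b * r ^ (CARD('n) + 2))" and b: "0 \<le> b"
  shows "(\<integral>\<^sup>+z. \<omega> z * ennreal (d z powr p) \<partial>lborel) \<le> ennreal (c powr p * b) * Np p h"
proof -
  define m where "m = r ^ (CARD('n) + 2)"
  have m: "0 < m" using r by (simp add: m_def)
  interpret P: pair_sigma_finite lborel "lborel :: 'n pt measure" ..
  have "ennreal m * (\<integral>\<^sup>+z. \<omega> z * ennreal (d z powr p) \<partial>lborel) = (\<integral>\<^sup>+z. \<omega> z * ennreal (d z powr p * m) \<partial>lborel)"
    using m by (subst nn_integral_cmult[symmetric]) (auto simp: ennreal_mult mult_ac)
  also have "\<dots> \<le> (\<integral>\<^sup>+z. \<omega> z * (ennreal (c powr p) * (\<integral>\<^sup>+w. ennreal (h w powr p) * indicator (pbox r z) w \<partial>lborel)) \<partial>lborel)"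
    using average_jensen[OF assms(1) h r p d c le] by (intro nn_integral_mono mult_left_mono) (auto simp: m_def)
  also have "\<dots> = ennreal (c powr p) * (\<integral>\<^sup>+z. (\<integral>\<^sup>+w. \<omega> z * (ennreal (h w powr p) * indicator (pbox r z) w) \<partial>lborel) \<partial>lborel)"
    by (subst nn_integral_cmult[symmetric]) (auto simp: nn_integral_cmult mult_ac)
  finally have 1: "ennreal m * (\<integral>\<^sup>+z. \<omega> z * ennreal (d z powr p) \<partial>lborel) \<le> \<dots>" .
  have "(\<integral>\<^sup>+z. (\<integral>\<^sup>+w. \<omega> z * (ennreal (h w powr p) * indicator (pbox r z) w) \<partial>lborel) \<partial>lborel)
      = (\<integral>\<^sup>+w. (\<integral>\<^sup>+z. \<omega> z * (ennreal (h w powr p) * indicator (pbox r z) w) \<partial>lborel) \<partial>lborel)"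
    by (rule lborel_pair.Fubini'[symmetric]) measurable
  also have "\<dots> = (\<integral>\<^sup>+w. ennreal (h w powr p) * (\<integral>\<^sup>+z. \<omega> z * indicator (pbox r z) w \<partial>lborel) \<partial>lborel)"
    by (intro nn_integral_cong) (simp add: nn_integral_cmult[symmetric] mult_ac)
  also have "\<dots> \<le> (\<integral>\<^sup>+w. ennreal (h w powr p) * ennreal (b * m) \<partial>lborel)"
    using B by (intro nn_integral_mono mult_left_mono) (auto simp: m_def)
  also have "\<dots> = ennreal (b * m) * Np p h"
    unfolding Np_def by (subst nn_integral_cmult[symmetric]) (use h in \<open>auto simp: mult.commute\<close>)
  finally have "ennreal (c powr p) * (\<integral>\<^sup>+z. (\<integral>\<^sup>+w. \<omega> z * (ennreal (h w powr p) * indicator (pbox r z) w) \<partial>lborel) \<partial>lborel)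
      \<le> ennreal (c powr p) * (ennreal (b * m) * Np p h)" by (rule mult_left_mono) simp
  with 1 have "ennreal m * (\<integral>\<^sup>+z. \<omega> z * ennreal (d z powr p) \<partial>lborel) \<le> ennreal (c powr p) * (ennreal (b * m) * Np p h)"
    by (rule order_trans)
  then have "ennreal m * (\<integral>\<^sup>+z. \<omega> z * ennreal (d z powr p) \<partial>lborel) \<le> ennreal m * (ennreal (c powr p * b) * Np p h)"
    using b m by (simp add: ennreal_mult mult_ac)
  then show ?thesis using m by (subst (asm) ennreal_mult_le_mult_iff) auto
qed

section \<open>Product kernels and mollification\<close>

text \<open>These are functions of \<open>x\<close> for a base point \<open>y\<close>.
  \<open>kf\<close> has mass one at every scale, so a difference of two of them has a compactly
  supported primitive, \<open>kq\<close>; \<open>kd\<close> is the derivative of \<open>kf\<close>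
  in \<open>x\<close>.\<close>

definition kf :: "real \<Rightarrow> real \<Rightarrow> real \<Rightarrow> real" where "kf r y x = bump ((y - x) / r) / r"
definition kq :: "real \<Rightarrow> real \<Rightarrow> real \<Rightarrow> real \<Rightarrow> real" where "kq r r' y x = ramp ((y - x) / r') - ramp ((y - x) / r)"
definition kd :: "real \<Rightarrow> real \<Rightarrow> real \<Rightarrow> real" where "kd r y x = - (pd 1 bump ((y - x) / r)) / r\<^sup>2"

lemma bump_deriv: "(bump has_real_derivative pd 1 bump x) (at x)"
proof -
  have d: "(bump has_derivative (\<lambda>e. pd e bump x)) (at x)" by (rule smooth_has_derivative[OF smooth_bump])
  have e: "(\<lambda>e. pd e bump x) = (*) (pd 1 bump x)"
  proof
    fix e
    show "pd e bump x = pd 1 bump x * e"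
      using linear_scale[OF has_derivative_linear[OF d], of e 1] by (simp add: mult.commute)
  qed
  show ?thesis
    unfolding has_field_derivative_def
    by (rule subst[OF e, of "\<lambda>f. (bump has_derivative f) (at x)"]) (rule d)
qed

lemma bump_test_fun: "test_fun UNIV bump"
  unfolding test_fun_iff using smooth_bump bump_zero by (intro conjI exI[of _ "{0..1}"]) auto

lemma smooth_affine_compose:
  fixes g :: "real \<Rightarrow> real" assumes "smooth g" shows "smooth (\<lambda>x. g ((y - x) / r))"
  using smooth_compose[OF assms smooth_affine[of "y / r" "- (1 / r)"]] by (simp add: diff_divide_distrib)

lemma smooth_kf: "smooth (kf r y)"
  unfolding kf_def[abs_def] divide_inverse[of _ r, symmetric]
  using smooth_mult[OF smooth_affine_compose[OF smooth_bump] smooth_const[of "1 / r"]] by simp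

lemma smooth_kq: "smooth (kq r r' y)"
  unfolding kq_def[abs_def] by (intro smooth_diff smooth_affine_compose smooth_ramp)

lemma kq_deriv: "(kq r r' y has_real_derivative (kf r y x - kf r' y x)) (at x)"
proof -
  have "((\<lambda>x. ramp ((y - x) / s)) has_real_derivative (- kf s y x)) (at x)" for s
  proof -
    have "((\<lambda>x. (y - x) / s) has_real_derivative (- 1 / s)) (at x)"
      by (auto intro!: derivative_eq_intros simp: divide_inverse)
    from DERIV_chain2[OF ramp_deriv this] show ?thesis by (simp add: kf_def)
  qed
  from DERIV_diff[OF this[of r'] this[of r]] show ?thesis unfolding kq_def[abs_def] by (simp add: algebra_simps)
qed

lemma kf_deriv: "(kf r y has_real_derivative kd r y x) (at x)"
proof -
  have "((\<lambda>x. (y - x) / r) has_real_derivative (- 1 / r)) (at x)"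
    by (auto intro!: derivative_eq_intros simp: divide_inverse)
  from DERIV_cdivide[OF DERIV_chain2[OF bump_deriv this], of r] show ?thesis
    unfolding kf_def[abs_def] by (simp add: kd_def power2_eq_square)
qed

text \<open>One bound for all profiles, taken at least 1 so that it also bounds differences of
  ramps.\<close>

definition kb :: real where
  "kb = (SOME b. 1 \<le> b \<and> (\<forall>x. \<bar>bump x\<bar> \<le> b \<and> \<bar>pd 1 bump x\<bar> \<le> b))"

lemma kb: "1 \<le> kb" "\<bar>bump x\<bar> \<le> kb" "\<bar>pd 1 bump x\<bar> \<le> kb"
proof -
  obtain b b' where "\<forall>x. \<bar>bump x\<bar> \<le> b" "\<forall>x. \<bar>pd 1 bump x\<bar> \<le> b'"
    using test_fun_bounded[OF bump_test_fun] test_fun_bounded[OF test_fun_pd[OF bump_test_fun]] by fastforce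
  then have "1 \<le> max 1 (max b b') \<and> (\<forall>x. \<bar>bump x\<bar> \<le> max 1 (max b b') \<and> \<bar>pd 1 bump x\<bar> \<le> max 1 (max b b'))"
    by (auto simp: max.coboundedI1 max.coboundedI2)
  then have "1 \<le> kb \<and> (\<forall>x. \<bar>bump x\<bar> \<le> kb \<and> \<bar>pd 1 bump x\<bar> \<le> kb)"
    unfolding kb_def by (rule someI)
  then show "1 \<le> kb" "\<bar>bump x\<bar> \<le> kb" "\<bar>pd 1 bump x\<bar> \<le> kb" by auto
qed

lemma pd_bump_zero: "x < 0 \<or> 1 < x \<Longrightarrow> pd 1 bump x = 0"
proof -
  assume x: "x < 0 \<or> 1 < x"
  have "((\<lambda>_. 0) has_real_derivative 0) (at x)" by simp
  then have "(bump has_real_derivative 0) (at x)"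
    using x by (subst DERIV_cong_ev[OF refl, of _ "\<lambda>_. 0"])
      (auto simp: eventually_nhds bump_zero intro: exI[of _ "{..<0}"] exI[of _ "{1<..}"])
  then show ?thesis by (rule pd_eq_real)
qed

lemma scaled_outside:
  fixes r s x y :: real
  assumes "0 < s" "s \<le> r" "x < y - r \<or> y < x" shows "(y - x) / s < 0 \<or> 1 < (y - x) / s"
  using assms by (auto simp: divide_less_0_iff)

lemma kf_bound: "0 < s \<Longrightarrow> \<bar>kf s y x\<bar> \<le> kb / s"
  unfolding kf_def using kb(2) by (simp add: divide_right_mono)

lemma kf_zero: "0 < s \<Longrightarrow> s \<le> r \<Longrightarrow> x < y - r \<or> y < x \<Longrightarrow> kf s y x = 0"
  unfolding kf_def using scaled_outside[of s r x y] bump_zero[of "(y - x) / s"] by auto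

lemma kd_bound: "0 < s \<Longrightarrow> \<bar>kd s y x\<bar> \<le> kb / s\<^sup>2"
  unfolding kd_def using kb(3) by (simp add: divide_right_mono)

lemma kd_zero: "0 < s \<Longrightarrow> s \<le> r \<Longrightarrow> x < y - r \<or> y < x \<Longrightarrow> kd s y x = 0"
  unfolding kd_def using scaled_outside[of s r x y] pd_bump_zero[of "(y - x) / s"] by auto

lemma kq_bound: "\<bar>kq r r' y x\<bar> \<le> kb"
  unfolding kq_def using kb(1) ramp_bounds[of "(y - x) / r'"] ramp_bounds[of "(y - x) / r"] by linarith

lemma kq_zero:
  assumes "0 < s" "s \<le> r" "x < y - r \<or> y < x" shows "kq r s y x = 0"
proof (cases "y < x")
  case True
  then have "(y - x) / s \<le> 0" "(y - x) / r \<le> 0" using assms by (auto simp: divide_le_0_iff)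
  then show ?thesis by (simp add: kq_def ramp_zero)
next
  case False
  then have "1 \<le> (y - x) / s" "1 \<le> (y - x) / r" using assms by auto
  then show ?thesis by (simp add: kq_def ramp_one)
qed

lemma prod_one_factor: "(\<Prod>k\<in>(UNIV::'n::finite set). c * (if k = l then d else 1)) = c ^ CARD('n) * (d::real)"
  by (simp add: prod.distrib)

lemma ptest_bound:
  fixes a :: "'n::finite \<Rightarrow> real \<Rightarrow> real"
  assumes "\<And>l x. \<bar>a l x\<bar> \<le> A l" "\<And>x. \<bar>b x\<bar> \<le> B" shows "\<bar>ptest a b w\<bar> \<le> (\<Prod>l\<in>UNIV. A l) * B"
proof -
  have "0 \<le> A l" for l using assms(1)[of l undefined] by linarith
  then show ?thesis unfolding ptest_def abs_mult abs_prod
    using assms by (intro mult_mono prod_mono) (auto intro: prod_nonneg)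
qed

lemma ptest_zero:
  fixes a :: "'n::finite \<Rightarrow> real \<Rightarrow> real"
  assumes "\<And>l x. x < fst z $ l - r \<or> fst z $ l < x \<Longrightarrow> a l x = 0" "\<And>x. x < snd z - r\<^sup>2 \<or> snd z < x \<Longrightarrow> b x = 0"
    "w \<notin> pbox r z"
  shows "ptest a b w = 0"
proof (cases "snd z - r\<^sup>2 \<le> snd w \<and> snd w \<le> snd z")
  case True
  then obtain l where "fst w $ l < fst z $ l - r \<or> fst z $ l < fst w $ l" using assms(3) by (auto simp: pbox_iff not_le)
  then have "a l (fst w $ l) = 0" using assms(1) by blast
  then show ?thesis by (auto simp: ptest_def intro!: prod_zero bexI[of _ l])
next
  case False then show ?thesis using assms(2)[of "snd w"] by (auto simp: ptest_def)
qed

lemma pbox_test_fun: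
  fixes a :: "'n::finite \<Rightarrow> real \<Rightarrow> real"
  assumes "\<And>l. smooth (a l)" "smooth b"
    and "\<And>l x. x < fst z $ l - r \<or> fst z $ l < x \<Longrightarrow> a l x = 0" "\<And>x. x < snd z - r\<^sup>2 \<or> snd z < x \<Longrightarrow> b x = 0"
  shows "test_fun UNIV (ptest a b)"
  by (rule test_fun_ptest[of a b "fst z - vec r" "fst z" "snd z - r\<^sup>2" "snd z"]) (use assms in auto)

lemma kernel_integral_bound:
  fixes g \<theta> :: "(real^'n) \<times> real \<Rightarrow> real"
  assumes i: "integrable lborel (\<lambda>w. g w * \<theta> w)" and [measurable]: "g \<in> borel_fun"
    and b: "\<And>w. \<bar>\<theta> w\<bar> \<le> M" and z: "\<And>w. w \<notin> pbox r z \<Longrightarrow> \<theta> w = 0"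
  shows "ennreal \<bar>\<integral>w. g w * \<theta> w \<partial>lborel\<bar> \<le> ennreal M * (\<integral>\<^sup>+w. ennreal \<bar>g w\<bar> * indicator (pbox r z) w \<partial>lborel)"
proof -
  have M: "0 \<le> M" using b[of undefined] by linarith
  have "ennreal \<bar>\<integral>w. g w * \<theta> w \<partial>lborel\<bar> \<le> (\<integral>\<^sup>+w. ennreal \<bar>g w * \<theta> w\<bar> \<partial>lborel)"
    using integral_norm_bound_ennreal[OF i] by simp
  also have "\<dots> \<le> (\<integral>\<^sup>+w. ennreal M * (ennreal \<bar>g w\<bar> * indicator (pbox r z) w) \<partial>lborel)"
    using b z M
    by (intro nn_integral_mono) (auto simp: indicator_def abs_mult ennreal_mult[symmetric] mult.commute[of M] intro!: ennreal_leI mult_left_mono)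
  also have "\<dots> = ennreal M * (\<integral>\<^sup>+w. ennreal \<bar>g w\<bar> * indicator (pbox r z) w \<partial>lborel)"
    by (rule nn_integral_cmult) simp
  finally show ?thesis .
qed

text \<open>\<open>S\<close> is the set of coordinates already refined from \<open>r\<close> to
  \<open>r / 2\<close>, and \<open>\<tau>\<close> tells whether the time scale has passed from
  \<open>r\<^sup>2\<close> to a quarter of it. Refining one variable at a time makes each change of
  kernel an exact derivative.\<close>

definition kS :: "real \<Rightarrow> (real^'n) \<times> real \<Rightarrow> 'n set \<Rightarrow> 'n \<Rightarrow> real \<Rightarrow> real" where
  "kS r z S l = kf (if l \<in> S then r / 2 else r) (fst z $ l)"
definition kT :: "real \<Rightarrow> (real^'n) \<times> real \<Rightarrow> bool \<Rightarrow> real \<Rightarrow> real" where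
  "kT r z \<tau> = kf (if \<tau> then r\<^sup>2 / 4 else r\<^sup>2) (snd z)"

definition Fn :: "real \<Rightarrow> (real^'n) \<times> real \<Rightarrow> 'n set \<Rightarrow> bool \<Rightarrow> ('n pt \<Rightarrow> real) \<Rightarrow> real" where
  "Fn r z S \<tau> h = (\<integral>w. h w * ptest (kS r z S) (kT r z \<tau>) w \<partial>lborel)"

definition kK :: "'n::finite itself \<Rightarrow> real" where "kK _ = (4 * kb) ^ (CARD('n) + 1)"

lemma kK_pos: "0 < kK TYPE('n::finite)" using kb(1) by (simp add: kK_def)

lemma kS_props:
  assumes r: "0 < r"
  shows "smooth (kS r z S l)" "\<bar>kS r z S l x\<bar> \<le> 4 * kb / r" "x < fst z $ l - r \<or> fst z $ l < x \<Longrightarrow> kS r z S l x = 0"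
proof -
  show "smooth (kS r z S l)" by (simp add: kS_def smooth_kf)
  have "kb / (r / 2) \<le> 4 * kb / r" "kb / r \<le> 4 * kb / r" using r kb(1) by (auto simp: field_simps)
  then show "\<bar>kS r z S l x\<bar> \<le> 4 * kb / r"
    using kf_bound[of "r / 2" "fst z $ l" x] kf_bound[of r "fst z $ l" x] r by (auto simp: kS_def)
  show "x < fst z $ l - r \<or> fst z $ l < x \<Longrightarrow> kS r z S l x = 0"
    using r kf_zero[of "r / 2" r x "fst z $ l"] kf_zero[of r r x "fst z $ l"] by (auto simp: kS_def)
qed

lemma kT_props:
  assumes r: "0 < r"
  shows "smooth (kT r z \<tau>)" "\<bar>kT r z \<tau> x\<bar> \<le> 4 * kb / r\<^sup>2" "x < snd z - r\<^sup>2 \<or> snd z < x \<Longrightarrow> kT r z \<tau> x = 0"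
proof -
  show "smooth (kT r z \<tau>)" by (simp add: kT_def smooth_kf)
  have "kb / (r\<^sup>2 / 4) = 4 * kb / r\<^sup>2" "kb / r\<^sup>2 \<le> 4 * kb / r\<^sup>2" using r kb(1) by (auto simp: field_simps)
  then show "\<bar>kT r z \<tau> x\<bar> \<le> 4 * kb / r\<^sup>2"
    using kf_bound[of "r\<^sup>2 / 4" "snd z" x] kf_bound[of "r\<^sup>2" "snd z" x] r by (cases \<tau>) (auto simp: kT_def mult.commute)
  show "x < snd z - r\<^sup>2 \<or> snd z < x \<Longrightarrow> kT r z \<tau> x = 0"
    using r kf_zero[of "r\<^sup>2 / 4" "r\<^sup>2" x "snd z"] kf_zero[of "r\<^sup>2" "r\<^sup>2" x "snd z"] by (auto simp: kT_def)
qed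

lemma kST_test_fun: "0 < r \<Longrightarrow> test_fun UNIV (ptest (kS r z S) (kT r z \<tau>))"
  by (rule pbox_test_fun[of _ _ z r]) (use kS_props[where r = r and z = z] kT_props[where r = r and z = z] in auto)

lemma Fn_bound:
  fixes h :: "(real^'n) \<times> real \<Rightarrow> real"
  assumes r: "0 < r" and h: "h \<in> borel_fun" "Np p h < top" and p: "1 \<le> p"
  shows "ennreal (\<bar>Fn r z S \<tau> h\<bar> * r ^ (CARD('n) + 2)) \<le> ennreal (kK TYPE('n)) * (\<integral>\<^sup>+w. ennreal \<bar>h w\<bar> * indicator (pbox r z) w \<partial>lborel)"
proof -
  let ?\<theta> = "ptest (kS r z S) (kT r z \<tau>)"
  have t: "test_fun UNIV ?\<theta>" by (rule kST_test_fun[OF r])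
  have M: "(\<Prod>l\<in>(UNIV::'n set). 4 * kb / r) * (4 * kb / r\<^sup>2) = kK TYPE('n) / r ^ (CARD('n) + 2)"
    by (simp add: kK_def power_add power2_eq_square power_divide mult_ac)
  have "\<bar>?\<theta> w\<bar> \<le> kK TYPE('n) / r ^ (CARD('n) + 2)" for w
    unfolding M[symmetric] by (intro ptest_bound kS_props(2)[OF r] kT_props(2)[OF r])
  moreover have "?\<theta> w = 0" if "w \<notin> pbox r z" for w
    by (rule ptest_zero[OF _ _ that]) (use kS_props(3)[OF r, where z = z] kT_props(3)[OF r, where z = z] in auto)
  ultimately have "ennreal \<bar>Fn r z S \<tau> h\<bar> \<le> ennreal (kK TYPE('n) / r ^ (CARD('n) + 2)) * (\<integral>\<^sup>+w. ennreal \<bar>h w\<bar> * indicator (pbox r z) w \<partial>lborel)"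
    unfolding Fn_def by (rule kernel_integral_bound[OF Np_test_integrable[OF h(1) p h(2) t] h(1)])
  then have "ennreal (r ^ (CARD('n) + 2)) * ennreal \<bar>Fn r z S \<tau> h\<bar> \<le> ennreal (r ^ (CARD('n) + 2)) * (ennreal (kK TYPE('n) / r ^ (CARD('n) + 2)) * (\<integral>\<^sup>+w. ennreal \<bar>h w\<bar> * indicator (pbox r z) w \<partial>lborel))"
    by (intro mult_left_mono) auto
  also have "\<dots> = ennreal (kK TYPE('n)) * (\<integral>\<^sup>+w. ennreal \<bar>h w\<bar> * indicator (pbox r z) w \<partial>lborel)"
    using r kK_pos[where 'n='n] by (subst mult.assoc[symmetric], subst ennreal_mult[symmetric]) auto
  finally show ?thesis using r by (simp add: ennreal_mult mult.commute)
qed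

text \<open>The two kernels differ by the l-th derivative of the kernel with \<open>kq\<close> as
  its l-th factor. Integration by parts moves the derivative to \<open>g\<close>, and since
  \<open>kq\<close> lacks the factor 1 / r of \<open>kf\<close>, the average of \<open>gl\<close>
  comes with a factor \<open>r\<close>.\<close>

lemma Fn_space_step:
  fixes g gl :: "(real^'n) \<times> real \<Rightarrow> real"
  assumes r: "0 < r" and wd: "wd (sp l) g gl" and p: "1 \<le> p"
    and g: "g \<in> borel_fun" "Np p g < top" and gl: "gl \<in> borel_fun" "Np p gl < top" and l: "l \<notin> S"
  shows "ennreal \<bar>Fn r z S \<tau> g - Fn r z (insert l S) \<tau> g\<bar> \<le> ennreal (kK TYPE('n) / r ^ (CARD('n) + 1)) * (\<integral>\<^sup>+w. ennreal \<bar>gl w\<bar> * indicator (pbox r z) w \<partial>lborel)"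
proof -
  define a where "a = (kS r z S)(l := kq r (r / 2) (fst z $ l))"
  have sa: "smooth (a k)" for k using kS_props(1)[OF r, where z = z] smooth_kq by (auto simp: a_def)
  have za: "x < fst z $ k - r \<or> fst z $ k < x \<Longrightarrow> a k x = 0" for k x
    using kS_props(3)[OF r, where z = z] kq_zero[of "r / 2" r x "fst z $ k"] r by (auto simp: a_def)
  have t: "test_fun UNIV (ptest a (kT r z \<tau>))"
    by (rule pbox_test_fun[of _ _ z r]) (use sa za kT_props[OF r, where z = z] in auto)
  have t1: "test_fun UNIV (ptest (kS r z S') (kT r z \<tau>))" for S'
    by (rule kST_test_fun[OF r])
  have "(a l has_real_derivative (kS r z S l x - kS r z (insert l S) l x)) (at x)" for x
    using kq_deriv[of r "r / 2" "fst z $ l" x] l by (simp add: a_def kS_def)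
  then have "pd (sp l) (ptest a (kT r z \<tau>)) w = ptest (a(l := \<lambda>x. kS r z S l x - kS r z (insert l S) l x)) (kT r z \<tau>) w" for w
    by (intro pd_ptest_space sa kT_props(1)[OF r])
  also have "ptest (a(l := \<lambda>x. kS r z S l x - kS r z (insert l S) l x)) (kT r z \<tau>) w
    = ptest (kS r z S) (kT r z \<tau>) w - ptest (kS r z (insert l S)) (kT r z \<tau>) w" for w
  proof -
    have 1: "(\<Prod>k\<in>UNIV-{l}. a k (fst w $ k)) = (\<Prod>k\<in>UNIV-{l}. kS r z S k (fst w $ k))"
      by (rule prod.cong) (auto simp: a_def)
    have 2: "(\<Prod>k\<in>UNIV-{l}. kS r z (insert l S) k (fst w $ k)) = (\<Prod>k\<in>UNIV-{l}. kS r z S k (fst w $ k))"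
      by (rule prod.cong) (auto simp: kS_def)
    show ?thesis unfolding ptest_def
      by (simp add: prod.remove[of UNIV l] 1 2 algebra_simps)
  qed
  finally have pd: "pd (sp l) (ptest a (kT r z \<tau>)) w = ptest (kS r z S) (kT r z \<tau>) w - ptest (kS r z (insert l S)) (kT r z \<tau>) w" for w .
  have "Fn r z S \<tau> g - Fn r z (insert l S) \<tau> g = (\<integral>w. g w * pd (sp l) (ptest a (kT r z \<tau>)) w \<partial>lborel)"
    unfolding Fn_def pd right_diff_distrib
    by (rule Bochner_Integration.integral_diff[symmetric]; rule Np_test_integrable[OF g(1) p g(2) t1])
  also have "\<dots> = - (\<integral>w. gl w * ptest a (kT r z \<tau>) w \<partial>lborel)"
    using wd t unfolding wd_def by blast
  finally have eq: "\<bar>Fn r z S \<tau> g - Fn r z (insert l S) \<tau> g\<bar> = \<bar>\<integral>w. gl w * ptest a (kT r z \<tau>) w \<partial>lborel\<bar>" by simp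
  have M: "(\<Prod>k\<in>(UNIV::'n set). 4 * kb / r * (if k = l then r else 1)) * (4 * kb / r\<^sup>2) = kK TYPE('n) / r ^ (CARD('n) + 1)"
    unfolding prod_one_factor using r by (simp add: kK_def power_add power2_eq_square power_divide mult_ac)
  have "\<bar>a k x\<bar> \<le> 4 * kb / r * (if k = l then r else 1)" for k x
    using kS_props(2)[OF r, where z = z and S = S and l = k and x = x] kq_bound[of r "r / 2" "fst z $ l" x] r kb(1) by (auto simp: a_def)
  then have "\<bar>ptest a (kT r z \<tau>) w\<bar> \<le> kK TYPE('n) / r ^ (CARD('n) + 1)" for w
    unfolding M[symmetric] using kT_props(2)[OF r, where z = z] by (intro ptest_bound) auto
  moreover have "ptest a (kT r z \<tau>) w = 0" if "w \<notin> pbox r z" for w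
    by (rule ptest_zero[OF _ _ that]) (use za kT_props(3)[OF r, where z = z] in auto)
  ultimately show ?thesis
    unfolding eq by (intro kernel_integral_bound[OF Np_test_integrable[OF gl(1) p gl(2) t] gl(1)])
qed

text \<open>No time derivative of the gradient is available. The change of kernel is a time
  derivative; the spatial derivative of \<open>vk\<close> is first moved to the kernel too, and one
  integration by parts in time then leaves \<open>vt\<close> against a spatial derivative of the
  kernel. The gain r^2 in time and the loss 1 / r in space again give \<open>r\<close>.\<close>

lemma Fn_time_step:
  fixes v vt vk :: "(real^'n) \<times> real \<Rightarrow> real"
  assumes r: "0 < r" and wdt: "wd tm v vt" and wdk: "wd (sp k) v vk" and p: "1 \<le> p"
    and vt: "vt \<in> borel_fun" "Np p vt < top" and vk: "vk \<in> borel_fun" "Np p vk < top"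
  shows "ennreal \<bar>Fn r z {} False vk - Fn r z {} True vk\<bar> \<le> ennreal (kK TYPE('n) / r ^ (CARD('n) + 1)) * (\<integral>\<^sup>+w. ennreal \<bar>vt w\<bar> * indicator (pbox r z) w \<partial>lborel)"
proof -
  define a where "a = kS r z {}"
  define b where "b = kq (r\<^sup>2) (r\<^sup>2 / 4) (snd z)"
  define b' where "b' x = kT r z False x - kT r z True x" for x
  define a' where "a' = a(k := kd r (fst z $ k))"
  have sa: "smooth (a l)" for l using kS_props(1)[OF r, where z = z] by (simp add: a_def)
  have sb: "smooth b" by (simp add: b_def smooth_kq)
  have sb': "smooth b'" unfolding b'_def[abs_def] by (intro smooth_diff kT_props(1)[OF r])
  have da: "(a k has_real_derivative kd r (fst z $ k) x) (at x)" for x using kf_deriv by (simp add: a_def kS_def)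
  have db: "(b has_real_derivative b' x) (at x)" for x
    using kq_deriv[of "r\<^sup>2" "r\<^sup>2 / 4" "snd z" x] by (simp add: b_def b'_def kT_def)
  have sa': "smooth (a' l)" for l using sa smooth_iff_deriv[OF da] by (auto simp: a'_def)
  have za: "x < fst z $ l - r \<or> fst z $ l < x \<Longrightarrow> a l x = 0" for l x
    using kS_props(3)[OF r, where z = z] by (simp add: a_def)
  have za': "x < fst z $ l - r \<or> fst z $ l < x \<Longrightarrow> a' l x = 0" for l x
    using za[of x l] kd_zero[of r r x "fst z $ k"] r by (auto simp: a'_def)
  have zb: "x < snd z - r\<^sup>2 \<or> snd z < x \<Longrightarrow> b x = 0" for x
    using kq_zero[of "r\<^sup>2 / 4" "r\<^sup>2" x "snd z"] r by (simp add: b_def)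
  have t: "test_fun UNIV (ptest a b)" by (rule pbox_test_fun[of _ _ z r]) (use sa sb za zb in auto)
  have t2: "test_fun UNIV (ptest a' b)" by (rule pbox_test_fun[of _ _ z r]) (use sa' sb za' zb in auto)
  have t1: "test_fun UNIV (ptest a (kT r z \<tau>))" for \<tau>
    by (rule pbox_test_fun[of _ _ z r]) (use sa za kT_props[OF r, where z = z] in auto)
  have 1: "pd tm (ptest a b) = ptest a b'" by (rule ext) (rule pd_ptest_time[OF sa sb db])
  have 2: "pd (sp k) (ptest a b) = ptest a' b" unfolding a'_def by (rule ext) (rule pd_ptest_space[of a b k "kd r (fst z $ k)", OF sa sb da])
  have 3: "pd (sp k) (ptest a b') = ptest a' b'" unfolding a'_def by (rule ext) (rule pd_ptest_space[of a b' k "kd r (fst z $ k)", OF sa sb' da])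
  have 4: "pd tm (ptest a' b) = ptest a' b'" by (rule ext) (rule pd_ptest_time[OF sa' sb db])
  have tb': "test_fun UNIV (ptest a b')" using test_fun_pd[OF t tm_Basis] 1 by simp
  have "(\<integral>w. v w * ptest a' b' w \<partial>lborel) = - (\<integral>w. vk w * ptest a b' w \<partial>lborel)"
    using wdk[unfolded wd_def, rule_format, OF tb'] by (simp only: fun_cong[OF 3])
  moreover have "(\<integral>w. v w * ptest a' b' w \<partial>lborel) = - (\<integral>w. vt w * ptest a' b w \<partial>lborel)"
    using wdt[unfolded wd_def, rule_format, OF t2] by (simp only: fun_cong[OF 4])
  ultimately have e: "(\<integral>w. vk w * ptest a b' w \<partial>lborel) = (\<integral>w. vt w * ptest a' b w \<partial>lborel)" by simp
  have "ptest a b' w = ptest a (kT r z False) w - ptest a (kT r z True) w" for w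
    by (simp add: ptest_def b'_def right_diff_distrib)
  then have "Fn r z {} False vk - Fn r z {} True vk = (\<integral>w. vk w * ptest a b' w \<partial>lborel)"
    unfolding Fn_def a_def[symmetric]
    by (simp add: right_diff_distrib Bochner_Integration.integral_diff[OF Np_test_integrable[OF vk(1) p vk(2) t1] Np_test_integrable[OF vk(1) p vk(2) t1]])
  then have eq: "\<bar>Fn r z {} False vk - Fn r z {} True vk\<bar> = \<bar>\<integral>w. vt w * ptest a' b w \<partial>lborel\<bar>" using e by simp
  have M: "(\<Prod>l\<in>(UNIV::'n set). 4 * kb / r * (if l = k then 1 / r else 1)) * (4 * kb) = kK TYPE('n) / r ^ (CARD('n) + 1)"
    unfolding prod_one_factor using r by (simp add: kK_def power_add power2_eq_square power_divide mult_ac)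
  have "\<bar>a' l x\<bar> \<le> 4 * kb / r * (if l = k then 1 / r else 1)" for l x
    using kS_props(2)[OF r, where z = z and S = "{}" and l = l and x = x] kd_bound[of r "fst z $ k" x] r kb(1)
    by (auto simp: a'_def a_def power2_eq_square intro: order_trans[OF _ divide_right_mono])
  moreover have "\<bar>b x\<bar> \<le> 4 * kb" for x using kq_bound[of "r\<^sup>2" "r\<^sup>2 / 4" "snd z" x] kb(1) by (simp add: b_def)
  ultimately have "\<bar>ptest a' b w\<bar> \<le> kK TYPE('n) / r ^ (CARD('n) + 1)" for w
    unfolding M[symmetric] by (intro ptest_bound) auto
  moreover have "ptest a' b w = 0" if "w \<notin> pbox r z" for w
    by (rule ptest_zero[OF _ _ that]) (use za' zb in auto)
  ultimately show ?thesis
    unfolding eq by (intro kernel_integral_bound[OF Np_test_integrable[OF vt(1) p vt(2) t2] vt(1)])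
qed

lemma Fn_half: "Fn r z UNIV True h = Fn (r / 2) z {} False h"
  by (simp add: Fn_def kS_def[abs_def] kT_def[abs_def] power_divide)

text \<open>The time scale is refined first and then the coordinates one by one, so that the time
  step is only needed with all coordinates still at scale \<open>r\<close>.\<close>

lemma Fn_diff:
  fixes v vt :: "(real^'n) \<times> real \<Rightarrow> real"
  assumes r: "0 < r" and S: "Sob p v vt Dv D2v" and p: "1 \<le> p"
  shows "ennreal (\<bar>Fn r z {} False (Dv k) - Fn (r / 2) z {} False (Dv k)\<bar> * r ^ (CARD('n) + 2))
    \<le> ennreal (kK TYPE('n) * r) * (\<integral>\<^sup>+w. ennreal (\<bar>vt w\<bar> + (\<Sum>l\<in>UNIV. \<bar>D2v k l w\<bar>)) * indicator (pbox r z) w \<partial>lborel)"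
proof -
  have [measurable]: "vt \<in> borel_fun" "\<And>k l. D2v k l \<in> borel_fun" using SobD[OF S] by auto
  let ?c = "ennreal (kK TYPE('n) / r ^ (CARD('n) + 1))"
  let ?I = "\<lambda>g. \<integral>\<^sup>+w. ennreal \<bar>g w\<bar> * indicator (pbox r z) w \<partial>lborel"
  have sp: "ennreal \<bar>Fn r z {} True (Dv k) - Fn r z A True (Dv k)\<bar> \<le> ?c * (\<Sum>l\<in>A. ?I (D2v k l))" if "finite A" for A :: "'n set"
    using that
  proof (induction A)
    case (insert l A)
    have "\<bar>Fn r z {} True (Dv k) - Fn r z (insert l A) True (Dv k)\<bar>
      \<le> \<bar>Fn r z {} True (Dv k) - Fn r z A True (Dv k)\<bar> + \<bar>Fn r z A True (Dv k) - Fn r z (insert l A) True (Dv k)\<bar>" by simp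
    then have "ennreal \<bar>Fn r z {} True (Dv k) - Fn r z (insert l A) True (Dv k)\<bar>
      \<le> ennreal \<bar>Fn r z {} True (Dv k) - Fn r z A True (Dv k)\<bar> + ennreal \<bar>Fn r z A True (Dv k) - Fn r z (insert l A) True (Dv k)\<bar>"
      by (simp add: ennreal_plus[symmetric] ennreal_leI del: ennreal_plus)
    also have "\<dots> \<le> ?c * (\<Sum>l\<in>A. ?I (D2v k l)) + ?c * ?I (D2v k l)"
      by (intro add_mono insert.IH Fn_space_step[where p = p]) (use SobD[OF S] r p insert in auto)
    finally show ?case using insert by (simp add: distrib_left add.commute)
  qed simp
  have "\<bar>Fn r z {} False (Dv k) - Fn (r / 2) z {} False (Dv k)\<bar>
      \<le> \<bar>Fn r z {} False (Dv k) - Fn r z {} True (Dv k)\<bar> + \<bar>Fn r z {} True (Dv k) - Fn r z UNIV True (Dv k)\<bar>"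
    unfolding Fn_half by simp
  then have "ennreal \<bar>Fn r z {} False (Dv k) - Fn (r / 2) z {} False (Dv k)\<bar>
      \<le> ennreal \<bar>Fn r z {} False (Dv k) - Fn r z {} True (Dv k)\<bar> + ennreal \<bar>Fn r z {} True (Dv k) - Fn r z UNIV True (Dv k)\<bar>"
    by (simp add: ennreal_plus[symmetric] ennreal_leI del: ennreal_plus)
  also have "\<dots> \<le> ?c * ?I vt + ?c * (\<Sum>l\<in>UNIV. ?I (D2v k l))"
    by (intro add_mono sp Fn_time_step[where p = p and v = v]) (use SobD[OF S] r p in auto)
  also have "\<dots> = ?c * (\<integral>\<^sup>+w. ennreal (\<bar>vt w\<bar> + (\<Sum>l\<in>UNIV. \<bar>D2v k l w\<bar>)) * indicator (pbox r z) w \<partial>lborel)"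
    by (simp add: distrib_left[symmetric] nn_integral_sum[symmetric] nn_integral_add[symmetric] sum_nonneg ennreal_plus
        sum_ennreal[symmetric] distrib_right sum_distrib_right del: sum_ennreal)
  finally have *: "ennreal \<bar>Fn r z {} False (Dv k) - Fn (r / 2) z {} False (Dv k)\<bar> \<le> \<dots>" .
  have "ennreal (r ^ (CARD('n) + 2)) * ennreal \<bar>Fn r z {} False (Dv k) - Fn (r / 2) z {} False (Dv k)\<bar>
    \<le> ennreal (r ^ (CARD('n) + 2)) * (?c * (\<integral>\<^sup>+w. ennreal (\<bar>vt w\<bar> + (\<Sum>l\<in>UNIV. \<bar>D2v k l w\<bar>)) * indicator (pbox r z) w \<partial>lborel))"
    by (intro mult_left_mono *) auto
  also have "ennreal (r ^ (CARD('n) + 2)) * (?c * (\<integral>\<^sup>+w. ennreal (\<bar>vt w\<bar> + (\<Sum>l\<in>UNIV. \<bar>D2v k l w\<bar>)) * indicator (pbox r z) w \<partial>lborel))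
    = ennreal (kK TYPE('n) * r) * (\<integral>\<^sup>+w. ennreal (\<bar>vt w\<bar> + (\<Sum>l\<in>UNIV. \<bar>D2v k l w\<bar>)) * indicator (pbox r z) w \<partial>lborel)"
    using r kK_pos[where 'n='n] by (subst mult.assoc[symmetric], subst ennreal_mult[symmetric]) (auto simp: field_simps)
  finally show ?thesis using r by (simp add: ennreal_mult mult.commute)
qed

section \<open>Mollification as the transpose of averaging\<close>

definition bump_prod :: "(real^'n) \<times> real \<Rightarrow> real" where "bump_prod = ptest (\<lambda>_. bump) bump"
text \<open>Averages are normalised by dividing by this mass, so that only its positivity has to be
  established.\<close>

definition bump_mass :: "'n::finite itself \<Rightarrow> real" where "bump_mass _ = (\<integral>y. bump_prod (y :: (real^'n) \<times> real) \<partial>lborel)"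

lemma bump_prod_test_fun: "test_fun UNIV bump_prod"
  unfolding bump_prod_def
  by (rule test_fun_ptest[of _ _ 0 "vec 1" 0 1]) (use smooth_bump bump_zero in auto)

lemma bump_prod_nonneg: "0 \<le> bump_prod y"
  unfolding bump_prod_def ptest_def by (intro mult_nonneg_nonneg prod_nonneg bump_nonneg ballI)

lemma bump_prod_borel [measurable]: "bump_prod \<in> borel_fun"
  by (rule test_fun_borel[OF bump_prod_test_fun])

text \<open>A vanishing integral would make the nonempty open set where the product is positive a
  null set.\<close>

lemma bump_mass_pos: "0 < bump_mass TYPE('n::finite)"
proof -
  have i: "integrable lborel (bump_prod :: (real^'n) \<times> real \<Rightarrow> real)"
    by (rule test_fun_integrable[OF bump_prod_test_fun])
  have "bump_mass TYPE('n) \<noteq> 0"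
  proof
    assume "bump_mass TYPE('n) = 0"
    then have "AE y in lborel. bump_prod (y :: 'n pt) = 0"
      unfolding bump_mass_def using integral_nonneg_eq_0_iff_AE[OF i AE_I2[OF bump_prod_nonneg]] by auto
    then have "AE y in lborel. y \<notin> {y :: 'n pt. 0 < bump_prod y}"
      by (auto elim!: eventually_mono)
    then have "{y :: 'n pt. 0 < bump_prod y} \<in> null_sets lborel"
      by (subst AE_iff_null_sets) simp_all
    then have "negligible {y :: 'n pt. 0 < bump_prod y}"
      by (simp add: negligible_iff_null_sets null_sets_completionI)
    moreover have "open {y :: 'n pt. 0 < bump_prod y}"
      using bump_prod_test_fun by (intro open_Collect_less) (auto simp: test_fun_iff intro: smooth_continuous)
    moreover have "0 < bump_prod (vec (1 / 2) :: real^'n, 1 / 2)"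
      unfolding bump_prod_def ptest_def
      using bump0_pos[of "1/2"] ramp0_1_pos by (auto intro!: mult_pos_pos prod_pos simp: bump_def)
    ultimately show False using open_not_negligible by blast
  qed
  moreover have "0 \<le> bump_mass TYPE('n)"
    unfolding bump_mass_def by (intro integral_nonneg_AE) (simp add: bump_prod_nonneg)
  ultimately show ?thesis by simp
qed

text \<open>Although the base point varies, in coordinates scaled around \<open>w\<close> the kernel
  is one fixed function up to the volume factor. This is what identifies the transpose of
  averaging.\<close>

lemma kernel_psc:
  fixes w y :: "(real^'n) \<times> real"
  assumes r: "0 < r"
  shows "ptest (kS r (psc r w y) {}) (kT r (psc r w y) False) w = bump_prod y / r ^ (CARD('n) + 2)"
proof -
  have "(\<Prod>l\<in>(UNIV::'n set). kS r (psc r w y) {} l (fst w $ l)) = (\<Prod>l\<in>(UNIV::'n set). bump (fst y $ l) / r)"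
    using r by (intro prod.cong) (auto simp: kS_def kf_def psc_def)
  moreover have "kT r (psc r w y) False (snd w) = bump (snd y) / r\<^sup>2"
    using r by (simp add: kT_def kf_def psc_def)
  ultimately show ?thesis
    by (simp add: ptest_def bump_prod_def prod_dividef power_add power2_eq_square)
qed

lemma kernel_continuous:
  assumes r: "0 < r"
  shows "continuous_on UNIV (\<lambda>(z :: (real^'n) \<times> real, w). ptest (kS r z {}) (kT r z False) w)"
proof -
  have c: "continuous_on UNIV bump" using smooth_continuous[OF smooth_bump] .
  show ?thesis
    unfolding ptest_def kS_def kT_def kf_def case_prod_unfold
    using r by (intro continuous_intros continuous_on_compose2[OF c]) auto
qed

lemma kernel_measurable [measurable]:
  assumes r: "0 < r"
  shows "(\<lambda>(z :: (real^'n) \<times> real, w). ptest (kS r z {}) (kT r z False) w) \<in> borel_measurable (borel \<Otimes>\<^sub>M borel)"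
  unfolding borel_prod by (rule borel_measurable_continuous_onI[OF kernel_continuous[OF r]])

lemma Fn_borel:
  assumes "0 < r" and [measurable]: "h \<in> borel_fun"
  shows "(\<lambda>z :: (real^'n) \<times> real. Fn r z {} False h) \<in> borel_fun"
proof -
  have [measurable]: "(\<lambda>(z :: 'n pt, w). ptest (kS r z {}) (kT r z False) w) \<in> borel_measurable (borel \<Otimes>\<^sub>M borel)"
    by (rule kernel_measurable[OF assms(1)])
  have "(\<lambda>z :: 'n pt. Fn r z {} False h) \<in> borel_measurable lborel"
    unfolding Fn_def by (rule lborel.borel_measurable_lebesgue_integral) measurable
  then show ?thesis by simp
qed

text \<open>The transpose of the averaging operator \<open>Fn\<close>, acting on the test
  function.\<close>

definition moll :: "real \<Rightarrow> ((real^'n) \<times> real \<Rightarrow> real) \<Rightarrow> 'n pt \<Rightarrow> real" where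
  "moll r \<psi> w = (\<integral>y. bump_prod y * \<psi> (psc r w y) \<partial>lborel)"

lemma pbox_dist:
  fixes z w :: "(real^'n) \<times> real"
  assumes "w \<in> pbox r z" "0 < r" "r \<le> 1" shows "norm (w - z) \<le> real CARD('n) + 1"
proof -
  have "\<bar>fst (w - z) $ l\<bar> \<le> 1" for l using assms by (auto simp: pbox_iff abs_le_iff) (smt (verit) assms(3))+
  then have "norm (fst (w - z)) \<le> real CARD('n)"
    using norm_le_l1_cart[of "fst (w - z)"] sum_mono[of UNIV "\<lambda>l. \<bar>fst (w - z) $ l\<bar>" "\<lambda>_. 1"] by simp
  moreover have "r\<^sup>2 \<le> 1" using assms by (simp add: power_le_one)
  then have "norm (snd (w - z)) \<le> 1" using assms by (auto simp: pbox_iff)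
  ultimately show ?thesis using norm_Pair_le[of "fst (w - z)" "snd (w - z)"] by (simp add: minus_prod_def)
qed

lemma moll_zero:
  fixes \<psi> :: "(real^'n) \<times> real \<Rightarrow> real"
  assumes r: "0 < r" "r \<le> 1" and K: "\<And>z. \<psi> z \<noteq> 0 \<Longrightarrow> norm z \<le> R" and w: "R + real CARD('n) + 1 < norm w"
  shows "moll r \<psi> w = 0"
proof -
  have "bump_prod y * \<psi> (psc r w y) = 0" for y
  proof (rule ccontr)
    assume "bump_prod y * \<psi> (psc r w y) \<noteq> 0"
    then have n: "bump_prod y \<noteq> 0" "norm (psc r w y) \<le> R" using K by auto
    have nz: "bump (fst y $ l) \<noteq> 0" "bump (snd y) \<noteq> 0" for l
      using n(1) by (auto simp: bump_prod_def ptest_def)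
    then have "0 \<le> fst y $ l" "fst y $ l \<le> 1" "0 \<le> snd y" "snd y \<le> 1" for l
      using bump_zero[of "fst y $ l"] bump_zero[of "snd y"] by (smt (verit))+
    then have "w \<in> pbox r (psc r w y)"
      using r by (auto simp: pbox_iff psc_def mult_left_le)
    from pbox_dist[OF this r] have "norm w \<le> R + real CARD('n) + 1"
      using n(2) norm_triangle_sub[of w "psc r w y"] by linarith
    then show False using w by simp
  qed
  then show ?thesis unfolding moll_def by (simp only: integral_zero)
qed

lemma moll_bound:
  fixes \<psi> :: "(real^'n) \<times> real \<Rightarrow> real"
  assumes M: "\<And>z. \<bar>\<psi> z\<bar> \<le> M" and [measurable]: "\<psi> \<in> borel_fun"
  shows "\<bar>moll r \<psi> w\<bar> \<le> bump_mass TYPE('n) * M"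
proof -
  have i: "integrable lborel (bump_prod :: 'n pt \<Rightarrow> real)"
    by (rule test_fun_integrable[OF bump_prod_test_fun])
  have "\<bar>moll r \<psi> w\<bar> \<le> (\<integral>y. bump_prod (y :: 'n pt) * M \<partial>lborel)"
    unfolding moll_def
  proof (rule order_trans[OF integral_abs_bound], rule integral_mono_AE)
    show "integrable lborel (\<lambda>y. \<bar>bump_prod y * \<psi> (psc r w y)\<bar>)"
      by (rule Bochner_Integration.integrable_bound[OF integrable_mult_left[OF i, of M]])
        (use M bump_prod_nonneg in \<open>auto simp: abs_mult intro!: mult_left_mono AE_I2 intro: order_trans[OF M abs_ge_self]\<close>)
    show "integrable lborel (\<lambda>y :: 'n pt. bump_prod y * M)" using i by simp
    show "AE y in lborel. \<bar>bump_prod y * \<psi> (psc r w y)\<bar> \<le> bump_prod y * M"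
      by (intro AE_I2) (simp add: abs_mult bump_prod_nonneg mult_left_mono M)
  qed
  also have "\<dots> = bump_mass TYPE('n) * M" by (simp add: bump_mass_def)
  finally show ?thesis .
qed

lemma moll_tendsto:
  fixes \<psi> :: "(real^'n) \<times> real \<Rightarrow> real"
  assumes M: "\<And>z. \<bar>\<psi> z\<bar> \<le> M" and c: "continuous_on UNIV \<psi>" and r: "r \<longlonglongrightarrow> 0"
  shows "(\<lambda>j. moll (r j) \<psi> w) \<longlonglongrightarrow> bump_mass TYPE('n) * \<psi> w"
proof -
  have i: "integrable lborel (bump_prod :: 'n pt \<Rightarrow> real)"
    by (rule test_fun_integrable[OF bump_prod_test_fun])
  have [measurable]: "\<psi> \<in> borel_fun" by (rule borel_measurable_continuous_onI[OF c])
  have "(\<lambda>j. \<integral>y. bump_prod y * \<psi> (psc (r j) w y) \<partial>lborel) \<longlonglongrightarrow> (\<integral>y. bump_prod (y :: 'n pt) * \<psi> w \<partial>lborel)"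
  proof (rule integral_dominated_convergence)
    show "integrable lborel (\<lambda>y :: 'n pt. bump_prod y * M)" using i by simp
    show "AE y in lborel. norm (bump_prod y * \<psi> (psc (r j) w y)) \<le> bump_prod y * M" for j
      by (intro AE_I2) (simp add: abs_mult bump_prod_nonneg mult_left_mono M)
    show "AE y in lborel. (\<lambda>j. bump_prod y * \<psi> (psc (r j) w y)) \<longlonglongrightarrow> bump_prod y * \<psi> w"
    proof (rule AE_I2)
      fix y :: "'n pt"
      have "(\<lambda>j. psc (r j) w y) \<longlonglongrightarrow> (fst w + 0 *\<^sub>R fst y, snd w + 0\<^sup>2 * snd y)"
        unfolding psc_def by (intro tendsto_intros r)
      then have "(\<lambda>j. psc (r j) w y) \<longlonglongrightarrow> w" by simp
      then have "(\<lambda>j. \<psi> (psc (r j) w y)) \<longlonglongrightarrow> \<psi> w"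
        by (rule continuous_on_tendsto_compose[OF c]) auto
      then show "(\<lambda>j. bump_prod y * \<psi> (psc (r j) w y)) \<longlonglongrightarrow> bump_prod y * \<psi> w" by (intro tendsto_intros)
    qed
  qed simp_all
  then show ?thesis by (simp add: moll_def[symmetric] bump_mass_def)
qed

text \<open>Fubini's theorem followed by the scaling around \<open>w\<close>. The majorant comes
  from the bounded support of \<psi> and from boxes of size at most 1, which together confine
  \<open>w\<close> to a ball where \<open>h\<close> is integrable.\<close>

lemma Fn_moll:
  fixes h \<psi> :: "(real^'n) \<times> real \<Rightarrow> real"
  assumes r: "0 < r" "r \<le> 1" and [measurable]: "h \<in> borel_fun" and h: "Np p h < top" and p: "1 \<le> p"
    and c: "continuous_on UNIV \<psi>" and K: "\<And>z. \<psi> z \<noteq> 0 \<Longrightarrow> norm z \<le> R" and M: "\<And>z. \<bar>\<psi> z\<bar> \<le> M"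
  shows "(\<integral>z. Fn r z {} False h * \<psi> z \<partial>lborel) = (\<integral>w. h w * moll r \<psi> w \<partial>lborel)"
proof -
  have [measurable]: "\<psi> \<in> borel_fun" by (rule borel_measurable_continuous_onI[OF c])
  let ?k = "\<lambda>(z :: 'n pt) w. ptest (kS r z {}) (kT r z False) w"
  have km [measurable]: "(\<lambda>(z, w). ?k z w) \<in> borel_measurable (borel \<Otimes>\<^sub>M borel)"
    by (rule kernel_measurable[OF r(1)])
  have kw: "?k z \<in> borel_fun" "(\<lambda>z. ?k z w) \<in> borel_fun" for z w
    using measurable_compose[OF _ km, of "\<lambda>w. (z, w)" borel] measurable_compose[OF _ km, of "\<lambda>z. (z, w)" borel] by auto
  note [measurable] = kw
  define A where "A = cball (0 :: 'n pt) R"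
  define A' where "A' = cball (0 :: 'n pt) (R + real CARD('n) + 1)"
  have [measurable]: "A \<in> sets borel" "A' \<in> sets borel" by (auto simp: A_def A'_def)
  define L where "L = (4 * kb / r) ^ CARD('n) * (4 * kb / r\<^sup>2)"
  have kb: "\<bar>?k z w\<bar> \<le> L" for z w
    using ptest_bound[of "kS r z {}" "\<lambda>_. 4 * kb / r" "kT r z False" "4 * kb / r\<^sup>2" w, OF kS_props(2)[OF r(1)] kT_props(2)[OF r(1)]]
    by (simp add: L_def)
  have L: "0 \<le> L" using kb[of undefined undefined] by linarith
  have kz: "?k z w = 0" if "w \<notin> pbox r z" for z w
    by (rule ptest_zero[OF _ _ that]) (use kS_props(3)[OF r(1), where z = z] kT_props(3)[OF r(1), where z = z] in auto)
  have supp: "z \<in> A \<and> w \<in> A'" if "\<psi> z * ?k z w \<noteq> 0" for z w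
  proof -
    have "norm z \<le> R" "w \<in> pbox r z" using K[of z] kz[of w z] that by fastforce+
    then show ?thesis using pbox_dist[OF _ r, of w z] norm_triangle_sub[of w z] by (auto simp: A_def A'_def)
  qed
  have "integrable lborel (\<lambda>w. h w * indicator A' w)"
    by (rule Np_local_integrable[OF _ _ p h, where K = A' and M = 1]) (auto simp: A'_def intro!: borel_measurable_indicator borel_closed)
  then have hA: "(\<integral>\<^sup>+w. ennreal \<bar>h w * indicator A' w\<bar> \<partial>lborel) < top"
    unfolding integrable_iff_bounded by simp
  have int: "integrable (lborel \<Otimes>\<^sub>M lborel) (\<lambda>(z, w). \<psi> z * (h w * ?k z w))"
  proof (rule integrableI_bounded)
    show "(\<lambda>(z, w). \<psi> z * (h w * ?k z w)) \<in> borel_measurable (lborel \<Otimes>\<^sub>M lborel)" by measurable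
    have "(\<integral>\<^sup>+zw. ennreal (norm (case zw of (z, w) \<Rightarrow> \<psi> z * (h w * ?k z w))) \<partial>(lborel \<Otimes>\<^sub>M lborel))
      = (\<integral>\<^sup>+z. (\<integral>\<^sup>+w. ennreal \<bar>\<psi> z * (h w * ?k z w)\<bar> \<partial>lborel) \<partial>lborel)"
      by (subst lborel.nn_integral_fst[symmetric]) auto
    also have "\<dots> \<le> (\<integral>\<^sup>+z. (\<integral>\<^sup>+w. ennreal (M * L) * indicator A z * ennreal \<bar>h w * indicator A' w\<bar> \<partial>lborel) \<partial>lborel)"
    proof (intro nn_integral_mono)
      fix z w :: "'n pt"
      have M0: "0 \<le> M" using M[of z] by linarith
      show "ennreal \<bar>\<psi> z * (h w * ?k z w)\<bar> \<le> ennreal (M * L) * indicator A z * ennreal \<bar>h w * indicator A' w\<bar>"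
      proof (cases "\<psi> z * ?k z w = 0")
        case True then show ?thesis by auto
      next
        case False
        then have "z \<in> A" "w \<in> A'" using supp[of z w] by auto
        moreover have "\<bar>\<psi> z * (h w * ?k z w)\<bar> \<le> M * L * \<bar>h w\<bar>"
          using mult_right_mono[OF mult_mono[OF M[of z] kb[of z w]], of "\<bar>h w\<bar>"] M0 by (simp add: abs_mult mult_ac)
        ultimately show ?thesis using M0 L by (simp add: ennreal_mult[symmetric] ennreal_leI)
      qed
    qed
    also have "\<dots> = ennreal (M * L) * vol A * (\<integral>\<^sup>+w. ennreal \<bar>h w * indicator A' w\<bar> \<partial>lborel)"
      by (simp add: nn_integral_cmult nn_integral_multc nn_integral_cmult_indicator)
    also have "\<dots> < top"
      using hA by (simp add: ennreal_mult_less_top A_def compact_emeasure_top)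
    finally show "(\<integral>\<^sup>+zw. ennreal (norm (case zw of (z, w) \<Rightarrow> \<psi> z * (h w * ?k z w))) \<partial>(lborel \<Otimes>\<^sub>M lborel)) < \<infinity>" by simp
  qed
  have "(\<integral>z. Fn r z {} False h * \<psi> z \<partial>lborel) = (\<integral>z. (\<integral>w. \<psi> z * (h w * ?k z w) \<partial>lborel) \<partial>lborel)"
    unfolding Fn_def by (simp add: mult.commute)
  also have "\<dots> = (\<integral>w. (\<integral>z. \<psi> z * (h w * ?k z w) \<partial>lborel) \<partial>lborel)"
    by (rule lborel_pair.Fubini_integral[OF int, symmetric])
  also have "\<dots> = (\<integral>w. h w * moll r \<psi> w \<partial>lborel)"
  proof (rule Bochner_Integration.integral_cong[OF refl])
    fix w :: "'n pt"
    have "(\<integral>z. \<psi> z * (h w * ?k z w) \<partial>lborel) = h w * (\<integral>z. \<psi> z * ?k z w \<partial>lborel)"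
      by (subst integral_mult_right_zero[symmetric]) (simp add: mult_ac)
    also have "(\<integral>z. \<psi> z * ?k z w \<partial>lborel) = r ^ (CARD('n) + 2) * (\<integral>y. \<psi> (psc r w y) * (bump_prod y / r ^ (CARD('n) + 2)) \<partial>lborel)"
      using integral_psc[of "\<lambda>z. \<psi> z * ?k z w" r w] r by (simp only: kernel_psc[OF r(1)]) simp
    also have "\<dots> = (\<integral>y. r ^ (CARD('n) + 2) * (\<psi> (psc r w y) * (bump_prod y / r ^ (CARD('n) + 2))) \<partial>lborel)"
      by (rule integral_mult_right_zero[symmetric])
    also have "\<dots> = moll r \<psi> w"
      unfolding moll_def using r by (intro Bochner_Integration.integral_cong) auto
    finally show "(\<integral>z. \<psi> z * (h w * ?k z w) \<partial>lborel) = h w * moll r \<psi> w" .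
  qed
  finally show ?thesis .
qed

lemma nn_integral_power_sum_le:
  fixes h \<psi> :: "'a::euclidean_space \<Rightarrow> real" and \<omega> :: "'a \<Rightarrow> ennreal"
  assumes [measurable]: "\<omega> \<in> borel_fun" "f \<in> borel_fun" "T \<in> borel_fun" and p: "0 \<le> p"
    and le: "AE z in lborel. T z < top \<longrightarrow> (\<exists>s\<ge>0. \<bar>g z\<bar> \<le> \<bar>f z\<bar> + s \<and> ennreal (s powr p) \<le> T z)" and T: "AE z in lborel. T z < top"
  shows "(\<integral>\<^sup>+z. \<omega> z * ennreal (\<bar>g z\<bar> powr p) \<partial>lborel)
    \<le> ennreal (2 powr p) * ((\<integral>\<^sup>+z. \<omega> z * ennreal (\<bar>f z\<bar> powr p) \<partial>lborel) + (\<integral>\<^sup>+z. \<omega> z * T z \<partial>lborel))"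
proof -
  have "AE z in lborel. \<omega> z * ennreal (\<bar>g z\<bar> powr p) \<le> ennreal (2 powr p) * (\<omega> z * ennreal (\<bar>f z\<bar> powr p) + \<omega> z * T z)"
    using le T
  proof eventually_elim
    case (elim z)
    then obtain s where s: "0 \<le> s" "\<bar>g z\<bar> \<le> \<bar>f z\<bar> + s" "ennreal (s powr p) \<le> T z" by blast
    have "\<bar>g z\<bar> powr p \<le> (\<bar>f z\<bar> + s) powr p" using s p by (intro powr_mono2) auto
    also have "\<dots> \<le> 2 powr p * (\<bar>f z\<bar> powr p + s powr p)" using s p by (intro powr_add_le) auto
    finally have "ennreal (\<bar>g z\<bar> powr p) \<le> ennreal (2 powr p) * (ennreal (\<bar>f z\<bar> powr p) + ennreal (s powr p))"
      by (simp add: ennreal_mult[symmetric] ennreal_plus[symmetric] ennreal_leI del: ennreal_plus)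
    also have "\<dots> \<le> ennreal (2 powr p) * (ennreal (\<bar>f z\<bar> powr p) + T z)"
      using s by (intro mult_left_mono add_mono) auto
    finally have "\<omega> z * ennreal (\<bar>g z\<bar> powr p) \<le> \<omega> z * (ennreal (2 powr p) * (ennreal (\<bar>f z\<bar> powr p) + T z))"
      by (intro mult_left_mono) auto
    then show ?case by (simp add: distrib_left mult_ac)
  qed
  then have "(\<integral>\<^sup>+z. \<omega> z * ennreal (\<bar>g z\<bar> powr p) \<partial>lborel) \<le> (\<integral>\<^sup>+z. ennreal (2 powr p) * (\<omega> z * ennreal (\<bar>f z\<bar> powr p) + \<omega> z * T z) \<partial>lborel)"
    by (rule nn_integral_mono_AE)
  also have "\<dots> = ennreal (2 powr p) * ((\<integral>\<^sup>+z. \<omega> z * ennreal (\<bar>f z\<bar> powr p) \<partial>lborel) + (\<integral>\<^sup>+z. \<omega> z * T z \<partial>lborel))"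
    by (simp add: nn_integral_cmult nn_integral_add)
  finally show ?thesis .
qed

section \<open>Gradients with drift weights\<close>

definition pbox' :: "real \<Rightarrow> (real^'n) \<times> real \<Rightarrow> 'n pt set" where
  "pbox' r w = pbox r (fst w + vec r, snd w + r\<^sup>2)"

lemma pbox'_iff: "z \<in> pbox' r w \<longleftrightarrow> w \<in> pbox r z"
  unfolding pbox'_def pbox_iff by (auto simp: algebra_simps)

lemma weight_one:
  fixes w :: "(real^'n) \<times> real"
  assumes "0 < r" shows "(\<integral>\<^sup>+z. 1 * indicator (pbox r z) w \<partial>lborel) = ennreal (r ^ (CARD('n) + 2))"
proof -
  have "(\<integral>\<^sup>+z. 1 * indicator (pbox r z) w \<partial>lborel) = (\<integral>\<^sup>+z. indicator (pbox' r w) z \<partial>lborel)"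
    by (intro nn_integral_cong) (auto simp: indicator_def pbox'_iff)
  then show ?thesis using assms emeasure_pbox[of r "(fst w + vec r, snd w + r\<^sup>2)"] by (simp add: pbox'_def)
qed

text \<open>Holder's inequality, obtained as Jensen's with exponent q / p for the mean of |\<mu>|^p
  on the box. The volume of the box becomes the factor \<open>r powr (- hdim / q)\<close>; against
  the factor \<open>r\<close> of a dyadic step it leaves
  \<open>r powr (1 - hdim / q)\<close>.\<close>

lemma weight_drift:
  fixes \<mu> :: "(real^'n) \<times> real \<Rightarrow> real"
  assumes r: "0 < r" and [measurable]: "\<mu> \<in> borel_fun" and X: "0 \<le> X" "Np_le q \<mu> X"
    and pq: "1 \<le> p" "p \<le> q"
  shows "(\<integral>\<^sup>+z. ennreal (\<bar>\<mu> z\<bar> powr p) * indicator (pbox r z) w \<partial>lborel)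
    \<le> ennreal (X powr p * (r powr (- hdim TYPE('n) / q)) powr p * r ^ (CARD('n) + 2))"
proof -
  define P where "P = pbox r (fst w + vec r, snd w + r\<^sup>2)"
  define m where "m = r ^ (CARD('n) + 2)"
  have m: "0 < m" using r by (simp add: m_def)
  define I where "I = (\<integral>\<^sup>+z. ennreal (\<bar>\<mu> z\<bar> powr p) * indicator P z \<partial>lborel)"
  have P: "P \<in> sets borel" "vol P = ennreal m" using emeasure_pbox[of r "(fst w + vec r, snd w + r\<^sup>2)"] r by (auto simp: P_def m_def)
  have Xq: "(\<integral>\<^sup>+z. ennreal ((\<bar>\<mu> z\<bar> powr p) powr (q / p)) * indicator P z \<partial>lborel) \<le> ennreal (X powr q)"
  proof -
    have "(\<integral>\<^sup>+z. ennreal ((\<bar>\<mu> z\<bar> powr p) powr (q / p)) * indicator P z \<partial>lborel) \<le> Np q \<mu>"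
      unfolding Np_def using pq by (intro nn_integral_mono) (auto simp: indicator_def powr_powr)
    then show ?thesis using X(2) by simp
  qed
  have fin: "I < top"
  proof -
    have "I \<le> (\<integral>\<^sup>+z. ennreal ((\<bar>\<mu> z\<bar> powr p) powr (q / p)) * indicator P z + indicator P z \<partial>lborel)"
      unfolding I_def
    proof (intro nn_integral_mono)
      fix z
      have "x \<le> x powr (q / p) + 1" if "0 \<le> x" for x :: real
        using powr_mono[of 1 "q / p" x] pq that by (cases "1 \<le> x") (auto simp: add_increasing)
      from this[of "\<bar>\<mu> z\<bar> powr p"] have "ennreal (\<bar>\<mu> z\<bar> powr p) \<le> ennreal ((\<bar>\<mu> z\<bar> powr p) powr (q / p)) + 1"
        by (simp add: ennreal_plus[symmetric] ennreal_1[symmetric] ennreal_leI del: ennreal_plus ennreal_1)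
      then show "ennreal (\<bar>\<mu> z\<bar> powr p) * indicator P z \<le> ennreal ((\<bar>\<mu> z\<bar> powr p) powr (q / p)) * indicator P z + indicator P z"
        by (auto simp: indicator_def)
    qed
    also have "\<dots> = (\<integral>\<^sup>+z. ennreal ((\<bar>\<mu> z\<bar> powr p) powr (q / p)) * indicator P z \<partial>lborel) + ennreal m"
      using P by (subst nn_integral_add) auto
    also have "\<dots> < top" using Xq by (simp add: ennreal_add_less_top le_less_trans)
    finally show ?thesis .
  qed
  define d where "d = enn2real I / m"
  have d: "0 \<le> d" using m by (simp add: d_def)
  have Id: "I = ennreal (d * m)" using fin m by (simp add: d_def)
  have "ennreal (d powr (q / p) * m) \<le> ennreal (1 powr (q / p)) * (\<integral>\<^sup>+z. ennreal ((\<bar>\<mu> z\<bar> powr p) powr (q / p)) * indicator P z \<partial>lborel)"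
    unfolding P_def m_def
    by (rule average_jensen) (use r pq d Id in \<open>auto simp: I_def P_def m_def\<close>)
  also have "\<dots> \<le> ennreal (X powr q)" using Xq by simp
  finally have "d powr (q / p) * m \<le> X powr q" by simp
  then have "d powr (q / p) \<le> X powr q / m" using m by (simp add: field_simps)
  then have "(d powr (q / p)) powr (p / q) \<le> (X powr q / m) powr (p / q)"
    using pq by (intro powr_mono2) auto
  moreover have "m = r powr hdim TYPE('n)"
    using r by (simp add: m_def hdim_def powr_add powr_realpow power2_eq_square)
  ultimately have "d \<le> X powr p * (r powr (- hdim TYPE('n) / q)) powr p"
    using pq d X r by (simp add: powr_powr powr_divide powr_minus_divide)
  then have "d * m \<le> X powr p * (r powr (- hdim TYPE('n) / q)) powr p * m" using m by simp
  moreover have "(\<integral>\<^sup>+z. ennreal (\<bar>\<mu> z\<bar> powr p) * indicator (pbox r z) w \<partial>lborel) = I"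
    unfolding I_def P_def pbox'_def[symmetric] by (intro nn_integral_cong) (simp add: indicator_def pbox'_iff)
  ultimately show ?thesis unfolding Id m_def by (simp add: ennreal_leI)
qed

context
  fixes p q :: real and dummy :: "'n::finite itself"
  assumes p: "1 \<le> p" and pq: "p \<le> q" and q: "hdim TYPE('n) < q"
begin

text \<open>\<open>al\<close> is the power of the scale left after the drift weight is paid for.
  \<open>be\<close> takes half of that decay: \<open>rj j powr al\<close> is
  \<open>be ^ (2 * j)\<close>, where one factor \<open>be ^ j\<close> pays for the weights
  \<open>wj\<close> of the power series inequality and the other is at most 1.\<close>

definition "al = 1 - hdim TYPE('n) / q"
definition "be = 2 powr (- al / 2)"
definition "rj j = (1 / 2 :: real) ^ j"
definition "wj j = (1 - be) * be ^ j"
definition "cK = kK TYPE('n) / bump_mass TYPE('n)"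
definition "FF h j z = Fn (rj j) z {} False h / bump_mass TYPE('n)" for h :: "(real^'n) \<times> real \<Rightarrow> real"

lemma al: "0 < al" "al \<le> 1" using q by (auto simp: al_def hdim_def)
lemma be: "0 < be" "be < 1" using al unfolding be_def by (auto simp: powr_less_one)
lemma rj: "0 < rj j" "rj j \<le> 1" by (auto simp: rj_def power_le_one)
lemma rj_Suc: "rj (Suc j) = rj j / 2" by (simp add: rj_def)
lemma rj_al: "rj j powr al = be ^ (2 * j)"
proof -
  have "rj j powr al = 2 powr (- (real j * al))"
    by (simp add: rj_def power_one_over powr_divide powr_minus_divide powr_realpow[symmetric] powr_powr)
  also have "\<dots> = be ^ (2 * j)" by (simp add: be_def powr_realpow[symmetric] powr_powr mult.commute)
  finally show ?thesis .
qed
lemma wj: "0 < wj j" "(\<Sum>k<N. wj k) \<le> 1" "(\<Sum>k. ennreal (wj k)) = 1"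
proof -
  show "0 < wj j" for j using be by (simp add: wj_def)
  have s: "wj sums 1"
    using sums_mult[OF geometric_sums[of be], of "1 - be"] be unfolding wj_def by simp
  show "(\<Sum>k<N. wj k) \<le> 1"
    using sum_le_suminf[OF sums_summable[OF s], of "{..<N}"] \<open>\<And>j. 0 < wj j\<close> sums_unique[OF s] by (simp add: less_imp_le)
  show "(\<Sum>k. ennreal (wj k)) = 1"
    using suminf_ennreal2[OF less_imp_le[OF \<open>\<And>j. 0 < wj j\<close>] sums_summable[OF s]] sums_unique[OF s] by simp
qed
lemma cK: "0 < cK" using kK_pos[where 'n='n] bump_mass_pos[where 'n='n] by (simp add: cK_def)

context
  fixes v vt :: "(real^'n) \<times> real \<Rightarrow> real" and Dv D2v and k :: 'n
  assumes S: "Sob p v vt Dv D2v"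
begin

text \<open>\<open>TT\<close> is the right-hand side of \<open>power_series_le\<close> for the
  dyadic differences \<open>dj\<close>. Where it is finite the telescoping series in
  \<open>GG\<close> converges absolutely, so \<open>GG\<close> is the limit of the averages
  there.\<close>

definition "HH w = \<bar>vt w\<bar> + (\<Sum>l\<in>UNIV. \<bar>D2v k l w\<bar>)"
definition "dj j z = \<bar>FF (Dv k) j z - FF (Dv k) (Suc j) z\<bar>"
definition "TT z = (\<Sum>j. ennreal (wj j powr (1 - p) * dj j z powr p))"
definition "GG z = FF (Dv k) 0 z + (\<Sum>j. FF (Dv k) (Suc j) z - FF (Dv k) j z)"

lemma FF_borel [measurable]: "FF (Dv k) j \<in> borel_fun"
  unfolding FF_def[abs_def] by (intro borel_measurable_divide borel_measurable_const Fn_borel rj SobD(3)[OF S])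

lemma dj_borel [measurable]: "dj j \<in> borel_fun" unfolding dj_def[abs_def] by measurable
lemma TT_borel [measurable]: "TT \<in> borel_fun" unfolding TT_def[abs_def] by measurable
lemma GG_borel [measurable]: "GG \<in> borel_fun" unfolding GG_def[abs_def] by measurable
lemma HH_borel [measurable]: "HH \<in> borel_fun"
proof -
  have [measurable]: "vt \<in> borel_fun" "\<And>l. D2v k l \<in> borel_fun" using SobD[OF S] by auto
  show ?thesis unfolding HH_def[abs_def] by measurable
qed

text \<open>The hypothesis on \<open>\<omega>\<close> lets box masses exceed the volume by the
  factor \<open>(rj j powr (al - 1)) powr p\<close>. Times the factor \<open>rj j\<close> of a
  dyadic step this is the p-th power of \<open>rj j powr al\<close>, which decays
  geometrically.\<close>

lemma weighted_bounds:
  fixes \<omega> :: "(real^'n) \<times> real \<Rightarrow> ennreal"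
  assumes [measurable]: "\<omega> \<in> borel_fun" and Y: "0 \<le> Y"
    and w: "\<And>j w. (\<integral>\<^sup>+z. \<omega> z * indicator (pbox (rj j) z) w \<partial>lborel) \<le> ennreal (Y * (rj j powr (al - 1)) powr p * rj j ^ (CARD('n) + 2))"
  shows "(\<integral>\<^sup>+z. \<omega> z * ennreal (\<bar>FF (Dv k) 0 z\<bar> powr p) \<partial>lborel) \<le> ennreal (cK powr p * Y) * Np p (Dv k)"
    and "(\<integral>\<^sup>+z. \<omega> z * TT z \<partial>lborel) \<le> ennreal ((cK / (1 - be)) powr p * Y) * Np p HH"
proof -
  have bm: "0 < bump_mass TYPE('n)" by (rule bump_mass_pos)
  have [measurable]: "Dv k \<in> borel_fun" using SobD[OF S] by auto
  have scale: "ennreal (\<bar>x / bump_mass TYPE('n)\<bar> * m) \<le> ennreal (c / bump_mass TYPE('n)) * I"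
    if "ennreal (\<bar>x\<bar> * m) \<le> ennreal c * I" "0 \<le> m" "0 \<le> c" for x m c I
  proof -
    have "ennreal (\<bar>x / bump_mass TYPE('n)\<bar> * m) = ennreal (1 / bump_mass TYPE('n)) * ennreal (\<bar>x\<bar> * m)"
      using bm that by (simp add: ennreal_mult[symmetric])
    also have "\<dots> \<le> ennreal (1 / bump_mass TYPE('n)) * (ennreal c * I)" using that by (intro mult_left_mono) auto
    also have "\<dots> = ennreal (c / bump_mass TYPE('n)) * I"
      using bm that by (simp add: mult.assoc[symmetric] ennreal_mult[symmetric])
    finally show ?thesis .
  qed
  have "(\<integral>\<^sup>+z. \<omega> z * ennreal (\<bar>FF (Dv k) 0 z\<bar> powr p) \<partial>lborel) \<le> ennreal (cK powr p * Y) * Np p (\<lambda>w. \<bar>Dv k w\<bar>)"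
  proof (rule weighted_average[where r = "rj 0"])
    show "ennreal (\<bar>FF (Dv k) 0 z\<bar> * rj 0 ^ (CARD('n) + 2)) \<le> ennreal cK * (\<integral>\<^sup>+w. ennreal \<bar>Dv k w\<bar> * indicator (pbox (rj 0) z) w \<partial>lborel)" for z
      unfolding FF_def cK_def
      by (rule scale[OF Fn_bound[OF rj(1) SobD(3)[OF S] SobD(7)[OF S] p]]) (use rj kK_pos in \<open>auto intro: less_imp_le\<close>)
    show "(\<integral>\<^sup>+z. \<omega> z * indicator (pbox (rj 0) z) w \<partial>lborel) \<le> ennreal (Y * rj 0 ^ (CARD('n) + 2))" for w
      using w[of 0 w] by (simp add: rj_def)
  qed (use p Y cK rj in auto)
  then show "(\<integral>\<^sup>+z. \<omega> z * ennreal (\<bar>FF (Dv k) 0 z\<bar> powr p) \<partial>lborel) \<le> ennreal (cK powr p * Y) * Np p (Dv k)"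
    by (simp add: Np_def)
  have dj: "(\<integral>\<^sup>+z. \<omega> z * ennreal (dj j z powr p) \<partial>lborel) \<le> ennreal ((cK * rj j) powr p * (Y * (rj j powr (al - 1)) powr p)) * Np p HH" for j
  proof (rule weighted_average[where r = "rj j"])
    show "ennreal (dj j z * rj j ^ (CARD('n) + 2)) \<le> ennreal (cK * rj j) * (\<integral>\<^sup>+w. ennreal (HH w) * indicator (pbox (rj j) z) w \<partial>lborel)" for z
    proof -
      have "dj j z = \<bar>(Fn (rj j) z {} False (Dv k) - Fn (rj j / 2) z {} False (Dv k)) / bump_mass TYPE('n)\<bar>"
        by (simp add: dj_def FF_def rj_Suc diff_divide_distrib)
      moreover have "cK * rj j = kK TYPE('n) * rj j / bump_mass TYPE('n)" by (simp add: cK_def)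
      ultimately show ?thesis unfolding HH_def
        using scale[OF Fn_diff[OF rj(1) S p]] rj(1)[of j] kK_pos[where 'n='n] by (simp add: less_imp_le)
    qed
    show "0 \<le> HH w" for w unfolding HH_def by (simp add: sum_nonneg)
    show "0 \<le> dj j z" for z by (simp add: dj_def)
  qed (use w p Y cK rj in auto)
  \<comment> \<open>Of the two factors \<open>be ^ j\<close> in \<open>rj j powr al\<close>, one
    combines with \<open>wj j powr (1 - p)\<close> to leave a multiple of \<open>wj j\<close>; the
    other is dropped.\<close>
  have coef: "wj j powr (1 - p) * ((cK * rj j) powr p * (Y * (rj j powr (al - 1)) powr p)) \<le> (cK / (1 - be)) powr p * Y * wj j" for j
  proof -
    have "(cK * rj j) powr p * (Y * (rj j powr (al - 1)) powr p) = cK powr p * Y * (rj j * rj j powr (al - 1)) powr p"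
      using cK rj(1)[of j] by (simp add: powr_mult mult_ac)
    also have "rj j * rj j powr (al - 1) = rj j powr al"
      using rj(1)[of j] by (simp add: powr_diff)
    also have "\<dots> = (be ^ j) * (be ^ j)" unfolding rj_al by (simp add: power_mult power2_eq_square power_mult_distrib)
    finally have e: "(cK * rj j) powr p * (Y * (rj j powr (al - 1)) powr p) = cK powr p * Y * ((be ^ j) powr p * (be ^ j) powr p)"
      using be by (simp add: powr_mult)
    have bj: "0 < be ^ j" "be ^ j \<le> 1" using be by (auto simp: power_le_one)
    have "wj j powr (1 - p) * (be ^ j) powr p = wj j * (1 / (1 - be)) powr p"
      using be bj by (simp add: wj_def powr_diff powr_mult powr_divide)
    then have "wj j powr (1 - p) * ((cK * rj j) powr p * (Y * (rj j powr (al - 1)) powr p))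
       = cK powr p * Y * (wj j * (1 / (1 - be)) powr p) * (be ^ j) powr p"
      unfolding e by (simp add: mult_ac)
    also have "\<dots> \<le> cK powr p * Y * (wj j * (1 / (1 - be)) powr p) * 1"
      using bj Y p wj(1)[of j] by (intro mult_left_mono) (auto simp: powr_le1)
    also have "\<dots> = (cK / (1 - be)) powr p * Y * wj j"
      using cK be by (simp add: powr_divide)
    finally show ?thesis .
  qed
  have "(\<integral>\<^sup>+z. \<omega> z * TT z \<partial>lborel) = (\<Sum>j. \<integral>\<^sup>+z. ennreal (wj j powr (1 - p)) * (\<omega> z * ennreal (dj j z powr p)) \<partial>lborel)"
    unfolding TT_def by (subst nn_integral_suminf[symmetric]) (auto simp: ennreal_suminf_cmult[symmetric] ennreal_mult mult_ac simp del: ennreal_suminf_cmult)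
  also have "\<dots> \<le> (\<Sum>j. ennreal ((cK / (1 - be)) powr p * Y) * Np p HH * ennreal (wj j))"
  proof (intro suminf_le)
    fix j
    have "(\<integral>\<^sup>+z. ennreal (wj j powr (1 - p)) * (\<omega> z * ennreal (dj j z powr p)) \<partial>lborel)
      \<le> ennreal (wj j powr (1 - p)) * (ennreal ((cK * rj j) powr p * (Y * (rj j powr (al - 1)) powr p)) * Np p HH)"
      by (subst nn_integral_cmult) (auto intro!: mult_left_mono dj)
    also have "\<dots> = ennreal (wj j powr (1 - p) * ((cK * rj j) powr p * (Y * (rj j powr (al - 1)) powr p))) * Np p HH"
      using Y by (simp add: ennreal_mult mult.assoc)
    also have "\<dots> \<le> ennreal ((cK / (1 - be)) powr p * Y * wj j) * Np p HH"
      by (intro mult_right_mono ennreal_leI coef) simp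
    finally show "(\<integral>\<^sup>+z. ennreal (wj j powr (1 - p)) * (\<omega> z * ennreal (dj j z powr p)) \<partial>lborel)
      \<le> ennreal ((cK / (1 - be)) powr p * Y) * Np p HH * ennreal (wj j)"
      using Y wj(1)[of j] by (simp add: ennreal_mult mult_ac)
  qed auto
  also have "\<dots> = ennreal ((cK / (1 - be)) powr p * Y) * Np p HH"
    by (simp add: wj(3))
  finally show "(\<integral>\<^sup>+z. \<omega> z * TT z \<partial>lborel) \<le> ennreal ((cK / (1 - be)) powr p * Y) * Np p HH" .
qed

lemma HH_finite: "Np p HH < top"
proof -
  have [measurable]: "vt \<in> borel_fun" "\<And>l. D2v k l \<in> borel_fun" using SobD[OF S] by auto
  have a: "Np p (\<lambda>w. \<bar>h w\<bar>) = Np p h" for h :: "(real^'n) \<times> real \<Rightarrow> real" by (simp add: Np_def)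
  have "Np p (\<lambda>w. \<Sum>l\<in>A. \<bar>D2v k l w\<bar>) < top" if "finite A" for A :: "'n set"
    using that
  proof (induction A)
    case empty then show ?case using p by (simp add: Np_def)
  next
    case (insert l A)
    then have "Np p (\<lambda>w. \<bar>D2v k l w\<bar> + (\<Sum>l\<in>A. \<bar>D2v k l w\<bar>)) < top"
      using SobD(8)[OF S, of k l] p by (intro Np_add_finite) (auto simp: a)
    then show ?case using insert by simp
  qed
  then show ?thesis unfolding HH_def[abs_def]
    using SobD(6)[OF S] p by (intro Np_add_finite) (auto simp: a)
qed

lemma weight_one_bound:
  fixes w :: "(real^'n) \<times> real"
  shows "(\<integral>\<^sup>+z. 1 * indicator (pbox (rj j) z) w \<partial>lborel) \<le> ennreal (1 * (rj j powr (al - 1)) powr p * rj j ^ (CARD('n) + 2))"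
proof -
  have "1 \<le> (rj j powr (al - 1)) powr p"
  proof (rule ge_one_powr_ge_zero)
    have "rj j powr (1 - al) \<le> 1" using rj[of j] al by (intro powr_le1) auto
    moreover have "rj j powr (al - 1) = 1 / rj j powr (1 - al)"
      using powr_minus_divide[of "rj j" "1 - al"] by simp
    moreover have "0 < rj j powr (1 - al)" using rj(1)[of j] by simp
    ultimately show "1 \<le> rj j powr (al - 1)" by simp
  qed (use p in simp)
  then show ?thesis using rj[of j] by (subst weight_one[OF rj(1)]) (auto intro!: ennreal_leI mult_right_mono simp: less_imp_le)
qed

lemma TT_finite: "AE z in lborel. TT z < top"
proof -
  have "(\<integral>\<^sup>+z. 1 * TT z \<partial>lborel) \<le> ennreal ((cK / (1 - be)) powr p * 1) * Np p HH"
    by (rule weighted_bounds(2)) (use weight_one_bound in auto)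
  also have "\<dots> < top" using HH_finite by (simp add: ennreal_mult_less_top)
  finally have "(\<integral>\<^sup>+z. TT z \<partial>lborel) \<noteq> \<infinity>" by simp
  then have "AE z in lborel. TT z \<noteq> \<infinity>" by (intro nn_integral_PInf_AE) auto
  then show ?thesis by (auto elim!: eventually_mono simp: less_top)
qed

lemma TT_pointwise:
  assumes "TT z < top"
  shows "summable (\<lambda>j. dj j z)" "ennreal ((\<Sum>j. dj j z) powr p) \<le> TT z" "(\<lambda>j. FF (Dv k) j z) \<longlonglongrightarrow> GG z"
    "\<bar>FF (Dv k) j z\<bar> \<le> \<bar>FF (Dv k) 0 z\<bar> + (\<Sum>j. dj j z)"
proof -
  have d: "0 \<le> dj j z" for j by (simp add: dj_def)
  show s: "summable (\<lambda>j. dj j z)" and "ennreal ((\<Sum>j. dj j z) powr p) \<le> TT z"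
    using power_series_le[of "\<lambda>j. dj j z" wj p, OF d wj(1) wj(2) p] assms unfolding TT_def by auto
  have s': "summable (\<lambda>j. FF (Dv k) (Suc j) z - FF (Dv k) j z)"
    by (rule summable_norm_cancel) (use s in \<open>simp add: dj_def abs_minus_commute\<close>)
  have tel: "FF (Dv k) 0 z + (\<Sum>i<j. FF (Dv k) (Suc i) z - FF (Dv k) i z) = FF (Dv k) j z" for j
    by (induction j) auto
  have "(\<lambda>j. FF (Dv k) 0 z + (\<Sum>i<j. FF (Dv k) (Suc i) z - FF (Dv k) i z)) \<longlonglongrightarrow> GG z"
    unfolding GG_def by (intro tendsto_intros summable_LIMSEQ s')
  then show "(\<lambda>j. FF (Dv k) j z) \<longlonglongrightarrow> GG z" unfolding tel .
  have "\<bar>\<Sum>i<j. FF (Dv k) (Suc i) z - FF (Dv k) i z\<bar> \<le> (\<Sum>i<j. dj i z)"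
  proof -
    have "dj i z = \<bar>FF (Dv k) (Suc i) z - FF (Dv k) i z\<bar>" for i by (simp add: dj_def abs_minus_commute)
    then show ?thesis by (simp only: sum_abs)
  qed
  also have "\<dots> \<le> (\<Sum>j. dj j z)" by (rule sum_le_suminf[OF s]) (auto simp: d)
  finally show "\<bar>FF (Dv k) j z\<bar> \<le> \<bar>FF (Dv k) 0 z\<bar> + (\<Sum>j. dj j z)" using tel[of j] by linarith
qed

lemma GG_pointwise:
  assumes "TT z < top" shows "\<bar>GG z\<bar> \<le> \<bar>FF (Dv k) 0 z\<bar> + (\<Sum>j. dj j z)"
  by (rule LIMSEQ_le_const2[OF tendsto_rabs[OF TT_pointwise(3)[OF assms]]]) (use TT_pointwise(4)[OF assms] in auto)

text \<open>Stated for any \<open>g\<close> under the pointwise bound, since it is applied to the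
  limit \<open>GG\<close> as well as to the majorant of all averages.\<close>

lemma GG_weighted:
  fixes \<omega> :: "(real^'n) \<times> real \<Rightarrow> ennreal"
  assumes [measurable]: "\<omega> \<in> borel_fun" and Y: "0 \<le> Y"
    and w: "\<And>j w. (\<integral>\<^sup>+z. \<omega> z * indicator (pbox (rj j) z) w \<partial>lborel) \<le> ennreal (Y * (rj j powr (al - 1)) powr p * rj j ^ (CARD('n) + 2))"
    and g: "\<And>z. TT z < top \<Longrightarrow> \<bar>g z\<bar> \<le> \<bar>FF (Dv k) 0 z\<bar> + (\<Sum>j. dj j z)"
  shows "(\<integral>\<^sup>+z. \<omega> z * ennreal (\<bar>g z\<bar> powr p) \<partial>lborel) \<le> ennreal ((2 * cK / (1 - be)) powr p * Y) * (Np p (Dv k) + Np p HH)"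
proof -
  have c: "cK powr p \<le> (cK / (1 - be)) powr p"
    using cK be p by (intro powr_mono2) (auto simp: field_simps)
  have "(\<integral>\<^sup>+z. \<omega> z * ennreal (\<bar>g z\<bar> powr p) \<partial>lborel)
    \<le> ennreal (2 powr p) * ((\<integral>\<^sup>+z. \<omega> z * ennreal (\<bar>FF (Dv k) 0 z\<bar> powr p) \<partial>lborel) + (\<integral>\<^sup>+z. \<omega> z * TT z \<partial>lborel))"
  proof (rule nn_integral_power_sum_le)
    have "\<exists>s\<ge>0. \<bar>g z\<bar> \<le> \<bar>FF (Dv k) 0 z\<bar> + s \<and> ennreal (s powr p) \<le> TT z" if "TT z < top" for z
      using g[OF that] TT_pointwise[OF that] by (intro exI[of _ "\<Sum>j. dj j z"]) (auto intro!: suminf_nonneg simp: dj_def)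
    then show "AE z in lborel. TT z < top \<longrightarrow> (\<exists>s\<ge>0. \<bar>g z\<bar> \<le> \<bar>FF (Dv k) 0 z\<bar> + s \<and> ennreal (s powr p) \<le> TT z)" by simp
  qed (use p TT_finite in auto)
  also have "\<dots> \<le> ennreal (2 powr p) * (ennreal ((cK / (1 - be)) powr p * Y) * Np p (Dv k) + ennreal ((cK / (1 - be)) powr p * Y) * Np p HH)"
  proof (intro mult_left_mono add_mono)
    show "(\<integral>\<^sup>+z. \<omega> z * ennreal (\<bar>FF (Dv k) 0 z\<bar> powr p) \<partial>lborel) \<le> ennreal ((cK / (1 - be)) powr p * Y) * Np p (Dv k)"
      by (rule order_trans[OF weighted_bounds(1)[OF assms(1-3)]])
        (use c Y in \<open>auto intro!: mult_right_mono ennreal_leI\<close>)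
  qed (use weighted_bounds(2)[OF assms(1-3)] in auto)
  also have "\<dots> = ennreal ((2 * cK / (1 - be)) powr p * Y) * (Np p (Dv k) + Np p HH)"
    using Y cK be by (simp add: distrib_left[symmetric] mult.assoc[symmetric] ennreal_mult[symmetric] powr_mult[symmetric])
  finally show ?thesis .
qed

text \<open>Two limits of the same integrals: the averages converge pointwise to \<open>GG\<close>
  under an L^p majorant, while by duality the mollified test functions converge boundedly to a
  multiple of \<psi>. Hence \<open>GG\<close> may replace the weak gradient in every weak
  identity.\<close>

lemma GG_integral:
  assumes t: "test_fun UNIV \<psi>"
  shows "(\<integral>z. GG z * \<psi> z \<partial>lborel) = (\<integral>z. Dv k z * \<psi> z \<partial>lborel)"
proof -
  obtain M where M: "\<And>z. \<bar>\<psi> z\<bar> \<le> M" using test_fun_bounded[OF t] by blast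
  obtain K where K: "compact K" "\<And>z. z \<notin> K \<Longrightarrow> \<psi> z = 0" and sm: "smooth \<psi>" using t unfolding test_fun_iff by blast
  obtain R where R: "\<And>z. z \<in> K \<Longrightarrow> norm z \<le> R" using compact_imp_bounded[OF K(1)] unfolding bounded_iff by blast
  have KR: "norm z \<le> R" if "\<psi> z \<noteq> 0" for z using that K(2) R by blast
  have [measurable]: "\<psi> \<in> borel_fun" "Dv k \<in> borel_fun" using t SobD[OF S] by (auto intro: test_fun_borel)
  have bm: "0 < bump_mass TYPE('n)" by (rule bump_mass_pos)
  define SS where "SS z = \<bar>FF (Dv k) 0 z\<bar> + (\<Sum>j. dj j z)" for z
  have [measurable]: "SS \<in> borel_fun" unfolding SS_def[abs_def] by measurable
  have SS0: "0 \<le> SS z" if "TT z < top" for z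
    unfolding SS_def using TT_pointwise(1)[OF that] by (intro add_nonneg_nonneg suminf_nonneg) (auto simp: dj_def)
  have "(\<integral>\<^sup>+z. 1 * ennreal (\<bar>SS z\<bar> powr p) \<partial>lborel) \<le> ennreal ((2 * cK / (1 - be)) powr p * 1) * (Np p (Dv k) + Np p HH)"
    by (rule GG_weighted) (use weight_one_bound SS0 in \<open>auto simp: SS_def\<close>)
  also have "\<dots> < top" using HH_finite SobD(7)[OF S] by (simp add: ennreal_mult_less_top ennreal_add_less_top)
  finally have SSf: "Np p SS < top" by (simp add: Np_def)
  have "(\<lambda>j. \<integral>z. FF (Dv k) j z * \<psi> z \<partial>lborel) \<longlonglongrightarrow> (\<integral>z. GG z * \<psi> z \<partial>lborel)"
  proof (rule integral_dominated_convergence)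
    show "integrable lborel (\<lambda>z. \<bar>SS z * \<psi> z\<bar>)"
      using Np_test_integrable[OF _ p SSf t] by auto
    show "AE z in lborel. (\<lambda>j. FF (Dv k) j z * \<psi> z) \<longlonglongrightarrow> GG z * \<psi> z"
      using TT_finite by eventually_elim (intro tendsto_intros TT_pointwise(3))
    show "AE z in lborel. norm (FF (Dv k) j z * \<psi> z) \<le> \<bar>SS z * \<psi> z\<bar>" for j
      using TT_finite
    proof eventually_elim
      case (elim z)
      then show ?case using TT_pointwise(4)[OF elim, of j] SS0[OF elim] by (simp add: abs_mult SS_def mult_right_mono)
    qed
  qed simp_all
  moreover have "(\<integral>z. FF (Dv k) j z * \<psi> z \<partial>lborel) = (\<integral>w. Dv k w * (moll (rj j) \<psi> w / bump_mass TYPE('n)) \<partial>lborel)" for j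
  proof -
    have "(\<integral>z. Fn (rj j) z {} False (Dv k) * \<psi> z \<partial>lborel) = (\<integral>w. Dv k w * moll (rj j) \<psi> w \<partial>lborel)"
      by (rule Fn_moll[OF rj(1) rj(2) _ SobD(7)[OF S] p smooth_continuous[OF sm] KR M]) auto
    then show ?thesis unfolding FF_def by simp
  qed
  moreover have "(\<lambda>j. \<integral>w. Dv k w * (moll (rj j) \<psi> w / bump_mass TYPE('n)) \<partial>lborel) \<longlonglongrightarrow> (\<integral>w. Dv k w * \<psi> w \<partial>lborel)"
  proof (rule integral_dominated_convergence)
    define A where "A = cball (0 :: (real^'n) \<times> real) (R + real CARD('n) + 1)"
    have [measurable]: "A \<in> sets borel" by (simp add: A_def)
    have "integrable lborel (\<lambda>w. Dv k w * (M * indicator A w))"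
      by (rule Np_local_integrable[OF _ _ p SobD(7)[OF S], where K = A and M = "\<bar>M\<bar>"]) (auto simp: A_def indicator_def)
    then show "integrable lborel (\<lambda>w. \<bar>Dv k w * (M * indicator A w)\<bar>)" by simp
    have rl: "rj \<longlonglongrightarrow> 0" unfolding rj_def[abs_def] by (intro LIMSEQ_realpow_zero) auto
    have "(\<lambda>j. moll (rj j) \<psi> w / bump_mass TYPE('n)) \<longlonglongrightarrow> bump_mass TYPE('n) * \<psi> w / bump_mass TYPE('n)" for w
      using bm by (intro tendsto_divide tendsto_const moll_tendsto[OF M smooth_continuous[OF sm] rl]) auto
    then show "AE w in lborel. (\<lambda>j. Dv k w * (moll (rj j) \<psi> w / bump_mass TYPE('n))) \<longlonglongrightarrow> Dv k w * \<psi> w"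
      using bm by (intro AE_I2 tendsto_mult tendsto_const) simp
    show "AE w in lborel. norm (Dv k w * (moll (rj j) \<psi> w / bump_mass TYPE('n))) \<le> \<bar>Dv k w * (M * indicator A w)\<bar>" for j
    proof (rule AE_I2)
      fix w
      have M0: "0 \<le> M" using M[of w] by linarith
      show "norm (Dv k w * (moll (rj j) \<psi> w / bump_mass TYPE('n))) \<le> \<bar>Dv k w * (M * indicator A w)\<bar>"
      proof (cases "w \<in> A")
        case True
        have le: "\<bar>moll (rj j) \<psi> w / bump_mass TYPE('n)\<bar> \<le> M"
          using moll_bound[where \<psi> = \<psi> and r = "rj j" and w = w, OF M] bm by (simp add: field_simps)
        show ?thesis using mult_left_mono[OF le, of "\<bar>Dv k w\<bar>"] True M0 by (simp add: abs_mult)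
      next
        case False
        then have "moll (rj j) \<psi> w = 0" by (intro moll_zero[OF rj(1) rj(2) KR]) (auto simp: A_def)
        then show ?thesis by simp
      qed
    qed
    show "(\<lambda>w. Dv k w * (moll (rj j) \<psi> w / bump_mass TYPE('n))) \<in> borel_measurable lborel" for j
    proof -
      have "(\<lambda>(w, y). psc (rj j) w y) \<in> borel_measurable (borel \<Otimes>\<^sub>M borel)"
        unfolding borel_prod psc_def case_prod_unfold by (intro borel_measurable_continuous_onI continuous_intros)
      then have [measurable]: "(\<lambda>(w, y). bump_prod y * \<psi> (psc (rj j) w y)) \<in> borel_measurable (borel \<Otimes>\<^sub>M borel)" by measurable
      have "moll (rj j) \<psi> \<in> borel_measurable lborel"
        unfolding moll_def[abs_def] by (rule lborel.borel_measurable_lebesgue_integral) measurable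
      then show ?thesis by measurable
    qed
  qed simp
  ultimately show ?thesis using LIMSEQ_unique by fastforce
qed

end

end

text \<open>\<open>G\<close> is the limit of dyadic averages of \<open>Dv\<close>.  Each step from scale \<open>r\<close> to \<open>r / 2\<close> costs \<open>r\<close> times an
  average of \<open>\<bar>v\<^sub>t\<bar> + \<bar>D\<^sup>2v\<bar>\<close>, which is summable against \<open>\<mu>\<close> when \<open>q > n + 2\<close>; no Sobolev embedding is needed.\<close>

theorem improved_gradient:
  fixes p q :: real
  assumes p: "1 \<le> p" and pq: "p \<le> q" and q: "hdim TYPE('n::finite) < q"
  shows "\<exists>C>0. \<forall>v vt Dv D2v. Sob p (v :: (real^'n) \<times> real \<Rightarrow> real) vt Dv D2v \<longrightarrow>
    (\<exists>G. Sob p v vt G D2v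
      \<and> (\<forall>\<mu> X k. \<mu> \<in> borel_fun \<longrightarrow> 0 \<le> X \<longrightarrow> Np_le q \<mu> X \<longrightarrow>
          Np p (\<lambda>z. \<mu> z * G k z) \<le> ennreal ((C * X) powr p) * (Np p (Dv k) + Np p (\<lambda>w. \<bar>vt w\<bar> + (\<Sum>l\<in>UNIV. \<bar>D2v k l w\<bar>))))
      \<and> (\<forall>k. Np p (G k) \<le> ennreal (C powr p) * (Np p (Dv k) + Np p (\<lambda>w. \<bar>vt w\<bar> + (\<Sum>l\<in>UNIV. \<bar>D2v k l w\<bar>)))))"
proof -
  note A = p pq q
  define C where "C = 2 * cK TYPE('n) / (1 - be TYPE('n) q)"
  have C: "0 < C" using cK[OF A] be[OF A] by (simp add: C_def)
  have "\<exists>G. Sob p v vt G D2v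
      \<and> (\<forall>\<mu> X k. \<mu> \<in> borel_fun \<longrightarrow> 0 \<le> X \<longrightarrow> Np_le q \<mu> X \<longrightarrow>
          Np p (\<lambda>z. \<mu> z * G k z) \<le> ennreal ((C * X) powr p) * (Np p (Dv k) + Np p (\<lambda>w. \<bar>vt w\<bar> + (\<Sum>l\<in>UNIV. \<bar>D2v k l w\<bar>))))
      \<and> (\<forall>k. Np p (G k) \<le> ennreal (C powr p) * (Np p (Dv k) + Np p (\<lambda>w. \<bar>vt w\<bar> + (\<Sum>l\<in>UNIV. \<bar>D2v k l w\<bar>))))"
    if S: "Sob p (v :: 'n pt \<Rightarrow> real) vt Dv D2v" for v vt Dv D2v
  proof -
    define G where "G k = GG Dv k" for k
    have H: "HH vt D2v k = (\<lambda>w. \<bar>vt w\<bar> + (\<Sum>l\<in>UNIV. \<bar>D2v k l w\<bar>))" for k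
      by (rule ext) (simp add: HH_def[OF A S])
    have [measurable]: "G k \<in> borel_fun" for k
      unfolding G_def by (rule GG_borel[OF A S])
    have 1: "Np p (G k) \<le> ennreal (C powr p) * (Np p (Dv k) + Np p (HH vt D2v k))" for k
    proof -
      have "(\<integral>\<^sup>+z. 1 * ennreal (\<bar>G k z\<bar> powr p) \<partial>lborel) \<le> ennreal (C powr p * 1) * (Np p (Dv k) + Np p (HH vt D2v k))"
        unfolding C_def G_def
        by (rule GG_weighted[OF A S borel_measurable_const _ weight_one_bound[OF A S] GG_pointwise[OF A S]]) auto
      then show ?thesis by (simp add: Np_def)
    qed
    have 2: "Np p (\<lambda>z. \<mu> z * G k z) \<le> ennreal ((C * X) powr p) * (Np p (Dv k) + Np p (HH vt D2v k))"
      if [measurable]: "\<mu> \<in> borel_fun" and X: "0 \<le> X" "Np_le q \<mu> X" for \<mu> X k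
    proof -
      have "al TYPE('n) q - 1 = - hdim TYPE('n) / q" by (simp add: al_def[OF A])
      then have "(\<integral>\<^sup>+z. ennreal (\<bar>\<mu> z\<bar> powr p) * indicator (pbox (rj j) z) w \<partial>lborel)
          \<le> ennreal (X powr p * (rj j powr (al TYPE('n) q - 1)) powr p * rj j ^ (CARD('n) + 2))" for j and w :: "'n pt"
        using weight_drift[OF rj(1)[OF A, of j] _ X p pq, of w] by simp
      then have "(\<integral>\<^sup>+z. ennreal (\<bar>\<mu> z\<bar> powr p) * ennreal (\<bar>G k z\<bar> powr p) \<partial>lborel)
          \<le> ennreal (C powr p * X powr p) * (Np p (Dv k) + Np p (HH vt D2v k))"
        unfolding C_def G_def by (intro GG_weighted[OF A S] GG_pointwise[OF A S]) auto
      then show ?thesis using C X by (simp add: Np_def abs_mult powr_mult ennreal_mult)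
    qed
    have fin: "Np p (G k) < top" for k
      by (rule le_less_trans[OF 1]) (use HH_finite[OF A S] SobD(7)[OF S] in \<open>auto simp: ennreal_mult_less_top\<close>)
    have "wd (sp k) v (G k)" for k
      using SobD(10)[OF S, of k] GG_integral[OF A S] unfolding wd_def G_def by simp
    moreover have "wd (sp l) (G k) (D2v k l)" for k l
      using SobD(11)[OF S, of l k] GG_integral[OF A S test_fun_pd[OF _ sp_Basis]] unfolding wd_def G_def by simp
    ultimately have "Sob p v vt G D2v" using SobD[OF S] fin unfolding Sob_def by auto
    then show ?thesis using 1 2 unfolding H by blast
  qed
  then show ?thesis using C by blast
qed

section \<open>Strong solutions\<close>

definition plateau :: "real \<Rightarrow> real \<Rightarrow> real \<Rightarrow> real" where
  "plateau c d x = ramp ((x + d) / (d - c)) * ramp ((d - x) / (d - c))"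

lemma smooth_plateau: "smooth (plateau c d)"
proof -
  have "smooth (\<lambda>x::real. ramp (d / (d - c) + 1 / (d - c) * x) * ramp (d / (d - c) + - 1 / (d - c) * x))"
    by (intro smooth_mult smooth_compose[OF smooth_ramp] smooth_affine)
  then show ?thesis by (simp add: plateau_def[abs_def] add_divide_distrib diff_divide_distrib add.commute)
qed

lemma plateau_bounds: "0 \<le> plateau c d x" "plateau c d x \<le> 1"
  unfolding plateau_def using ramp_bounds by (auto intro!: mult_le_one)

lemma plateau_one: "c < d \<Longrightarrow> \<bar>x\<bar> \<le> c \<Longrightarrow> plateau c d x = 1"
  unfolding plateau_def by (subst ramp_one, (auto simp: field_simps)[1])+ simp

lemma plateau_zero: "c < d \<Longrightarrow> d \<le> \<bar>x\<bar> \<Longrightarrow> plateau c d x = 0"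
  unfolding plateau_def using ramp_zero[of "(x + d) / (d - c)"] ramp_zero[of "(d - x) / (d - c)"]
  by (auto simp: divide_le_0_iff abs_le_iff abs_real_def split: if_splits)

lemma smooth_shift: fixes g :: "real \<Rightarrow> real" assumes "smooth g" shows "smooth (\<lambda>x. g (x - c))"
  using smooth_compose[OF assms smooth_affine[of "- c" 1]] by simp

text \<open>Chosen so that boxes of half-side up to \<open>2 * rad\<close> lie in the ball of radius
  1/2, by the l1 bound on the norm.\<close>

definition rad :: "'n::finite itself \<Rightarrow> real" where "rad _ = 1 / (4 * real CARD('n))"

lemma rad_pos: "0 < rad TYPE('n::finite)" by (simp add: rad_def)

text \<open>The equation will hold on \<open>Qc\<close>; \<open>Qm\<close> leaves room for the
  cutoff, which is 1 on \<open>Qc\<close> and vanishes outside a compact part of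
  \<open>Qm\<close>.\<close>

definition Qc :: "((real^'n) \<times> real) set" where
  "Qc = box (vec (- rad TYPE('n))) (vec (rad TYPE('n))) \<times> {1/4<..<3/4}"
definition Qm :: "((real^'n) \<times> real) set" where
  "Qm = box (vec (- 2 * rad TYPE('n))) (vec (2 * rad TYPE('n))) \<times> {1/8<..<7/8}"

definition cutoff :: "(real^'n) \<times> real \<Rightarrow> real" where
  "cutoff = ptest (\<lambda>_. plateau (rad TYPE('n)) (3 / 2 * rad TYPE('n))) (\<lambda>t. plateau (1/4) (5/16) (t - 1/2))"

lemma open_Qc: "open Qc" unfolding Qc_def by (intro open_Times open_box) simp
lemma open_Qm: "open Qm" unfolding Qm_def by (intro open_Times open_box) simp

lemma Qc_iff: "z \<in> (Qc :: ((real^'n) \<times> real) set) \<longleftrightarrow> (\<forall>l. \<bar>fst z $ l\<bar> < rad TYPE('n)) \<and> \<bar>snd z - 1/2\<bar> < 1/4"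
proof -
  have "z \<in> Qc \<longleftrightarrow> (\<forall>l. - rad TYPE('n) < fst z $ l \<and> fst z $ l < rad TYPE('n)) \<and> 1/4 < snd z \<and> snd z < 3/4"
    by (cases z) (simp add: Qc_def mem_box_cart)
  moreover have "1/4 < snd z \<and> snd z < 3/4 \<longleftrightarrow> \<bar>snd z - 1/2\<bar> < 1/4" by arith
  moreover have "- c < x \<and> x < c \<longleftrightarrow> \<bar>x\<bar> < c" for x c :: real by arith
  ultimately show ?thesis by simp
qed

lemma Qm_iff: "z \<in> (Qm :: ((real^'n) \<times> real) set) \<longleftrightarrow> (\<forall>l. \<bar>fst z $ l\<bar> < 2 * rad TYPE('n)) \<and> \<bar>snd z - 1/2\<bar> < 3/8"
proof -
  have "z \<in> Qm \<longleftrightarrow> (\<forall>l. - (2 * rad TYPE('n)) < fst z $ l \<and> fst z $ l < 2 * rad TYPE('n)) \<and> 1/8 < snd z \<and> snd z < 7/8"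
    by (cases z) (simp add: Qm_def mem_box_cart)
  moreover have "1/8 < snd z \<and> snd z < 7/8 \<longleftrightarrow> \<bar>snd z - 1/2\<bar> < 3/8" by arith
  moreover have "- c < x \<and> x < c \<longleftrightarrow> \<bar>x\<bar> < c" for x c :: real by arith
  ultimately show ?thesis by simp
qed

lemma cutoff_test_fun: "test_fun Qm (cutoff :: (real^'n) \<times> real \<Rightarrow> real)"
  unfolding cutoff_def
proof (rule test_fun_ptest[of _ _ "vec (- (3 / 2 * rad TYPE('n)))" "vec (3 / 2 * rad TYPE('n))" "3/16" "13/16"])
  show "plateau (rad TYPE('n)) (3 / 2 * rad TYPE('n)) x = 0"
    if "x < vec (- (3 / 2 * rad TYPE('n))) $ l \<or> vec (3 / 2 * rad TYPE('n)) $ l < x" for x and l :: 'n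
    using that rad_pos[where 'n='n] by (intro plateau_zero) auto
  show "plateau (1/4) (5/16) (t - 1/2) = 0" if "t < 3/16 \<or> 13/16 < t" for t :: real
    using that by (intro plateau_zero) auto
  show "cbox (vec (- (3 / 2 * rad TYPE('n)))) (vec (3 / 2 * rad TYPE('n))) \<times> {3/16..13/16} \<subseteq> (Qm :: 'n pt set)"
  proof
    fix z :: "'n pt" assume z: "z \<in> cbox (vec (- (3 / 2 * rad TYPE('n)))) (vec (3 / 2 * rad TYPE('n))) \<times> {3/16..13/16::real}"
    then have "- (3 / 2 * rad TYPE('n)) \<le> fst z $ l" "fst z $ l \<le> 3 / 2 * rad TYPE('n)" for l
      by (auto simp: mem_box_cart)
    then have "\<bar>fst z $ l\<bar> \<le> 3 / 2 * rad TYPE('n)" for l by (simp only: abs_le_iff minus_le_iff)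
    moreover have "3 / 2 * rad TYPE('n) < 2 * rad TYPE('n)" using rad_pos[where 'n='n] by simp
    ultimately have "\<bar>fst z $ l\<bar> < 2 * rad TYPE('n)" for l by (rule order_le_less_trans)
    moreover have "\<bar>snd z - 1/2\<bar> < 3/8" using z by (auto simp: abs_if)
    ultimately show "z \<in> Qm" by (simp add: Qm_iff)
  qed
qed (use smooth_plateau smooth_shift[OF smooth_plateau] in auto)

lemma cutoff_bounds: "0 \<le> cutoff z" "cutoff z \<le> 1"
  unfolding cutoff_def ptest_def using plateau_bounds
  by (auto intro!: mult_nonneg_nonneg prod_nonneg mult_le_one prod_le_1)

lemma cutoff_one: "z \<in> Qc \<Longrightarrow> cutoff z = 1"
  unfolding cutoff_def ptest_def Qc_iff using rad_pos
  by (subst prod.neutral) (auto intro!: plateau_one simp: less_imp_le)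

lemma pd_const_on_open:
  assumes "open U" "z \<in> U" "\<And>y. y \<in> U \<Longrightarrow> f y = c" shows "pd e f z = 0"
proof -
  have "(f has_derivative (\<lambda>_. 0)) (at z)"
    by (rule has_derivative_transform_within_open[of "\<lambda>_. c" _ _ _ U]) (use assms in auto)
  then show ?thesis by (simp add: pd_eq)
qed

lemma norm_Qm: "z \<in> (Qm :: ((real^'n) \<times> real) set) \<Longrightarrow> norm (fst z) < 1/2"
proof -
  assume z: "z \<in> (Qm :: 'n pt set)"
  have "norm (fst z) \<le> (\<Sum>l\<in>UNIV. \<bar>fst z $ l\<bar>)" by (rule norm_le_l1_cart)
  also have "\<dots> < (\<Sum>l\<in>(UNIV::'n set). 2 * rad TYPE('n))"
    using z by (intro sum_strict_mono) (auto simp: Qm_iff)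
  also have "\<dots> = 1/2" by (simp add: rad_def)
  finally show ?thesis .
qed

lemma Qc_subset_Qm: "Qc \<subseteq> (Qm :: ((real^'n) \<times> real) set)"
proof
  fix z :: "'n pt" assume z: "z \<in> Qc"
  then have "\<bar>fst z $ l\<bar> < 2 * rad TYPE('n)" for l
    using rad_pos[where 'n='n] by (auto simp: Qc_iff intro: order_less_trans)
  then show "z \<in> Qm" using z by (auto simp: Qm_iff Qc_iff)
qed

lemma Qm_subset: "Qm \<subseteq> cylinder (ball (0 :: real^'n) 1) 1"
proof
  fix z :: "(real^'n) \<times> real" assume z: "z \<in> Qm"
  then have "norm (fst z) < 1" "0 < snd z" "snd z \<le> 1"
    using norm_Qm[OF z] by (auto simp: Qm_iff abs_if split: if_splits)
  then show "z \<in> cylinder (ball 0 1) 1" by (cases z) (simp add: cylinder_def)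
qed

lemma Qm_inside: "compactly_inside Qm (ball (0 :: real^'n) 1) 1"
  unfolding compactly_inside_def
proof (intro conjI)
  show "Qm \<in> sets (lebesgue :: ((real^'n) \<times> real) measure)" by (intro sets_completionI_sets) (simp add: open_Qm borel_open)
  show "Qm \<subseteq> cylinder (ball (0 :: real^'n) 1) 1" by (rule Qm_subset)
  have "ereal (1/4) \<le> ereal (parabolic_dist z w)"
    if z: "z \<in> Qm" and w: "w \<in> parabolic_boundary (ball (0 :: real^'n) 1) 1" for z w :: "'n pt"
  proof -
    have "(1/4)\<^sup>2 \<le> (norm (fst z - fst w))\<^sup>2 + \<bar>snd z - snd w\<bar>"
    proof (cases "snd w = 0")
      case True
      then have "1/8 \<le> \<bar>snd z - snd w\<bar>" using z by (auto simp: Qm_iff abs_if split: if_splits)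
      moreover have "(1/4 :: real)\<^sup>2 \<le> 1/8" by (simp add: power2_eq_square)
      ultimately show ?thesis using zero_le_power2[of "norm (fst z - fst w)"] by linarith
    next
      case False
      then have "norm (fst w) = 1" using w by (auto simp: parabolic_boundary_def)
      then have "1/2 \<le> norm (fst z - fst w)"
        using norm_Qm[OF z] norm_triangle_ineq2[of "fst w" "fst z"] by (simp add: norm_minus_commute)
      then have "(1/2)\<^sup>2 \<le> (norm (fst z - fst w))\<^sup>2" by (intro power_mono) auto
      moreover have "(1/4 :: real)\<^sup>2 \<le> (1/2)\<^sup>2" by (simp add: power2_eq_square)
      ultimately show ?thesis using abs_ge_zero[of "snd z - snd w"] by linarith
    qed
    then have "1/4 \<le> parabolic_dist z w"
      unfolding parabolic_dist_def by (intro real_le_rsqrt) simp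
    then show ?thesis by simp
  qed
  then have "ereal (1/4) \<le> parabolic_setdist Qm (parabolic_boundary (ball (0 :: real^'n) 1) 1)"
    unfolding parabolic_setdist_def by (intro INF_greatest)
  then show "0 < parabolic_setdist Qm (parabolic_boundary (ball (0 :: real^'n) 1) 1)"
    by (rule order_less_le_trans[rotated]) simp
qed

lemma Np_mult_le:
  assumes "\<And>z. \<bar>b z\<bar> \<le> Z" "f \<in> borel_fun" "0 \<le> p" "0 \<le> W" "Np_le p f W"
  shows "Np_le p (\<lambda>z. b z * f z) (Z * W)"
proof -
  have Z: "0 \<le> Z" using assms(1)[of undefined] by linarith
  have "\<bar>b z * f z\<bar> \<le> \<bar>Z * f z\<bar>" for z
    using assms(1)[of z] by (simp add: abs_mult mult_right_mono)
  then have "Np p (\<lambda>z. b z * f z) \<le> Np p (\<lambda>z. Z * f z)" by (intro Np_mono assms)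
  also have "\<dots> = ennreal (Z powr p) * Np p f" using assms(2) Z by (simp add: Np_cmult)
  also have "\<dots> \<le> ennreal (Z powr p) * ennreal (W powr p)" by (intro mult_left_mono assms) simp
  also have "\<dots> = ennreal ((Z * W) powr p)" using Z assms(4) by (simp add: powr_mult ennreal_mult)
  finally show ?thesis .
qed

text \<open>The factor 2 from two equal terms is absorbed by 2 \<le> 2 powr p, which together with
  the constant of \<open>Np_add\<close> gives 4 after taking roots.\<close>

lemma Np_add_le:
  assumes "f \<in> borel_fun" "g \<in> borel_fun" "1 \<le> p" "0 \<le> W"
    "Np_le p f W" "Np_le p g W"
  shows "Np_le p (\<lambda>z. f z + g z) (4 * W)"
proof -
  have "Np p (\<lambda>z. f z + g z) \<le> ennreal (2 powr p) * (Np p f + Np p g)"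
    using assms by (intro Np_add) auto
  also have "\<dots> \<le> ennreal (2 powr p) * (ennreal (W powr p) + ennreal (W powr p))"
    by (intro mult_left_mono add_mono assms) simp
  also have "\<dots> = ennreal (2 powr p * 2 * W powr p)"
    by (simp add: ennreal_mult[symmetric] ennreal_plus[symmetric] del: ennreal_plus)
  also have "\<dots> \<le> ennreal (2 powr p * 2 powr p * W powr p)"
    using powr_mono[of 1 p 2] assms by (intro ennreal_leI mult_right_mono mult_left_mono) auto
  also have "2 powr p * 2 powr p * W powr p = (4 * W) powr p"
    using assms(4) by (simp add: powr_mult[symmetric])
  finally show ?thesis .
qed

lemma Lp_norm_nonneg: "0 \<le> Lp_norm p U f" by (simp add: Lp_norm_def)

lemma Lp_norm_component:
  assumes "h \<in> {f, ft} \<union> range (\<lambda>k z. Df z $ k) \<union> range (\<lambda>(k, l) z. D2f z $ k $ l)"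
  shows "Lp_norm p U h \<le> W21_norm p U f ft Df (D2f :: (real^'n) \<times> real \<Rightarrow> real^'n^'n)"
proof -
  have 1: "Lp_norm p U (\<lambda>z. Df z $ k) \<le> (\<Sum>k\<in>UNIV. Lp_norm p U (\<lambda>z. Df z $ k))" for k
    by (rule member_le_sum) (auto simp: Lp_norm_nonneg)
  have 2: "Lp_norm p U (\<lambda>z. D2f z $ k $ l) \<le> (\<Sum>k\<in>UNIV. \<Sum>l\<in>UNIV. Lp_norm p U (\<lambda>z. D2f z $ k $ l))" for k l
    by (rule order_trans[OF member_le_sum[of l] member_le_sum[of k]]) (auto simp: Lp_norm_nonneg sum_nonneg)
  have pos: "0 \<le> (\<Sum>k\<in>UNIV. Lp_norm p U (\<lambda>z. Df z $ k))" "0 \<le> (\<Sum>k\<in>UNIV. \<Sum>l\<in>UNIV. Lp_norm p U (\<lambda>z. D2f z $ k $ l))"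
    by (auto intro!: sum_nonneg simp: Lp_norm_nonneg)
  note 0 = Lp_norm_nonneg[of p U f] Lp_norm_nonneg[of p U ft]
  consider "h = f" | "h = ft" | k where "h = (\<lambda>z. Df z $ k)" | k l where "h = (\<lambda>z. D2f z $ k $ l)"
    using assms by auto
  then show ?thesis
  proof cases
    case (3 k)
    show ?thesis unfolding W21_norm_def 3 using 0 1[of k] pos by linarith
  next
    case (4 k l)
    show ?thesis unfolding W21_norm_def 4 using 0 2[of k l] pos by linarith
  qed (use 0 pos in \<open>simp_all add: W21_norm_def\<close>)
qed

lemma wd_cong_AE:
  assumes "wd e f g" "AE z in lborel. f' z = f z" "f \<in> borel_fun" "f' \<in> borel_fun" "e \<in> Basis"
  shows "wd e f' g"
  unfolding wd_def
proof (intro allI impI)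
  fix \<psi> :: "'a \<Rightarrow> real" assume t: "test_fun UNIV \<psi>"
  have [measurable]: "f \<in> borel_fun" "f' \<in> borel_fun" "pd e \<psi> \<in> borel_fun"
    using assms test_fun_borel[OF test_fun_pd[OF t assms(5)]] by auto
  have "(\<integral>z. f' z * pd e \<psi> z \<partial>lborel) = (\<integral>z. f z * pd e \<psi> z \<partial>lborel)"
    by (rule integral_cong_AE) (use assms(2) in \<open>auto elim!: eventually_mono\<close>)
  then show "(\<integral>z. f' z * pd e \<psi> z \<partial>lborel) = - (\<integral>z. g z * \<psi> z \<partial>lborel)"
    using assms(1) t unfolding wd_def by simp
qed

lemma Lp_norm_le_Np:
  fixes g :: "'a::euclidean_space \<Rightarrow> real"
  assumes [measurable]: "g \<in> borel_fun" and U: "U \<in> sets lebesgue" and p: "0 < p" and Y: "0 \<le> Y" "Np_le p g Y"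
  shows "Lp_norm p U g \<le> Y"
proof -
  have i: "in_Lp p U g" by (rule in_Lp_of_Np) (use assms in \<open>auto intro: le_less_trans[of "Np p g" "ennreal (Y powr p)"]\<close>)
  obtain g' where g': "AE z in lborel. g' z = indicator U z * g z" "Np p g' = ennreal (Lp_norm p U g powr p)"
    using in_Lp_version[OF i U p] by blast
  have "Np p g' \<le> Np p g"
    using g'(1) p by (intro Np_mono_AE) (auto elim!: eventually_mono simp: indicator_def)
  then have "ennreal (Lp_norm p U g powr p) \<le> ennreal (Y powr p)"
    unfolding g'(2) using Y(2) by (rule order_trans)
  then have "Lp_norm p U g powr p \<le> Y powr p" by simp
  then show ?thesis using p Y Lp_norm_nonneg[of p U g] by (metis powr_less_mono2 not_le)
qed

lemma test_fun_family_bound: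
  assumes "finite F" "\<And>f. f \<in> F \<Longrightarrow> test_fun U f" shows "\<exists>Z\<ge>1. \<forall>f\<in>F. \<forall>z. \<bar>f z\<bar> \<le> Z"
  using assms
proof (induction F)
  case (insert f F)
  then obtain Z M where "1 \<le> Z" "\<forall>f\<in>F. \<forall>z. \<bar>f z\<bar> \<le> Z" "\<forall>z. \<bar>f z\<bar> \<le> M"
    using test_fun_bounded[of U f] by auto
  then show ?case by (intro exI[of _ "max Z M"]) (auto simp: max.coboundedI1 max.coboundedI2)
qed (auto intro: exI[of _ 1])

section \<open>Cutting off the solutions supplied by the maximum principle\<close>

definition Lp_source :: "real \<Rightarrow> ((real^'n) \<times> real \<Rightarrow> real) \<Rightarrow> real \<Rightarrow> bool" where
  "Lp_source p g Y \<longleftrightarrow> g \<in> borel_fun \<and> (\<forall>z. 0 \<le> g z) \<and> 0 \<le> Y \<and> Np_le p g Y"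

text \<open>The source has a sign, so the solution is nonpositive and can be added to a barrier
  without spoiling upper bounds. One number \<open>W\<close> bounds its depth and all norms.\<close>

definition pucci_sol where
  "pucci_sol lam Lam p W g (v :: (real^'n) \<times> real \<Rightarrow> real) vt Dv D2v \<longleftrightarrow> Sob p v vt Dv D2v \<and> continuous_on UNIV v
    \<and> (\<forall>z. - W \<le> v z \<and> v z \<le> 0)
    \<and> (AE z in lborel. z \<in> Qc \<longrightarrow> vt z + pucci_plus lam Lam (\<chi> k l. D2v k l z) = - g z)
    \<and> Np_le p v W \<and> Np_le p vt W
    \<and> (\<forall>k. Np_le p (Dv k) W) \<and> (\<forall>k l. Np_le p (D2v k l) W)"

lemma pucci_solD:
  assumes "pucci_sol lam Lam p W g v vt Dv D2v"
  shows "Sob p v vt Dv D2v" "continuous_on UNIV v" "\<forall>z. - W \<le> v z \<and> v z \<le> 0"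
    "AE z in lborel. z \<in> Qc \<longrightarrow> vt z + pucci_plus lam Lam (\<chi> k l. D2v k l z) = - g z"
    "Np_le p v W" "Np_le p vt W" "Np_le p (Dv k) W" "Np_le p (D2v k l) W"
  using assms unfolding pucci_sol_def by blast+

text \<open>The solution on the unit cylinder is multiplied by a cutoff. On \<open>Qc\<close>
  nothing changes, and elsewhere the product rule bounds all derivatives by the interior norms on
  \<open>Qm\<close>. The result is a function on the whole space, to which scaling and averaging
  apply.\<close>

theorem sol_operator:
  fixes p p1 lam Lam :: real
  assumes lam: "0 < lam" "lam \<le> Lam" and abp: "ABP_exponent TYPE('n::finite) lam Lam p1" and pp: "p1 < p"
  shows "\<exists>C>0. \<forall>(g :: (real^'n) \<times> real \<Rightarrow> real) Y. Lp_source p g Y \<longrightarrow> (\<exists>v vt Dv D2v. pucci_sol lam Lam p (C * Y) g v vt Dv D2v)"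
proof -
  let ?\<Omega> = "ball (0 :: real^'n) 1"
  let ?Q = "cylinder ?\<Omega> 1"
  let ?d = "parabolic_setdist Qm (parabolic_boundary ?\<Omega> 1)"
  have p1: "1 \<le> p" using abp pp by (auto simp: ABP_exponent_def)
  define sol where "sol C C' f \<longleftrightarrow> (\<exists>u ut Du D2u. continuous_on (closure ?Q) u \<and> W21_loc p ?\<Omega> 1 u ut Du D2u
      \<and> (AE z in lebesgue_on ?Q. ut z + pucci_plus lam Lam (D2u z) = f z)
      \<and> (\<forall>z\<in>parabolic_boundary ?\<Omega> 1. u z = 0)
      \<and> (\<forall>z\<in>?Q. - C * Lp_norm p ?Q (\<lambda>w. max (- f w) 0) \<le> u z \<and> u z \<le> C * Lp_norm p ?Q (\<lambda>w. max (f w) 0))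
      \<and> (\<forall>Q'. compactly_inside Q' ?\<Omega> 1 \<longrightarrow>
           W21_norm p Q' u ut Du D2u \<le> C' (parabolic_setdist Q' (parabolic_boundary ?\<Omega> 1)) * Lp_norm p ?Q f))" for C :: real and C' :: "ereal \<Rightarrow> real" and f
  have "\<exists>C C'. \<forall>f. in_Lp p ?Q f \<longrightarrow> sol C C' f"
    using abp pp unfolding ABP_exponent_def Let_def sol_def by blast
  then obtain C C' where abp': "\<forall>f. in_Lp p ?Q f \<longrightarrow> sol C C' f"
    by (elim exE)
  have tc: "test_fun Qm (cutoff :: 'n pt \<Rightarrow> real)" by (rule cutoff_test_fun)
  have tc1: "test_fun Qm (pd e (cutoff :: 'n pt \<Rightarrow> real))" if "e \<in> Basis" for e by (rule test_fun_pd[OF tc that])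
  have tc2: "test_fun Qm (pd e' (pd e (cutoff :: 'n pt \<Rightarrow> real)))" if "e \<in> Basis" "e' \<in> Basis" for e e'
    by (rule test_fun_pd[OF tc1[OF that(1)] that(2)])
  \<comment> \<open>The cutoff and its derivatives up to order two are the factors in the product
    rule.\<close>
  define F where "F = {cutoff :: 'n pt \<Rightarrow> real} \<union> (\<lambda>e. pd e cutoff) ` Basis \<union> (\<lambda>(e, e'). pd e' (pd e cutoff)) ` (Basis \<times> Basis)"
  obtain Z where Z: "1 \<le> Z" "\<And>f z. f \<in> F \<Longrightarrow> \<bar>f z\<bar> \<le> Z"
  proof -
    have "finite F" unfolding F_def by simp
    moreover have "test_fun Qm f" if "f \<in> F" for f
      using that unfolding F_def by (elim UnE imageE singletonE) (auto intro: tc tc1 tc2 simp del: split_paired_All)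
    ultimately have "\<exists>Z\<ge>1. \<forall>f\<in>F. \<forall>z. \<bar>f z\<bar> \<le> Z" by (rule test_fun_family_bound)
    then show ?thesis using that by blast
  qed
  have Zs: "\<bar>cutoff z\<bar> \<le> Z" "e \<in> Basis \<Longrightarrow> \<bar>pd e cutoff z\<bar> \<le> Z" "e \<in> Basis \<Longrightarrow> e' \<in> Basis \<Longrightarrow> \<bar>pd e' (pd e cutoff) z\<bar> \<le> Z"
    for e e' and z :: "'n pt"
  proof -
    have "cutoff \<in> F" unfolding F_def by simp
    then show "\<bar>cutoff z\<bar> \<le> Z" by (rule Z(2))
    show "\<bar>pd e cutoff z\<bar> \<le> Z" if "e \<in> Basis"
    proof -
      have "pd e cutoff \<in> F" unfolding F_def by (intro UnI1 UnI2 imageI that)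
      then show ?thesis by (rule Z(2))
    qed
    show "\<bar>pd e' (pd e cutoff) z\<bar> \<le> Z" if "e \<in> Basis" "e' \<in> Basis"
    proof -
      have "pd e' (pd e cutoff) \<in> F" unfolding F_def
        by (intro UnI2 image_eqI[of _ _ "(e, e')"]) (simp_all add: that)
      then show ?thesis by (rule Z(2))
    qed
  qed
  define A where "A = max (C' ?d) 0 + 1"
  \<comment> \<open>The first summand serves the maximum bound. In the second, \<open>A\<close> is
    the interior constant, \<open>Z\<close> bounds the derivatives of the cutoff, and 16 comes from
    two nested uses of \<open>Np_add_le\<close> for the second derivatives.\<close>
  define C0 where "C0 = max C 0 + 16 * Z * A"
  have A: "1 \<le> A" by (simp add: A_def)
  have C0: "0 < C0" "16 * Z * A \<le> C0" using Z A by (auto simp: C0_def add_nonneg_pos)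
  show ?thesis
  proof (intro exI[of _ C0] conjI allI impI; (elim conjE)?)
    show "0 < C0" by (rule C0)
    fix g :: "'n pt \<Rightarrow> real" and Y assume "Lp_source p g Y"
    then have g [measurable]: "g \<in> borel_fun" and g0: "\<forall>z. 0 \<le> g z" and Y: "0 \<le> Y" "Np_le p g Y"
      by (auto simp: Lp_source_def)
    have Qs: "?Q \<in> sets lebesgue" unfolding cylinder_def
      by (intro sets_completionI_sets) (simp add: borel_Times)
    have gLp: "in_Lp p ?Q g" "in_Lp p ?Q (\<lambda>z. - g z)"
      using le_less_trans[OF Y(2) ennreal_less_top] Qs by (auto intro!: in_Lp_of_Np simp: Np_def)
    have nY: "Lp_norm p ?Q g \<le> Y" by (rule Lp_norm_le_Np) (use Qs p1 Y in auto)
    have nY': "Lp_norm p ?Q (\<lambda>z. - g z) = Lp_norm p ?Q g" by (simp add: Lp_norm_def)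
    obtain u ut Du D2u where u: "continuous_on (closure ?Q) u" "W21_loc p ?\<Omega> 1 u ut Du D2u"
      "AE z in lebesgue_on ?Q. ut z + pucci_plus lam Lam (D2u z) = - g z"
      "\<And>z. z \<in> ?Q \<Longrightarrow> - C * Lp_norm p ?Q (\<lambda>w. max (- (- g w)) 0) \<le> u z \<and> u z \<le> C * Lp_norm p ?Q (\<lambda>w. max (- g w) 0)"
      "W21_norm p Qm u ut Du D2u \<le> C' ?d * Lp_norm p ?Q (\<lambda>z. - g z)"
      using mp[OF spec[OF abp'] gLp(2)] Qm_inside unfolding sol_def by blast
    have ub: "- (C0 * Y) \<le> u z" "u z \<le> 0" if "z \<in> ?Q" for z
    proof -
      have "max (- (- g w)) 0 = g w" "max (- g w) 0 = 0" for w using g0[rule_format, of w] by simp_all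
      then have "(\<lambda>w. max (- (- g w)) 0) = g" "(\<lambda>w. max (- g w) 0) = (\<lambda>w. 0)" by (simp_all only:)
      moreover have "Lp_norm p ?Q (\<lambda>w. 0) = 0" by (simp add: Lp_norm_def)
      ultimately have b: "- C * Lp_norm p ?Q g \<le> u z" "u z \<le> 0" using u(4)[OF that] by auto
      have "C \<le> C0" using Z A by (simp add: C0_def add_increasing2)
      then have "C * Lp_norm p ?Q g \<le> C0 * Lp_norm p ?Q g" by (rule mult_right_mono) (rule Lp_norm_nonneg)
      also have "\<dots> \<le> C0 * Y" using nY C0 by (intro mult_left_mono) auto
      finally have "C * Lp_norm p ?Q g \<le> C0 * Y" .
      then show "- (C0 * Y) \<le> u z" "u z \<le> 0" using b by auto
    qed
    have W: "W21 p Qm u ut Du D2u" using u(2) Qm_inside unfolding W21_loc_def by blast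
    have AY: "C' ?d * Lp_norm p ?Q (\<lambda>z. - g z) \<le> A * Y"
      unfolding nY' using nY A Lp_norm_nonneg[of p ?Q g] by (intro mult_mono) (auto simp: A_def)
    have AY0: "0 \<le> A * Y" using A Y by simp
    define vers where "vers h h' \<longleftrightarrow> h' \<in> borel_fun \<and> (AE z in lborel. z \<in> Qm \<longrightarrow> h' z = h z) \<and> Np_le p h' (A * Y)"
      for h h' :: "'n pt \<Rightarrow> real"
    have ver: "\<exists>h'. vers h h'"
      if h: "h \<in> {u, ut} \<union> range (\<lambda>k z. Du z $ k) \<union> range (\<lambda>(k, l) z. D2u z $ k $ l)" "in_Lp p Qm h" for h
    proof -
      have "Lp_norm p Qm h \<le> A * Y" using Lp_norm_component[OF h(1)] u(5) AY by (meson order_trans)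
      then have "Lp_norm p Qm h powr p \<le> (A * Y) powr p" using p1 Lp_norm_nonneg[of p Qm h] by (intro powr_mono2) auto
      moreover have "Qm \<in> sets (lebesgue :: 'n pt measure)"
        by (intro sets_completionI_sets) (simp add: open_Qm borel_open)
      then obtain h' where "h' \<in> borel_fun" "AE z in lborel. h' z = indicator Qm z * h z" "Np p h' = ennreal (Lp_norm p Qm h powr p)"
        using in_Lp_version[OF h(2), of] p1 by fastforce
      ultimately show ?thesis unfolding vers_def by (intro exI[of _ h']) (auto elim!: eventually_mono intro: ennreal_leI)
    qed
    have "\<exists>u'. vers u u'" "\<exists>ut'. vers ut ut'" using W unfolding W21_def by (intro ver; auto)+
    then obtain u' ut' where vers_u: "vers u u'" "vers ut ut'" by blast
    have "\<forall>k. \<exists>h'. vers (\<lambda>z. Du z $ k) h'" using W unfolding W21_def by (intro allI ver) auto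
    from choice[OF this] obtain Du' where Du'0: "\<And>k. vers (\<lambda>z. Du z $ k) (Du' k)" by blast
    have "\<exists>h'. vers (\<lambda>z. D2u z $ k $ l) h'" for k l
    proof -
      have "(\<lambda>z. D2u z $ k $ l) \<in> range (\<lambda>(k, l) z. D2u z $ k $ l)" by (rule image_eqI[of _ _ "(k, l)"]) auto
      then show ?thesis using W unfolding W21_def by (intro ver) auto
    qed
    then have "\<forall>k. \<exists>D. \<forall>l. vers (\<lambda>z. D2u z $ k $ l) (D l)" by (intro allI choice) blast
    from choice[OF this] obtain D2u' where D2u'0: "\<And>k l. vers (\<lambda>z. D2u z $ k $ l) (D2u' k l)" by blast
    note u'e = vers_u(1)[unfolded vers_def, THEN conjunct2, THEN conjunct1] vers_u(1)[unfolded vers_def, THEN conjunct2, THEN conjunct2]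
    note ut'e = vers_u(2)[unfolded vers_def, THEN conjunct2, THEN conjunct1] vers_u(2)[unfolded vers_def, THEN conjunct2, THEN conjunct2]
    note Du'e = Du'0[unfolded vers_def, THEN conjunct2, THEN conjunct1] Du'0[unfolded vers_def, THEN conjunct2, THEN conjunct2]
    note D2u'e = D2u'0[unfolded vers_def, THEN conjunct2, THEN conjunct1] D2u'0[unfolded vers_def, THEN conjunct2, THEN conjunct2]
    have u' [measurable]: "u' \<in> borel_fun" and ut' [measurable]: "ut' \<in> borel_fun"
      and Du' [measurable]: "\<And>k. Du' k \<in> borel_fun" and D2u' [measurable]: "\<And>k l. D2u' k l \<in> borel_fun"
      using vers_u Du'0 D2u'0 unfolding vers_def by auto
    \<comment> \<open>The function keeps the continuous \<open>u\<close>, since touching is a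
      pointwise notion; only the derivatives are formed with Borel versions.\<close>
    define v where "v z = cutoff z * u z" for z
    define vt where "vt z = cutoff z * ut' z + pd tm cutoff z * u' z" for z
    define Dv where "Dv k z = cutoff z * Du' k z + pd (sp k) cutoff z * u' z" for k z
    define D2v where "D2v k l z = (cutoff z * D2u' k l z + pd (sp l) cutoff z * Du' k z)
        + (pd (sp k) cutoff z * Du' l z + pd (sp l) (pd (sp k) cutoff) z * u' z)" for k l z
    have [measurable]: "(cutoff :: 'n pt \<Rightarrow> real) \<in> borel_fun" by (rule test_fun_borel[OF tc])
    have [measurable]: "pd tm (cutoff :: 'n pt \<Rightarrow> real) \<in> borel_fun" by (rule test_fun_borel[OF tc1[OF tm_Basis]])
    have [measurable]: "pd (sp k) (cutoff :: 'n pt \<Rightarrow> real) \<in> borel_fun" for k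
      by (rule test_fun_borel[OF tc1[OF sp_Basis]])
    have [measurable]: "pd (sp l) (pd (sp k) (cutoff :: 'n pt \<Rightarrow> real)) \<in> borel_fun" for k l
      by (rule test_fun_borel[OF tc2[OF sp_Basis sp_Basis]])
    have less: "ennreal ((A * Y) powr p) < top" by simp
    note fin = le_less_trans[OF u'e(2) less] le_less_trans[OF ut'e(2) less] le_less_trans[OF Du'e(2) less] le_less_trans[OF D2u'e(2) less]
    obtain K :: "'n pt set" where K: "compact K" "K \<subseteq> Qm" "\<And>z. z \<notin> K \<Longrightarrow> cutoff z = 0" using tc unfolding test_fun_iff by blast
    \<comment> \<open>\<open>u\<close> is continuous only on the closed cylinder, but the product
      vanishes off a compact part of the open set \<open>Qm\<close>, so two open sets cover the
      space.\<close>
    have vc: "continuous_on UNIV v"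
    proof -
      have "continuous_on Qm v" unfolding v_def[abs_def]
        using tc closure_subset[of ?Q] Qm_subset
        by (intro continuous_on_mult continuous_on_subset[OF smooth_continuous] continuous_on_subset[OF u(1)]) (auto simp: test_fun_iff)
      moreover have "continuous_on (- K) v"
        by (rule continuous_on_eq[of _ "\<lambda>_. 0"]) (auto simp: v_def K(3))
      ultimately have "continuous_on (Qm \<union> - K) v"
        using open_Qm K(1) by (intro continuous_on_open_Un) (auto simp: compact_imp_closed open_Compl)
      moreover have "Qm \<union> - K = UNIV" using K(2) by auto
      ultimately show ?thesis by simp
    qed
    have vb [measurable]: "v \<in> borel_fun" by (rule borel_measurable_continuous_onI[OF vc])
    have vae: "AE z in lborel. v z = cutoff z * u' z"
      using u'e(1) by eventually_elim (use K in \<open>auto simp: v_def\<close>)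
    have iQ: "interior Qm = (Qm :: 'n pt set)" by (rule interior_open[OF open_Qm])
    have mU: "u \<in> borel_measurable (lebesgue_on Qm)" "ut \<in> borel_measurable (lebesgue_on Qm)"
      "(\<lambda>z. Du z $ k) \<in> borel_measurable (lebesgue_on Qm)" "(\<lambda>z. D2u z $ k $ l) \<in> borel_measurable (lebesgue_on Qm)" for k l
      using W unfolding W21_def in_Lp_def by auto
    have wdt: "wd tm v vt" unfolding vt_def[abs_def]
      by (rule wd_cong_AE[OF cutoff_wd[OF open_Qm tm_Basis p1 _ mU(1,2) u' ut' u'e(1) ut'e(1) fin(1,2) tc] vae])
        (use W tm_Basis in \<open>auto simp: W21_def iQ\<close>)
    have wdx: "wd (sp k) v (Dv k)" for k unfolding Dv_def[abs_def]
      by (rule wd_cong_AE[OF cutoff_wd[OF open_Qm sp_Basis p1 _ mU(1,3) u' Du' u'e(1) Du'e(1) fin(1,3) tc] vae])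
        (use W sp_Basis in \<open>auto simp: W21_def iQ\<close>)
    note tk = tc1[OF sp_Basis]
    have bz: "\<bar>cutoff z\<bar> \<le> Z" "\<bar>pd tm cutoff z\<bar> \<le> Z" "\<bar>pd (sp k) cutoff z\<bar> \<le> Z" "\<bar>pd (sp l) (pd (sp k) cutoff) z\<bar> \<le> Z" for k l and z :: "'n pt"
      using Zs sp_Basis tm_Basis by blast+
    note m1 = Np_mult_le[OF bz(1) _ _ AY0] and m2 = Np_mult_le[OF bz(2) _ _ AY0] and m3 = Np_mult_le[OF bz(3) _ _ AY0] and m4 = Np_mult_le[OF bz(4) _ _ AY0]
    have ZA: "0 \<le> Z * (A * Y)" using Z AY0 by simp
    have Z4: "0 \<le> 4 * (Z * (A * Y))" using ZA by simp
    have p0: "0 \<le> p" using p1 by simp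
    have n2a: "Np_le p (\<lambda>z. cutoff z * D2u' k l z + pd (sp l) cutoff z * Du' k z) (4 * (Z * (A * Y)))" for k l
      by (rule Np_add_le[OF _ _ p1 ZA m1[OF _ p0 D2u'e(2)] m3[OF _ p0 Du'e(2)]]) measurable
    have n2b: "Np_le p (\<lambda>z. pd (sp k) cutoff z * Du' l z + pd (sp l) (pd (sp k) cutoff) z * u' z) (4 * (Z * (A * Y)))" for k l
      by (rule Np_add_le[OF _ _ p1 ZA m3[OF _ p0 Du'e(2)] m4[OF _ p0 u'e(2)]]) measurable
    have n2: "Np_le p (D2v k l) (4 * (4 * (Z * (A * Y))))" for k l unfolding D2v_def[abs_def]
      by (rule Np_add_le[OF _ _ p1 Z4 n2a n2b]) measurable
    have n1: "Np_le p (Dv k) (4 * (Z * (A * Y)))" for k unfolding Dv_def[abs_def]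
      by (rule Np_add_le[OF _ _ p1 ZA m1[OF _ p0 Du'e(2)] m3[OF _ p0 u'e(2)]]) measurable
    have nt: "Np_le p vt (4 * (Z * (A * Y)))" unfolding vt_def[abs_def]
      by (rule Np_add_le[OF _ _ p1 ZA m1[OF _ p0 ut'e(2)] m2[OF _ p0 u'e(2)]]) measurable
    have nv: "Np_le p v (Z * (A * Y))"
      unfolding Np_cong_AE[OF vae] by (rule m1[OF _ p0 u'e(2)]) measurable
    have wd2: "wd (sp l) (Dv k) (D2v k l)" for k l
      unfolding Dv_def[abs_def] D2v_def[abs_def]
    proof (rule wd_add[OF _ _ sp_Basis p1])
      show "wd (sp l) (\<lambda>z. cutoff z * Du' k z) (\<lambda>z. cutoff z * D2u' k l z + pd (sp l) cutoff z * Du' k z)"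
        by (rule cutoff_wd[OF open_Qm sp_Basis p1 _ mU(3,4) Du' D2u' Du'e(1) D2u'e(1) fin(3,4) tc]) (use W in \<open>auto simp: W21_def iQ\<close>)
      show "wd (sp l) (\<lambda>z. pd (sp k) cutoff z * u' z) (\<lambda>z. pd (sp k) cutoff z * Du' l z + pd (sp l) (pd (sp k) cutoff) z * u' z)"
        by (rule cutoff_wd[OF open_Qm sp_Basis p1 _ mU(1,3) u' Du' u'e(1) Du'e(1) fin(1,3) tk]) (use W in \<open>auto simp: W21_def iQ\<close>)
      show "Np p (\<lambda>z. cutoff z * Du' k z) < top" by (rule le_less_trans[OF m1[OF _ p0 Du'e(2)]]) auto
      show "Np p (\<lambda>z. pd (sp k) cutoff z * u' z) < top" by (rule le_less_trans[OF m3[OF _ p0 u'e(2)]]) auto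
      show "Np p (\<lambda>z. cutoff z * D2u' k l z + pd (sp l) cutoff z * Du' k z) < top" by (rule le_less_trans[OF n2a]) auto
      show "Np p (\<lambda>z. pd (sp k) cutoff z * Du' l z + pd (sp l) (pd (sp k) cutoff) z * u' z) < top" by (rule le_less_trans[OF n2b]) auto
    qed measurable
    have up: "ennreal (x powr p) \<le> ennreal ((C0 * Y) powr p)" if "0 \<le> x" "x \<le> 16 * (Z * (A * Y))" for x
    proof -
      have "16 * (Z * (A * Y)) \<le> C0 * Y" using mult_right_mono[OF C0(2) Y(1)] by (simp add: mult_ac)
      then show ?thesis using that p0 by (intro ennreal_leI powr_mono2) auto
    qed
    have S: "Sob p v vt Dv D2v"
      unfolding Sob_def
    proof (intro conjI allI)
      show "Np p v < top" by (rule le_less_trans[OF nv]) simp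
      show "Np p vt < top" by (rule le_less_trans[OF nt]) simp
      show "Np p (Dv k) < top" for k by (rule le_less_trans[OF n1]) simp
      show "Np p (D2v k l) < top" for k l by (rule le_less_trans[OF n2]) simp
      show "vt \<in> borel_fun" "Dv k \<in> borel_fun" "D2v k l \<in> borel_fun" for k l
        unfolding vt_def[abs_def] Dv_def[abs_def] D2v_def[abs_def] by measurable
    qed (use vb wdt wdx wd2 in auto)
    have "AE z in lebesgue. z \<in> ?Q \<longrightarrow> ut z + pucci_plus lam Lam (D2u z) = - g z"
      using u(3) Qs by (subst (asm) AE_restrict_space_iff) auto
    then have eq: "AE z in lborel. z \<in> ?Q \<longrightarrow> ut z + pucci_plus lam Lam (D2u z) = - g z"
      by (simp add: AE_completion_iff)
    have ae2: "AE z in lborel. \<forall>k l. z \<in> Qm \<longrightarrow> D2u' k l z = D2u z $ k $ l"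
      by (intro AE_all_countable[THEN iffD2] allI D2u'e(1))
    have "AE z in lborel. z \<in> Qc \<longrightarrow> vt z + pucci_plus lam Lam (\<chi> k l. D2v k l z) = - g z"
      using eq ae2 ut'e(1)
    proof eventually_elim
      case (elim z)
      show ?case
      proof
        assume z: "z \<in> Qc"
        have zm: "z \<in> Qm" "z \<in> ?Q" using z Qc_subset_Qm Qm_subset by blast+
        have d1: "pd e cutoff y = 0" if "y \<in> Qc" for e and y :: "'n pt"
          by (rule pd_const_on_open[OF open_Qc that cutoff_one])
        have d2: "pd e' (pd e cutoff) z = 0" for e e'
          by (rule pd_const_on_open[OF open_Qc z d1])
        have "vt z = ut z" using elim(3) zm d1[OF z] cutoff_one[OF z] by (simp add: vt_def)
        moreover have "(\<chi> k l. D2v k l z) = D2u z"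
          using elim(2) zm d1[OF z] d2 cutoff_one[OF z] by (simp add: vec_eq_iff D2v_def)
        ultimately show "vt z + pucci_plus lam Lam (\<chi> k l. D2v k l z) = - g z" using elim(1) zm by simp
      qed
    qed
    moreover have "- (C0 * Y) \<le> v z \<and> v z \<le> 0" for z
    proof (cases "z \<in> Qm")
      case True
      then have b: "- (C0 * Y) \<le> u z" "u z \<le> 0" using ub Qm_subset by blast+
      have "v z \<le> 0" using b cutoff_bounds[of z] by (simp add: v_def mult_nonneg_nonpos)
      moreover have "cutoff z * u z \<ge> 1 * u z" using b cutoff_bounds[of z] by (intro mult_right_mono_neg) auto
      ultimately show ?thesis using b by (simp add: v_def)
    next
      case False
      then have "v z = 0" using K(2) K(3)[of z] by (auto simp: v_def)
      then show ?thesis using C0 Y by simp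
    qed
    moreover have "Np_le p v (C0 * Y)" by (rule order_trans[OF nv up]) (use ZA in \<open>simp_all add: mult_ac\<close>)
    moreover have "Np_le p vt (C0 * Y)" by (rule order_trans[OF nt up]) (use ZA in \<open>simp_all add: mult_ac\<close>)
    moreover have "Np_le p (Dv k) (C0 * Y)" for k by (rule order_trans[OF n1 up]) (use ZA in \<open>simp_all add: mult_ac\<close>)
    moreover have "Np_le p (D2v k l) (C0 * Y)" for k l by (rule order_trans[OF n2 up]) (use ZA in \<open>simp_all add: mult_ac\<close>)
    ultimately show "\<exists>v vt Dv D2v. pucci_sol lam Lam p (C0 * Y) g v vt Dv D2v"
      unfolding pucci_sol_def using S vc by blast
  qed
qed

section \<open>Finite sums and series of Sobolev functions\<close>

lemma Np_sum_le:
  assumes "finite S" "\<And>k. k \<in> S \<Longrightarrow> f k \<in> borel_fun" "1 \<le> p" "0 \<le> W" "\<And>k. k \<in> S \<Longrightarrow> Np_le p (f k) W"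
  shows "Np_le p (\<lambda>z. \<Sum>k\<in>S. f k z) (4 ^ card S * W)"
  using assms
proof (induction S)
  case empty
  then show ?case by (simp add: Np_def)
next
  case (insert k S)
  have "W \<le> 4 ^ card S * W" using insert.prems by (simp add: mult_le_cancel_right1)
  then have "W powr p \<le> (4 ^ card S * W) powr p" using insert.prems by (intro powr_mono2) auto
  then have "Np_le p (f k) (4 ^ card S * W)"
    using insert.prems(4)[of k] by (auto intro: order_trans ennreal_leI)
  moreover have "Np_le p (\<lambda>z. \<Sum>k\<in>S. f k z) (4 ^ card S * W)"
    using insert by auto
  ultimately have "Np_le p (\<lambda>z. f k z + (\<Sum>k\<in>S. f k z)) (4 * (4 ^ card S * W))"
    using insert.prems by (intro Np_add_le) auto
  then show ?case using insert.hyps by (simp add: mult.assoc)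
qed

text \<open>The decay 4^(-j) is at most twice the weights 2^(-j-1) inserted into the power series
  inequality, so the resulting series of p-th powers is integrable.\<close>

lemma series_Np:
  fixes h :: "nat \<Rightarrow> 'a::euclidean_space \<Rightarrow> real"
  assumes [measurable]: "\<And>j. h j \<in> borel_fun" and p: "1 \<le> p" and B: "0 \<le> B"
    and le: "\<And>j. Np_le p (h j) (B / 4 ^ j)"
  shows "AE z in lborel. summable (\<lambda>j. \<bar>h j z\<bar>)" "Np p (\<lambda>z. \<Sum>j. \<bar>h j z\<bar>) < top"
proof -
  define w where "w j = (1 / 2 :: real) ^ Suc j" for j
  have w: "0 < w j" "(\<Sum>k<N. w k) \<le> 1" for j N
  proof -
    show "0 < w j" by (simp add: w_def)
    have "(\<Sum>k<N. w k) \<le> (\<Sum>k. w k)"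
      using sums_summable[OF power_half_series] by (intro sum_le_suminf) (auto simp: w_def)
    then show "(\<Sum>k<N. w k) \<le> 1" using sums_unique[OF power_half_series] by (simp add: w_def)
  qed
  have ws: "(\<Sum>j. ennreal (w j)) = 1"
  proof -
    have "w sums 1" unfolding w_def[abs_def] by (rule power_half_series)
    then show ?thesis
      using suminf_ennreal2[OF less_imp_le[OF w(1)] sums_summable] sums_unique by fastforce
  qed
  define T where "T z = (\<Sum>j. ennreal (w j powr (1 - p) * \<bar>h j z\<bar> powr p))" for z
  have [measurable]: "T \<in> borel_fun" unfolding T_def[abs_def] by measurable
  have coef: "w j powr (1 - p) * (B / 4 ^ j) powr p \<le> (2 * B) powr p * w j" for j
  proof -
    have "w j powr (1 - p) * (B / 4 ^ j) powr p = w j * (B / 4 ^ j / w j) powr p"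
      using w(1)[of j] B by (simp add: powr_diff powr_divide powr_mult)
    also have "B / 4 ^ j / w j = 2 * B * (1 / 2) ^ j"
      by (simp add: w_def power_divide field_simps power_mult_distrib[symmetric])
    also have "w j * (2 * B * (1 / 2) ^ j) powr p \<le> w j * (2 * B) powr p"
      using w(1)[of j] B p by (intro mult_left_mono powr_mono2) (auto simp: mult_left_le power_le_one)
    finally show ?thesis by (simp add: mult.commute)
  qed
  have "(\<integral>\<^sup>+z. T z \<partial>lborel) = (\<Sum>j. \<integral>\<^sup>+z. ennreal (w j powr (1 - p)) * ennreal (\<bar>h j z\<bar> powr p) \<partial>lborel)"
    unfolding T_def by (subst nn_integral_suminf[symmetric]) (auto simp: ennreal_mult)
  also have "\<dots> = (\<Sum>j. ennreal (w j powr (1 - p)) * Np p (h j))"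
    by (simp add: nn_integral_cmult Np_def)
  also have "\<dots> \<le> (\<Sum>j. ennreal ((2 * B) powr p) * ennreal (w j))"
  proof (intro suminf_le)
    fix j
    have "ennreal (w j powr (1 - p)) * Np p (h j) \<le> ennreal (w j powr (1 - p)) * ennreal ((B / 4 ^ j) powr p)"
      by (intro mult_left_mono le) simp
    also have "\<dots> \<le> ennreal ((2 * B) powr p * w j)"
      using coef[of j] by (simp add: ennreal_mult[symmetric] ennreal_leI)
    finally show "ennreal (w j powr (1 - p)) * Np p (h j) \<le> ennreal ((2 * B) powr p) * ennreal (w j)"
      using w(1)[of j] by (simp add: ennreal_mult)
  qed auto
  also have "\<dots> = ennreal ((2 * B) powr p)" by (simp add: ws)
  finally have IT: "(\<integral>\<^sup>+z. T z \<partial>lborel) \<le> ennreal ((2 * B) powr p)" .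
  then have "(\<integral>\<^sup>+z. T z \<partial>lborel) \<noteq> \<infinity>" by (auto simp: top_unique)
  then have "AE z in lborel. T z \<noteq> \<infinity>" by (intro nn_integral_PInf_AE) auto
  then have fin: "AE z in lborel. T z < top" by (auto elim!: eventually_mono simp: less_top)
  have pt: "summable (\<lambda>j. \<bar>h j z\<bar>) \<and> ennreal ((\<Sum>j. \<bar>h j z\<bar>) powr p) \<le> T z" if "T z < top" for z
    using power_series_le[of "\<lambda>j. \<bar>h j z\<bar>" w p, OF _ w(1) w(2) p] that unfolding T_def by auto
  show "AE z in lborel. summable (\<lambda>j. \<bar>h j z\<bar>)" using fin by eventually_elim (use pt in auto)
  have "Np p (\<lambda>z. \<Sum>j. \<bar>h j z\<bar>) \<le> (\<integral>\<^sup>+z. T z \<partial>lborel)"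
    unfolding Np_def using fin
  proof (intro nn_integral_mono_AE, eventually_elim)
    case (elim z)
    have "0 \<le> (\<Sum>j. \<bar>h j z\<bar>)" using pt[OF elim(2)] by (intro suminf_nonneg) auto
    then show ?case using pt[OF elim(2)] by simp
  qed
  also have "\<dots> < top" using IT by (rule order_le_less_trans) simp
  finally show "Np p (\<lambda>z. \<Sum>j. \<bar>h j z\<bar>) < top" .
qed

lemma series_Np_signed:
  fixes h :: "nat \<Rightarrow> 'a::euclidean_space \<Rightarrow> real"
  assumes "\<And>j. h j \<in> borel_fun" and "1 \<le> p" and "0 \<le> B" "\<And>j. Np_le p (h j) (B / 4 ^ j)"
  shows "Np p (\<lambda>z. \<Sum>j. h j z) < top"
proof (rule le_less_trans[OF Np_mono_AE series_Np(2)[OF assms]])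
  show "AE z in lborel. \<bar>\<Sum>j. h j z\<bar> \<le> \<bar>\<Sum>j. \<bar>h j z\<bar>\<bar>"
    using series_Np(1)[OF assms] by eventually_elim (use summable_rabs in fastforce)
qed (use assms in auto)

lemma series_test_integral:
  fixes h :: "nat \<Rightarrow> 'a::euclidean_space \<Rightarrow> real"
  assumes h [measurable]: "\<And>j. h j \<in> borel_fun" and p: "1 \<le> p" and B: "0 \<le> B" "\<And>j. Np_le p (h j) (B / 4 ^ j)"
    and t: "test_fun UNIV \<psi>"
  shows "(\<lambda>N. \<Sum>j<N. \<integral>z. h j z * \<psi> z \<partial>lborel) \<longlonglongrightarrow> (\<integral>z. (\<Sum>j. h j z) * \<psi> z \<partial>lborel)"
proof -
  have [measurable]: "\<psi> \<in> borel_fun" by (rule test_fun_borel[OF t])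
  note S = series_Np[OF h p B]
  have f: "Np p (h j) < top" for j by (rule le_less_trans[OF B(2)]) simp
  have "(\<lambda>N. \<integral>z. (\<Sum>j<N. h j z) * \<psi> z \<partial>lborel) \<longlonglongrightarrow> (\<integral>z. (\<Sum>j. h j z) * \<psi> z \<partial>lborel)"
  proof (rule integral_dominated_convergence)
    show "integrable lborel (\<lambda>z. \<bar>(\<Sum>j. \<bar>h j z\<bar>) * \<psi> z\<bar>)"
      using Np_test_integrable[OF _ p S(2) t] by auto
    show "AE z in lborel. (\<lambda>N. (\<Sum>j<N. h j z) * \<psi> z) \<longlonglongrightarrow> (\<Sum>j. h j z) * \<psi> z"
      using S(1) by eventually_elim (rule tendsto_mult[OF summable_LIMSEQ[OF summable_rabs_cancel] tendsto_const])
    show "AE z in lborel. norm ((\<Sum>j<N. h j z) * \<psi> z) \<le> \<bar>(\<Sum>j. \<bar>h j z\<bar>) * \<psi> z\<bar>" for N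
      using S(1)
    proof eventually_elim
      case (elim z)
      have "\<bar>\<Sum>j<N. h j z\<bar> \<le> (\<Sum>j<N. \<bar>h j z\<bar>)" by (rule sum_abs)
      also have "\<dots> \<le> (\<Sum>j. \<bar>h j z\<bar>)" by (rule sum_le_suminf[OF elim]) auto
      finally show ?case by (simp add: abs_mult mult_right_mono)
    qed
  qed simp_all
  moreover have "(\<integral>z. (\<Sum>j<N. h j z) * \<psi> z \<partial>lborel) = (\<Sum>j<N. \<integral>z. h j z * \<psi> z \<partial>lborel)" for N
    unfolding sum_distrib_right by (intro Bochner_Integration.integral_sum Np_test_integrable[OF h p f t])
  ultimately show ?thesis by simp
qed

lemma wd_series:
  fixes f g :: "nat \<Rightarrow> 'a::euclidean_space \<Rightarrow> real"
  assumes wd: "\<And>j. wd e (f j) (g j)" and e: "e \<in> Basis" and p: "1 \<le> p" and B: "0 \<le> B"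
    and f: "\<And>j. f j \<in> borel_fun" "\<And>j. Np_le p (f j) (B / 4 ^ j)"
    and g: "\<And>j. g j \<in> borel_fun" "\<And>j. Np_le p (g j) (B / 4 ^ j)"
  shows "wd e (\<lambda>z. \<Sum>j. f j z) (\<lambda>z. \<Sum>j. g j z)"
  unfolding wd_def
proof (intro allI impI)
  fix \<psi> :: "'a \<Rightarrow> real" assume t: "test_fun UNIV \<psi>"
  have 1: "(\<integral>z. f j z * pd e \<psi> z \<partial>lborel) = - (\<integral>z. g j z * \<psi> z \<partial>lborel)" for j
    using wd[of j] t unfolding wd_def by blast
  have "(\<lambda>N. \<Sum>j<N. \<integral>z. f j z * pd e \<psi> z \<partial>lborel) \<longlonglongrightarrow> (\<integral>z. (\<Sum>j. f j z) * pd e \<psi> z \<partial>lborel)"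
    by (rule series_test_integral[OF f(1) p B f(2) test_fun_pd[OF t e]])
  moreover have "(\<lambda>N. - (\<Sum>j<N. \<integral>z. g j z * \<psi> z \<partial>lborel)) \<longlonglongrightarrow> - (\<integral>z. (\<Sum>j. g j z) * \<psi> z \<partial>lborel)"
    by (intro tendsto_minus series_test_integral[OF g(1) p B g(2) t])
  ultimately show "(\<integral>z. (\<Sum>j. f j z) * pd e \<psi> z \<partial>lborel) = - (\<integral>z. (\<Sum>j. g j z) * \<psi> z \<partial>lborel)"
    unfolding 1 sum_negf by (rule LIMSEQ_unique)
qed

lemma gradient_series_norm:
  fixes d :: "nat \<Rightarrow> 'n::finite \<Rightarrow> real"
  assumes "\<And>k. summable (\<lambda>j. \<bar>d j k\<bar>)"
  shows "summable (\<lambda>j. norm (\<chi> k. d j k))" "norm (\<chi> k. \<Sum>j. d j k) \<le> (\<Sum>j. norm (\<chi> k. d j k))"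
proof -
  have "summable (\<lambda>j. \<Sum>k\<in>UNIV. \<bar>d j k\<bar>)" by (intro summable_sum assms)
  then show s: "summable (\<lambda>j. norm (\<chi> k. d j k))"
    by (rule summable_comparison_test'[where N = 0]) (use norm_le_l1_cart[of "\<chi> k. d _ k"] in simp)
  have "(\<chi> k. \<Sum>j. d j k) = (\<Sum>j. \<chi> k. d j k)"
    using bounded_linear.suminf[OF bounded_linear_vec_nth summable_norm_cancel[OF s]] by (simp add: vec_eq_iff)
  then show "norm (\<chi> k. \<Sum>j. d j k) \<le> (\<Sum>j. norm (\<chi> k. d j k))" using summable_norm[OF s] by simp
qed

section \<open>Strong subsolutions with small drift\<close>

lemma borel_measurable_vec_lambda_comp:
  assumes "\<And>k. f k \<in> borel_measurable M" shows "(\<lambda>z. (\<chi> k. f k z) :: real^'n) \<in> borel_measurable M"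
proof (rule borel_measurable_euclidean_space[THEN iffD2], rule ballI)
  fix i :: "real^'n" assume "i \<in> Basis"
  then obtain k where "i = axis k 1" by (auto simp: Basis_vec_def)
  then show "(\<lambda>z. (\<chi> k. f k z) \<bullet> i) \<in> borel_measurable M" using assms[of k] by (simp add: inner_axis)
qed

text \<open>Only an inequality is asked for: the operator and the norm of the gradient are
  subadditive, so the sum of the iterates is a subsolution rather than a solution.\<close>

definition drift_sol where
  "drift_sol lam Lam p W \<mu> (g :: (real^'n) \<times> real \<Rightarrow> real) \<longleftrightarrow>
    (\<exists>v vt Dv D2v. Sob p v vt Dv D2v \<and> continuous_on UNIV v \<and> (\<forall>z. - W \<le> v z \<and> v z \<le> 0)
      \<and> (AE z in lborel. z \<in> Qc \<longrightarrow> vt z + pucci_plus lam Lam (\<chi> k l. D2v k l z) + \<bar>\<mu> z\<bar> * norm (\<chi> k. Dv k z) \<le> - g z))"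

context
  fixes lam Lam p q p1 :: real and dummy :: "'n::finite itself"
  assumes lam: "0 < lam" "lam \<le> Lam" and abp: "ABP_exponent TYPE('n) lam Lam p1" and pp: "p1 < p"
    and pq: "p \<le> q" and q: "hdim TYPE('n) < q"
begin

lemma p_ge: "1 \<le> p" using abp pp by (auto simp: ABP_exponent_def)

text \<open>One round of the iteration: the drift term of the solution is itself a source, with the
  norm bound multiplied by \<open>K * X\<close>. The gradient is replaced by its improved version,
  whose product with \<open>\<mu>\<close> is again in L^p.\<close>

lemma drift_step:
  "\<exists>C>0. \<exists>K>0. \<forall>\<mu> X g Y. (\<mu> :: (real^'n) \<times> real \<Rightarrow> real) \<in> borel_fun \<and> 0 \<le> X \<and> Np_le q \<mu> X \<and> Lp_source p g Y \<longrightarrow>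
    (\<exists>v vt Dv D2v. pucci_sol lam Lam p (C * Y) g v vt Dv D2v \<and> Np_le p (\<lambda>z. \<bar>\<mu> z\<bar> * norm (\<chi> k. Dv k z)) (K * X * Y))"
proof -
  obtain C1 where C1: "0 < C1" and sol: "\<forall>(g :: 'n pt \<Rightarrow> real) Y. Lp_source p g Y \<longrightarrow> (\<exists>v vt Dv D2v. pucci_sol lam Lam p (C1 * Y) g v vt Dv D2v)"
    using sol_operator[OF lam abp pp] by (elim exE conjE)
  obtain C2 where C2: "0 < C2" and grad: "\<forall>v vt Dv D2v. Sob p (v :: 'n pt \<Rightarrow> real) vt Dv D2v \<longrightarrow>
    (\<exists>G. Sob p v vt G D2v
      \<and> (\<forall>\<mu> X k. \<mu> \<in> borel_fun \<longrightarrow> 0 \<le> X \<longrightarrow> Np_le q \<mu> X \<longrightarrow>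
          Np p (\<lambda>z. \<mu> z * G k z) \<le> ennreal ((C2 * X) powr p) * (Np p (Dv k) + Np p (\<lambda>w. \<bar>vt w\<bar> + (\<Sum>l\<in>UNIV. \<bar>D2v k l w\<bar>))))
      \<and> (\<forall>k. Np p (G k) \<le> ennreal (C2 powr p) * (Np p (Dv k) + Np p (\<lambda>w. \<bar>vt w\<bar> + (\<Sum>l\<in>UNIV. \<bar>D2v k l w\<bar>)))))"
    using improved_gradient[OF p_ge pq q] by (elim exE conjE)
  \<comment> \<open>\<open>4 ^ CARD('n)\<close> comes from summing the second derivatives over
    \<open>l\<close>, 4 from adding the time derivative, and 2 from adding the norm of the
    gradient.\<close>
  define M where "M = 2 * (4 * (4 ^ CARD('n) * C1))"
  define C where "C = C1 + C2 * M"
  define K where "K = 4 ^ CARD('n) * (C2 * M)"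
  have M: "0 < M" "C1 \<le> 4 ^ CARD('n) * C1" using C1 by (auto simp: M_def mult_le_cancel_right1)
  have CK: "0 < C" "0 < K" "C1 \<le> C" "C2 * M \<le> C" using C1 C2 M by (auto simp: C_def K_def add_pos_pos)
  have "\<exists>v vt Dv D2v. pucci_sol lam Lam p (C * Y) g v vt Dv D2v \<and> Np_le p (\<lambda>z. \<bar>\<mu> z\<bar> * norm (\<chi> k. Dv k z)) (K * X * Y)"
    if mu [measurable]: "\<mu> \<in> borel_fun" and X: "0 \<le> X" "Np_le q \<mu> X"
      and g: "Lp_source p g Y"
    for \<mu> g :: "'n pt \<Rightarrow> real" and X Y
  proof -
    have Y: "0 \<le> Y" using g by (simp add: Lp_source_def)
    have p0: "0 \<le> p" using p_ge by simp
    obtain v vt Dv D2v where "pucci_sol lam Lam p (C1 * Y) g v vt Dv D2v" using sol g by blast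
    note v = pucci_solD[OF this]
    obtain G where G: "Sob p v vt G D2v"
      and Gm: "\<And>k. Np p (\<lambda>z. \<mu> z * G k z) \<le> ennreal ((C2 * X) powr p) * (Np p (Dv k) + Np p (\<lambda>w. \<bar>vt w\<bar> + (\<Sum>l\<in>UNIV. \<bar>D2v k l w\<bar>)))"
      and Gn: "\<And>k. Np p (G k) \<le> ennreal (C2 powr p) * (Np p (Dv k) + Np p (\<lambda>w. \<bar>vt w\<bar> + (\<Sum>l\<in>UNIV. \<bar>D2v k l w\<bar>)))"
      using mp[OF spec[OF spec[OF spec[OF spec[OF grad]]]] v(1)] X mu by blast
    note [measurable] = SobD(2)[OF G] SobD(3)[OF G] SobD(4)[OF G]
    define W where "W = 4 ^ CARD('n) * C1 * Y"
    have W: "0 \<le> W" "C1 * Y \<le> W" using C1 Y M(2) by (auto simp: W_def mult_right_mono)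
    have CY: "0 \<le> C1 * Y" using C1 Y by simp
    have leW: "ennreal ((C1 * Y) powr p) \<le> ennreal (W powr p)" using W CY p0 by (intro ennreal_leI powr_mono2) auto
    have ab: "Np p (\<lambda>w. \<bar>h w\<bar>) = Np p h" for h :: "'n pt \<Rightarrow> real" by (simp add: Np_def)
    have "Np_le p (\<lambda>w. \<Sum>l\<in>UNIV. \<bar>D2v k l w\<bar>) W" for k
      using Np_sum_le[of UNIV "\<lambda>l w. \<bar>D2v k l w\<bar>" p "C1 * Y"] v(8) p_ge CY by (simp add: ab W_def mult.assoc)
    then have H: "Np_le p (\<lambda>w. \<bar>vt w\<bar> + (\<Sum>l\<in>UNIV. \<bar>D2v k l w\<bar>)) (4 * W)" for k
      using v(6) leW W by (intro Np_add_le p_ge) (auto simp: ab intro: order_trans)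
    have "Np p (Dv k) + Np p (\<lambda>w. \<bar>vt w\<bar> + (\<Sum>l\<in>UNIV. \<bar>D2v k l w\<bar>)) \<le> ennreal ((2 * (4 * W)) powr p)" for k
    proof -
      have "Np p (Dv k) + Np p (\<lambda>w. \<bar>vt w\<bar> + (\<Sum>l\<in>UNIV. \<bar>D2v k l w\<bar>)) \<le> ennreal ((4 * W) powr p) + ennreal ((4 * W) powr p)"
      proof (intro add_mono H)
        have "(C1 * Y) powr p \<le> (4 * W) powr p" using W CY p0 by (intro powr_mono2) auto
        then show "Np_le p (Dv k) (4 * W)" using v(7)[of k] by (auto intro: order_trans ennreal_leI)
      qed
      also have "\<dots> = ennreal (2 * (4 * W) powr p)" by (simp add: ennreal_plus[symmetric] del: ennreal_plus)
      also have "\<dots> \<le> ennreal (2 powr p * (4 * W) powr p)"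
        using powr_mono[of 1 p 2] p_ge by (intro ennreal_leI mult_right_mono) auto
      also have "2 powr p * (4 * W) powr p = (2 * (4 * W)) powr p"
        by (subst powr_mult[of 2 "4 * W"]) (use W in auto)
      finally show ?thesis .
    qed
    then have S: "Np p (Dv k) + Np p (\<lambda>w. \<bar>vt w\<bar> + (\<Sum>l\<in>UNIV. \<bar>D2v k l w\<bar>)) \<le> ennreal ((M * Y) powr p)" for k
      by (simp add: M_def W_def mult.assoc)
    have MY: "0 \<le> M * Y" using M Y by simp
    have Gm': "Np_le p (\<lambda>z. \<mu> z * G k z) (C2 * X * (M * Y))" for k
    proof -
      have "Np p (\<lambda>z. \<mu> z * G k z) \<le> ennreal ((C2 * X) powr p) * ennreal ((M * Y) powr p)"
        by (rule order_trans[OF Gm mult_left_mono[OF S]]) simp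
      also have "\<dots> = ennreal ((C2 * X * (M * Y)) powr p)" using C2 X MY by (simp add: powr_mult ennreal_mult)
      finally show ?thesis .
    qed
    have Gn': "Np_le p (G k) (C * Y)" for k
    proof -
      have "Np p (G k) \<le> ennreal (C2 powr p) * ennreal ((M * Y) powr p)"
        by (rule order_trans[OF Gn mult_left_mono[OF S]]) simp
      also have "\<dots> = ennreal ((C2 * (M * Y)) powr p)" using C2 MY by (simp add: powr_mult ennreal_mult)
      also have "\<dots> \<le> ennreal ((C * Y) powr p)"
        using C2 MY p0 mult_right_mono[OF CK(4) Y] by (intro ennreal_leI powr_mono2) (auto simp: mult.assoc)
      finally show ?thesis .
    qed
    have CYC: "C1 * Y \<le> C * Y" using CK Y by (intro mult_right_mono) auto
    have up: "ennreal ((C1 * Y) powr p) \<le> ennreal ((C * Y) powr p)"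
      using CYC CY p0 by (intro ennreal_leI powr_mono2) auto
    have "Np p (\<lambda>z. \<bar>\<mu> z\<bar> * norm (\<chi> k. G k z)) \<le> Np p (\<lambda>z. \<Sum>k\<in>UNIV. \<bar>\<mu> z * G k z\<bar>)"
    proof (rule Np_mono[OF p0])
      fix z
      have "\<bar>\<mu> z\<bar> * norm (\<chi> k. G k z) \<le> \<bar>\<mu> z\<bar> * (\<Sum>k\<in>UNIV. \<bar>G k z\<bar>)"
        using norm_le_l1_cart[of "\<chi> k. G k z"] by (intro mult_left_mono) auto
      then show "\<bar>\<bar>\<mu> z\<bar> * norm (\<chi> k. G k z)\<bar> \<le> \<bar>\<Sum>k\<in>UNIV. \<bar>\<mu> z * G k z\<bar>\<bar>"
        by (simp add: abs_mult sum_distrib_left)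
    qed
    also have "\<dots> \<le> ennreal ((4 ^ CARD('n) * (C2 * X * (M * Y))) powr p)"
    proof (rule Np_sum_le)
      show "0 \<le> C2 * X * (M * Y)" using C2 X MY by simp
      show "Np_le p (\<lambda>z. \<bar>\<mu> z * G k z\<bar>) (C2 * X * (M * Y))" for k using Gm'[of k] by (simp add: ab)
    qed (use p_ge in auto)
    also have "4 ^ CARD('n) * (C2 * X * (M * Y)) = K * X * Y" by (simp add: K_def mult_ac)
    finally have fin: "Np_le p (\<lambda>z. \<bar>\<mu> z\<bar> * norm (\<chi> k. G k z)) (K * X * Y)" .
    have bd: "\<forall>z. - (C * Y) \<le> v z \<and> v z \<le> 0"
    proof
      fix z show "- (C * Y) \<le> v z \<and> v z \<le> 0" using v(3)[rule_format, of z] CYC by linarith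
    qed
    show ?thesis
      using G v(2,4) bd order_trans[OF v(5) up] order_trans[OF v(6) up] order_trans[OF v(8) up] Gn' fin unfolding pucci_sol_def by blast
  qed
  then show ?thesis using CK(1,2) by blast
qed

text \<open>Fixed-point iteration written as a series: the source of round j + 1 is the drift term
  of round j. In the sum, the sources of all later rounds compensate the drift terms, and only
  \<open>- g\<close> remains.\<close>

theorem drift_solution:
  "\<exists>\<delta>>0. \<exists>C>0. \<forall>\<mu> g Y. (\<mu> :: (real^'n) \<times> real \<Rightarrow> real) \<in> borel_fun \<and> Np_le q \<mu> \<delta> \<and> Lp_source p g Y \<longrightarrow> drift_sol lam Lam p (C * Y) \<mu> g"
proof -
  obtain C K where C: "0 < C" and K: "0 < K" and step: "\<forall>\<mu> X g Y. (\<mu> :: 'n pt \<Rightarrow> real) \<in> borel_fun \<and> 0 \<le> X \<and> Np_le q \<mu> X \<and> Lp_source p g Y \<longrightarrow>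
    (\<exists>v vt Dv D2v. pucci_sol lam Lam p (C * Y) g v vt Dv D2v \<and> Np_le p (\<lambda>z. \<bar>\<mu> z\<bar> * norm (\<chi> k. Dv k z)) (K * X * Y))"
    using drift_step by (elim exE conjE)
  \<comment> \<open>Each round then divides the norm bound of the source by 4, which is the decay
    that the series lemmas require.\<close>
  define \<delta> where "\<delta> = 1 / (4 * K)"
  have \<delta>: "0 < \<delta>" "K * \<delta> = 1 / 4" using K by (auto simp: \<delta>_def)
  note p = p_ge
  have "drift_sol lam Lam p (2 * C * Y) \<mu> g"
    if \<mu> [measurable]: "\<mu> \<in> borel_fun" and X: "Np_le q \<mu> \<delta>"
      and g: "Lp_source p g Y"
    for \<mu> g :: "'n pt \<Rightarrow> real" and Y
  proof -
    have Y: "0 \<le> Y" using g by (simp add: Lp_source_def)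
    define ok where "ok j h \<longleftrightarrow> Lp_source p h (Y / 4 ^ j)" for j :: nat and h :: "'n pt \<Rightarrow> real"
    define good where "good j h v vt Dv D2v \<longleftrightarrow> pucci_sol lam Lam p (C * (Y / 4 ^ j)) h v vt Dv D2v
      \<and> ok (Suc j) (\<lambda>z. \<bar>\<mu> z\<bar> * norm (\<chi> k. Dv k z))" for j h v vt Dv D2v
    have ex: "\<exists>v vt Dv D2v. good j h v vt Dv D2v" if h: "ok j h" for j h
    proof -
      have Yj: "0 \<le> Y / 4 ^ j" using Y by simp
      obtain v vt Dv D2v where sv: "pucci_sol lam Lam p (C * (Y / 4 ^ j)) h v vt Dv D2v"
        and fin: "Np_le p (\<lambda>z. \<bar>\<mu> z\<bar> * norm (\<chi> k. Dv k z)) (K * \<delta> * (Y / 4 ^ j))"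
        using step[rule_format, of \<mu> \<delta> h "Y / 4 ^ j"] \<mu> X \<delta>(1) h unfolding ok_def by (auto 0 4 simp: less_imp_le)
      have "K * \<delta> * (Y / 4 ^ j) = Y / 4 ^ Suc j" unfolding \<delta>(2) by simp
      moreover note [measurable] = SobD(3)[OF pucci_solD(1)[OF sv]]
      have "(\<lambda>z. (\<chi> k. Dv k z) :: real^'n) \<in> borel_fun"
        by (rule borel_measurable_vec_lambda_comp) measurable
      then have "(\<lambda>z. \<bar>\<mu> z\<bar> * norm ((\<chi> k. Dv k z) :: real^'n)) \<in> borel_fun" by measurable
      ultimately have "ok (Suc j) (\<lambda>z. \<bar>\<mu> z\<bar> * norm (\<chi> k. Dv k z))" unfolding ok_def Lp_source_def using fin Yj by simp
      then have "good j h v vt Dv D2v" unfolding good_def using sv by blast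
      then show ?thesis by blast
    qed
    \<comment> \<open>A solution and its derivatives are chosen as a function of the source, so that
      the sources can be defined by recursion.\<close>
    define pick where "pick j h = (SOME r. case r of (v, vt, Dv, D2v) \<Rightarrow> good j h v vt Dv D2v)" for j h
    have pick: "case pick j h of (v, vt, Dv, D2v) \<Rightarrow> good j h v vt Dv D2v" if "ok j h" for j h
    proof -
      have "\<exists>r. case r of (v, vt, Dv, D2v) \<Rightarrow> good j h v vt Dv D2v" using ex[OF that] by (auto intro!: exI)
      then show ?thesis unfolding pick_def by (rule someI_ex)
    qed
    define next' where "next' j h = (\<lambda>z. \<bar>\<mu> z\<bar> * norm (\<chi> k. fst (snd (snd (pick j h))) k z))" for j h
    define gs where "gs = rec_nat g next'"
    have gs0: "gs 0 = g" and gsS: "gs (Suc j) = next' j (gs j)" for j by (simp_all add: gs_def)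
    define v where "v j = fst (pick j (gs j))" for j
    define vt where "vt j = fst (snd (pick j (gs j)))" for j
    define Dv where "Dv j = fst (snd (snd (pick j (gs j))))" for j
    define D2v where "D2v j = snd (snd (snd (pick j (gs j))))" for j
    have gsD: "gs (Suc j) = (\<lambda>z. \<bar>\<mu> z\<bar> * norm (\<chi> k. Dv j k z))" for j by (simp add: gsS next'_def Dv_def)
    have ok: "ok j (gs j)" for j
    proof (induction j)
      case 0 then show ?case using g by (simp add: ok_def gs0)
    next
      case (Suc j)
      then show ?case using pick[OF Suc] unfolding gsD by (auto simp: good_def Dv_def case_prod_unfold)
    qed
    have good: "good j (gs j) (v j) (vt j) (Dv j) (D2v j)" for j
      using pick[OF ok[of j]] by (simp add: v_def vt_def Dv_def D2v_def case_prod_unfold)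
    note gd = pucci_solD[OF good[unfolded good_def, THEN conjunct1]]
    note S = gd(1)
    note meas = SobD(1-4)[OF S]
    define B where "B = C * Y"
    have B: "0 \<le> B" using C Y by (simp add: B_def)
    have N: "Np_le p (v j) (B / 4 ^ j)" "Np_le p (vt j) (B / 4 ^ j)"
      "Np_le p (Dv j k) (B / 4 ^ j)" "Np_le p (D2v j k l) (B / 4 ^ j)" for j k l
      using gd(5-8)[of j] by (simp_all add: B_def)
    define V where "V z = (\<Sum>j. v j z)" for z
    define Vt where "Vt z = (\<Sum>j. vt j z)" for z
    define DV where "DV k z = (\<Sum>j. Dv j k z)" for k z
    define D2V where "D2V k l z = (\<Sum>j. D2v j k l z)" for k l z
    have SV: "Sob p V Vt DV D2V"
      unfolding Sob_def V_def[abs_def] Vt_def[abs_def] DV_def[abs_def] D2V_def[abs_def]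
    proof (intro conjI allI)
      show "wd tm (\<lambda>z. \<Sum>j. v j z) (\<lambda>z. \<Sum>j. vt j z)"
        by (rule wd_series[OF SobD(9)[OF S] tm_Basis p B meas(1) N(1) meas(2) N(2)])
      show "wd (sp k) (\<lambda>z. \<Sum>j. v j z) (\<lambda>z. \<Sum>j. Dv j k z)" for k
        by (rule wd_series[OF SobD(10)[OF S] sp_Basis p B meas(1) N(1) meas(3) N(3)])
      show "wd (sp l) (\<lambda>z. \<Sum>j. Dv j k z) (\<lambda>z. \<Sum>j. D2v j k l z)" for k l
        by (rule wd_series[OF SobD(11)[OF S] sp_Basis p B meas(3) N(3) meas(4) N(4)])
      show "Np p (\<lambda>z. \<Sum>j. v j z) < top" by (rule series_Np_signed[OF meas(1) p B N(1)])
      show "Np p (\<lambda>z. \<Sum>j. vt j z) < top" by (rule series_Np_signed[OF meas(2) p B N(2)])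
      show "Np p (\<lambda>z. \<Sum>j. Dv j k z) < top" for k by (rule series_Np_signed[OF meas(3) p B N(3)])
      show "Np p (\<lambda>z. \<Sum>j. D2v j k l z) < top" for k l by (rule series_Np_signed[OF meas(4) p B N(4)])
    qed (intro borel_measurable_suminf meas)+
    have vb: "- (B / 4 ^ j) \<le> v j z \<and> v j z \<le> 0" for j z
    proof -
      have "- (C * (Y / 4 ^ j)) \<le> v j z \<and> v j z \<le> 0" using gd(3)[of j] by blast
      then show ?thesis by (simp add: B_def)
    qed
    have geo: "(\<lambda>j. B / 4 ^ j) sums (4 / 3 * B)"
      using sums_mult[OF geometric_sums[of "1 / 4 :: real"], of B] by (simp add: power_divide field_simps)
    have vn: "norm (v j z) \<le> B / 4 ^ j" for j z using vb[of j z] by auto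
    have vs: "summable (\<lambda>j. v j z)" for z
      by (rule summable_comparison_test'[OF sums_summable[OF geo], of 0]) (use vn in auto)
    note SV
    moreover have "continuous_on UNIV V"
    proof (rule uniform_limit_theorem)
      show "uniform_limit UNIV (\<lambda>N z. \<Sum>j<N. v j z) V sequentially"
        unfolding V_def by (rule Weierstrass_m_test[OF vn sums_summable[OF geo]])
      show "\<forall>\<^sub>F N in sequentially. continuous_on UNIV (\<lambda>z. \<Sum>j<N. v j z)"
        by (intro always_eventually allI continuous_on_sum gd(2))
    qed simp
    moreover have "- (2 * C * Y) \<le> V z \<and> V z \<le> 0" for z
    proof
      have "V z \<le> suminf (\<lambda>j. 0 :: real)" unfolding V_def by (intro suminf_le vs) (use vb in auto)
      then show "V z \<le> 0" by simp
      have "suminf (\<lambda>j. - (B / 4 ^ j)) \<le> V z"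
        unfolding V_def by (intro suminf_le vs summable_minus sums_summable[OF geo]) (use vb in auto)
      then have "- (4 / 3 * B) \<le> V z" using sums_unique[OF sums_minus[OF geo]] by simp
      then show "- (2 * C * Y) \<le> V z" using B by (simp add: B_def)
    qed
    moreover have "AE z in lborel. z \<in> Qc \<longrightarrow> Vt z + pucci_plus lam Lam (\<chi> k l. D2V k l z) + \<bar>\<mu> z\<bar> * norm (\<chi> k. DV k z) \<le> - g z"
    proof -
      have "AE z in lborel. \<forall>j. z \<in> Qc \<longrightarrow> vt j z + pucci_plus lam Lam (\<chi> k l. D2v j k l z) = - gs j z"
        by (intro AE_all_countable[THEN iffD2] allI gd(4))
      moreover have "AE z in lborel. summable (\<lambda>j. \<bar>vt j z\<bar>)" by (rule series_Np(1)[OF meas(2) p B N(2)])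
      moreover have "AE z in lborel. \<forall>k. summable (\<lambda>j. \<bar>Dv j k z\<bar>)"
        by (intro AE_all_countable[THEN iffD2] allI series_Np(1)[OF meas(3) p B N(3)])
      moreover have "AE z in lborel. \<forall>k l. summable (\<lambda>j. \<bar>D2v j k l z\<bar>)"
        by (intro AE_all_countable[THEN iffD2] allI series_Np(1)[OF meas(4) p B N(4)])
      ultimately show ?thesis
      proof eventually_elim
        case (elim z)
        show ?case
        proof
          assume z: "z \<in> Qc"
          let ?P = "\<lambda>j. pucci_plus lam Lam (\<chi> k l. D2v j k l z)"
          have sP: "summable ?P"
          proof (rule summable_comparison_test'[where N = 0])
            show "summable (\<lambda>j. Lam * (\<Sum>k\<in>UNIV. \<Sum>l\<in>UNIV. \<bar>D2v j k l z\<bar>))"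
              using elim(4) by (intro summable_mult summable_sum) auto
            show "norm (?P j) \<le> Lam * (\<Sum>k\<in>UNIV. \<Sum>l\<in>UNIV. \<bar>D2v j k l z\<bar>)" for j
              using pucci_abs_le[OF lam, of "\<chi> k l. D2v j k l z"] by simp
          qed
          have st: "summable (\<lambda>j. vt j z)" using elim(2) by (rule summable_rabs_cancel)
          have le1: "pucci_plus lam Lam (\<chi> k l. D2V k l z) \<le> (\<Sum>j. ?P j)"
            using pucci_sums[OF lam, of "\<lambda>j. \<chi> k l. D2v j k l z"] elim(4) sP
            by (auto simp: D2V_def intro: summable_rabs_cancel)
          note gr = gradient_series_norm[of "\<lambda>j k. Dv j k z"]
          have sg: "summable (\<lambda>j. norm (\<chi> k. Dv j k z))" using gr(1) elim(3) by blast
          have sgs: "summable (\<lambda>j. gs (Suc j) z)" unfolding gsD by (rule summable_mult[OF sg])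
          have le2: "\<bar>\<mu> z\<bar> * norm (\<chi> k. DV k z) \<le> (\<Sum>j. gs (Suc j) z)"
            unfolding gsD DV_def suminf_mult[OF sg] using gr(2) elim(3) by (intro mult_left_mono) auto
          have "Vt z + (\<Sum>j. ?P j) = (\<Sum>j. vt j z + ?P j)"
            unfolding Vt_def by (rule suminf_add[OF st sP])
          also have "\<dots> = (\<Sum>j. - gs j z)" using elim(1) z by simp
          \<comment> \<open>The head of the series is \<open>g\<close>, and the tail dominates the
            drift term of the sum by \<open>le2\<close>.\<close>
          also have "\<dots> = - (\<Sum>j. gs (Suc j) z) - g z"
          proof -
            have s0: "summable (\<lambda>j. gs j z)" using sgs by (simp only: summable_Suc_iff[of "\<lambda>j. gs j z"])
            show ?thesis using suminf_split_head[OF s0] suminf_minus[OF s0] by (simp add: gs0)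
          qed
          finally show "Vt z + pucci_plus lam Lam (\<chi> k l. D2V k l z) + \<bar>\<mu> z\<bar> * norm (\<chi> k. DV k z) \<le> - g z"
            using le1 le2 by linarith
        qed
      qed
    qed
    ultimately show ?thesis unfolding drift_sol_def by blast
  qed
  then show ?thesis using \<delta>(1) C by (intro exI[of _ \<delta>] exI[of _ "2 * C"] conjI) auto
qed

end

lemma pd_cong_open:
  assumes "open U" "z \<in> U" "\<And>y. y \<in> U \<Longrightarrow> f y = g y" "smooth g" shows "pd e f z = pd e g z"
proof -
  have "(f has_derivative (\<lambda>e. pd e g z)) (at z)"
    by (rule has_derivative_transform_within_open[OF smooth_has_derivative[OF assms(4)] assms(1,2)]) (use assms(3) in simp)
  then show ?thesis by (rule pd_eq)
qed

section \<open>The comparison function\<close>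

text \<open>The vertex of the paraboloid is placed at (0, 1/2), and \<open>bY\<close> vanishes on
  its lateral boundary. Squaring it puts a positive multiple of the rank-one matrix of x into the
  Hessian, and the exponential contributes a term - \<kappa> \<open>bY\<close>^2 that controls the
  terms linear in \<open>bY\<close>.\<close>

definition bY :: "real \<Rightarrow> (real^'n) \<times> real \<Rightarrow> real" where
  "bY c z = c * (snd z - 1/2) - fst z \<bullet> fst z"
definition bE :: "real \<Rightarrow> (real^'n) \<times> real \<Rightarrow> real" where
  "bE \<kappa> z = exp (- \<kappa> * (snd z - 1/2))"
definition barrier :: "real \<Rightarrow> real \<Rightarrow> (real^'n) \<times> real \<Rightarrow> real" where
  "barrier c \<kappa> z = (bY c z)\<^sup>2 * bE \<kappa> z"

lemma bY_derivative: "(bY c has_derivative (\<lambda>e. c * snd e - 2 * (fst z \<bullet> fst e))) (at z)"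
  unfolding bY_def[abs_def] by (auto intro!: derivative_eq_intros simp: inner_commute)

lemma bE_derivative: "(bE \<kappa> has_derivative (\<lambda>e. - \<kappa> * snd e * bE \<kappa> z)) (at z)"
  unfolding bE_def[abs_def] by (auto intro!: derivative_eq_intros)

lemma smooth_bY: "smooth (bY c)"
  unfolding bY_def[abs_def] inner_vec_def
  by (intro smooth_diff smooth_mult smooth_const smooth_snd smooth_sum) (auto intro: smooth_mult smooth_fst_nth)

lemma smooth_bE: "smooth (bE \<kappa>)"
  unfolding bE_def[abs_def]
  by (intro smooth_compose[OF smooth_exp] smooth_mult smooth_diff smooth_const smooth_snd)

lemma smooth_barrier: "smooth (barrier c \<kappa>)"
  unfolding barrier_def[abs_def] by (intro smooth_mult smooth_power smooth_bY smooth_bE)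

lemma barrier_derivative:
  "(barrier c \<kappa> has_derivative (\<lambda>e. (2 * bY c z * (c * snd e - 2 * (fst z \<bullet> fst e)) - (bY c z)\<^sup>2 * \<kappa> * snd e) * bE \<kappa> z)) (at z)"
proof -
  have "((\<lambda>z. (bY c z)\<^sup>2) has_derivative (\<lambda>e. 2 * bY c z * (c * snd e - 2 * (fst z \<bullet> fst e)))) (at z)"
    using has_derivative_mult[OF bY_derivative[of c z] bY_derivative[of c z]]
    unfolding power2_eq_square by (rule has_derivative_eq_rhs) (auto simp: fun_eq_iff algebra_simps)
  from has_derivative_mult[OF this bE_derivative] show ?thesis
    unfolding barrier_def[abs_def] by (rule has_derivative_eq_rhs) (auto simp: fun_eq_iff algebra_simps)
qed

lemma pd_barrier_time: "pd tm (barrier c \<kappa>) z = (2 * c * bY c z - \<kappa> * (bY c z)\<^sup>2) * bE \<kappa> z"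
  by (subst pd_eq[OF barrier_derivative]) (simp add: mult_ac)

lemma pd_barrier_space: "pd (sp k) (barrier c \<kappa>) z = - 4 * (bY c z * (fst z $ k) * bE \<kappa> z)"
  by (subst pd_eq[OF barrier_derivative]) (simp add: inner_axis)

lemma pd_barrier_space2:
  "pd (sp l) (pd (sp k) (barrier c \<kappa>)) z = (8 * bE \<kappa> z) * (fst z $ k * fst z $ l) - (4 * bY c z * bE \<kappa> z) * (if k = l then 1 else 0)"
proof -
  have 1: "pd (sp k) (barrier c \<kappa>) = (\<lambda>z. - 4 * (bY c z * (fst z $ k) * bE \<kappa> z))" by (rule ext) (rule pd_barrier_space)
  have 2: "((\<lambda>z::(real^'a) \<times> real. fst z $ k) has_derivative (\<lambda>e. fst e $ k)) (at z)"
    by (intro bounded_linear_imp_has_derivative bounded_linear_compose[OF bounded_linear_vec_nth bounded_linear_fst])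
  have "((\<lambda>z. - 4 * (bY c z * (fst z $ k) * bE \<kappa> z)) has_derivative
      (\<lambda>e. - 4 * (bY c z * (fst z $ k) * (- \<kappa> * snd e * bE \<kappa> z)
        + (bY c z * (fst e $ k) + (c * snd e - 2 * (fst z \<bullet> fst e)) * (fst z $ k)) * bE \<kappa> z))) (at z)"
    by (intro has_derivative_mult_right has_derivative_mult bY_derivative 2 bE_derivative)
  then have 3: "pd (sp l) (\<lambda>z. - 4 * (bY c z * (fst z $ k) * bE \<kappa> z)) z = - 4 * (bY c z * (fst z $ k) * (- \<kappa> * snd (sp l) * bE \<kappa> z)
        + (bY c z * (fst (sp l) $ k) + (c * snd (sp l) - 2 * (fst z \<bullet> fst (sp l))) * (fst z $ k)) * bE \<kappa> z)"
    by (rule pd_eq)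
  have "fst z \<bullet> axis l 1 = fst z $ l" "axis l (1::real) $ k = (if k = l then 1 else 0)"
    by (simp add: inner_axis) (simp add: axis_def)
  then show ?thesis unfolding 1 3 by (simp add: algebra_simps)
qed

text \<open>The opening \<open>cc\<close> is large enough that the paraboloid with vertex in a dense cube covers the stack above
  its parent; \<open>sg\<close> is the height up to which the paraboloid stays in the region \<open>Qc\<close> of the solution operator.\<close>

definition cc :: "'n::finite itself \<Rightarrow> real" where "cc _ = 16 * real CARD('n)"
definition sg :: "'n::finite itself \<Rightarrow> real" where "sg _ = (rad TYPE('n))\<^sup>2 / (4 * cc TYPE('n))"

lemma card_ge1: "1 \<le> real CARD('n::finite)" by (simp add: Suc_leI)

lemma cc_sg: "16 \<le> cc TYPE('n::finite)" "0 < sg TYPE('n)" "cc TYPE('n) * sg TYPE('n) = (rad TYPE('n))\<^sup>2 / 4"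
    "sg TYPE('n) \<le> 1/8" "(rad TYPE('n))\<^sup>2 / 4 \<le> 1/64"
proof -
  show c: "16 \<le> cc TYPE('n)" using card_ge1[where 'n='n] by (simp add: cc_def)
  then show "0 < sg TYPE('n)" using rad_pos[where 'n='n] by (simp add: sg_def)
  show e: "cc TYPE('n) * sg TYPE('n) = (rad TYPE('n))\<^sup>2 / 4" using c by (simp add: sg_def)
  have "rad TYPE('n) \<le> 1/4" using card_ge1[where 'n='n] by (simp add: rad_def field_simps)
  then have "(rad TYPE('n))\<^sup>2 \<le> (1/4)\<^sup>2" using rad_pos[where 'n='n] by (intro power_mono) auto
  then show r: "(rad TYPE('n))\<^sup>2 / 4 \<le> 1/64" by (simp add: power2_eq_square)
  have "16 * sg TYPE('n) \<le> cc TYPE('n) * sg TYPE('n)" using c \<open>0 < sg TYPE('n)\<close> by (intro mult_right_mono) auto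
  then show "sg TYPE('n) \<le> 1/8" using e r by linarith
qed

text \<open>Open laterally, where comparison functions are nonpositive, and closed at the top:
  viscosity cylinders only look backwards in time, so the top face counts as interior.\<close>

definition cone :: "((real^'n) \<times> real) set" where
  "cone = {z. fst z \<bullet> fst z < cc TYPE('n) * (snd z - 1/2) \<and> snd z - 1/2 \<le> sg TYPE('n)}"

lemma closed_cone_Qc:
  fixes z :: "(real^'n) \<times> real"
  assumes "fst z \<bullet> fst z \<le> cc TYPE('n) * (snd z - 1/2)" "snd z - 1/2 \<le> sg TYPE('n)"
  shows "z \<in> Qc" "0 \<le> snd z - 1/2" "fst z \<bullet> fst z \<le> 1/64" "cc TYPE('n) * (snd z - 1/2) \<le> 1/64"
proof -
  have c: "0 < cc TYPE('n)" using cc_sg(1)[where 'n='n] by linarith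
  have "0 \<le> cc TYPE('n) * (snd z - 1/2)" using assms(1) inner_ge_zero[of "fst z"] by linarith
  then show s: "0 \<le> snd z - 1/2" using c by (simp add: zero_le_mult_iff)
  have le: "cc TYPE('n) * (snd z - 1/2) \<le> (rad TYPE('n))\<^sup>2 / 4"
    unfolding cc_sg(3)[symmetric] using assms(2) c by (intro mult_left_mono) auto
  then show "cc TYPE('n) * (snd z - 1/2) \<le> 1/64" "fst z \<bullet> fst z \<le> 1/64" using cc_sg(5)[where 'n='n] assms(1) by linarith+
  have "(norm (fst z))\<^sup>2 < (rad TYPE('n))\<^sup>2"
    using le assms(1) rad_pos[where 'n='n] by (simp add: power2_norm_eq_inner) (smt (verit) zero_less_power)
  then have "norm (fst z) < rad TYPE('n)" using rad_pos[where 'n='n] by (simp add: power2_less_imp_less)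
  then have "\<bar>fst z $ l\<bar> < rad TYPE('n)" for l using component_le_norm_cart[of "fst z" l] by linarith
  then show "z \<in> Qc" using s assms(2) cc_sg(4)[where 'n='n] by (simp add: Qc_iff)
qed

text \<open>After division of \<mu> by the norm bound d, |x|^p \<le> 1 + |x|^q; on a set of volume
  at most 1 both terms integrate to at most 1.\<close>

lemma Np_Lq_le:
  fixes \<mu> :: "'a::euclidean_space \<Rightarrow> real"
  assumes [measurable]: "\<mu> \<in> borel_fun" "A \<in> sets borel" and A: "vol A \<le> 1" and d: "0 < d" "Np_le q \<mu> d" and pq: "1 \<le> p" "p \<le> q"
  shows "Np_le p (\<lambda>z. \<mu> z * indicator A z) (2 * d)"
proof -
  have pt: "\<bar>x\<bar> powr p \<le> d powr p * (1 + \<bar>x / d\<bar> powr q)" for x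
  proof -
    have "\<bar>x / d\<bar> powr p \<le> 1 + \<bar>x / d\<bar> powr q"
    proof (cases "\<bar>x / d\<bar> \<le> 1")
      case True
      then have "\<bar>x / d\<bar> powr p \<le> 1" using pq by (intro powr_le1) auto
      then show ?thesis by (simp add: add_increasing2)
    next
      case False
      then have "\<bar>x / d\<bar> powr p \<le> \<bar>x / d\<bar> powr q" using pq by (intro powr_mono) auto
      then show ?thesis by simp
    qed
    then have "d powr p * \<bar>x / d\<bar> powr p \<le> d powr p * (1 + \<bar>x / d\<bar> powr q)" by (intro mult_left_mono) auto
    moreover have "d powr p * \<bar>x / d\<bar> powr p = \<bar>x\<bar> powr p" using d by (simp add: abs_divide powr_divide)
    ultimately show ?thesis by simp
  qed
  have "Np p (\<lambda>z. \<mu> z * indicator A z) \<le> (\<integral>\<^sup>+z. ennreal (d powr p) * (indicator A z + ennreal (1 / d powr q) * ennreal (\<bar>\<mu> z\<bar> powr q)) \<partial>lborel)"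
    unfolding Np_def
  proof (intro nn_integral_mono)
    fix z
    have "ennreal (\<bar>\<mu> z\<bar> powr p) \<le> ennreal (d powr p * (1 + 1 / d powr q * \<bar>\<mu> z\<bar> powr q))"
      using pt[of "\<mu> z"] d by (intro ennreal_leI) (simp add: abs_divide powr_divide)
    also have "\<dots> = ennreal (d powr p) * (1 + ennreal (1 / d powr q) * ennreal (\<bar>\<mu> z\<bar> powr q))"
    proof -
      have "ennreal (1 / d powr q) * ennreal (\<bar>\<mu> z\<bar> powr q) = ennreal (1 / d powr q * \<bar>\<mu> z\<bar> powr q)"
        by (rule ennreal_mult[symmetric]) auto
      then show ?thesis by (simp add: ennreal_mult del: times_divide_eq_left)
    qed
    finally show "ennreal (\<bar>\<mu> z * indicator A z\<bar> powr p) \<le> ennreal (d powr p) * (indicator A z + ennreal (1 / d powr q) * ennreal (\<bar>\<mu> z\<bar> powr q))"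
      by (cases "z \<in> A") auto
  qed
  also have "\<dots> = ennreal (d powr p) * (vol A + ennreal (1 / d powr q) * Np q \<mu>)"
    by (simp add: nn_integral_cmult nn_integral_add Np_def)
  also have "\<dots> \<le> ennreal (d powr p) * (1 + ennreal (1 / d powr q) * ennreal (d powr q))"
    by (intro mult_left_mono add_mono A d) auto
  also have "ennreal (1 / d powr q) * ennreal (d powr q) = 1"
    using d by (simp add: ennreal_mult[symmetric])
  also have "ennreal (d powr p) * (1 + 1) = ennreal (2 * d powr p)"
    by (simp add: ennreal_mult mult.commute)
  also have "\<dots> \<le> ennreal (2 powr p * d powr p)"
    using powr_mono[of 1 p 2] pq by (intro ennreal_leI mult_right_mono) auto
  also have "2 powr p * d powr p = (2 * d) powr p" by (subst powr_mult[of 2 d]) (use d in auto)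
  finally show ?thesis .
qed

lemma emeasure_Qc: "vol (Qc :: ((real^'n) \<times> real) set) \<le> 1"
proof -
  have "Qc \<subseteq> pbox 1 (vec (1/2) :: real^'n, 3/4)"
  proof
    fix z :: "'n pt" assume z: "z \<in> Qc"
    have r: "rad TYPE('n) \<le> 1/4" using card_ge1[where 'n='n] by (simp add: rad_def field_simps)
    have "- (1/2) \<le> fst z $ l \<and> fst z $ l \<le> 1/2" for l
    proof -
      have "\<bar>fst z $ l\<bar> < rad TYPE('n)" using z by (simp add: Qc_iff)
      then show ?thesis using r by linarith
    qed
    moreover have "\<bar>snd z - 1/2\<bar> < 1/4" using z by (simp add: Qc_iff)
    then have "- (1/4) \<le> snd z" "snd z \<le> 3/4" by linarith+
    ultimately show "z \<in> pbox 1 (vec (1/2), 3/4)" by (simp add: pbox_iff)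
  qed
  then have "vol (Qc :: 'n pt set) \<le> vol (pbox 1 (vec (1/2) :: real^'n, 3/4))"
    by (intro emeasure_mono) auto
  then show ?thesis by (simp add: emeasure_pbox)
qed

text \<open>\<open>N\<close> will be the part of the tip where the supersolution lies below the
  level, normalised to 1. In the rest of the tip no inequality is imposed: there the supersolution
  is already above \<open>\<Phi>\<close>, which is at most 1.\<close>

definition comparison where
  "comparison lam Lam p t0 \<eta> \<mu> f N \<longleftrightarrow>
    (\<exists>\<Phi> \<Phi>t D\<Phi> D2\<Phi>. Sob p (\<Phi> :: (real^'n) \<times> real \<Rightarrow> real) \<Phi>t D\<Phi> D2\<Phi> \<and> continuous_on UNIV \<Phi>
      \<and> (AE z in lborel. z \<in> cone \<and> (snd z - 1/2 \<le> t0 \<longrightarrow> z \<in> N) \<longrightarrow>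
            \<Phi>t z + pucci_plus lam Lam (\<chi> k l. D2\<Phi> k l z) + \<bar>\<mu> z\<bar> * norm (\<chi> k. D\<Phi> k z) + f z \<le> - \<eta>)
      \<and> (\<forall>z\<in>cone. \<Phi> z \<le> 1)
      \<and> (\<forall>z. fst z \<bullet> fst z = cc TYPE('n) * (snd z - 1/2) \<and> snd z - 1/2 \<le> sg TYPE('n) \<longrightarrow> \<Phi> z \<le> 0)
      \<and> (\<forall>z. fst z \<bullet> fst z \<le> cc TYPE('n) * (snd z - 1/2) / 2 \<and> t0 \<le> snd z - 1/2 \<and> snd z - 1/2 \<le> sg TYPE('n) \<longrightarrow> \<eta> \<le> \<Phi> z))"

context
  fixes lam Lam p q p1 :: real and dummy :: "'n::finite itself"
  assumes lam: "0 < lam" "lam \<le> Lam" and abp: "ABP_exponent TYPE('n) lam Lam p1" and pp: "p1 < p"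
    and pq: "p \<le> q" and q: "hdim TYPE('n) < q"
begin

text \<open>Substituting |x|^2 = c (t - 1/2) - \<open>bY\<close> splits the elliptic gain into a
  part growing with the height over the vertex and a part linear in \<open>bY\<close> that joins the
  other linear terms.\<close>

lemma barrier_operator:
  fixes z :: "(real^'n) \<times> real"
  assumes y: "0 \<le> bY c z"
  shows "pd tm (barrier c \<kappa>) z + pucci_plus lam Lam (\<chi> k l. pd (sp l) (pd (sp k) (barrier c \<kappa>)) z)
    \<le> ((2 * c + 8 * lam + 4 * Lam * real CARD('n)) * bY c z - \<kappa> * (bY c z)\<^sup>2 - 8 * lam * (c * (snd z - 1/2))) * bE \<kappa> z"
proof -
  have E: "0 < bE \<kappa> z" by (simp add: bE_def)
  have "pucci_plus lam Lam (\<chi> k l. pd (sp l) (pd (sp k) (barrier c \<kappa>)) z)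
    \<le> - (8 * bE \<kappa> z * (lam * (norm (fst z))\<^sup>2)) + 4 * bY c z * bE \<kappa> z * (Lam * real CARD('n))"
    unfolding pd_barrier_space2 using E y by (intro pucci_rank_one[OF lam]) auto
  then show ?thesis
    unfolding pd_barrier_time by (simp add: power2_norm_eq_inner bY_def algebra_simps)
qed

theorem comparison_function:
  fixes t0 :: real
  assumes t0: "0 < t0"
  shows "\<exists>\<delta>>0. \<exists>\<eta>>0. \<forall>\<mu> f N. (\<mu> :: (real^'n) \<times> real \<Rightarrow> real) \<in> borel_fun \<and> Np_le q \<mu> \<delta>
      \<and> f \<in> borel_fun \<and> (\<forall>z. 0 \<le> f z) \<and> Np_le p f \<delta> \<and> N \<in> sets borel \<and> vol N \<le> ennreal (\<delta> powr p) \<longrightarrow> comparison lam Lam p t0 \<eta> \<mu> f N"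
proof -
  note p = p_ge[OF lam abp pp pq q]
  define c where "c = cc TYPE('n)"
  define \<sigma> where "\<sigma> = sg TYPE('n)"
  have c: "16 \<le> c" "0 < \<sigma>" using cc_sg(1,2)[where 'n='n] by (auto simp: c_def \<sigma>_def)
  define m where "m = 2 * c + 8 * lam + 4 * Lam * real CARD('n)"
  \<comment> \<open>Half of the gain 8 \<open>lam\<close> c \<open>t0\<close> at height
    \<open>t0\<close>; above that height the gain beats \<open>C1\<close> with another
    \<open>C1\<close> to spare.\<close>
  define C1 where "C1 = 4 * lam * c * t0"
  have C1: "0 < C1" using lam c t0 by (simp add: C1_def)
  \<comment> \<open>The maximum of m y - \<kappa> y^2 is m^2 / (4 \<kappa>), which this choice makes
    equal to \<open>C1\<close>.\<close>
  define \<kappa> where "\<kappa> = m\<^sup>2 / (4 * C1)"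
  have m: "0 < m" using lam c by (simp add: m_def add_pos_nonneg)
  have \<kappa>: "0 < \<kappa>" using m C1 by (simp add: \<kappa>_def)
  have quad: "m * y - \<kappa> * y\<^sup>2 \<le> C1" for y
  proof -
    have "0 \<le> \<kappa> * (y - m / (2 * \<kappa>))\<^sup>2" using \<kappa> by simp
    also have "\<dots> = \<kappa> * y\<^sup>2 - m * y + m\<^sup>2 / (4 * \<kappa>)" using \<kappa> by (simp add: power2_eq_square field_simps)
    also have "m\<^sup>2 / (4 * \<kappa>) = C1" using m C1 by (simp add: \<kappa>_def)
    finally show ?thesis by simp
  qed
  define e0 where "e0 = exp (- \<kappa> * \<sigma>)"
  define \<eta>1 where "\<eta>1 = C1 * e0"
  \<comment> \<open>Half of a lower bound for the barrier on the inner paraboloid above height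
    \<open>t0\<close>; the other half is left for the correction \<open>v\<close>.\<close>
  define \<eta>2 where "\<eta>2 = (c * t0 / 2)\<^sup>2 * e0 / 2"
  have e0: "0 < e0" by (simp add: e0_def)
  have \<eta>: "0 < \<eta>1" "0 < \<eta>2" using C1 e0 c t0 by (auto simp: \<eta>1_def \<eta>2_def)
  obtain \<delta>V CV where V: "0 < \<delta>V" "0 < CV" and sol: "\<forall>\<mu> g Y. (\<mu> :: 'n pt \<Rightarrow> real) \<in> borel_fun \<and> Np_le q \<mu> \<delta>V \<and> Lp_source p g Y \<longrightarrow> drift_sol lam Lam p (CV * Y) \<mu> g"
    using drift_solution[OF lam abp pp pq q] by (elim exE conjE)
  \<comment> \<open>\<open>C1 + \<eta>1\<close> pays for \<open>N\<close>, 8 for the drift acting on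
    the barrier (gradient at most 4, and a factor 2 from \<open>Np_Lq_le\<close>), and 1 for
    \<open>f\<close>. The 16 in the next definition comes from adding three terms with
    \<open>Np_add_le\<close>.\<close>
  define L where "L = C1 + \<eta>1 + 9"
  define \<delta> where "\<delta> = min \<delta>V (\<eta>2 / (CV * (16 * L)))"
  have L: "0 < L" "C1 + \<eta>1 \<le> L" "8 \<le> L" "1 \<le> L" using C1 \<eta> by (auto simp: L_def)
  have \<delta>: "0 < \<delta>" "\<delta> \<le> \<delta>V" "CV * (16 * L * \<delta>) \<le> \<eta>2"
  proof -
    show "0 < \<delta>" "\<delta> \<le> \<delta>V" using V \<eta> L by (auto simp: \<delta>_def)
    have "CV * (16 * L) * \<delta> \<le> CV * (16 * L) * (\<eta>2 / (CV * (16 * L)))"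
      using V L by (intro mult_left_mono) (auto simp: \<delta>_def)
    then show "CV * (16 * L * \<delta>) \<le> \<eta>2" using V L by (simp add: mult.assoc)
  qed
  define \<eta>0 where "\<eta>0 = min \<eta>1 \<eta>2"
  have "comparison lam Lam p t0 \<eta>0 \<mu> f N"
    if \<mu> [measurable]: "\<mu> \<in> borel_fun" and \<mu>n: "Np_le q \<mu> \<delta>"
      and f [measurable]: "f \<in> borel_fun" and f0: "\<forall>z. 0 \<le> f z" and fn: "Np_le p f \<delta>"
      and N [measurable]: "N \<in> sets borel" and Nn: "vol N \<le> ennreal (\<delta> powr p)"
    for \<mu> f :: "'n pt \<Rightarrow> real" and N
  proof -
    have Qcb [measurable]: "(Qc :: 'n pt set) \<in> sets borel" by (simp add: open_Qc borel_open)
    \<comment> \<open>The source collects what the barrier fails to absorb: its positive operator on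
      \<open>N\<close>, the drift applied to its gradient, and \<open>f\<close>. The operator with
      drift applied to the correction \<open>v\<close> is at most \<open>- g\<close>.\<close>
    define g where "g z = ((C1 + \<eta>1) * indicator N z + 4 * \<bar>\<mu> z * indicator Qc z\<bar>) + f z" for z
    have [measurable]: "g \<in> borel_fun" unfolding g_def[abs_def] by measurable
    have g0: "\<forall>z. 0 \<le> g z" using C1 \<eta> f0 unfolding g_def by (intro allI add_nonneg_nonneg mult_nonneg_nonneg) auto
    have W: "x \<le> L * \<delta> \<Longrightarrow> 0 \<le> x \<Longrightarrow> ennreal (x powr p) \<le> ennreal ((L * \<delta>) powr p)" for x
      using p by (intro ennreal_leI powr_mono2) auto
    have pow: "ennreal (a powr p) * ennreal (b powr p) = ennreal ((a * b) powr p)" if "0 \<le> a" "0 \<le> b" for a b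
      using that by (simp add: powr_mult ennreal_mult)
    have n1: "Np_le p (\<lambda>z. (C1 + \<eta>1) * indicator N z) (L * \<delta>)"
    proof -
      have "Np p (indicator N :: 'n pt \<Rightarrow> real) = vol N"
      proof -
        have "ennreal (\<bar>indicator N z :: real\<bar> powr p) = indicator N z" for z by (simp add: indicator_def)
        then show ?thesis unfolding Np_def by simp
      qed
      then have "Np p (\<lambda>z. (C1 + \<eta>1) * indicator N z) \<le> ennreal ((C1 + \<eta>1) powr p) * ennreal (\<delta> powr p)"
        using Nn C1 \<eta> by (subst Np_cmult) (auto intro!: mult_left_mono)
      also have "\<dots> = ennreal (((C1 + \<eta>1) * \<delta>) powr p)"
        by (rule pow) (use C1 \<eta> \<delta> in auto)
      also have "\<dots> \<le> ennreal ((L * \<delta>) powr p)"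
        by (rule W) (use C1 \<eta> \<delta> L in \<open>auto intro!: mult_right_mono\<close>)
      finally show ?thesis .
    qed
    have n2: "Np_le p (\<lambda>z. 4 * \<bar>\<mu> z * indicator Qc z\<bar>) (L * \<delta>)"
    proof -
      have "Np p (\<lambda>z. \<bar>\<mu> z * indicator Qc z\<bar>) = Np p (\<lambda>z. \<mu> z * indicator Qc z)" by (simp add: Np_def)
      also have "\<dots> \<le> ennreal ((2 * \<delta>) powr p)"
        by (rule Np_Lq_le[OF \<mu> Qcb emeasure_Qc \<delta>(1) \<mu>n p pq])
      finally have "Np p (\<lambda>z. 4 * \<bar>\<mu> z * indicator Qc z\<bar>) \<le> ennreal (4 powr p) * ennreal ((2 * \<delta>) powr p)"
        by (subst Np_cmult) (auto intro!: mult_left_mono)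
      also have "\<dots> = ennreal ((4 * (2 * \<delta>)) powr p)"
        by (rule pow) (use \<delta> in auto)
      also have "\<dots> \<le> ennreal ((L * \<delta>) powr p)"
        by (rule W) (use \<delta> L in auto)
      finally show ?thesis .
    qed
    have n3: "Np_le p f (L * \<delta>)" by (rule order_trans[OF fn W]) (use \<delta> L in auto)
    have Ld: "0 \<le> L * \<delta>" "0 \<le> 4 * (L * \<delta>)" using L \<delta> by auto
    have n12: "Np_le p (\<lambda>z. (C1 + \<eta>1) * indicator N z + 4 * \<bar>\<mu> z * indicator Qc z\<bar>) (4 * (L * \<delta>))"
      by (rule Np_add_le[OF _ _ p Ld(1) n1 n2]) measurable
    have n3': "Np_le p f (4 * (L * \<delta>))"
      by (rule order_trans[OF n3]) (use Ld p in \<open>auto intro!: ennreal_leI powr_mono2\<close>)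
    have gn: "Np_le p g (4 * (4 * (L * \<delta>)))" unfolding g_def[abs_def]
      by (rule Np_add_le[OF _ _ p Ld(2) n12 n3']) measurable
    define Y where "Y = 4 * (4 * (L * \<delta>))"
    have Y: "0 \<le> Y" "CV * Y \<le> \<eta>2" using Ld \<delta>(3) by (auto simp: Y_def mult_ac)
    have \<mu>n': "Np_le q \<mu> \<delta>V"
      using \<delta> p pq by (intro order_trans[OF \<mu>n] ennreal_leI powr_mono2) auto
    obtain v vt Dv D2v where v: "Sob p (v :: 'n pt \<Rightarrow> real) vt Dv D2v" "continuous_on UNIV v"
      "\<forall>z. - (CV * Y) \<le> v z \<and> v z \<le> 0"
      "AE z in lborel. z \<in> Qc \<longrightarrow> vt z + pucci_plus lam Lam (\<chi> k l. D2v k l z) + \<bar>\<mu> z\<bar> * norm (\<chi> k. Dv k z) \<le> - g z"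
      using sol[rule_format, of \<mu> g Y] \<mu> \<mu>n' g0 Y(1) gn unfolding Y_def Lp_source_def drift_sol_def by (auto 0 4)
    let ?b = "barrier c \<kappa> :: 'n pt \<Rightarrow> real"
    define B where "B z = cutoff z * ?b z" for z
    have tB: "test_fun UNIV B"
      unfolding B_def[abs_def] using test_fun_mult[OF smooth_barrier test_fun_mono[OF cutoff_test_fun], of UNIV c \<kappa>] by (simp add: mult.commute)
    have SB: "Sob p B (pd tm B) (\<lambda>k. pd (sp k) B) (\<lambda>k l. pd (sp l) (pd (sp k) B))"
      using Sob_test_fun[OF tB] p by simp
    have Bb: "B z = ?b z" if "z \<in> Qc" for z using cutoff_one[OF that] by (simp add: B_def)
    have B1: "pd e B z = pd e ?b z" if "z \<in> Qc" for e z
      by (rule pd_cong_open[OF open_Qc that Bb smooth_barrier])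
    have B2: "pd (sp l) (pd (sp k) B) z = pd (sp l) (pd (sp k) ?b) z" if "z \<in> Qc" for k l z
      by (rule pd_cong_open[OF open_Qc that B1 smooth_pd[OF smooth_barrier sp_Basis]])
    have E: "0 < bE \<kappa> z" for z :: "'n pt" by (simp add: bE_def)
    have Eb: "bE \<kappa> z \<le> 1" if "0 \<le> snd z - 1/2" for z :: "'n pt"
      unfolding bE_def using that \<kappa> by simp
    have Ee: "e0 \<le> bE \<kappa> z" if "snd z - 1/2 \<le> \<sigma>" for z :: "'n pt"
      unfolding bE_def e0_def using that \<kappa> by simp
    have bval: "?b z \<le> 1" if "fst z \<bullet> fst z \<le> c * (snd z - 1/2)" "snd z - 1/2 \<le> \<sigma>" for z
    proof -
      note D = closed_cone_Qc[of z, folded c_def \<sigma>_def, OF that]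
      have "0 \<le> bY c z" "bY c z \<le> 1" unfolding bY_def using that D(4) inner_ge_zero[of "fst z"] by linarith+
      then have "(bY c z)\<^sup>2 \<le> 1" by (simp add: power_le_one)
      then show ?thesis using Eb[OF D(2)] E[of z] unfolding barrier_def by (intro mult_le_one) auto
    qed
    have "Sob p (\<lambda>z. B z + v z) (\<lambda>z. pd tm B z + vt z) (\<lambda>k z. pd (sp k) B z + Dv k z) (\<lambda>k l z. pd (sp l) (pd (sp k) B) z + D2v k l z)"
      by (rule Sob_add[OF SB v(1) p])
    moreover have "continuous_on UNIV (\<lambda>z. B z + v z)"
      using tB v(2) by (intro continuous_on_add) (auto simp: test_fun_iff intro: smooth_continuous)
    moreover have "AE z in lborel. z \<in> cone \<and> (snd z - 1/2 \<le> t0 \<longrightarrow> z \<in> N) \<longrightarrow>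
        (pd tm B z + vt z) + pucci_plus lam Lam (\<chi> k l. pd (sp l) (pd (sp k) B) z + D2v k l z) + \<bar>\<mu> z\<bar> * norm (\<chi> k. pd (sp k) B z + Dv k z) + f z \<le> - \<eta>0"
      using v(4)
    proof eventually_elim
      case (elim z)
      show ?case
      proof
        assume "z \<in> cone \<and> (snd z - 1/2 \<le> t0 \<longrightarrow> z \<in> N)"
        then have z: "fst z \<bullet> fst z < c * (snd z - 1/2)" "snd z - 1/2 \<le> \<sigma>" and zN: "snd z - 1/2 \<le> t0 \<Longrightarrow> z \<in> N"
          by (auto simp: cone_def c_def \<sigma>_def)
        note D = closed_cone_Qc[of z, folded c_def \<sigma>_def, OF less_imp_le[OF z(1)] z(2)]
        have y: "0 \<le> bY c z" "bY c z \<le> 1" unfolding bY_def using z D(4) inner_ge_zero[of "fst z"] by linarith+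
        let ?bt = "pd tm ?b z" and ?bP = "pucci_plus lam Lam (\<chi> k l. pd (sp l) (pd (sp k) ?b) z)"
        have bop: "?bt + ?bP \<le> (C1 - 8 * lam * (c * (snd z - 1/2))) * bE \<kappa> z"
          using barrier_operator[OF y(1), of \<kappa>] quad[of "bY c z"] E[of z] unfolding m_def
          by (smt (verit) mult_right_mono)
        have op: "?bt + ?bP \<le> (C1 + \<eta>1) * indicator N z - \<eta>1"
        proof (cases "snd z - 1/2 \<le> t0")
          case True
          have "0 \<le> 8 * lam * (c * (snd z - 1/2))" using lam c D(2) by simp
          then have "(C1 - 8 * lam * (c * (snd z - 1/2))) * bE \<kappa> z \<le> C1 * bE \<kappa> z"
            using E[of z] by (intro mult_right_mono) auto
          also have "\<dots> \<le> C1 * 1" using Eb[OF D(2)] C1 by (intro mult_left_mono) auto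
          finally show ?thesis using bop zN[OF True] by simp
        next
          case False
          have "8 * lam * (c * t0) \<le> 8 * lam * (c * (snd z - 1/2))"
            using lam c False by (intro mult_left_mono) auto
          moreover have "8 * lam * (c * t0) = 2 * C1" by (simp add: C1_def)
          ultimately have "C1 - 8 * lam * (c * (snd z - 1/2)) \<le> - C1" by linarith
          then have "(C1 - 8 * lam * (c * (snd z - 1/2))) * bE \<kappa> z \<le> - C1 * bE \<kappa> z"
            using E[of z] by (intro mult_right_mono) auto
          also have "\<dots> \<le> - \<eta>1" using Ee[OF z(2)] C1 by (simp add: \<eta>1_def)
          finally show ?thesis using bop C1 \<eta> by (simp add: indicator_def)
        qed
        have gradb: "norm (\<chi> k. pd (sp k) B z) \<le> 4"
        proof -
          have "(\<chi> k. pd (sp k) B z) = (- 4 * bY c z * bE \<kappa> z) *\<^sub>R fst z"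
            using B1[OF D(1)] by (simp add: vec_eq_iff pd_barrier_space)
          then have "norm (\<chi> k. pd (sp k) B z) = 4 * (bY c z * bE \<kappa> z) * norm (fst z)"
            using y E[of z] by (simp add: abs_mult)
          also have "\<dots> \<le> 4 * (1 * 1) * 1"
          proof (intro mult_mono)
            have "(norm (fst z))\<^sup>2 \<le> 1\<^sup>2" using D(3) by (simp add: power2_norm_eq_inner)
            then show "norm (fst z) \<le> 1" by (rule power2_le_imp_le) simp
          qed (use y Eb[OF D(2)] E[of z] in \<open>auto simp: less_imp_le\<close>)
          finally show ?thesis by simp
        qed
        have "norm (\<chi> k. pd (sp k) B z + Dv k z) \<le> norm (\<chi> k. pd (sp k) B z) + norm (\<chi> k. Dv k z)"
        proof -
          have "(\<chi> k. pd (sp k) B z + Dv k z) = (\<chi> k. pd (sp k) B z) + (\<chi> k. Dv k z)" by (simp add: vec_eq_iff)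
          then show ?thesis by (simp only: norm_triangle_ineq)
        qed
        then have "\<bar>\<mu> z\<bar> * norm (\<chi> k. pd (sp k) B z + Dv k z) \<le> \<bar>\<mu> z\<bar> * (4 + norm (\<chi> k. Dv k z))"
          using gradb by (intro mult_left_mono) auto
        moreover have "pucci_plus lam Lam (\<chi> k l. pd (sp l) (pd (sp k) B) z + D2v k l z) \<le> ?bP + pucci_plus lam Lam (\<chi> k l. D2v k l z)"
        proof -
          have "(\<chi> k l. pd (sp l) (pd (sp k) B) z + D2v k l z) = (\<chi> k l. pd (sp l) (pd (sp k) ?b) z) + (\<chi> k l. D2v k l z)"
            using B2[OF D(1)] by (simp add: vec_eq_iff)
          then show ?thesis by (simp only: pucci_add[OF lam])
        qed
        moreover have "g z = (C1 + \<eta>1) * indicator N z + 4 * \<bar>\<mu> z\<bar> + f z" using D(1) by (simp add: g_def)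
        moreover have "vt z + pucci_plus lam Lam (\<chi> k l. D2v k l z) + \<bar>\<mu> z\<bar> * norm (\<chi> k. Dv k z) \<le> - g z" using elim D(1) by blast
        moreover have "pd tm B z = ?bt" by (rule B1[OF D(1)])
        moreover have "\<eta>0 \<le> \<eta>1" by (simp add: \<eta>0_def)
        ultimately show "(pd tm B z + vt z) + pucci_plus lam Lam (\<chi> k l. pd (sp l) (pd (sp k) B) z + D2v k l z) + \<bar>\<mu> z\<bar> * norm (\<chi> k. pd (sp k) B z + Dv k z) + f z \<le> - \<eta>0"
          using op by (simp add: distrib_left)
      qed
    qed
    moreover have "\<forall>z\<in>cone. B z + v z \<le> 1"
    proof
      fix z :: "'n pt" assume "z \<in> cone"
      then have z: "fst z \<bullet> fst z \<le> c * (snd z - 1/2)" "snd z - 1/2 \<le> \<sigma>" by (auto simp: cone_def c_def \<sigma>_def)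
      show "B z + v z \<le> 1"
        using bval[OF z] Bb[OF closed_cone_Qc(1)[of z, folded c_def \<sigma>_def, OF z]] v(3)[rule_format, of z] by linarith
    qed
    moreover have "B z + v z \<le> 0" if "fst z \<bullet> fst z = cc TYPE('n) * (snd z - 1/2)" "snd z - 1/2 \<le> sg TYPE('n)" for z
    proof -
      have "B z = ?b z" by (rule Bb[OF closed_cone_Qc(1)]) (use that in auto)
      also have "\<dots> = 0" using that by (simp add: barrier_def bY_def c_def)
      finally show ?thesis using v(3)[rule_format, of z] by linarith
    qed
    moreover have "\<eta>0 \<le> B z + v z" if "fst z \<bullet> fst z \<le> cc TYPE('n) * (snd z - 1/2) / 2" "t0 \<le> snd z - 1/2" "snd z - 1/2 \<le> sg TYPE('n)" for z
    proof -
      have z: "fst z \<bullet> fst z \<le> c * (snd z - 1/2) / 2" "snd z - 1/2 \<le> \<sigma>" using that by (auto simp: c_def \<sigma>_def)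
      have ct: "c * t0 \<le> c * (snd z - 1/2)" "0 < c * t0" using that(2) c t0 by auto
      then have z': "fst z \<bullet> fst z \<le> c * (snd z - 1/2)" using z by linarith
      have "c * t0 / 2 \<le> bY c z" using z ct unfolding bY_def by linarith
      then have "(c * t0 / 2)\<^sup>2 \<le> (bY c z)\<^sup>2" using ct by (intro power_mono) auto
      then have "(c * t0 / 2)\<^sup>2 * e0 \<le> ?b z"
        unfolding barrier_def using Ee[OF z(2)] e0 by (intro mult_mono) auto
      then have "2 * \<eta>2 \<le> B z" using Bb[OF closed_cone_Qc(1)[of z, folded c_def \<sigma>_def, OF z' z(2)]] by (simp add: \<eta>2_def)
      moreover have "- \<eta>2 \<le> v z" using v(3)[rule_format, of z] Y(2) by linarith
      ultimately show ?thesis by (simp add: \<eta>0_def)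
    qed
    ultimately show ?thesis unfolding comparison_def by blast
  qed
  then show ?thesis using \<delta>(1) \<eta> by (intro exI[of _ \<delta>] exI[of _ \<eta>0] conjI allI impI) (auto simp: \<eta>0_def)
qed

end

section \<open>Growth of supersolutions\<close>

text \<open>\<open>Lim\<close> is informative only once the limit exists. Monotonicity makes it
  exist and equal the infimum, so any one radius gives an upper bound.\<close>

lemma mono_at_right_Lim:
  fixes g :: "real \<Rightarrow> ereal"
  assumes r: "0 < r" and mono: "\<And>a b. 0 < a \<Longrightarrow> a \<le> b \<Longrightarrow> b \<le> r \<Longrightarrow> g a \<le> g b"
  shows "Lim (at_right 0) g \<le> g r"
proof -
  let ?I = "INF a\<in>{0<..r}. g a"
  have "(g \<longlongrightarrow> ?I) (at_right 0)"
  proof (rule order_tendstoI)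
    fix a assume a: "a < ?I"
    have "a < g b" if "0 < b" "b < r" for b
      using a INF_lower[of b "{0<..r}" g] that by (auto intro: less_le_trans)
    then show "\<forall>\<^sub>F b in at_right 0. a < g b"
      using r by (auto simp: eventually_at_right_field intro!: exI[of _ r])
  next
    fix a assume "?I < a"
    then obtain b where b: "0 < b" "b \<le> r" "g b < a" by (auto simp: INF_less_iff)
    have "g c < a" if "0 < c" "c < b" for c
      using mono[of c b] that b by (auto intro: le_less_trans)
    then show "\<forall>\<^sub>F c in at_right 0. g c < a"
      using b by (auto simp: eventually_at_right_field intro!: exI[of _ b])
  qed
  then have "Lim (at_right 0) g = ?I" by (intro tendsto_Lim) (auto simp: trivial_limit_at_right_real)
  moreover have "?I \<le> g r" using r by (intro INF_lower) auto
  ultimately show ?thesis by simp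
qed

lemma pcyl_iff: "w \<in> pcyl r z \<longleftrightarrow> (\<forall>l. \<bar>fst w $ l - fst z $ l\<bar> < r) \<and> - (r\<^sup>2) < snd w - snd z \<and> snd w \<le> snd z"
proof -
  have "w \<in> pcyl r z \<longleftrightarrow> w - z \<in> box (vec (- r)) (vec r) \<times> {- (r\<^sup>2)<..0}"
  proof
    assume "w \<in> pcyl r z" then show "w - z \<in> box (vec (- r)) (vec r) \<times> {- (r\<^sup>2)<..0}" unfolding pcyl_def by auto
  next
    assume "w - z \<in> box (vec (- r)) (vec r) \<times> {- (r\<^sup>2)<..0}"
    then show "w \<in> pcyl r z" unfolding pcyl_def by (rule image_eqI[of w "(+) z" "w - z", rotated]) (simp only: add_diff_cancel_left' diff_add_cancel add.commute[of z])
  qed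
  moreover have "- r < x \<and> x < r \<longleftrightarrow> \<bar>x\<bar> < r" for x :: real by auto
  ultimately show ?thesis by (cases w; cases z) (simp add: mem_box_cart)
qed

lemma pcyl_mono: "0 \<le> r \<Longrightarrow> r \<le> r' \<Longrightarrow> pcyl r z \<subseteq> pcyl r' z"
proof
  fix w assume r: "0 \<le> r" "r \<le> r'" and w: "w \<in> pcyl r z"
  have "r\<^sup>2 \<le> r'\<^sup>2" using r by (intro power_mono) auto
  moreover have "\<bar>fst w $ l - fst z $ l\<bar> < r'" for l
    using w r by (auto simp: pcyl_iff intro: less_le_trans)
  ultimately show "w \<in> pcyl r' z" using w by (auto simp: pcyl_iff)
qed

lemma pcyl_borel: "pcyl r z \<in> sets borel"
proof -
  have "pcyl r z = {w. \<forall>l. \<bar>fst w $ l - fst z $ l\<bar> < r} \<inter> {w. - (r\<^sup>2) < snd w - snd z} \<inter> {w. snd w \<le> snd z}"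
    by (auto simp: pcyl_iff)
  moreover have 1: "open {w :: (real^'n) \<times> real. \<forall>l. \<bar>fst w $ l - fst z $ l\<bar> < r}" for z :: "(real^'n) \<times> real"
  proof -
    have "{w :: (real^'n) \<times> real. \<forall>l. \<bar>fst w $ l - fst z $ l\<bar> < r} = (\<Inter>l. {w. \<bar>fst w $ l - fst z $ l\<bar> < r})" by auto
    then show ?thesis by (auto intro!: open_INT open_Collect_less continuous_intros)
  qed
  moreover have 2: "open {w :: (real^'n) \<times> real. - (r\<^sup>2) < snd w - snd z}" for z :: "(real^'n) \<times> real"
    by (intro open_Collect_less continuous_intros)
  moreover have 3: "closed {w :: (real^'n) \<times> real. snd w \<le> snd z}" for z :: "(real^'n) \<times> real"
    by (intro closed_Collect_le continuous_intros)
  ultimately show ?thesis using sets.Int[OF sets.Int[OF borel_open[OF 1[of z]] borel_open[OF 2[of z]]] borel_closed[OF 3[of z]]] by simp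
qed

lemma pcyl_subset_ball:
  fixes z :: "(real^'n) \<times> real"
  assumes "0 < e" shows "\<exists>r>0. pcyl r z \<subseteq> ball z e"
proof -
  define r where "r = min 1 (e / (real CARD('n) + 2))"
  have r: "0 < r" "r \<le> 1" "r * (real CARD('n) + 2) \<le> e"
  proof -
    have "r * (real CARD('n) + 2) \<le> e / (real CARD('n) + 2) * (real CARD('n) + 2)"
      unfolding r_def by (intro mult_right_mono) auto
    then show "r * (real CARD('n) + 2) \<le> e" by simp
  qed (use assms in \<open>auto simp: r_def\<close>)
  have "w \<in> ball z e" if w: "w \<in> pcyl r z" for w
  proof -
    have "norm (fst w - fst z) \<le> (\<Sum>l\<in>UNIV. \<bar>(fst w - fst z) $ l\<bar>)" by (rule norm_le_l1_cart)
    also have "\<dots> \<le> (\<Sum>l\<in>(UNIV::'n set). r)" using w by (intro sum_mono) (auto simp: pcyl_iff intro: less_imp_le)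
    finally have 1: "norm (fst w - fst z) \<le> real CARD('n) * r" by simp
    have "r\<^sup>2 \<le> r * 1" unfolding power2_eq_square using r by (intro mult_left_mono) auto
    then have 2: "\<bar>snd w - snd z\<bar> \<le> r" using w by (auto simp: pcyl_iff)
    have "norm (w - z) \<le> norm (fst w - fst z) + norm (snd w - snd z)"
      using norm_Pair_le[of "fst w - fst z" "snd w - snd z"] by (simp add: minus_prod_def)
    also have "\<dots> \<le> real CARD('n) * r + r" using 1 2 by simp
    also have "\<dots> < e" using r by (simp add: algebra_simps)
    finally show ?thesis by (simp add: dist_norm norm_minus_commute)
  qed
  then show ?thesis using r by blast
qed

text \<open>For shrinking cylinders this is the monotonicity in the radius through which the limit
  in the viscosity definition is evaluated.\<close>

lemma esssup_subset:
  fixes h :: "'a::euclidean_space \<Rightarrow> ereal"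
  assumes A: "A \<in> sets lebesgue" "B \<in> sets lebesgue" "A \<subseteq> B" and h: "h \<in> borel_measurable (lebesgue_on B)"
  shows "esssup (lebesgue_on A) h \<le> esssup (lebesgue_on B) h"
proof (rule esssup_I)
  show "h \<in> borel_measurable (lebesgue_on A)" by (rule measurable_restrict_mono[OF h A(3)])
  have "AE x in lebesgue_on B. h x \<le> esssup (lebesgue_on B) h" by (rule esssup_AE)
  then have "AE x in lebesgue. x \<in> B \<longrightarrow> h x \<le> esssup (lebesgue_on B) h"
    using A by (subst (asm) AE_restrict_space_iff) auto
  then have "AE x in lebesgue. x \<in> A \<longrightarrow> h x \<le> esssup (lebesgue_on B) h"
    using A(3) by (auto elim!: eventually_mono)
  then show "AE x in lebesgue_on A. h x \<le> esssup (lebesgue_on B) h"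
    using A by (subst AE_restrict_space_iff) auto
qed

text \<open>The only way in which the viscosity inequality is used: a strict classical subsolution cannot touch
  a supersolution from below.\<close>

lemma no_touching:
  fixes u \<phi> :: "(real^'n) \<times> real \<Rightarrow> real"
  assumes visc: "Lp_viscosity_supersolution p \<Omega> T (\<lambda>z \<xi> X. pucci_plus lam Lam X + \<mu> z * norm \<xi> + f z) u"
    and lam: "0 < lam" "lam \<le> Lam"
    and S: "Sob p \<phi> \<phi>t D\<phi> D2\<phi>" and c: "continuous_on UNIV \<phi>" and z: "z \<in> cylinder \<Omega> T"
    and r: "0 < r" "pcyl r z \<subseteq> cylinder \<Omega> T" "\<And>w. w \<in> pcyl r z \<Longrightarrow> u z - \<phi> z \<le> u w - \<phi> w"
    and mf: "\<mu> \<in> borel_measurable (lebesgue_on (cylinder \<Omega> T))" "f \<in> borel_measurable (lebesgue_on (cylinder \<Omega> T))"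
    and ae: "AE w in lborel. w \<in> pcyl r z \<longrightarrow> \<phi>t w + (pucci_plus lam Lam (\<chi> k l. D2\<phi> k l w) + \<mu> w * norm (\<chi> k. D\<phi> k w) + f w) \<le> - e"
    and e: "0 < e"
  shows False
proof -
  define h where "h w = \<phi>t w + (pucci_plus lam Lam (\<chi> k l. D2\<phi> k l w) + \<mu> w * norm ((\<chi> k. D\<phi> k w) :: real^'n) + f w)" for w
  let ?g = "\<lambda>\<epsilon>. esssup (lebesgue_on (pcyl \<epsilon> z)) (\<lambda>w. ereal (h w))"
  have lim: "0 \<le> Lim (at_right 0) ?g"
    using visc[unfolded Lp_viscosity_supersolution_def, THEN conjunct2, rule_format, OF z Sob_W21_loc[OF S] continuous_on_subset[OF c subset_UNIV]
        exI[of _ r], OF conjI, OF r(1) conjI, OF r(2) ballI, OF r(3)]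
    unfolding h_def by simp
  have pl: "pcyl \<epsilon> z \<in> sets lebesgue" for \<epsilon> by (intro sets_completionI_sets) (simp add: pcyl_borel)
  have mh: "h \<in> borel_measurable (lebesgue_on (pcyl r z))"
  proof -
    have b: "g \<in> borel_measurable (lebesgue_on (pcyl r z))" if "g \<in> borel_fun" for g :: "'n pt \<Rightarrow> real"
      by (intro measurable_restrict_space1 measurable_completion) (use that in simp)
    have [measurable]: "D\<phi> k \<in> borel_fun" "D2\<phi> k l \<in> borel_fun" "\<phi>t \<in> borel_fun" for k l
      using SobD[OF S] by auto
    have v: "(\<lambda>w. (\<chi> k. D\<phi> k w) :: real^'n) \<in> borel_fun"
      by (rule borel_measurable_vec_lambda_comp) measurable
    have D: "(\<lambda>w. norm ((\<chi> k. D\<phi> k w) :: real^'n)) \<in> borel_fun"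
      using v by measurable
    have "(\<lambda>w. (\<chi> k l. D2\<phi> k l w) :: real^'n^'n) \<in> borel_fun"
    proof (rule borel_measurable_euclidean_space[THEN iffD2], rule ballI)
      fix i :: "real^'n^'n" assume "i \<in> Basis"
      then obtain k l where "i = axis k (axis l 1)" by (auto simp: Basis_vec_def)
      then show "(\<lambda>w. (\<chi> k l. D2\<phi> k l w) \<bullet> i) \<in> borel_fun" by (simp add: inner_axis)
    qed
    from measurable_compose[OF this pucci_borel[OF lam]]
    have P: "(\<lambda>w. pucci_plus lam Lam (\<chi> k l. D2\<phi> k l w)) \<in> borel_fun" .
    have m: "\<mu> \<in> borel_measurable (lebesgue_on (pcyl r z))" "f \<in> borel_measurable (lebesgue_on (pcyl r z))"
      using measurable_restrict_mono[OF _ r(2)] mf by auto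
    show ?thesis unfolding h_def[abs_def]
      by (intro borel_measurable_add borel_measurable_times b[OF P] b[OF D] b[OF SobD(2)[OF S]] m)
  qed
  have "Lim (at_right 0) ?g \<le> ?g r"
  proof (rule mono_at_right_Lim[OF r(1)])
    fix a b :: real assume ab: "0 < a" "a \<le> b" "b \<le> r"
    show "?g a \<le> ?g b"
    proof (rule esssup_subset[OF pl pl pcyl_mono])
      have "h \<in> borel_measurable (lebesgue_on (pcyl b z))"
        by (rule measurable_restrict_mono[OF mh pcyl_mono]) (use ab in auto)
      then show "(\<lambda>w. ereal (h w)) \<in> borel_measurable (lebesgue_on (pcyl b z))" by measurable
    qed (use ab in auto)
  qed
  also have "?g r \<le> ereal (- e)"
  proof (rule esssup_I)
    show "(\<lambda>w. ereal (h w)) \<in> borel_measurable (lebesgue_on (pcyl r z))" using mh by measurable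
    have "AE w in lebesgue. w \<in> pcyl r z \<longrightarrow> ereal (h w) \<le> ereal (- e)"
      using AE_completion[OF ae] unfolding h_def by (auto elim!: eventually_mono)
    then show "AE w in lebesgue_on (pcyl r z). ereal (h w) \<le> ereal (- e)"
      using pl by (subst AE_restrict_space_iff) auto
  qed
  also have "ereal (- e) < 0" using e by simp
  finally show False using lim by simp
qed

section \<open>Growth at arbitrary position, scale and level\<close>

abbreviation (input) \<Omega>10 :: "(real^'n) set" where "\<Omega>10 \<equiv> box (vec (- 10)) (vec 10)"
abbreviation (input) Q10 :: "((real^'n) \<times> real) set" where "Q10 \<equiv> cylinder \<Omega>10 10"

lemma Q10_iff: "z \<in> Q10 \<longleftrightarrow> fst z \<in> \<Omega>10 \<and> 0 < snd z \<and> snd z \<le> 10"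
  by (cases z) (auto simp: cylinder_def)

lemma Q10_borel: "(Q10 :: ((real^'n) \<times> real) set) \<in> sets borel"
  unfolding cylinder_def by (simp add: borel_Times)

lemma Q10_lebesgue: "(Q10 :: ((real^'n) \<times> real) set) \<in> sets lebesgue"
  by (intro sets_completionI_sets) (simp add: Q10_borel)

definition supersol where
  "supersol lam Lam p \<mu> f (u :: (real^'n) \<times> real \<Rightarrow> real) \<longleftrightarrow> in_Lp_plus p Q10 f \<and> (\<forall>z\<in>Q10. 0 \<le> u z)
    \<and> Lp_viscosity_supersolution p \<Omega>10 10 (\<lambda>z \<xi> X. pucci_plus lam Lam X + \<mu> z * norm \<xi> + f z) u"

text \<open>The premises on \<open>\<mu>\<close> and \<open>f\<close> make the coefficients small
  after rescaling to unit size and level 1, and the exceptional set is measured against R^(n + 2).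
  The condition on x keeps the paraboloid inside the domain laterally; it may leave the domain
  through the top.\<close>

definition grows where
  "grows p q t0 \<delta> \<eta> \<mu> f (u :: (real^'n) \<times> real \<Rightarrow> real) \<longleftrightarrow> (\<forall>R x0 a0 L.
    0 < R \<longrightarrow> R \<le> 1 \<longrightarrow> 0 < L \<longrightarrow> R powr (1 - hdim TYPE('n) / q) * Lp_norm q Q10 \<mu> \<le> \<delta> \<longrightarrow>
    Lp_norm p Q10 f \<le> \<delta> * L \<longrightarrow> 0 < a0 \<longrightarrow>
    (\<forall>x. (x - x0) \<bullet> (x - x0) \<le> cc TYPE('n) * sg TYPE('n) * R\<^sup>2 \<longrightarrow> x \<in> \<Omega>10) \<longrightarrow>
    vol {z \<in> Q10. (fst z - x0) \<bullet> (fst z - x0) < cc TYPE('n) * (snd z - a0) \<and> snd z - a0 \<le> t0 * R\<^sup>2 \<and> u z < L}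
      \<le> ennreal (\<delta> powr p * R ^ (CARD('n) + 2)) \<longrightarrow>
    (\<forall>z\<in>Q10. (fst z - x0) \<bullet> (fst z - x0) \<le> cc TYPE('n) * (snd z - a0) / 2 \<and> t0 * R\<^sup>2 \<le> snd z - a0
      \<and> snd z - a0 \<le> sg TYPE('n) * R\<^sup>2 \<longrightarrow> \<eta> * L \<le> u z))"

context
  fixes lam Lam p q p1 :: real and dummy :: "'n::finite itself"
  assumes lam: "0 < lam" "lam \<le> Lam" and abp: "ABP_exponent TYPE('n) lam Lam p1" and pp: "p1 < p"
    and pq: "p \<le> q" and q: "hdim TYPE('n) < q"
begin

text \<open>Suppose the bound fails, and minimise u - \<phi> over the closed truncated paraboloid,
  \<phi> being the rescaled comparison function. The minimum is negative, so it is not attained on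
  the lateral boundary, where \<phi> \<le> 0 \<le> u; and at the minimum u < \<phi> \<le> L. By
  continuity u < L nearby, so a backward cylinder lies where \<phi> is a strict subsolution, against
  \<open>no_touching\<close>.\<close>

theorem growth:
  fixes t0 :: real
  assumes t0: "0 < t0"
  shows "\<exists>\<delta>>0. \<exists>\<eta>>0. \<forall>\<mu> f u. in_Lp q Q10 (\<mu> :: (real^'n) \<times> real \<Rightarrow> real) \<longrightarrow> supersol lam Lam p \<mu> f u \<longrightarrow> grows p q t0 \<delta> \<eta> \<mu> f u"
proof -
  note p = p_ge[OF lam abp pp pq q]
  \<comment> \<open>Since p > p1 \<ge> (n + 2) / 2, the exponent 2 - (n + 2) / p is nonnegative, and
    scaling to unit size does not increase the norm of \<open>f\<close>.\<close>
  have p2: "hdim TYPE('n) / p \<le> 2"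
  proof -
    have "(real CARD('n) + 2) / 2 \<le> p1" using abp unfolding ABP_exponent_def by (rule conjunct1)
    then show ?thesis using pp p by (simp add: hdim_def field_simps)
  qed
  define c where "c = cc TYPE('n)"
  define \<sigma> where "\<sigma> = sg TYPE('n)"
  have c: "16 \<le> c" "0 < \<sigma>" using cc_sg(1,2)[where 'n='n] by (auto simp: c_def \<sigma>_def)
  obtain \<delta> \<eta> where \<delta>: "0 < \<delta>" and \<eta>: "0 < \<eta>" and comp: "\<forall>\<mu> f N. (\<mu> :: 'n pt \<Rightarrow> real) \<in> borel_fun \<and> Np_le q \<mu> \<delta>
      \<and> f \<in> borel_fun \<and> (\<forall>z. 0 \<le> f z) \<and> Np_le p f \<delta> \<and> N \<in> sets borel \<and> vol N \<le> ennreal (\<delta> powr p) \<longrightarrow> comparison lam Lam p t0 \<eta> \<mu> f N"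
    using comparison_function[OF lam abp pp pq q t0] by (elim exE conjE)
  show ?thesis
  proof (rule exI[of _ \<delta>], intro conjI \<delta>, rule exI[of _ \<eta>], intro conjI allI impI \<eta>, unfold grows_def, intro allI impI ballI; (elim conjE)?)
    fix \<mu> f u :: "'n pt \<Rightarrow> real" and R x0 a0 L and z1 :: "'n pt"
    assume \<mu>: "in_Lp q Q10 \<mu>" and ss: "supersol lam Lam p \<mu> f u"
      and R: "0 < R" "R \<le> 1" and L: "0 < L" and \<mu>n: "R powr (1 - hdim TYPE('n) / q) * Lp_norm q Q10 \<mu> \<le> \<delta>"
      and fn: "Lp_norm p Q10 f \<le> \<delta> * L" and a0: "0 < a0"
      and dom: "\<forall>x. (x - x0) \<bullet> (x - x0) \<le> cc TYPE('n) * sg TYPE('n) * R\<^sup>2 \<longrightarrow> x \<in> \<Omega>10"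
      and meas: "vol {z \<in> Q10. (fst z - x0) \<bullet> (fst z - x0) < cc TYPE('n) * (snd z - a0) \<and> snd z - a0 \<le> t0 * R\<^sup>2 \<and> u z < L}
      \<le> ennreal (\<delta> powr p * R ^ (CARD('n) + 2))"
      and z1: "z1 \<in> Q10" "(fst z1 - x0) \<bullet> (fst z1 - x0) \<le> cc TYPE('n) * (snd z1 - a0) / 2" "t0 * R\<^sup>2 \<le> snd z1 - a0"
        "snd z1 - a0 \<le> sg TYPE('n) * R\<^sup>2"
    have f: "in_Lp_plus p Q10 f" and u0: "\<forall>z\<in>Q10. 0 \<le> u z"
      and visc: "Lp_viscosity_supersolution p \<Omega>10 10 (\<lambda>z \<xi> X. pucci_plus lam Lam X + \<mu> z * norm \<xi> + f z) u"
      using ss by (auto simp: supersol_def)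
    have R2: "0 < R\<^sup>2" and R1: "1 / R \<noteq> 0" using R by simp_all
    have uc: "continuous_on Q10 u" using visc by (simp add: Lp_viscosity_supersolution_def)
    obtain \<mu>1 where \<mu>1 [measurable]: "\<mu>1 \<in> borel_fun" and \<mu>1e: "AE z in lborel. \<mu>1 z = indicator Q10 z * \<mu> z"
      "Np q \<mu>1 = ennreal (Lp_norm q Q10 \<mu> powr q)"
      using in_Lp_version[OF \<mu> Q10_lebesgue] p pq by auto
    obtain f1 where f1 [measurable]: "f1 \<in> borel_fun" and f1e: "AE z in lborel. f1 z = indicator Q10 z * f z"
      "Np p f1 = ennreal (Lp_norm p Q10 f powr p)"
      using in_Lp_version[OF _ Q10_lebesgue, of p f] f p by (auto simp: in_Lp_plus_def)
    let ?W = "(x0, a0 - R\<^sup>2 / 2)"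
    let ?V = "(- (1 / R) *\<^sub>R x0, 1/2 - a0 / R\<^sup>2)"
    \<comment> \<open>\<open>Sc\<close> carries the paraboloid with vertex (x0, a0) and size R to
      the model with vertex (0, 1/2); \<open>Tc\<close> is its inverse.\<close>
    define Sc where "Sc = psc (1 / R) ?V"
    define Tc where "Tc = psc R ?W"
    have TS: "Tc (Sc z) = z" for z
      using R by (simp add: Tc_def Sc_def psc_def prod_eq_iff algebra_simps power_divide)
    have ST: "Sc (Tc y) = y" for y
      using R by (simp add: Tc_def Sc_def psc_def prod_eq_iff algebra_simps power_divide)
    have Sf: "R *\<^sub>R fst (Sc z) = fst z - x0" "R\<^sup>2 * (snd (Sc z) - 1/2) = snd z - a0" for z
      using R by (simp_all add: Sc_def psc_def algebra_simps power_divide)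
    have Sf1: "R\<^sup>2 * (fst (Sc z) \<bullet> fst (Sc z)) = (fst z - x0) \<bullet> (fst z - x0)" for z
      unfolding Sf(1)[symmetric] by (simp add: power2_eq_square)
    have Sc_le: "fst (Sc z) \<bullet> fst (Sc z) \<le> k * (snd (Sc z) - 1/2) \<longleftrightarrow> (fst z - x0) \<bullet> (fst z - x0) \<le> k * (snd z - a0)"
      "fst (Sc z) \<bullet> fst (Sc z) < k * (snd (Sc z) - 1/2) \<longleftrightarrow> (fst z - x0) \<bullet> (fst z - x0) < k * (snd z - a0)"
      "snd (Sc z) - 1/2 \<le> s \<longleftrightarrow> snd z - a0 \<le> s * R\<^sup>2" "s \<le> snd (Sc z) - 1/2 \<longleftrightarrow> s * R\<^sup>2 \<le> snd z - a0" for z k s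
    proof -
      have "fst (Sc z) \<bullet> fst (Sc z) \<le> k * (snd (Sc z) - 1/2) \<longleftrightarrow> R\<^sup>2 * (fst (Sc z) \<bullet> fst (Sc z)) \<le> R\<^sup>2 * (k * (snd (Sc z) - 1/2))"
        using R2 by simp
      moreover have "fst (Sc z) \<bullet> fst (Sc z) < k * (snd (Sc z) - 1/2) \<longleftrightarrow> R\<^sup>2 * (fst (Sc z) \<bullet> fst (Sc z)) < R\<^sup>2 * (k * (snd (Sc z) - 1/2))"
        using R2 by simp
      moreover have e: "R\<^sup>2 * (k * (snd (Sc z) - 1/2)) = k * (snd z - a0)" unfolding Sf(2)[symmetric] by simp
      ultimately show "fst (Sc z) \<bullet> fst (Sc z) \<le> k * (snd (Sc z) - 1/2) \<longleftrightarrow> (fst z - x0) \<bullet> (fst z - x0) \<le> k * (snd z - a0)"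
        "fst (Sc z) \<bullet> fst (Sc z) < k * (snd (Sc z) - 1/2) \<longleftrightarrow> (fst z - x0) \<bullet> (fst z - x0) < k * (snd z - a0)"
        unfolding Sf1 e by blast+
      show "snd (Sc z) - 1/2 \<le> s \<longleftrightarrow> snd z - a0 \<le> s * R\<^sup>2" "s \<le> snd (Sc z) - 1/2 \<longleftrightarrow> s * R\<^sup>2 \<le> snd z - a0"
        unfolding Sf(2)[symmetric] using R2 by (simp_all add: mult.commute[of _ "R\<^sup>2"] del: Sf)
    qed
    define N0 where "N0 = {z \<in> Q10. (fst z - x0) \<bullet> (fst z - x0) < c * (snd z - a0) \<and> snd z - a0 \<le> t0 * R\<^sup>2 \<and> u z < L}"
    obtain U where U: "open U" "{z \<in> Q10. u z < L} = Q10 \<inter> U"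
    proof -
      have "openin (top_of_set Q10) (Q10 \<inter> u -` {..<L})"
        using uc by (simp add: continuous_openin_preimage_gen)
      then obtain U where "open U" "Q10 \<inter> u -` {..<L} = Q10 \<inter> U" by (auto simp: openin_open)
      then show ?thesis using that[of U] by (auto simp: vimage_def)
    qed
    have N0b [measurable]: "N0 \<in> sets borel"
    proof -
      have "N0 = (Q10 \<inter> U) \<inter> {z. (fst z - x0) \<bullet> (fst z - x0) < c * (snd z - a0)} \<inter> {z. snd z - a0 \<le> t0 * R\<^sup>2}"
        unfolding U(2)[symmetric] N0_def by auto
      moreover have 1: "open {z. (fst z - x0) \<bullet> (fst z - x0) < c * (snd z - a0)}"
        by (intro open_Collect_less continuous_intros)
      moreover have 2: "closed {z :: 'n pt. snd z - a0 \<le> t0 * R\<^sup>2}"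
        by (intro closed_Collect_le continuous_intros)
      ultimately show ?thesis using sets.Int[OF sets.Int[OF sets.Int[OF Q10_borel borel_open[OF U(1)]] borel_open[OF 1]] borel_closed[OF 2]] by simp
    qed
    \<comment> \<open>Coefficients after division by L / R^2, the factor of the second-order part.
      The gradient scales with L / R only, hence the factor R on the drift.\<close>
    define \<mu>u where "\<mu>u y = R * \<mu>1 (Tc y)" for y
    define fu where "fu y = (R\<^sup>2 / L) * \<bar>f1 (Tc y)\<bar>" for y
    define N where "N = {y. Tc y \<in> N0}"
    have Tb [measurable]: "Tc \<in> borel_fun" unfolding Tc_def by simp
    have mN: "N \<in> sets borel"
      using measurable_sets[OF Tb N0b] by (simp add: N_def vimage_def)
    have Rn: "R ^ (CARD('n) + 2) = R powr hdim TYPE('n)"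
      using R by (simp add: hdim_def powr_add powr_realpow power2_eq_square)
    have scale: "Np s (\<lambda>y. k * h (Tc y)) = ennreal ((k * R powr (- hdim TYPE('n) / s) * Y) powr s)"
      if [measurable]: "h \<in> borel_fun" and hn: "Np s h = ennreal (Y powr s)" and Y: "0 \<le> Y" and k: "0 \<le> k" and s: "0 < s" for h s k Y
    proof -
      have "ennreal (R powr hdim TYPE('n)) * Np s (\<lambda>y. h (Tc y)) = ennreal (Y powr s)"
        using Np_psc[of h R s ?W] R hn unfolding Tc_def by (simp add: Rn[symmetric])
      then have "ennreal (R powr (- hdim TYPE('n))) * (ennreal (R powr hdim TYPE('n)) * Np s (\<lambda>y. h (Tc y))) = ennreal (R powr (- hdim TYPE('n)) * Y powr s)"
        by (simp add: ennreal_mult)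
      then have "Np s (\<lambda>y. h (Tc y)) = ennreal (R powr (- hdim TYPE('n)) * Y powr s)"
        using R by (simp add: mult.assoc[symmetric] ennreal_mult[symmetric] powr_add[symmetric])
      then have "Np s (\<lambda>y. k * h (Tc y)) = ennreal (k powr s * (R powr (- hdim TYPE('n)) * Y powr s))"
        using k by (subst Np_cmult) (auto simp: ennreal_mult)
      also have "k powr s * (R powr (- hdim TYPE('n)) * Y powr s) = (k * R powr (- hdim TYPE('n) / s) * Y) powr s"
        using k Y R s by (simp add: powr_mult powr_powr)
      finally show ?thesis .
    qed
    have n1: "Np_le q \<mu>u \<delta>"
    proof -
      have "Np q \<mu>u = ennreal ((R * R powr (- hdim TYPE('n) / q) * Lp_norm q Q10 \<mu>) powr q)"
        unfolding \<mu>u_def[abs_def] by (rule scale) (use \<mu>1e R p pq Lp_norm_nonneg in auto)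
      moreover have "R * R powr (- hdim TYPE('n) / q) = R powr (1 - hdim TYPE('n) / q)"
        using R powr_add[of R 1 "- hdim TYPE('n) / q"] by simp
      ultimately show ?thesis
        using \<mu>n R p pq Lp_norm_nonneg[of q Q10 \<mu>] by (auto intro!: ennreal_leI powr_mono2)
    qed
    have n2: "Np_le p fu \<delta>"
    proof -
      have "Np p (\<lambda>z. \<bar>f1 z\<bar>) = ennreal (Lp_norm p Q10 f powr p)" using f1e(2) by (simp add: Np_def)
      then have "Np p fu = ennreal ((R\<^sup>2 / L * R powr (- hdim TYPE('n) / p) * Lp_norm p Q10 f) powr p)"
        unfolding fu_def[abs_def] by (intro scale) (use R L p Lp_norm_nonneg in auto)
      moreover have "R\<^sup>2 / L * R powr (- hdim TYPE('n) / p) * Lp_norm p Q10 f \<le> \<delta>"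
      proof -
        have "R\<^sup>2 * R powr (- hdim TYPE('n) / p) = R powr (2 - hdim TYPE('n) / p)"
          using R powr_add[of R 2 "- hdim TYPE('n) / p"] by simp
        also have "\<dots> \<le> 1" using R p2 by (intro powr_le1) auto
        finally have "(R\<^sup>2 * R powr (- hdim TYPE('n) / p)) * Lp_norm p Q10 f \<le> 1 * (\<delta> * L)"
          using fn Lp_norm_nonneg[of p Q10 f] by (intro mult_mono) auto
        then have "(R\<^sup>2 * R powr (- hdim TYPE('n) / p)) * Lp_norm p Q10 f / L \<le> \<delta>"
          using L by (simp add: field_simps)
        then show ?thesis by simp
      qed
      ultimately show ?thesis
        using R L p Lp_norm_nonneg[of p Q10 f] by (auto intro!: ennreal_leI powr_mono2)
    qed
    have n3: "vol N \<le> ennreal (\<delta> powr p)"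
    proof -
      have "vol N0 = (\<integral>\<^sup>+z. indicator N0 z \<partial>lborel)" by simp
      also have "\<dots> = ennreal (R ^ (CARD('n) + 2)) * (\<integral>\<^sup>+y. indicator N0 (Tc y) \<partial>lborel)"
        using nn_integral_psc[of "indicator N0" R ?W] R unfolding Tc_def by simp
      also have "(\<integral>\<^sup>+y. indicator N0 (Tc y) \<partial>lborel) = (\<integral>\<^sup>+y. indicator N y \<partial>lborel)"
        by (intro nn_integral_cong) (auto simp: N_def indicator_def)
      also have "\<dots> = vol N" using mN by simp
      finally have "ennreal (R ^ (CARD('n) + 2)) * vol N = vol N0" ..
      also have "\<dots> \<le> ennreal (R ^ (CARD('n) + 2)) * ennreal (\<delta> powr p)"
        using meas R unfolding N0_def c_def by (simp add: ennreal_mult mult.commute)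
      finally show ?thesis using R by (subst (asm) ennreal_mult_le_mult_iff) auto
    qed
    obtain \<Phi> \<Phi>t D\<Phi> D2\<Phi> where \<Phi>: "Sob p (\<Phi> :: 'n pt \<Rightarrow> real) \<Phi>t D\<Phi> D2\<Phi>" "continuous_on UNIV \<Phi>"
      "AE z in lborel. z \<in> cone \<and> (snd z - 1/2 \<le> t0 \<longrightarrow> z \<in> N) \<longrightarrow>
            \<Phi>t z + pucci_plus lam Lam (\<chi> k l. D2\<Phi> k l z) + \<bar>\<mu>u z\<bar> * norm (\<chi> k. D\<Phi> k z) + fu z \<le> - \<eta>"
      "\<forall>z\<in>cone. \<Phi> z \<le> 1"
      "\<forall>z. fst z \<bullet> fst z = cc TYPE('n) * (snd z - 1/2) \<and> snd z - 1/2 \<le> sg TYPE('n) \<longrightarrow> \<Phi> z \<le> 0"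
      "\<forall>z. fst z \<bullet> fst z \<le> cc TYPE('n) * (snd z - 1/2) / 2 \<and> t0 \<le> snd z - 1/2 \<and> snd z - 1/2 \<le> sg TYPE('n) \<longrightarrow> \<eta> \<le> \<Phi> z"
    proof -
      have "\<mu>u \<in> borel_fun" "fu \<in> borel_fun" unfolding \<mu>u_def[abs_def] fu_def[abs_def] by measurable
      moreover have "\<forall>y. 0 \<le> fu y" using L by (simp add: fu_def)
      ultimately show ?thesis using that comp[rule_format, of \<mu>u fu N] n1 n2 n3 mN unfolding comparison_def by blast
    qed
    define \<phi> where "\<phi> z = L * \<Phi> (Sc z)" for z
    have S\<phi>: "Sob p \<phi> (\<lambda>z. L * ((1 / R)\<^sup>2 * \<Phi>t (Sc z))) (\<lambda>k z. L * ((1 / R) * D\<Phi> k (Sc z))) (\<lambda>k l z. L * ((1 / R)\<^sup>2 * D2\<Phi> k l (Sc z)))"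
      unfolding \<phi>_def[abs_def] Sc_def by (rule Sob_cmult[OF Sob_psc[OF \<Phi>(1)]]) (use R in simp)
    have \<phi>c: "continuous_on UNIV \<phi>"
      unfolding \<phi>_def[abs_def] Sc_def
      by (intro continuous_on_mult continuous_on_const continuous_on_compose2[OF \<Phi>(2) psc_continuous]) simp
    show "\<eta> * L \<le> u z1"
    proof (rule ccontr)
      assume neg: "\<not> \<eta> * L \<le> u z1"
      \<comment> \<open>Cut at time 10, the top of the domain, so that the minimum is taken inside
        it even if the paraboloid is taller.\<close>
      define Dc where "Dc = {z. (fst z - x0) \<bullet> (fst z - x0) \<le> c * (snd z - a0) \<and> snd z - a0 \<le> \<sigma> * R\<^sup>2 \<and> snd z \<le> 10}"
      have DcQ: "z \<in> Q10" "(fst z - x0) \<bullet> (fst z - x0) \<le> c * \<sigma> * R\<^sup>2" "0 \<le> snd z - a0" if "z \<in> Dc" for z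
      proof -
        have z: "(fst z - x0) \<bullet> (fst z - x0) \<le> c * (snd z - a0)" "snd z - a0 \<le> \<sigma> * R\<^sup>2" "snd z \<le> 10" using that by (auto simp: Dc_def)
        have "0 \<le> c * (snd z - a0)" using z(1) inner_ge_zero[of "fst z - x0"] by linarith
        then show s: "0 \<le> snd z - a0" using c by (simp add: zero_le_mult_iff)
        have "c * (snd z - a0) \<le> c * (\<sigma> * R\<^sup>2)" using z(2) c by (intro mult_left_mono) auto
        then show r: "(fst z - x0) \<bullet> (fst z - x0) \<le> c * \<sigma> * R\<^sup>2" using z(1) by (simp add: mult.assoc)
        then have "fst z \<in> \<Omega>10" using dom by (simp add: c_def \<sigma>_def)
        then show "z \<in> Q10" using s a0 z(3) by (auto simp: Q10_iff)
      qed
      have "compact Dc"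
        unfolding compact_eq_bounded_closed
      proof
        have "closed {z. (fst z - x0) \<bullet> (fst z - x0) \<le> c * (snd z - a0)}" "closed {z :: 'n pt. snd z - a0 \<le> \<sigma> * R\<^sup>2}" "closed {z :: 'n pt. snd z \<le> 10}"
          by (intro closed_Collect_le continuous_intros)+
        then have "closed ({z. (fst z - x0) \<bullet> (fst z - x0) \<le> c * (snd z - a0)} \<inter> {z. snd z - a0 \<le> \<sigma> * R\<^sup>2} \<inter> {z. snd z \<le> 10})" by auto
        moreover have "Dc = {z. (fst z - x0) \<bullet> (fst z - x0) \<le> c * (snd z - a0)} \<inter> {z. snd z - a0 \<le> \<sigma> * R\<^sup>2} \<inter> {z. snd z \<le> 10}"
          by (auto simp: Dc_def)
        ultimately show "closed Dc" by simp
        have "Dc \<subseteq> \<Omega>10 \<times> {0..10}" using DcQ(1) by (fastforce simp: Q10_iff)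
        then show "bounded Dc" using bounded_Times[OF bounded_box bounded_closed_interval] bounded_subset by blast
      qed
      moreover have z1D: "z1 \<in> Dc"
      proof -
        have "0 < t0 * R\<^sup>2" using t0 R2 by (rule mult_pos_pos)
        then have "0 \<le> c * (snd z1 - a0)" using c z1(3) by (intro mult_nonneg_nonneg) linarith+
        then show ?thesis using z1 by (auto simp: Dc_def c_def \<sigma>_def Q10_iff)
      qed
      moreover have "continuous_on Dc (\<lambda>z. u z - \<phi> z)"
        using DcQ(1) by (intro continuous_on_diff continuous_on_subset[OF uc] continuous_on_subset[OF \<phi>c]) auto
      ultimately obtain zm where zm: "zm \<in> Dc" "\<And>z. z \<in> Dc \<Longrightarrow> u zm - \<phi> zm \<le> u z - \<phi> z"
        using continuous_attains_inf[of Dc "\<lambda>z. u z - \<phi> z"] by blast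
      have zmQ: "zm \<in> Q10" by (rule DcQ(1)[OF zm(1)])
      have "\<eta> \<le> \<Phi> (Sc z1)"
      proof -
        have "(fst z1 - x0) \<bullet> (fst z1 - x0) \<le> (c / 2) * (snd z1 - a0)" using z1(2) by (simp add: c_def)
        then have "fst (Sc z1) \<bullet> fst (Sc z1) \<le> (c / 2) * (snd (Sc z1) - 1/2)" unfolding Sc_le .
        moreover have "t0 \<le> snd (Sc z1) - 1/2" "snd (Sc z1) - 1/2 \<le> sg TYPE('n)" unfolding Sc_le using z1(3,4) .
        ultimately show ?thesis using \<Phi>(6)[rule_format, of "Sc z1"] by (simp add: c_def)
      qed
      then have "L * \<eta> \<le> \<phi> z1" using L by (simp add: \<phi>_def)
      then have less: "u zm < \<phi> zm" using zm(2)[OF z1D] neg by (simp add: mult.commute)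
      have zmc: "Sc zm \<in> cone" "(fst zm - x0) \<bullet> (fst zm - x0) < c * (snd zm - a0)"
      proof -
        show lt: "(fst zm - x0) \<bullet> (fst zm - x0) < c * (snd zm - a0)"
        proof (rule ccontr)
          assume "\<not> (fst zm - x0) \<bullet> (fst zm - x0) < c * (snd zm - a0)"
          then have "fst (Sc zm) \<bullet> fst (Sc zm) \<le> c * (snd (Sc zm) - 1/2)" "\<not> fst (Sc zm) \<bullet> fst (Sc zm) < c * (snd (Sc zm) - 1/2)" "snd (Sc zm) - 1/2 \<le> \<sigma>"
            unfolding Sc_le using zm(1) by (auto simp: Dc_def)
          then have "\<Phi> (Sc zm) \<le> 0" using \<Phi>(5)[rule_format, of "Sc zm"] unfolding c_def \<sigma>_def by auto
          then have "\<phi> zm \<le> 0" using L by (simp add: \<phi>_def mult_nonneg_nonpos)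
          then show False using less u0 zmQ by force
        qed
        show "Sc zm \<in> cone" unfolding cone_def mem_Collect_eq c_def[symmetric] \<sigma>_def[symmetric] Sc_le using lt zm(1) by (auto simp: Dc_def)
      qed
      have "\<Phi> (Sc zm) \<le> 1" using \<Phi>(4) zmc(1) by blast
      then have "\<phi> zm \<le> L" using L by (simp add: \<phi>_def mult_left_le)
      then have "zm \<in> U" using less zmQ U(2) by fastforce
      then have "zm \<in> U \<inter> {z. (fst z - x0) \<bullet> (fst z - x0) < c * (snd z - a0)}" using zmc(2) by simp
      moreover have "open (U \<inter> {z. (fst z - x0) \<bullet> (fst z - x0) < c * (snd z - a0)})"
        by (intro open_Int U open_Collect_less continuous_intros)
      ultimately obtain e where "0 < e" "ball zm e \<subseteq> U \<inter> {z. (fst z - x0) \<bullet> (fst z - x0) < c * (snd z - a0)}"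
        using open_contains_ball[THEN iffD1] by blast
      then obtain r where r: "0 < r" "pcyl r zm \<subseteq> U \<inter> {z. (fst z - x0) \<bullet> (fst z - x0) < c * (snd z - a0)}"
        using pcyl_subset_ball[of e zm] by blast
      have pD: "w \<in> Dc" "u w < L" "Sc w \<in> cone" if "w \<in> pcyl r zm" for w
      proof -
        have w: "w \<in> U" "(fst w - x0) \<bullet> (fst w - x0) < c * (snd w - a0)" "snd w \<le> snd zm" using subsetD[OF r(2) that] that by (simp_all add: pcyl_iff)
        then show D: "w \<in> Dc" using zm(1) by (auto simp: Dc_def)
        then show "u w < L" using U(2) DcQ(1)[OF D] w(1) by blast
        show "Sc w \<in> cone" unfolding cone_def mem_Collect_eq c_def[symmetric] \<sigma>_def[symmetric] Sc_le
          using w D by (auto simp: Dc_def)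
      qed
      have pQ: "pcyl r zm \<subseteq> Q10" using DcQ(1)[OF pD(1)] by blast
      have "AE w in lborel. w \<in> pcyl r zm \<longrightarrow> L * ((1 / R)\<^sup>2 * \<Phi>t (Sc w)) + (pucci_plus lam Lam (\<chi> k l. L * ((1 / R)\<^sup>2 * D2\<Phi> k l (Sc w)))
          + \<mu> w * norm ((\<chi> k. L * ((1 / R) * D\<Phi> k (Sc w))) :: real^'n) + f w) \<le> - (L / R\<^sup>2 * \<eta>)"
        using AE_psc[OF _ \<Phi>(3), of "1 / R" ?V, folded Sc_def, OF R1] \<mu>1e(1) f1e(1)
      proof eventually_elim
        fix w assume 3: "Sc w \<in> cone \<and> (snd (Sc w) - 1/2 \<le> t0 \<longrightarrow> Sc w \<in> N) \<longrightarrow>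
            \<Phi>t (Sc w) + pucci_plus lam Lam (\<chi> k l. D2\<Phi> k l (Sc w)) + \<bar>\<mu>u (Sc w)\<bar> * norm (\<chi> k. D\<Phi> k (Sc w)) + fu (Sc w) \<le> - \<eta>"
          and 1: "\<mu>1 w = indicator Q10 w * \<mu> w" and 2: "f1 w = indicator Q10 w * f w"
        show "w \<in> pcyl r zm \<longrightarrow> L * ((1 / R)\<^sup>2 * \<Phi>t (Sc w)) + (pucci_plus lam Lam (\<chi> k l. L * ((1 / R)\<^sup>2 * D2\<Phi> k l (Sc w)))
          + \<mu> w * norm ((\<chi> k. L * ((1 / R) * D\<Phi> k (Sc w))) :: real^'n) + f w) \<le> - (L / R\<^sup>2 * \<eta>)"
        proof
          assume w: "w \<in> pcyl r zm"
          have wQ: "w \<in> Q10" using w pQ by blast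
          \<comment> \<open>In the tip, u < L puts the point into the exceptional set, where the
            inequality for \<open>\<Phi>\<close> is available.\<close>
          have "Sc w \<in> N" if "snd (Sc w) - 1/2 \<le> t0"
            using that w r(2) wQ pD(2)[OF w] unfolding N_def N0_def Sc_le by (auto simp: TS)
          then have 4: "\<Phi>t (Sc w) + pucci_plus lam Lam (\<chi> k l. D2\<Phi> k l (Sc w)) + \<bar>\<mu>u (Sc w)\<bar> * norm ((\<chi> k. D\<Phi> k (Sc w)) :: real^'n) + fu (Sc w) \<le> - \<eta>"
            using 3 pD(3)[OF w] by blast
          \<comment> \<open>Multiplying the normalised inequality by this factor restores the
            original equation.\<close>
          define k where "k = L / R\<^sup>2"
          have k: "0 \<le> k" using L R2 by (simp add: k_def)
          have a: "L * ((1 / R)\<^sup>2 * y) = k * y" for y by (simp add: k_def power_divide)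
          have "(\<chi> i l. L * ((1 / R)\<^sup>2 * D2\<Phi> i l (Sc w))) = k *\<^sub>R (\<chi> i l. D2\<Phi> i l (Sc w) :: real^'n^'n)"
            by (simp add: vec_eq_iff a)
          then have P: "pucci_plus lam Lam (\<chi> i l. L * ((1 / R)\<^sup>2 * D2\<Phi> i l (Sc w)) :: real^'n^'n) \<le> k * pucci_plus lam Lam (\<chi> i l. D2\<Phi> i l (Sc w))"
            using pucci_scale_le[OF lam k] by simp
          have "(\<chi> i. L * ((1 / R) * D\<Phi> i (Sc w))) = (L / R) *\<^sub>R ((\<chi> i. D\<Phi> i (Sc w)) :: real^'n)"
            by (simp add: vec_eq_iff)
          then have n: "norm ((\<chi> i. L * ((1 / R) * D\<Phi> i (Sc w))) :: real^'n) = (L / R) * norm ((\<chi> i. D\<Phi> i (Sc w)) :: real^'n)"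
            using L R by simp
          have "\<mu>u (Sc w) = R * \<mu> w" using 1 wQ by (simp add: \<mu>u_def TS)
          then have "k * (\<bar>\<mu>u (Sc w)\<bar> * norm ((\<chi> k. D\<Phi> k (Sc w)) :: real^'n)) = \<bar>\<mu> w\<bar> * ((L / R) * norm ((\<chi> i. D\<Phi> i (Sc w)) :: real^'n))"
            using R by (simp add: k_def abs_mult power2_eq_square)
          moreover have "\<mu> w * ((L / R) * norm ((\<chi> i. D\<Phi> i (Sc w)) :: real^'n)) \<le> \<bar>\<mu> w\<bar> * ((L / R) * norm ((\<chi> i. D\<Phi> i (Sc w)) :: real^'n))"
            using L R by (intro mult_right_mono) auto
          moreover have "k * fu (Sc w) = \<bar>f w\<bar>" using 2 wQ L R by (simp add: fu_def TS k_def)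
          moreover have "k * (\<Phi>t (Sc w) + pucci_plus lam Lam (\<chi> k l. D2\<Phi> k l (Sc w)) + \<bar>\<mu>u (Sc w)\<bar> * norm ((\<chi> k. D\<Phi> k (Sc w)) :: real^'n) + fu (Sc w)) \<le> k * (- \<eta>)"
            using 4 k by (rule mult_left_mono)
          ultimately show "L * ((1 / R)\<^sup>2 * \<Phi>t (Sc w)) + (pucci_plus lam Lam (\<chi> k l. L * ((1 / R)\<^sup>2 * D2\<Phi> k l (Sc w)))
            + \<mu> w * norm ((\<chi> k. L * ((1 / R) * D\<Phi> k (Sc w))) :: real^'n) + f w) \<le> - (L / R\<^sup>2 * \<eta>)"
            unfolding a n k_def[symmetric] using P[unfolded a] abs_ge_self[of "f w"] by (simp add: distrib_left)
        qed
      qed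
      moreover have "0 < L / R\<^sup>2 * \<eta>" using L R2 \<eta> by simp
      moreover have "\<mu> \<in> borel_measurable (lebesgue_on Q10)" "f \<in> borel_measurable (lebesgue_on Q10)"
        using \<mu> f by (auto simp: in_Lp_def in_Lp_plus_def)
      ultimately show False
        using no_touching[OF visc lam S\<phi> \<phi>c zmQ r(1) pQ zm(2)[OF pD(1)]] by blast
    qed
  qed
qed

end

section \<open>Parabolic dyadic cubes\<close>

text \<open>Rounding \<open>- 4 ^ g * t\<close> instead of \<open>t\<close> makes the cubes closed at the top, like parabolic cylinders.\<close>

definition idx :: "nat \<Rightarrow> (real^'n) \<times> real \<Rightarrow> nat \<times> ('n \<Rightarrow> int) \<times> int" where
  "idx g z = (g, (\<lambda>l. \<lfloor>2 ^ g * fst z $ l\<rfloor>), \<lfloor>- (4 ^ g * snd z)\<rfloor>)"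

definition cube :: "nat \<times> ('n \<Rightarrow> int) \<times> int \<Rightarrow> ((real^'n) \<times> real) set" where
  "cube i = {z. idx (fst i) z = i}"

definition base :: "nat \<times> ('n \<Rightarrow> int) \<times> int \<Rightarrow> (real^'n) set" where
  "base i = {y. \<forall>l. \<lfloor>2 ^ fst i * y $ l\<rfloor> = fst (snd i) l}"

definition roof :: "nat \<times> ('n \<Rightarrow> int) \<times> int \<Rightarrow> real" where
  "roof i = - real_of_int (snd (snd i)) / 4 ^ fst i"

lemma cube_eq: "cube i = base i \<times> {roof i - 1 / 4 ^ fst i<..roof i}"
proof -
  obtain g k j where i: "i = (g, k, j)" by (cases i)
  have "\<lfloor>- (4 ^ g * t)\<rfloor> = j \<longleftrightarrow> roof i - 1 / 4 ^ g < t \<and> t \<le> roof i" for t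
    by (simp add: floor_eq_iff roof_def i field_simps) argo
  then show ?thesis by (auto simp: cube_def idx_def base_def i fun_eq_iff)
qed

lemma idx_cube: "z \<in> cube (idx g z)"
  by (simp add: cube_def idx_def)

lemma fst_idx [simp]: "fst (idx g z) = g" by (simp add: idx_def)

lemma cube_idx: "z \<in> cube i \<Longrightarrow> idx (fst i) z = i" by (simp add: cube_def)

text \<open>The coarser integer part is the integer quotient of the finer one by a power of
  \<open>b\<close>, hence determined by it. This is the nesting of dyadic cubes in one
  variable.\<close>

lemma floor_scale_mono:
  fixes x y :: real and b :: int
  assumes "\<lfloor>real_of_int b ^ h * x\<rfloor> = \<lfloor>real_of_int b ^ h * y\<rfloor>" "g \<le> h" "0 < b"
  shows "\<lfloor>real_of_int b ^ g * x\<rfloor> = \<lfloor>real_of_int b ^ g * y\<rfloor>"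
proof -
  have "real_of_int b ^ g * v = real_of_int b ^ h * v / real_of_int (b ^ (h - g))" for v
    using assms(2,3) power_add[of "real_of_int b" g "h - g"] by simp
  then show ?thesis using assms by (simp only: floor_divide_real_eq_div zero_le_power less_imp_le)
qed

lemma idx_mono: "idx h z = idx h w \<Longrightarrow> g \<le> h \<Longrightarrow> idx g z = idx g w"
  using floor_scale_mono[of 2 h "fst z $ l" "fst w $ l" g for l] floor_scale_mono[of 4 h "- snd z" "- snd w" g]
  by (simp add: idx_def fun_eq_iff)

lemma cube_nested:
  assumes "w \<in> cube i" "w \<in> cube i'" "fst i \<le> fst i'"
  shows "cube i' \<subseteq> cube i"
proof
  fix v assume "v \<in> cube i'"
  then have "idx (fst i') v = idx (fst i') w" using assms(2) by (simp add: cube_def)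
  then have "idx (fst i) v = idx (fst i) w" using assms(3) by (rule idx_mono)
  then show "v \<in> cube i" using assms(1) by (simp add: cube_def)
qed

lemma base_borel [measurable]:
  fixes i :: "nat \<times> ('n::finite \<Rightarrow> int) \<times> int"
  shows "base i \<in> sets borel"
proof -
  have "base i = {y. \<forall>l. real_of_int (fst (snd i) l) \<le> 2 ^ fst i * y $ l} \<inter> (\<Inter>l. {y. 2 ^ fst i * y $ l < real_of_int (fst (snd i) l) + 1})"
    by (auto simp: base_def floor_eq_iff)
  moreover have 1: "closed {y :: real^'n. \<forall>l. real_of_int (fst (snd i) l) \<le> 2 ^ fst i * y $ l}"
    by (intro closed_Collect_all closed_Collect_le continuous_intros)
  moreover have 2: "open (\<Inter>l. {y :: real^'n. 2 ^ fst i * y $ l < real_of_int (fst (snd i) l) + 1})"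
    by (intro open_INT) (auto intro!: open_Collect_less continuous_intros)
  ultimately show ?thesis using sets.Int[OF borel_closed[OF 1] borel_open[OF 2]] by simp
qed

lemma slab_borel [measurable]: "base i \<times> {a<..b :: real} \<in> sets borel"
  by (intro borel_Times) auto

lemma cube_borel [measurable]: "cube i \<in> sets borel"
  unfolding cube_eq by (rule slab_borel)

lemma emeasure_cube_le:
  fixes i :: "nat \<times> ('n::finite \<Rightarrow> int) \<times> int"
  shows "vol (cube i) \<le> ennreal ((1 / 2 ^ fst i) ^ (CARD('n) + 2))"
proof -
  define r :: real where "r = 1 / 2 ^ fst i"
  have r2: "r\<^sup>2 = 1 / 4 ^ fst i" by (simp add: r_def power_divide power2_eq_square flip: power_mult_distrib)
  have "cube i \<subseteq> pbox r ((\<chi> l. (real_of_int (fst (snd i) l) + 1) * r), roof i)"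
  proof
    fix w assume w: "w \<in> cube i"
    have "real_of_int (fst (snd i) l) \<le> 2 ^ fst i * fst w $ l" "2 ^ fst i * fst w $ l < real_of_int (fst (snd i) l) + 1" for l
      using w by (auto simp: cube_eq base_def floor_eq_iff)
    then have "(real_of_int (fst (snd i) l) + 1) * r - r \<le> fst w $ l" "fst w $ l \<le> (real_of_int (fst (snd i) l) + 1) * r" for l
      by (auto simp: r_def field_simps less_imp_le)
    then show "w \<in> pbox r ((\<chi> l. (real_of_int (fst (snd i) l) + 1) * r), roof i)"
      using w unfolding pbox_iff r2 by (auto simp: cube_eq)
  qed
  then have "vol (cube i) \<le> vol (pbox r ((\<chi> l. (real_of_int (fst (snd i) l) + 1) * r), roof i))"
    by (intro emeasure_mono) auto
  also have "\<dots> = ennreal (r ^ (CARD('n) + 2))" by (rule emeasure_pbox) (simp add: r_def)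
  finally show ?thesis by (simp add: r_def)
qed

text \<open>Only cubes of least generation among those of \<open>F\<close> that they meet are kept.
  They are disjoint, and since cubes that meet are nested they still cover the union, so the density
  bounds add up.\<close>

lemma density_union:
  fixes F :: "(nat \<times> ('n::finite \<Rightarrow> int) \<times> int) set"
  assumes F: "finite F" and V [measurable]: "V \<in> sets borel"
    and d: "\<And>i. i \<in> F \<Longrightarrow> vol (cube i \<inter> V) \<le> c * vol (cube i)"
  shows "vol ((\<Union>i\<in>F. cube i) \<inter> V) \<le> c * vol (\<Union>i\<in>F. cube i)"
proof -
  define G where "G = {i \<in> F. \<forall>i'\<in>F. cube i \<inter> cube i' \<noteq> {} \<longrightarrow> fst i \<le> fst i'}"
  have G: "finite G" "G \<subseteq> F" using F by (auto simp: G_def)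
  have dis: "disjoint_family_on cube G"
    unfolding disjoint_family_on_def
  proof (intro ballI impI)
    fix i i' assume i: "i \<in> G" "i' \<in> G" "i \<noteq> i'"
    show "cube i \<inter> cube i' = {}"
    proof (rule ccontr)
      assume ne: "cube i \<inter> cube i' \<noteq> {}"
      then have ne': "cube i' \<inter> cube i \<noteq> {}" by blast
      have "i \<in> F" "i' \<in> F" using i(1,2) G(2) by blast+
      then have "fst i \<le> fst i'" "fst i' \<le> fst i" using i(1,2) ne ne' unfolding G_def by blast+
      then have "fst i = fst i'" by simp
      moreover obtain v where "v \<in> cube i" "v \<in> cube i'" using ne by blast
      ultimately show False using i(3) cube_idx[of v i] cube_idx[of v i'] by simp
    qed
  qed
  have cov: "(\<Union>i\<in>F. cube i) = (\<Union>i\<in>G. cube i)"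
  proof
    show "(\<Union>i\<in>F. cube i) \<subseteq> (\<Union>i\<in>G. cube i)"
    proof
      fix w assume "w \<in> (\<Union>i\<in>F. cube i)"
      then have "\<exists>i. i \<in> F \<and> w \<in> cube i" by blast
      from ex_has_least_nat[of "\<lambda>i. i \<in> F \<and> w \<in> cube i" _ fst] this
      obtain i where i: "i \<in> F" "w \<in> cube i" "\<And>i'. i' \<in> F \<Longrightarrow> w \<in> cube i' \<Longrightarrow> fst i \<le> fst i'" by blast
      have "fst i \<le> fst i'" if i': "i' \<in> F" "cube i \<inter> cube i' \<noteq> {}" for i'
      proof (rule ccontr)
        assume "\<not> fst i \<le> fst i'"
        moreover obtain v where "v \<in> cube i" "v \<in> cube i'" using i'(2) by blast
        ultimately have "cube i \<subseteq> cube i'" by (intro cube_nested[of v]) auto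
        then show False using i i'(1) \<open>\<not> fst i \<le> fst i'\<close> by blast
      qed
      then have "i \<in> G" unfolding G_def using i(1) by blast
      then show "w \<in> (\<Union>i\<in>G. cube i)" using i(2) by blast
    qed
  qed (use G in auto)
  have dis': "disjoint_family_on (\<lambda>i. cube i \<inter> V) G" using dis unfolding disjoint_family_on_def by blast
  have "(\<Union>i\<in>F. cube i) \<inter> V = (\<Union>i\<in>G. cube i \<inter> V)" using cov by auto
  then have "vol ((\<Union>i\<in>F. cube i) \<inter> V) = (\<Sum>i\<in>G. vol (cube i \<inter> V))"
    using sum_emeasure[OF _ dis' G(1), of lborel] by (simp add: image_subset_iff)
  also have "\<dots> \<le> (\<Sum>i\<in>G. c * vol (cube i))" using d G by (intro sum_mono) auto
  also have "\<dots> = c * vol (\<Union>i\<in>G. cube i)"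
    using sum_emeasure[OF _ dis G(1), of lborel] by (simp add: image_subset_iff flip: sum_distrib_left)
  finally show ?thesis using cov by simp
qed

text \<open>The interval with the leftmost endpoint is added last, so that to the left of its right endpoint the union is
  this interval alone.\<close>

lemma stack_interval:
  fixes a c :: "'i \<Rightarrow> real" and U :: "real set"
  assumes I: "finite I" and [measurable]: "U \<in> sets borel"
    and U: "\<And>i t. i \<in> I \<Longrightarrow> a i \<le> t \<Longrightarrow> t \<le> c i \<Longrightarrow> ennreal (\<alpha> * (c i - t)) \<le> vol (U \<inter> {t<..c i})"
    and \<alpha>: "0 \<le> \<alpha>"
  shows "ennreal \<alpha> * vol ((\<Union>i\<in>I. {a i<..c i}) \<inter> {s<..}) \<le> vol (U \<inter> (\<Union>i\<in>I. {a i<..c i}) \<inter> {s<..})"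
  using I U
proof (induction I arbitrary: s rule: finite_ranking_induct[where f = "\<lambda>i. - a i"])
  case (insert x S)
  let ?W = "\<lambda>I. \<Union>i\<in>I. {a i<..c i}"
  have [measurable]: "?W J \<in> sets borel" if "finite J" for J using that by auto
  have IH: "ennreal \<alpha> * vol (?W S \<inter> {s<..}) \<le> vol (U \<inter> ?W S \<inter> {s<..})" for s
    by (rule insert.IH) (use insert.prems in blast)
  have main: "ennreal \<alpha> * vol (?W (insert x S) \<inter> {s<..}) \<le> vol (U \<inter> ?W (insert x S) \<inter> {s<..})" if s: "a x \<le> s" for s
  proof (cases "s < c x")
    case False
    then have "?W (insert x S) \<inter> {s<..} = ?W S \<inter> {s<..}" by auto
    then show ?thesis using IH[of s] by (simp add: Int_assoc)
  next
    case True
    have e: "?W (insert x S) \<inter> {s<..} = {s<..c x} \<union> (?W S \<inter> {c x<..})" using s True by auto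
    have "ennreal \<alpha> * vol (?W (insert x S) \<inter> {s<..}) = ennreal \<alpha> * (vol {s<..c x} + vol (?W S \<inter> {c x<..}))"
      unfolding e using insert.hyps(1) by (subst plus_emeasure) auto
    also have "\<dots> = ennreal (\<alpha> * (c x - s)) + ennreal \<alpha> * vol (?W S \<inter> {c x<..})"
      using True \<alpha> by (simp add: distrib_left ennreal_mult)
    also have "\<dots> \<le> vol (U \<inter> {s<..c x}) + vol (U \<inter> ?W S \<inter> {c x<..})"
      using insert.prems[of x s] s True IH by (intro add_mono) auto
    also have "\<dots> = vol ((U \<inter> {s<..c x}) \<union> (U \<inter> ?W S \<inter> {c x<..}))"
      using insert.hyps(1) by (subst plus_emeasure) auto
    also have "(U \<inter> {s<..c x}) \<union> (U \<inter> ?W S \<inter> {c x<..}) = U \<inter> ?W (insert x S) \<inter> {s<..}"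
      unfolding Int_assoc e by auto
    finally show ?thesis .
  qed
  show ?case
  proof (cases "a x \<le> s")
    case False
    have "?W (insert x S) \<subseteq> {a x<..}" using insert.hyps(2) by force
    then have "?W (insert x S) \<inter> {s<..} = ?W (insert x S) \<inter> {a x<..}" using False by auto
    then show ?thesis using main[of "a x"] by (simp add: Int_assoc)
  qed (rule main)
qed simp

text \<open>By Fubini's theorem it suffices to compare time intervals over each point of space. A
  cube gives an interval of length h and its stack the next m h; to the right of any point of the
  joint interval the stack fills at least the fraction m / (m + 1), which is the hypothesis of
  \<open>stack_interval\<close>.\<close>

lemma stack_measure:
  fixes F :: "(nat \<times> ('n::finite \<Rightarrow> int) \<times> int) set" and m :: real
  assumes F: "finite F" and m: "0 < m"
  defines "S i \<equiv> base i \<times> {roof i<..roof i + m / 4 ^ fst i}"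
  shows "ennreal (m / (m + 1)) * vol (\<Union>i\<in>F. cube i) \<le> vol (\<Union>i\<in>F. S i)"
proof -
  have sl: "vol X = (\<integral>\<^sup>+x. vol {t. (x, t) \<in> X} \<partial>lborel)" if "X \<in> sets borel" for X :: "((real^'n) \<times> real) set"
  proof -
    have "X \<in> sets (lborel \<Otimes>\<^sub>M lborel)" using that by (simp only: lborel_prod sets_lborel)
    from lborel.emeasure_pair_measure_alt[OF this] show ?thesis by (simp add: lborel_prod vimage_def)
  qed
  have mm: "(\<lambda>x. vol {t. (x, t) \<in> X}) \<in> borel_measurable lborel" if "X \<in> sets borel" for X :: "'n pt set"
  proof -
    have "X \<in> sets (lborel \<Otimes>\<^sub>M lborel)" using that by (simp only: lborel_prod sets_lborel)
    from lborel.measurable_emeasure_Pair[OF this] show ?thesis by (simp add: vimage_def)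
  qed
  have b: "(\<Union>i\<in>F. cube i) \<in> sets borel" "(\<Union>i\<in>F. S i) \<in> sets borel"
    using F by (auto simp: S_def intro!: sets.finite_UN)
  have "ennreal (m / (m + 1)) * vol (\<Union>i\<in>F. cube i)
      = (\<integral>\<^sup>+x. ennreal (m / (m + 1)) * vol {t. (x, t) \<in> (\<Union>i\<in>F. cube i)} \<partial>lborel)"
    unfolding sl[OF b(1)] by (rule nn_integral_cmult[symmetric, OF mm[OF b(1)]])
  also have "\<dots> \<le> (\<integral>\<^sup>+x. vol {t. (x, t) \<in> (\<Union>i\<in>F. S i)} \<partial>lborel)"
  proof (rule nn_integral_mono)
    fix x :: "real^'n"
    define I where "I = {i \<in> F. x \<in> base i}"
    define U where "U = (\<Union>i\<in>I. {roof i<..roof i + m / 4 ^ fst i})"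
    let ?J = "\<Union>i\<in>I. {roof i - 1 / 4 ^ fst i<..roof i + m / 4 ^ fst i}"
    have I: "finite I" using F by (simp add: I_def)
    have [measurable]: "U \<in> sets borel" using I by (auto simp: U_def)
    have "ennreal (m / (m + 1)) * vol (?J \<inter> {s<..}) \<le> vol (U \<inter> ?J \<inter> {s<..})" for s
    proof (rule stack_interval[OF I])
      fix i t assume i: "i \<in> I" and t: "roof i - 1 / 4 ^ fst i \<le> t" "t \<le> roof i + m / 4 ^ fst i"
      let ?c = "roof i + m / 4 ^ fst i"
      let ?h = "1 / 4 ^ fst i :: real"
      have "m / (m + 1) * (?c - t) \<le> ?c - max t (roof i)"
      proof (cases "t \<le> roof i")
        case True
        have "(m + 1) * ?h = m / 4 ^ fst i + ?h" by (simp add: add_divide_distrib)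
        then have "m * (?c - t) \<le> m * ((m + 1) * ?h)" using t m by (intro mult_left_mono) auto
        then have "m / (m + 1) * (?c - t) \<le> m * ?h" using m by (simp add: divide_simps)
        then show ?thesis using True by simp
      next
        case False
        have "m / (m + 1) * (?c - t) \<le> 1 * (?c - t)" using m t by (intro mult_right_mono) auto
        then show ?thesis using False by simp
      qed
      then have "ennreal (m / (m + 1) * (?c - t)) \<le> vol {max t (roof i)<..?c}"
        using t m by (simp add: ennreal_leI)
      also have "\<dots> \<le> vol (U \<inter> {t<..?c})"
        using i by (intro emeasure_mono) (auto simp: U_def)
      finally show "ennreal (m / (m + 1) * (?c - t)) \<le> vol (U \<inter> {t<..?c})" .
    qed (use m in auto)
    note J = this
    have "{t. (x, t) \<in> (\<Union>i\<in>F. cube i)} = (\<Union>i\<in>I. {roof i - 1 / 4 ^ fst i<..roof i})" by (auto simp: I_def cube_eq)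
    moreover have "{t. (x, t) \<in> (\<Union>i\<in>F. S i)} = U" by (auto simp: I_def U_def S_def)
    moreover have "ennreal (m / (m + 1)) * vol (\<Union>i\<in>I. {roof i - 1 / 4 ^ fst i<..roof i}) \<le> vol U"
    proof (cases "I = {}")
      case False
      \<comment> \<open>A cut below all intervals, so that the statement for half-lines covers the
        whole unions.\<close>
      define s where "s = Min ((\<lambda>i. roof i - 1 / 4 ^ fst i) ` I)"
      have s: "s \<le> roof i - 1 / 4 ^ fst i" if "i \<in> I" for i using I that by (simp add: s_def)
      have "(\<Union>i\<in>I. {roof i - 1 / 4 ^ fst i<..roof i}) \<subseteq> ?J \<inter> {s<..}"
      proof
        fix t assume "t \<in> (\<Union>i\<in>I. {roof i - 1 / 4 ^ fst i<..roof i})"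
        then obtain i where i: "i \<in> I" "roof i - 1 / 4 ^ fst i < t" "t \<le> roof i" by auto
        moreover have "0 \<le> m / 4 ^ fst i" using m by simp
        ultimately have "t \<in> {roof i - 1 / 4 ^ fst i<..roof i + m / 4 ^ fst i}" "s < t" using s[of i] by auto
        then show "t \<in> ?J \<inter> {s<..}" using i(1) by blast
      qed
      then have "ennreal (m / (m + 1)) * vol (\<Union>i\<in>I. {roof i - 1 / 4 ^ fst i<..roof i}) \<le> ennreal (m / (m + 1)) * vol (?J \<inter> {s<..})"
        using I by (intro mult_left_mono emeasure_mono) auto
      also have "\<dots> \<le> vol (U \<inter> ?J \<inter> {s<..})" by (rule J)
      also have "\<dots> \<le> vol U" by (intro emeasure_mono) auto
      finally show ?thesis .
    qed simp
    ultimately show "ennreal (m / (m + 1)) * vol {t. (x, t) \<in> (\<Union>i\<in>F. cube i)} \<le> vol {t. (x, t) \<in> (\<Union>i\<in>F. S i)}"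
      by simp
  qed
  also have "\<dots> = vol (\<Union>i\<in>F. S i)" by (rule sl[OF b(2), symmetric])
  finally show ?thesis .
qed

section \<open>Propagation of lower bounds\<close>

text \<open>The growth property of supersolutions with the data removed: it holds at all levels above \<open>K\<close> and all
  scales below a multiple of \<open>R\<close>.\<close>

definition gro :: "real \<Rightarrow> real \<Rightarrow> real \<Rightarrow> ((real^'n) \<times> real \<Rightarrow> real) \<Rightarrow> real \<Rightarrow> real \<Rightarrow> bool" where
  "gro T \<theta> \<eta> u R K \<longleftrightarrow> (\<forall>x s \<rho> L. (\<forall>l. \<bar>x $ l\<bar> \<le> 9) \<longrightarrow> 0 < s \<longrightarrow> K \<le> L \<longrightarrow> 0 < L \<longrightarrow> 0 < \<rho> \<longrightarrow> T * \<rho>\<^sup>2 \<le> sg TYPE('n) * R\<^sup>2 \<longrightarrow>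
    vol {z \<in> Q10. (fst z - x) \<bullet> (fst z - x) < cc TYPE('n) * (snd z - s) \<and> snd z - s \<le> \<rho>\<^sup>2 \<and> u z < L}
      \<le> ennreal (\<theta> * \<rho> ^ (CARD('n) + 2)) \<longrightarrow>
    (\<forall>z\<in>Q10. (fst z - x) \<bullet> (fst z - x) \<le> cc TYPE('n) * (snd z - s) / 2 \<and> \<rho>\<^sup>2 \<le> snd z - s
      \<and> snd z - s \<le> T * \<rho>\<^sup>2 \<longrightarrow> \<eta> * L \<le> u z))"

lemma gro_mono:
  fixes u :: "(real^'n) \<times> real \<Rightarrow> real"
  assumes g: "gro T \<theta> \<eta> u R K" and "\<theta>' \<le> \<theta>" "\<eta>' \<le> \<eta>" "K \<le> K'"
  shows "gro T \<theta>' \<eta>' u R K'"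
  unfolding gro_def
proof (intro allI impI ballI)
  fix x :: "real^'n" and s \<rho> L z
  assume a: "\<forall>l. \<bar>x $ l\<bar> \<le> 9" "0 < s" "K' \<le> L" "0 < L" "0 < \<rho>" "T * \<rho>\<^sup>2 \<le> sg TYPE('n) * R\<^sup>2"
    and e: "vol {z \<in> Q10. (fst z - x) \<bullet> (fst z - x) < cc TYPE('n) * (snd z - s) \<and> snd z - s \<le> \<rho>\<^sup>2 \<and> u z < L}
      \<le> ennreal (\<theta>' * \<rho> ^ (CARD('n) + 2))"
    and z: "z \<in> Q10" "(fst z - x) \<bullet> (fst z - x) \<le> cc TYPE('n) * (snd z - s) / 2 \<and> \<rho>\<^sup>2 \<le> snd z - s \<and> snd z - s \<le> T * \<rho>\<^sup>2"
  have "K \<le> L" using a assms(4) by simp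
  note e
  also have "ennreal (\<theta>' * \<rho> ^ (CARD('n) + 2)) \<le> ennreal (\<theta> * \<rho> ^ (CARD('n) + 2))"
    using assms(2) a(5) by (intro ennreal_leI mult_right_mono) auto
  finally have "\<eta> * L \<le> u z"
    using g[unfolded gro_def, rule_format, OF a(1)[rule_format] a(2) \<open>K \<le> L\<close> a(4-6) _ z] by simp
  moreover have "\<eta>' * L \<le> \<eta> * L" using assms(3) a(4) by (intro mult_right_mono) auto
  ultimately show "\<eta>' * L \<le> u z" by simp
qed

context
  fixes lam Lam p q p1 :: real and dummy :: "'n::finite itself"
  assumes lam: "0 < lam" "lam \<le> Lam" and abp: "ABP_exponent TYPE('n) lam Lam p1" and pp: "p1 < p"
    and pq: "p \<le> q" and q: "hdim TYPE('n) < q"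
begin

text \<open>The ratio of the two time scales is fixed: with \<open>t0 = sg / T\<close> and R =
  \<rho> / sqrt \<open>t0\<close>, the tip has height \<rho>^2 and the paraboloid height T \<rho>^2.
  Smallness of \<mu> at one scale passes to smaller scales because q > n + 2.\<close>

lemma supersolution_gro:
  fixes T :: real
  assumes T: "1 \<le> T"
  shows "\<exists>\<delta>>0. \<exists>\<eta>>0. \<forall>\<mu> f u R. in_Lp q Q10 (\<mu> :: (real^'n) \<times> real \<Rightarrow> real) \<longrightarrow> supersol lam Lam p \<mu> f u \<longrightarrow>
    0 < R \<longrightarrow> R \<le> 1 \<longrightarrow> R powr (1 - hdim TYPE('n) / q) * Lp_norm q Q10 \<mu> \<le> \<delta> \<longrightarrow>
    gro T (\<delta> powr p) \<eta> u R (Lp_norm p Q10 f / \<delta>)"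
proof -
  define t0 where "t0 = sg TYPE('n) / T"
  have t0: "0 < t0" "t0 \<le> 1"
    using cc_sg(2,4)[where 'n='n] T by (auto simp: t0_def divide_le_eq)
  obtain \<delta> \<eta> where \<delta>: "0 < \<delta>" and \<eta>: "0 < \<eta>" and gr: "\<forall>\<mu> f u. in_Lp q Q10 (\<mu> :: 'n pt \<Rightarrow> real) \<longrightarrow> supersol lam Lam p \<mu> f u \<longrightarrow> grows p q t0 \<delta> \<eta> \<mu> f u"
    using growth[OF lam abp pp pq q t0(1)] by (elim exE conjE)
  show ?thesis
  proof (rule exI[of _ \<delta>], intro conjI \<delta>, rule exI[of _ \<eta>], intro conjI allI impI \<eta>)
    fix \<mu> f u :: "'n pt \<Rightarrow> real" and R1
    assume h: "in_Lp q Q10 \<mu>" "supersol lam Lam p \<mu> f u"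
      and R1: "0 < R1" "R1 \<le> 1" and \<mu>n: "R1 powr (1 - hdim TYPE('n) / q) * Lp_norm q Q10 \<mu> \<le> \<delta>"
    show "gro T (\<delta> powr p) \<eta> u R1 (Lp_norm p Q10 f / \<delta>)"
      unfolding gro_def
    proof (intro allI impI)
      fix x :: "real^'n" and s \<rho> L
      assume x: "\<forall>l. \<bar>x $ l\<bar> \<le> 9" and s: "0 < s" and L: "Lp_norm p Q10 f / \<delta> \<le> L" "0 < L" and \<rho>: "0 < \<rho>" "T * \<rho>\<^sup>2 \<le> sg TYPE('n) * R1\<^sup>2"
        and e: "vol {z \<in> Q10. (fst z - x) \<bullet> (fst z - x) < cc TYPE('n) * (snd z - s) \<and> snd z - s \<le> \<rho>\<^sup>2 \<and> u z < L}
          \<le> ennreal (\<delta> powr p * \<rho> ^ (CARD('n) + 2))"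
      define R where "R = \<rho> / sqrt t0"
      have R: "0 < R" using \<rho> t0 by (simp add: R_def)
      have R2: "t0 * R\<^sup>2 = \<rho>\<^sup>2" using t0 by (simp add: R_def power_divide)
      have R2': "sg TYPE('n) * R\<^sup>2 = T * \<rho>\<^sup>2"
        using T unfolding R2[symmetric] t0_def by simp
      have "R\<^sup>2 \<le> R1\<^sup>2" using \<rho>(2) cc_sg(2)[where 'n='n] unfolding R2'[symmetric] by simp
      then have RR: "R \<le> R1" by (rule power2_le_imp_le) (use R1 in simp)
      have "R powr (1 - hdim TYPE('n) / q) * Lp_norm q Q10 \<mu> \<le> R1 powr (1 - hdim TYPE('n) / q) * Lp_norm q Q10 \<mu>"
        using R RR q by (intro mult_right_mono powr_mono2) (auto simp: Lp_norm_nonneg hdim_def)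
      then have 1: "R powr (1 - hdim TYPE('n) / q) * Lp_norm q Q10 \<mu> \<le> \<delta>" using \<mu>n by simp
      have 2: "Lp_norm p Q10 f \<le> \<delta> * L" using L \<delta> by (simp add: divide_le_eq mult.commute)
      have 3: "\<forall>x'. (x' - x) \<bullet> (x' - x) \<le> cc TYPE('n) * sg TYPE('n) * R\<^sup>2 \<longrightarrow> x' \<in> \<Omega>10"
      proof (intro allI impI)
        fix x' :: "real^'n" assume a: "(x' - x) \<bullet> (x' - x) \<le> cc TYPE('n) * sg TYPE('n) * R\<^sup>2"
        have "cc TYPE('n) * sg TYPE('n) * R\<^sup>2 \<le> 1/64 * 1"
          unfolding cc_sg(3) using cc_sg(5)[where 'n='n] R RR R1 by (intro mult_mono power_le_one) auto
        then have "(norm (x' - x))\<^sup>2 < 1\<^sup>2" using a by (simp add: power2_norm_eq_inner)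
        then have "norm (x' - x) < 1" by (rule power2_less_imp_less) simp
        then have "\<bar>x' $ l - x $ l\<bar> < 1" for l using component_le_norm_cart[of "x' - x" l] by simp
        then have "- 10 < x' $ l \<and> x' $ l < 10" for l using x[rule_format, of l] by (smt (verit))
        then show "x' \<in> \<Omega>10" by (simp add: mem_box_cart)
      qed
      have "\<rho> \<le> R" using \<rho> t0 by (simp add: R_def le_divide_eq mult_left_le)
      then have "\<delta> powr p * \<rho> ^ (CARD('n) + 2) \<le> \<delta> powr p * R ^ (CARD('n) + 2)"
        using \<rho>(1) by (intro mult_left_mono power_mono) auto
      then have 4: "vol {z \<in> Q10. (fst z - x) \<bullet> (fst z - x) < cc TYPE('n) * (snd z - s) \<and> snd z - s \<le> t0 * R\<^sup>2 \<and> u z < L}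
          \<le> ennreal (\<delta> powr p * R ^ (CARD('n) + 2))"
        unfolding R2 using e by (meson ennreal_leI order_trans)
      have R': "R \<le> 1" using RR R1 by simp
      show "\<forall>z\<in>Q10. (fst z - x) \<bullet> (fst z - x) \<le> cc TYPE('n) * (snd z - s) / 2 \<and> \<rho>\<^sup>2 \<le> snd z - s
        \<and> snd z - s \<le> T * \<rho>\<^sup>2 \<longrightarrow> \<eta> * L \<le> u z"
        using gr[rule_format, OF h, unfolded grows_def, THEN spec[of _ R], THEN spec[of _ x], THEN spec[of _ s], THEN spec[of _ L],
            THEN mp, OF R, THEN mp, OF R', THEN mp, OF L(2), THEN mp, OF 1, THEN mp, OF 2,
            THEN mp, OF s, THEN mp, OF 3, THEN mp, OF 4]
        unfolding R2 R2' .
    qed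
  qed
qed

end

text \<open>The set contains the tip of height \<rho>^2 of the paraboloid with vertex (x, s), so the
  exceptional set in \<open>gro\<close> is empty and the lower bound can be passed on.\<close>

definition PP :: "((real^'n) \<times> real \<Rightarrow> real) \<Rightarrow> real^'n \<Rightarrow> real \<Rightarrow> real \<Rightarrow> real \<Rightarrow> bool" where
  "PP u x s \<rho> L \<longleftrightarrow> (\<forall>z\<in>Q10. (fst z - x) \<bullet> (fst z - x) \<le> cc TYPE('n) * \<rho>\<^sup>2 \<and> s \<le> snd z \<and> snd z \<le> s + \<rho>\<^sup>2 \<longrightarrow> L \<le> u z)"

lemma inner_split_le:
  fixes a b :: "'a::real_inner"
  shows "(a + b) \<bullet> (a + b) \<le> 2 * (a \<bullet> a) + 2 * (b \<bullet> b)"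
  using inner_ge_zero[of "a - b"] by (simp add: algebra_simps inner_commute)

lemma PP_gro:
  fixes u :: "(real^'n) \<times> real \<Rightarrow> real"
  assumes g: "gro T \<theta> \<eta> u R K" and x: "\<And>l. \<bar>x $ l\<bar> \<le> 9" and s: "0 < s" and L: "K \<le> L" "0 < L"
    and \<rho>: "0 < \<rho>" "T * \<rho>\<^sup>2 \<le> sg TYPE('n) * R\<^sup>2" and PP: "PP u x s \<rho> L"
    and z: "z \<in> Q10" "(fst z - x) \<bullet> (fst z - x) \<le> cc TYPE('n) * (snd z - s) / 2" "\<rho>\<^sup>2 \<le> snd z - s" "snd z - s \<le> T * \<rho>\<^sup>2"
  shows "\<eta> * L \<le> u z"
proof -
  have c: "0 < cc TYPE('n)" using cc_sg(1)[where 'n='n] by linarith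
  have "{z \<in> Q10. (fst z - x) \<bullet> (fst z - x) < cc TYPE('n) * (snd z - s) \<and> snd z - s \<le> \<rho>\<^sup>2 \<and> u z < L} = {}"
  proof (intro equals0I, elim CollectE conjE)
    fix z assume z: "z \<in> Q10" "(fst z - x) \<bullet> (fst z - x) < cc TYPE('n) * (snd z - s)" "snd z - s \<le> \<rho>\<^sup>2" "u z < L"
    have "0 < cc TYPE('n) * (snd z - s)" using z(2) inner_ge_zero[of "fst z - x"] by linarith
    then have "s \<le> snd z" using c by (simp add: zero_less_mult_iff)
    moreover have "cc TYPE('n) * (snd z - s) \<le> cc TYPE('n) * \<rho>\<^sup>2" using z(3) c by (intro mult_left_mono) auto
    ultimately have "L \<le> u z" using PP[unfolded PP_def, rule_format, OF z(1)] z(2,3) by linarith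
    then show False using z(4) by simp
  qed
  then have "vol {z \<in> Q10. (fst z - x) \<bullet> (fst z - x) < cc TYPE('n) * (snd z - s) \<and> snd z - s \<le> \<rho>\<^sup>2 \<and> u z < L}
      \<le> ennreal (\<theta> * \<rho> ^ (CARD('n) + 2))" by (simp only: emeasure_empty zero_le)
  from g[unfolded gro_def, rule_format, OF x s L \<rho> this z(1)] show ?thesis using z by blast
qed

text \<open>From time 8 \<rho>^2 on, the inner paraboloid has squared radius at least 4
  \<open>cc\<close> \<rho>^2. This is twice the old radius, which allows either doubling or a shift
  of the centre by one radius; the horizon 16 \<rho>^2 covers the end times 8 + 4 and 15 +
  1.\<close>

lemma PP_step:
  fixes u :: "(real^'n) \<times> real \<Rightarrow> real"
  assumes g: "gro 16 \<theta> \<eta> u R K" and x: "\<And>l. \<bar>x $ l\<bar> \<le> 9" and s: "0 < s" and L: "K \<le> L" "0 < L"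
    and \<rho>: "0 < \<rho>" "16 * \<rho>\<^sup>2 \<le> sg TYPE('n) * R\<^sup>2" and PP: "PP u x s \<rho> L"
  shows "PP u x (s + 8 * \<rho>\<^sup>2) (2 * \<rho>) (\<eta> * L)"
    and "8 * \<rho>\<^sup>2 \<le> s' - s \<Longrightarrow> s' - s \<le> 15 * \<rho>\<^sup>2 \<Longrightarrow> (x' - x) \<bullet> (x' - x) \<le> cc TYPE('n) * \<rho>\<^sup>2 \<Longrightarrow> PP u x' s' \<rho> (\<eta> * L)"
proof -
  have c: "0 < cc TYPE('n)" using cc_sg(1)[where 'n='n] by linarith
  have r: "0 < \<rho>\<^sup>2" using \<rho> by simp
  have *: "\<eta> * L \<le> u z" if z: "z \<in> Q10" "(fst z - x) \<bullet> (fst z - x) \<le> 4 * (cc TYPE('n) * \<rho>\<^sup>2)" "8 * \<rho>\<^sup>2 \<le> snd z - s" "snd z - s \<le> 16 * \<rho>\<^sup>2" for z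
  proof (rule PP_gro[OF g x s L \<rho> PP z(1) _ _ z(4)])
    have "cc TYPE('n) * (8 * \<rho>\<^sup>2) \<le> cc TYPE('n) * (snd z - s)" using z(3) c by (intro mult_left_mono) auto
    then show "(fst z - x) \<bullet> (fst z - x) \<le> cc TYPE('n) * (snd z - s) / 2" using z(2) by simp
    show "\<rho>\<^sup>2 \<le> snd z - s" using z(3) r by linarith
  qed
  show "PP u x (s + 8 * \<rho>\<^sup>2) (2 * \<rho>) (\<eta> * L)"
    unfolding PP_def
  proof (intro ballI impI, elim conjE)
    fix z assume "z \<in> Q10" "(fst z - x) \<bullet> (fst z - x) \<le> cc TYPE('n) * (2 * \<rho>)\<^sup>2" "s + 8 * \<rho>\<^sup>2 \<le> snd z" "snd z \<le> s + 8 * \<rho>\<^sup>2 + (2 * \<rho>)\<^sup>2"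
    then show "\<eta> * L \<le> u z" using r by (intro *) (auto simp: power_mult_distrib)
  qed
  assume s': "8 * \<rho>\<^sup>2 \<le> s' - s" "s' - s \<le> 15 * \<rho>\<^sup>2" and x': "(x' - x) \<bullet> (x' - x) \<le> cc TYPE('n) * \<rho>\<^sup>2"
  show "PP u x' s' \<rho> (\<eta> * L)"
    unfolding PP_def
  proof (intro ballI impI, elim conjE)
    fix z assume z: "z \<in> Q10" "(fst z - x') \<bullet> (fst z - x') \<le> cc TYPE('n) * \<rho>\<^sup>2" "s' \<le> snd z" "snd z \<le> s' + \<rho>\<^sup>2"
    have "(fst z - x) \<bullet> (fst z - x) \<le> 4 * (cc TYPE('n) * \<rho>\<^sup>2)"
      using inner_split_le[of "fst z - x'" "x' - x"] z(2) x' by simp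
    then show "\<eta> * L \<le> u z" using z s' by (intro *) auto
  qed
qed

lemma pow_level:
  fixes \<eta> :: real
  assumes "0 < \<eta>" "\<eta> \<le> 1" "0 < L" "K \<le> \<eta> ^ j * L" "i \<le> j"
  shows "K \<le> \<eta> ^ i * L"
proof -
  have "\<eta> ^ j * L \<le> \<eta> ^ i * L" using assms by (intro mult_right_mono power_decreasing) auto
  then show ?thesis using assms by linarith
qed

text \<open>The elapsed time is the geometric sum of the waiting times 8 (2^j \<rho>)^2.\<close>

lemma PP_doubling:
  fixes u :: "(real^'n) \<times> real \<Rightarrow> real"
  assumes g: "gro 16 \<theta> \<eta> u R K" and x: "\<And>l. \<bar>x $ l\<bar> \<le> 9" and s: "0 < s" and \<eta>: "0 < \<eta>" "\<eta> \<le> 1" and L: "K \<le> \<eta> ^ i * L" "0 < L"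
    and \<rho>: "0 < \<rho>" "16 * (2 ^ i * \<rho>)\<^sup>2 \<le> sg TYPE('n) * R\<^sup>2" and PP: "PP u x s \<rho> L"
  shows "PP u x (s + 8 / 3 * (4 ^ i - 1) * \<rho>\<^sup>2) (2 ^ i * \<rho>) (\<eta> ^ i * L)"
  using L(1) \<rho>(2)
proof (induction i)
  case (Suc i)
  have K: "K \<le> \<eta> ^ i * L" by (rule pow_level[OF \<eta> L(2) Suc.prems(1)]) simp
  have "(2 ^ i * \<rho>)\<^sup>2 \<le> (2 ^ Suc i * \<rho>)\<^sup>2" using \<rho> by (intro power_mono mult_right_mono power_increasing) auto
  then have b: "16 * (2 ^ i * \<rho>)\<^sup>2 \<le> sg TYPE('n) * R\<^sup>2" using Suc.prems(2) by linarith
  have p: "0 \<le> 8 / 3 * (4 ^ i - 1) * \<rho>\<^sup>2" by simp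
  have "PP u x (s + 8 / 3 * (4 ^ i - 1) * \<rho>\<^sup>2 + 8 * (2 ^ i * \<rho>)\<^sup>2) (2 * (2 ^ i * \<rho>)) (\<eta> * (\<eta> ^ i * L))"
  proof (rule PP_step(1)[OF g x _ K _ _ b Suc.IH[OF K b]])
    show "0 < s + 8 / 3 * (4 ^ i - 1) * \<rho>\<^sup>2" using s p by linarith
    show "0 < \<eta> ^ i * L" "0 < 2 ^ i * \<rho>" using \<eta> L \<rho> by simp_all
  qed
  moreover have "(2 ^ i)\<^sup>2 = (4 ^ i :: real)" by (simp add: power2_eq_square flip: power_mult_distrib)
  then have "s + 8 / 3 * (4 ^ i - 1) * \<rho>\<^sup>2 + 8 * (2 ^ i * \<rho>)\<^sup>2 = s + 8 / 3 * (4 ^ Suc i - 1) * \<rho>\<^sup>2"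
    by (simp add: power_mult_distrib field_simps)
  ultimately show ?case by (simp only: mult.assoc power_Suc)
qed (use PP in simp)

text \<open>Equal steps along a straight segment in space-time, each lasting between 8 \<rho>^2 and
  15 \<rho>^2 and moving by at most one radius. The way-points stay in the admissible range of
  centres by convexity.\<close>

lemma PP_chain:
  fixes u :: "(real^'n) \<times> real \<Rightarrow> real"
  assumes g: "gro 16 \<theta> \<eta> u R K" and x: "\<And>l. \<bar>x $ l\<bar> \<le> 9" "\<And>l. \<bar>x' $ l\<bar> \<le> 9" and s: "0 < s" and \<eta>: "0 < \<eta>" "\<eta> \<le> 1"
    and L: "K \<le> \<eta> ^ N * L" "0 < L" and \<rho>: "0 < \<rho>" "16 * \<rho>\<^sup>2 \<le> sg TYPE('n) * R\<^sup>2" and PP: "PP u x s \<rho> L"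
    and N: "0 < N" "8 * \<rho>\<^sup>2 * real N \<le> s' - s" "s' - s \<le> 15 * \<rho>\<^sup>2 * real N" "(x' - x) \<bullet> (x' - x) \<le> cc TYPE('n) * \<rho>\<^sup>2 * (real N)\<^sup>2"
  shows "PP u x' s' \<rho> (\<eta> ^ N * L)"
proof -
  have "PP u (x + (real i / real N) *\<^sub>R (x' - x)) (s + real i / real N * (s' - s)) \<rho> (\<eta> ^ i * L)" if "i \<le> N" for i
    using that
  proof (induction i)
    case (Suc i)
    let ?t = "real i / real N"
    have t: "0 \<le> ?t" "?t \<le> 1" using Suc.prems by auto
    have K: "K \<le> \<eta> ^ i * L" by (rule pow_level[OF \<eta> L(2,1)]) (use Suc.prems in simp)
    have "0 \<le> 8 * \<rho>\<^sup>2 * real N" by simp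
    then have ss: "0 \<le> s' - s" using N(2) by linarith
    have e: "real (Suc i) / real N = ?t + 1 / real N" by (simp add: add_divide_distrib)
    have "PP u (x + (real (Suc i) / real N) *\<^sub>R (x' - x)) (s + real (Suc i) / real N * (s' - s)) \<rho> (\<eta> * (\<eta> ^ i * L))"
    proof (rule PP_step(2)[OF g _ _ K _ \<rho> Suc.IH])
      fix l
      have "\<bar>(x + ?t *\<^sub>R (x' - x)) $ l\<bar> = \<bar>(1 - ?t) * x $ l + ?t * x' $ l\<bar>" by (simp add: algebra_simps)
      also have "\<dots> \<le> (1 - ?t) * \<bar>x $ l\<bar> + ?t * \<bar>x' $ l\<bar>" using abs_triangle_ineq[of "(1 - ?t) * x $ l" "?t * x' $ l"] t by (simp add: abs_mult)
      also have "\<dots> \<le> (1 - ?t) * 9 + ?t * 9" using x t by (intro add_mono mult_left_mono) auto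
      finally show "\<bar>(x + ?t *\<^sub>R (x' - x)) $ l\<bar> \<le> 9" by simp
      show "0 < s + ?t * (s' - s)" using s ss t by (intro add_pos_nonneg mult_nonneg_nonneg) auto
      show "0 < \<eta> ^ i * L" using \<eta> L by simp
      show "i \<le> N" using Suc.prems by simp
      have d: "s + real (Suc i) / real N * (s' - s) - (s + ?t * (s' - s)) = (s' - s) / real N" unfolding e by (simp add: algebra_simps)
      show "8 * \<rho>\<^sup>2 \<le> s + real (Suc i) / real N * (s' - s) - (s + ?t * (s' - s))" unfolding d using N by (simp add: le_divide_eq)
      show "s + real (Suc i) / real N * (s' - s) - (s + ?t * (s' - s)) \<le> 15 * \<rho>\<^sup>2" unfolding d using N by (simp add: divide_le_eq)
      have "x + (real (Suc i) / real N) *\<^sub>R (x' - x) - (x + ?t *\<^sub>R (x' - x)) = (1 / real N) *\<^sub>R (x' - x)" unfolding e by (simp add: algebra_simps)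
      then show "(x + (real (Suc i) / real N) *\<^sub>R (x' - x) - (x + ?t *\<^sub>R (x' - x))) \<bullet> (x + (real (Suc i) / real N) *\<^sub>R (x' - x) - (x + ?t *\<^sub>R (x' - x))) \<le> cc TYPE('n) * \<rho>\<^sup>2"
        using N(1,4) by (simp add: divide_le_eq power2_eq_square)
    qed
    then show ?case by (simp add: mult.assoc)
  qed (use PP in simp)
  from this[of N] show ?thesis using N(1) by simp
qed

text \<open>With \<rho>^2 = \<open>kap\<close> h, where h is the height of a cube, the tip of the
  paraboloid has squared radius at most \<open>cc\<close> \<rho>^2 = h / 4, so it fits into the cube
  around its centre.\<close>

definition kap :: "'n::finite itself \<Rightarrow> real" where "kap _ = 1 / (4 * cc TYPE('n))"

lemma kap: "0 < kap TYPE('n::finite)" "kap TYPE('n) \<le> 1/64" "cc TYPE('n) * kap TYPE('n) = 1/4"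
  using cc_sg(1)[where 'n='n] by (auto simp: kap_def field_simps)

lemma inner_le_card:
  fixes x :: "real^'n"
  assumes "\<And>l. \<bar>x $ l\<bar> \<le> d"
  shows "x \<bullet> x \<le> real CARD('n) * d\<^sup>2"
proof -
  have "x $ l * x $ l \<le> d\<^sup>2" for l
    using power_mono[OF assms[of l] abs_ge_zero, of 2] by (simp add: power2_eq_square)
  then have "x \<bullet> x \<le> (\<Sum>l\<in>(UNIV::'n set). d\<^sup>2)" unfolding inner_vec_def by (intro sum_mono) simp
  then show ?thesis by simp
qed

text \<open>The doublings end at a squared scale h by time 2 + 1/24, so the time left to a point of
  J2 is between 6.9 and 10. As N h lies between 2/3 and 2/3 + h, this time lies between 8 h N and 15
  h N, which is what chaining requires.\<close>

lemma PP_propagate: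
  fixes u :: "(real^'n) \<times> real \<Rightarrow> real"
  assumes g: "gro 16 \<theta> \<eta> u R K" and x: "\<And>l. \<bar>x $ l\<bar> \<le> 2" and s: "0 < s" "s \<le> 2" and \<eta>: "0 < \<eta>" "\<eta> \<le> 1"
    and \<rho>: "0 < \<rho>" "16 * (2 ^ i * \<rho>)\<^sup>2 \<le> sg TYPE('n) * R\<^sup>2" "(2 ^ i * \<rho>)\<^sup>2 \<le> 1/64" and N: "N = nat \<lceil>2 / (3 * (2 ^ i * \<rho>)\<^sup>2)\<rceil>"
    and L: "K \<le> \<eta> ^ (i + N) * L" "0 < L" and PP: "PP u x s \<rho> L" and z: "\<And>l. \<bar>fst z $ l\<bar> < 1" "9 < snd z" "snd z \<le> 10"
  shows "\<eta> ^ (i + N) * L \<le> u z"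
proof -
  define h where "h = (2 ^ i * \<rho>)\<^sup>2"
  have h: "0 < h" "h \<le> 1/64" using \<rho> by (auto simp: h_def)
  define s1 where "s1 = s + 8 / 3 * (4 ^ i - 1) * \<rho>\<^sup>2"
  have hi: "h = 4 ^ i * \<rho>\<^sup>2"
    by (simp add: h_def power_mult_distrib power2_eq_square flip: power_mult_distrib[of 2 2])
  have "0 \<le> (4 ^ i - 1) * \<rho>\<^sup>2" by simp
  moreover have "(4 ^ i - 1) * \<rho>\<^sup>2 = h - \<rho>\<^sup>2" unfolding hi by (simp add: algebra_simps)
  moreover have "0 < \<rho>\<^sup>2" using \<rho> by simp
  moreover have "s1 = s + 8 / 3 * ((4 ^ i - 1) * \<rho>\<^sup>2)" by (simp add: s1_def)
  ultimately have s1: "0 < s1" "s1 \<le> 2 + 1/24" using s h by linarith+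
  have Kb: "K \<le> \<eta> ^ i * L" by (rule pow_level[OF \<eta> L(2,1)]) simp
  have x9: "\<bar>x $ l\<bar> \<le> 9" for l using x[of l] by linarith
  have P1: "PP u x s1 (2 ^ i * \<rho>) (\<eta> ^ i * L)"
    unfolding s1_def by (rule PP_doubling[OF g x9 s(1) \<eta> Kb L(2) \<rho>(1,2) PP])
  have N1: "2 / (3 * h) \<le> real N" unfolding N h_def by (rule real_nat_ceiling_ge)
  have N2: "real N \<le> 2 / (3 * h) + 1" unfolding N h_def[symmetric] using h by (simp add: of_nat_ceiling order.strict_implies_order)
  have N3: "2 / 3 \<le> h * real N" "h * real N \<le> 2 / 3 + h"
    using mult_left_mono[OF N1, of h] mult_left_mono[OF N2, of h] h by (auto simp: distrib_left)
  have N4: "2 \<le> real N"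
  proof (rule ccontr)
    assume "\<not> 2 \<le> real N"
    then have "h * real N \<le> 1/64 * 2" using h by (intro mult_mono) auto
    then show False using N3 by simp
  qed
  have "PP u (fst z) (snd z) (2 ^ i * \<rho>) (\<eta> ^ N * (\<eta> ^ i * L))"
  proof (rule PP_chain[OF g x9 _ s1(1) \<eta> _ _ _ \<rho>(2) P1])
    show "\<bar>fst z $ l\<bar> \<le> 9" for l using z(1)[of l] by linarith
    show "K \<le> \<eta> ^ N * (\<eta> ^ i * L)" using L(1) by (simp add: power_add mult_ac)
    show "0 < \<eta> ^ i * L" "0 < 2 ^ i * \<rho>" "0 < N" using \<eta> L \<rho> N4 by auto
    show "8 * (2 ^ i * \<rho>)\<^sup>2 * real N \<le> snd z - s1" "snd z - s1 \<le> 15 * (2 ^ i * \<rho>)\<^sup>2 * real N"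
      unfolding h_def[symmetric] using N3 h s1 z by (simp_all add: mult.assoc)
    have "\<bar>(fst z - x) $ l\<bar> \<le> 3" for l using x[of l] z(1)[of l] by simp
    from inner_le_card[OF this] have "(fst z - x) \<bullet> (fst z - x) \<le> cc TYPE('n) * 1" by (simp add: cc_def)
    also have "\<dots> \<le> cc TYPE('n) * (h * (real N)\<^sup>2)"
    proof (rule mult_left_mono)
      have "2 / 3 * 2 \<le> (h * real N) * real N" using N3 N4 by (intro mult_mono) auto
      then show "1 \<le> h * (real N)\<^sup>2" by (simp add: power2_eq_square mult.assoc)
    qed (simp add: cc_def)
    finally show "(fst z - x) \<bullet> (fst z - x) \<le> cc TYPE('n) * (2 ^ i * \<rho>)\<^sup>2 * (real N)\<^sup>2" by (simp add: h_def mult.assoc)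
  qed
  moreover have "z \<in> Q10"
  proof -
    have "- 10 < fst z $ l \<and> fst z $ l < 10" for l using z(1)[of l] by linarith
    then show ?thesis using z by (auto simp: Q10_iff mem_box_cart)
  qed
  ultimately have "\<eta> ^ N * (\<eta> ^ i * L) \<le> u z"
    unfolding PP_def by (elim ballE[of _ _ z]) (auto simp: cc_def)
  then show ?thesis by (simp add: power_add mult_ac)
qed

section \<open>Dense cubes and the stacks above them\<close>

definition ctr :: "nat \<times> ('n \<Rightarrow> int) \<times> int \<Rightarrow> real^'n" where
  "ctr i = (\<chi> l. (real_of_int (fst (snd i) l) + 1/2) / 2 ^ fst i)"

definition dense_in :: "real \<Rightarrow> ((real^'n) \<times> real) set \<Rightarrow> nat \<times> ('n \<Rightarrow> int) \<times> int \<Rightarrow> bool" where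
  "dense_in d V i \<longleftrightarrow> ennreal (1 - d) * vol (cube i) \<le> vol (cube i \<inter> V)"

lemma dense_in_Diff:
  fixes i :: "nat \<times> ('n::finite \<Rightarrow> int) \<times> int"
  assumes V [measurable]: "V \<in> sets borel" and d: "dense_in d V i" "0 \<le> d" "d \<le> 1"
  shows "vol (cube i - V) \<le> ennreal (d * (1 / 2 ^ fst i) ^ (CARD('n) + 2))"
proof -
  have fin: "vol (cube i) < top" using emeasure_cube_le[of i] by (rule le_less_trans) simp
  have "vol (cube i \<inter> V) \<le> vol (cube i)" by (rule emeasure_mono) simp_all
  then have fin': "vol (cube i \<inter> V) < top" using fin by (rule le_less_trans)
  obtain x where x: "0 \<le> x" "vol (cube i) = ennreal x" using fin by (cases "vol (cube i)") auto
  obtain y where y: "0 \<le> y" "vol (cube i \<inter> V) = ennreal y" using fin' by (cases "vol (cube i \<inter> V)") auto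
  have xy: "(1 - d) * x \<le> y" using d(1) d(3) x y by (simp add: dense_in_def ennreal_mult[symmetric])
  have xr: "x \<le> (1 / 2 ^ fst i) ^ (CARD('n) + 2)" using emeasure_cube_le[of i] x by (simp del: power_one_over add: power_divide)
  have "vol (cube i - V) = vol (cube i - cube i \<inter> V)" by (rule arg_cong[where f = "emeasure lborel"]) auto
  also have "\<dots> = ennreal x - ennreal y" using fin' x y by (subst emeasure_Diff) auto
  also have "\<dots> = ennreal (x - y)" using y by (simp add: ennreal_minus)
  also have "\<dots> \<le> ennreal (d * x)" using xy by (intro ennreal_leI) (simp add: algebra_simps)
  also have "\<dots> \<le> ennreal (d * (1 / 2 ^ fst i) ^ (CARD('n) + 2))" using xr d by (intro ennreal_leI mult_left_mono)
  finally show ?thesis .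
qed

text \<open>Roofs are integer multiples of the height of the cube, so a cube with positive roof lies
  entirely in positive time.\<close>

lemma roof_ge: "0 < roof i \<Longrightarrow> 1 / 4 ^ fst i \<le> roof i"
proof -
  assume "0 < roof i"
  then have "snd (snd i) < 0" by (simp add: roof_def divide_less_0_iff)
  then have "1 \<le> real_of_int (- snd (snd i))" by linarith
  then show ?thesis unfolding roof_def by (intro divide_right_mono) auto
qed

text \<open>The vertex is put at the centre of the base, one eighth of the cube's height above its
  bottom, which makes the vertex time positive. The tip lies in the cube, so its exceptional set has
  at most the measure missing from the dense cube. The bound is read off from time 2 \<rho>^2 after
  the vertex on, when the inner paraboloid has squared radius \<open>cc\<close> \<rho>^2.\<close>

lemma dense_PP:
  fixes u :: "(real^'n) \<times> real \<Rightarrow> real" and i :: "nat \<times> ('n \<Rightarrow> int) \<times> int"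
  assumes g: "gro 16 \<theta> \<eta> u R K" and d: "0 \<le> d" "d \<le> 1" "d \<le> \<theta> * sqrt (kap TYPE('n)) ^ (CARD('n) + 2)"
    and i: "16 * (kap TYPE('n) / 4 ^ fst i) \<le> sg TYPE('n) * R\<^sup>2" "0 < roof i" "\<And>l. \<bar>ctr i $ l\<bar> \<le> 9"
    and L: "K \<le> L" "0 < L" and V: "{w \<in> Q10. L < u w} \<in> sets borel" "dense_in d {w \<in> Q10. L < u w} i"
  shows "PP u (ctr i) (roof i - 7 / 8 / 4 ^ fst i + 2 * (kap TYPE('n) / 4 ^ fst i)) (sqrt (kap TYPE('n)) / 2 ^ fst i) (\<eta> * L)"
proof -
  define h :: real where "h = 1 / 4 ^ fst i"
  define \<rho> where "\<rho> = sqrt (kap TYPE('n)) / 2 ^ fst i"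
  define a where "a = roof i - 7 / 8 * h"
  have c: "0 < cc TYPE('n)" using cc_sg(1)[where 'n='n] by linarith
  have h0: "0 < h" by (simp add: h_def)
  have \<rho>0: "0 < \<rho>" using kap(1)[where 'n='n] by (simp add: \<rho>_def)
  have r2: "\<rho>\<^sup>2 = kap TYPE('n) * h"
    using kap(1)[where 'n='n] by (simp add: \<rho>_def h_def power_divide power2_eq_square[of "2 ^ _"] flip: power_mult_distrib)
  have r3: "\<rho>\<^sup>2 \<le> h / 64" unfolding r2 using mult_right_mono[OF kap(2)[where 'n='n], of h] h0 by simp
  have cr: "cc TYPE('n) * \<rho>\<^sup>2 = h / 4" unfolding r2 using kap(3)[where 'n='n] by (simp add: mult.assoc[symmetric])
  have "h \<le> roof i" using roof_ge[OF i(2)] by (simp add: h_def)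
  then have a0: "0 < a" using h0 by (simp add: a_def)
  have "{z \<in> Q10. (fst z - ctr i) \<bullet> (fst z - ctr i) < cc TYPE('n) * (snd z - a) \<and> snd z - a \<le> \<rho>\<^sup>2 \<and> u z < L} \<subseteq> cube i - {w \<in> Q10. L < u w}"
  proof (intro subsetI, elim CollectE conjE)
    fix z assume z: "z \<in> Q10" "(fst z - ctr i) \<bullet> (fst z - ctr i) < cc TYPE('n) * (snd z - a)" "snd z - a \<le> \<rho>\<^sup>2" "u z < L"
    have "0 < cc TYPE('n) * (snd z - a)" using z(2) inner_ge_zero[of "fst z - ctr i"] by linarith
    then have t: "a < snd z" using c by (simp add: zero_less_mult_iff)
    have "cc TYPE('n) * (snd z - a) \<le> cc TYPE('n) * \<rho>\<^sup>2" using z(3) c by (intro mult_left_mono) auto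
    then have "(norm (fst z - ctr i))\<^sup>2 < (1 / (2 * 2 ^ fst i))\<^sup>2"
      using z(2) cr by (simp add: power2_norm_eq_inner h_def power_divide power_mult_distrib power2_eq_square[of "2 ^ _"] flip: power_mult_distrib[of 2 2])
    then have n: "norm (fst z - ctr i) < 1 / (2 * 2 ^ fst i)" by (rule power2_less_imp_less) simp
    have "\<lfloor>2 ^ fst i * fst z $ l\<rfloor> = fst (snd i) l" for l
    proof -
      have "\<bar>fst z $ l - ctr i $ l\<bar> < 1 / (2 * 2 ^ fst i)" using component_le_norm_cart[of "fst z - ctr i" l] n by simp
      then have "2 ^ fst i * \<bar>fst z $ l - ctr i $ l\<bar> < 1 / 2" by (simp add: field_simps)
      then have "\<bar>2 ^ fst i * (fst z $ l - ctr i $ l)\<bar> < 1 / 2" by (simp add: abs_mult)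
      moreover have "2 ^ fst i * (fst z $ l - ctr i $ l) = 2 ^ fst i * fst z $ l - (real_of_int (fst (snd i) l) + 1/2)"
        by (simp add: ctr_def right_diff_distrib)
      ultimately show ?thesis unfolding floor_eq_iff by linarith
    qed
    then have "z \<in> cube i" using t z(3) r3 h0 unfolding a_def cube_eq base_def h_def
      by (cases z) auto
    then show "z \<in> cube i - {w \<in> Q10. L < u w}" using z(4) by simp
  qed
  then have "vol {z \<in> Q10. (fst z - ctr i) \<bullet> (fst z - ctr i) < cc TYPE('n) * (snd z - a) \<and> snd z - a \<le> \<rho>\<^sup>2 \<and> u z < L}
      \<le> vol (cube i - {w \<in> Q10. L < u w})"
    using V(1) by (intro emeasure_mono) auto
  also have "\<dots> \<le> ennreal (d * (1 / 2 ^ fst i) ^ (CARD('n) + 2))" by (rule dense_in_Diff[OF V d(1,2)])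
  also have "d * (1 / 2 ^ fst i) ^ (CARD('n) + 2) \<le> \<theta> * sqrt (kap TYPE('n)) ^ (CARD('n) + 2) * (1 / 2 ^ fst i) ^ (CARD('n) + 2)"
    using d(3) by (intro mult_right_mono) auto
  also have "\<dots> = \<theta> * (sqrt (kap TYPE('n)) * (1 / 2 ^ fst i)) ^ (CARD('n) + 2)"
    unfolding power_mult_distrib by (simp only: mult.assoc)
  also have "\<dots> = \<theta> * \<rho> ^ (CARD('n) + 2)" by (simp add: \<rho>_def)
  finally have e: "vol {z \<in> Q10. (fst z - ctr i) \<bullet> (fst z - ctr i) < cc TYPE('n) * (snd z - a) \<and> snd z - a \<le> \<rho>\<^sup>2 \<and> u z < L}
      \<le> ennreal (\<theta> * \<rho> ^ (CARD('n) + 2))" by (simp add: ennreal_leI)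
  have r16: "16 * \<rho>\<^sup>2 \<le> sg TYPE('n) * R\<^sup>2" using i(1) unfolding r2 h_def by simp
  have "PP u (ctr i) (a + 2 * \<rho>\<^sup>2) \<rho> (\<eta> * L)"
    unfolding PP_def
  proof (intro ballI impI, elim conjE)
    fix z assume z: "z \<in> Q10" "(fst z - ctr i) \<bullet> (fst z - ctr i) \<le> cc TYPE('n) * \<rho>\<^sup>2" "a + 2 * \<rho>\<^sup>2 \<le> snd z" "snd z \<le> a + 2 * \<rho>\<^sup>2 + \<rho>\<^sup>2"
    have "cc TYPE('n) * (2 * \<rho>\<^sup>2) \<le> cc TYPE('n) * (snd z - a)" using z(3) c by (intro mult_left_mono) auto
    moreover have "0 < \<rho>\<^sup>2" using \<rho>0 by simp
    ultimately show "\<eta> * L \<le> u z"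
      using g[unfolded gro_def, rule_format, OF i(3) a0 L \<rho>0 r16 e z(1)] z(2-4) by simp
  qed
  then show ?thesis unfolding a_def r2 by (simp add: h_def \<rho>_def)
qed

text \<open>Growth is used twice: into a small set in the dense child, and from there over the
  stack. In units of the child's height h, the stack ends at most 4 m + 4 above the child's roof and
  the start is less than 1 below it, hence the horizon (4 m + 5) h. The parent is covered because at
  height h / 2 the inner squared radius is already 4 n h, while 2 sqrt h is the side of the
  parent.\<close>

lemma dense_stack:
  fixes u :: "(real^'n) \<times> real \<Rightarrow> real" and i i' :: "nat \<times> ('n \<Rightarrow> int) \<times> int"
  assumes g: "gro 16 \<theta> \<eta> u R K" and gm: "gro ((4 * m + 5) / kap TYPE('n)) \<theta>' \<eta> u R K" and \<eta>: "0 < \<eta>"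
    and d: "0 \<le> d" "d \<le> 1" "d \<le> \<theta> * sqrt (kap TYPE('n)) ^ (CARD('n) + 2)"
    and i: "(4 * m + 5) / 4 ^ fst i \<le> sg TYPE('n) * R\<^sup>2" "0 < roof i" "\<And>l. \<bar>ctr i $ l\<bar> \<le> 9" and m: "0 < m"
    and L: "K \<le> L" "K \<le> \<eta> * L" "0 < L" and V: "{w \<in> Q10. L < u w} \<in> sets borel" "dense_in d {w \<in> Q10. L < u w} i"
    and i': "fst i = Suc (fst i')" "cube i \<subseteq> cube i'"
    and w: "w \<in> Q10" "fst w \<in> base i'" "roof i' < snd w" "snd w \<le> roof i' + m / 4 ^ fst i'"
  shows "\<eta> * (\<eta> * L) \<le> u w"
proof -
  define k where "k = kap TYPE('n)"
  note k = kap[where 'n='n, folded k_def]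
  define h :: real where "h = 1 / 4 ^ fst i"
  have h: "0 < h" "1 / 4 ^ fst i' = 4 * h" by (simp_all add: h_def i'(1))
  have kh: "k * h \<le> h / 64" "0 < k * h" using mult_right_mono[OF k(2), of h] h k(1) by auto
  define s where "s = roof i - 7 / 8 * h + 2 * (k * h)"
  have r2: "(sqrt k / 2 ^ fst i)\<^sup>2 = k * h"
    using k(1) by (simp add: h_def power_divide power2_eq_square[of "2 ^ _"] flip: power_mult_distrib)
  have mh: "(4 * m + 5) * h \<le> sg TYPE('n) * R\<^sup>2" using i(1) by (simp add: h_def)
  have mh0: "0 < m * h" using m h by simp
  have "16 * (k * h) \<le> sg TYPE('n) * R\<^sup>2"
  proof -
    have "(4 * m + 5) * h = 4 * (m * h) + 5 * h" by (simp add: algebra_simps)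
    then show ?thesis using mh kh mh0 h(1) by linarith
  qed
  then have "16 * (k / 4 ^ fst i) \<le> sg TYPE('n) * R\<^sup>2" by (simp add: h_def)
  then have P: "PP u (ctr i) s (sqrt k / 2 ^ fst i) (\<eta> * L)"
    using dense_PP[OF g d _ i(2,3) L(1,3) V] unfolding s_def k_def h_def by simp
  have "h \<le> roof i" using roof_ge[OF i(2)] by (simp add: h_def)
  then have s0: "0 < s" using kh h unfolding s_def by linarith
  have "(ctr i, roof i) \<in> cube i" by (simp add: cube_eq base_def ctr_def floor_eq_iff)
  then have "(ctr i, roof i) \<in> cube i'" using i'(2) by blast
  then have v: "ctr i \<in> base i'" "roof i' - 4 * h < roof i" "roof i \<le> roof i'" using h(2) by (auto simp: cube_eq)
  have wl: "\<bar>(fst w - ctr i) $ l\<bar> \<le> 1 / 2 ^ fst i'" for l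
  proof -
    have "\<lfloor>2 ^ fst i' * fst w $ l\<rfloor> = \<lfloor>2 ^ fst i' * ctr i $ l\<rfloor>" using w(2) v(1) by (simp add: base_def)
    then have "\<bar>2 ^ fst i' * fst w $ l - 2 ^ fst i' * ctr i $ l\<bar> \<le> 1" by linarith
    then have "2 ^ fst i' * \<bar>(fst w - ctr i) $ l\<bar> \<le> 1" by (simp add: abs_mult flip: right_diff_distrib)
    then show ?thesis by (simp add: field_simps)
  qed
  have "(fst w - ctr i) \<bullet> (fst w - ctr i) \<le> real CARD('n) * (4 * h)"
    using inner_le_card[OF wl] h(2) by (simp add: power_divide power2_eq_square[of "2 ^ _"] flip: power_mult_distrib)
  also have "\<dots> \<le> cc TYPE('n) * (snd w - s) / 2"
  proof -
    have "h / 2 \<le> snd w - s" using w(3) v(3) kh h unfolding s_def by linarith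
    then have "real CARD('n) * (h / 2) \<le> real CARD('n) * (snd w - s)" by (intro mult_left_mono) auto
    then show ?thesis by (simp add: cc_def)
  qed
  finally have 1: "(fst w - ctr i) \<bullet> (fst w - ctr i) \<le> cc TYPE('n) * (snd w - s) / 2" .
  show ?thesis
  proof (rule PP_gro[OF gm i(3) s0 L(2) _ _ _ P w(1) 1])
    show "0 < \<eta> * L" using \<eta> L by simp
    show "0 < sqrt k / 2 ^ fst i" using k by simp
    have e: "(4 * m + 5) / kap TYPE('n) * (sqrt k / 2 ^ fst i)\<^sup>2 = (4 * m + 5) * h" unfolding r2 using k(1) by (simp add: k_def)
    show "(4 * m + 5) / kap TYPE('n) * (sqrt k / 2 ^ fst i)\<^sup>2 \<le> sg TYPE('n) * R\<^sup>2" unfolding e by (rule mh)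
    show "(sqrt k / 2 ^ fst i)\<^sup>2 \<le> snd w - s" unfolding r2 using w(3) v(3) kh h unfolding s_def by linarith
    have "m / 4 ^ fst i' = 4 * (m * h)" using h(2) by (simp add: h_def i'(1))
    then show "snd w - s \<le> (4 * m + 5) / kap TYPE('n) * (sqrt k / 2 ^ fst i)\<^sup>2"
      unfolding e s_def distrib_right mult.assoc using w(4) v(2) kh h by linarith
  qed
qed

section \<open>Decay of superlevel sets\<close>

text \<open>Half-open in space like the cubes: [-1, 1) is a union of dyadic intervals of each
  generation, so a stack over a cube that meets the window does not leave it sideways.\<close>

definition win :: "real \<Rightarrow> ((real^'n) \<times> real) set" where
  "win \<tau> = {z. (\<forall>l. - 1 \<le> fst z $ l \<and> fst z $ l < 1) \<and> 0 < snd z \<and> snd z \<le> \<tau>}"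

lemma win_borel: "(win \<tau> :: ((real^'n) \<times> real) set) \<in> sets borel"
proof -
  have 1: "closed {z :: 'n pt. (\<forall>l. - 1 \<le> fst z $ l) \<and> snd z \<le> \<tau>}"
    by (intro closed_Collect_conj closed_Collect_all closed_Collect_le continuous_intros)
  have 2: "open ((\<Inter>l. {z :: 'n pt. fst z $ l < 1}) \<inter> {z. 0 < snd z})"
    by (intro open_Int open_INT ballI finite open_Collect_less continuous_intros)
  have "win \<tau> = {z :: 'n pt. (\<forall>l. - 1 \<le> fst z $ l) \<and> snd z \<le> \<tau>} \<inter> ((\<Inter>l. {z. fst z $ l < 1}) \<inter> {z. 0 < snd z})"
    by (auto simp: win_def)
  then show ?thesis using sets.Int[OF borel_closed[OF 1] borel_open[OF 2]] by simp
qed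

lemma win_Q10: "\<tau> \<le> 10 \<Longrightarrow> z \<in> win \<tau> \<Longrightarrow> z \<in> Q10"
proof -
  assume "\<tau> \<le> 10" and z: "z \<in> win \<tau>"
  moreover have "- 10 < fst z $ l \<and> fst z $ l < 10" for l using z unfolding win_def mem_Collect_eq by (smt (verit))
  ultimately show ?thesis by (auto simp: Q10_iff win_def mem_box_cart)
qed

lemma superlevel_open:
  fixes u :: "(real^'n) \<times> real \<Rightarrow> real"
  assumes uc: "continuous_on Q10 u"
  shows "\<exists>U. open U \<and> {w \<in> Q10. L < u w} = Q10 \<inter> U"
proof -
  have "openin (top_of_set Q10) (Q10 \<inter> u -` {L<..})"
    using uc by (simp add: continuous_openin_preimage_gen)
  then obtain U where "open U" "Q10 \<inter> u -` {L<..} = Q10 \<inter> U" by (auto simp: openin_open)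
  moreover have "{w \<in> Q10. L < u w} = Q10 \<inter> u -` {L<..}" by auto
  ultimately show ?thesis by auto
qed

lemma superlevel_borel:
  fixes u :: "(real^'n) \<times> real \<Rightarrow> real"
  assumes uc: "continuous_on Q10 u"
  shows "{w \<in> Q10. L < u w} \<in> sets borel"
proof -
  obtain U where U: "open U" "{w \<in> Q10. L < u w} = Q10 \<inter> U" using superlevel_open[OF uc] by blast
  show ?thesis unfolding U(2) by (rule sets.Int[OF Q10_borel borel_open[OF U(1)]])
qed

lemma idx_close:
  fixes z w :: "(real^'n) \<times> real"
  assumes "w \<in> cube (idx j z)"
  shows "\<bar>fst w $ l - fst z $ l\<bar> \<le> 1 / 2 ^ j" "snd w \<le> snd z + 1 / 4 ^ j" "snd z \<le> snd w + 1 / 4 ^ j"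
proof -
  have e: "idx j w = idx j z" using assms by (simp add: cube_def)
  then have "\<lfloor>2 ^ j * fst w $ l\<rfloor> = \<lfloor>2 ^ j * fst z $ l\<rfloor>" by (auto simp: idx_def fun_eq_iff)
  then have "\<bar>2 ^ j * fst w $ l - 2 ^ j * fst z $ l\<bar> \<le> 1" by linarith
  then have "2 ^ j * \<bar>fst w $ l - fst z $ l\<bar> \<le> 1" by (simp add: abs_mult flip: right_diff_distrib)
  then show "\<bar>fst w $ l - fst z $ l\<bar> \<le> 1 / 2 ^ j" by (simp add: field_simps)
  have "\<lfloor>- (4 ^ j * snd w)\<rfloor> = \<lfloor>- (4 ^ j * snd z)\<rfloor>" using e by (simp add: idx_def)
  then have "4 ^ j * snd w \<le> 4 ^ j * snd z + 1" "4 ^ j * snd z \<le> 4 ^ j * snd w + 1" by linarith+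
  then show "snd w \<le> snd z + 1 / 4 ^ j" "snd z \<le> snd w + 1 / 4 ^ j" by (simp_all add: field_simps)
qed

lemma idx_roof:
  "snd z \<le> roof (idx j z)" "roof (idx j z) < snd z + 1 / 4 ^ j"
  using idx_cube[of z j] by (auto simp: cube_eq mem_Times_iff)

lemma idx_ctr: "\<bar>ctr (idx j z) $ l - fst z $ l\<bar> \<le> 1 / 2 ^ j"
proof -
  have "2 ^ j * (ctr (idx j z) $ l - fst z $ l) = real_of_int \<lfloor>2 ^ j * fst z $ l\<rfloor> + 1/2 - 2 ^ j * fst z $ l"
    by (simp add: ctr_def idx_def right_diff_distrib)
  then have "\<bar>2 ^ j * (ctr (idx j z) $ l - fst z $ l)\<bar> \<le> 1" by linarith
  then have "2 ^ j * \<bar>ctr (idx j z) $ l - fst z $ l\<bar> \<le> 1" by (simp add: abs_mult)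
  then show ?thesis by (simp add: field_simps)
qed

text \<open>Continuity takes the role of a density theorem: the superlevel set is relatively open,
  so small cubes around its points lie in it entirely. They stay in positive time by
  \<open>roof_ge\<close>.\<close>

lemma eventually_dense:
  fixes u :: "(real^'n) \<times> real \<Rightarrow> real"
  assumes uc: "continuous_on Q10 u" and z: "z \<in> win 2" "L < u z" and d: "0 \<le> d"
  shows "\<exists>j\<ge>g. dense_in d {w \<in> Q10. L < u w} (idx j z)"
proof -
  obtain U where U: "open U" "{w \<in> Q10. L < u w} = Q10 \<inter> U" using superlevel_open[OF uc] by blast
  have zQ: "z \<in> Q10" by (rule win_Q10[OF _ z(1)]) simp
  then have "z \<in> U" using U(2) z(2) by blast
  then obtain e where e: "0 < e" "ball z e \<subseteq> U" using U(1) open_contains_ball by blast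
  obtain j0 where j0: "(real CARD('n) + 1) / e < 2 ^ j0" using real_arch_pow[of 2] by auto
  define j where "j = max j0 g"
  have "2 ^ j0 \<le> (2 ^ j :: real)" by (intro power_increasing) (auto simp: j_def)
  then have "(real CARD('n) + 1) / e < 2 ^ j" using j0 by linarith
  then have j: "(real CARD('n) + 1) / 2 ^ j < e" using e(1) by (simp add: field_simps)
  have p: "1 / 2 ^ j \<le> (1::real)" "1 / 4 ^ j \<le> (1 / 2 ^ j :: real)" by (auto intro: power_mono simp: divide_simps)
  have "cube (idx j z) \<subseteq> {w \<in> Q10. L < u w}"
  proof
    fix w assume w: "w \<in> cube (idx j z)"
    note c = idx_close[OF w]
    have zw: "\<bar>fst z $ l\<bar> \<le> 1" for l using z(1) unfolding win_def mem_Collect_eq by (smt (verit))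
    have "- 10 < fst w $ l \<and> fst w $ l < 10" for l using c(1)[of l] zw[of l] p by linarith
    moreover have "0 < snd w"
    proof -
      have "0 < roof (idx j z)" using idx_roof(1)[where z = z and j = j] zQ by (auto simp: Q10_iff)
      from roof_ge[OF this] show ?thesis using w by (auto simp: cube_eq)
    qed
    moreover have "snd z \<le> 2" using z(1) by (simp add: win_def)
    then have "snd w \<le> 10" using c(2) p by linarith
    ultimately have wQ: "w \<in> Q10" by (auto simp: Q10_iff mem_box_cart)
    have "norm (w - z) \<le> norm (fst w - fst z) + norm (snd w - snd z)"
      using norm_Pair_le[of "fst w - fst z" "snd w - snd z"] by (simp add: minus_prod_def)
    also have "\<dots> \<le> (\<Sum>l\<in>UNIV. \<bar>(fst w - fst z) $ l\<bar>) + \<bar>snd w - snd z\<bar>" using norm_le_l1_cart[of "fst w - fst z"] by simp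
    also have "\<dots> \<le> (\<Sum>l\<in>(UNIV::'n set). 1 / 2 ^ j) + 1 / 2 ^ j"
      using c p by (intro add_mono sum_mono) (auto simp: abs_le_iff)
    also have "\<dots> = (real CARD('n) + 1) / 2 ^ j" by (simp add: add_divide_distrib)
    finally have "w \<in> ball z e" using j by (simp add: dist_norm norm_minus_commute)
    then show "w \<in> {w \<in> Q10. L < u w}" unfolding U(2) using e(2) wQ by blast
  qed
  then have "cube (idx j z) \<inter> {w \<in> Q10. L < u w} = cube (idx j z)" by blast
  moreover have "ennreal (1 - d) * vol (cube (idx j z)) \<le> 1 * vol (cube (idx j z))"
    using d by (intro mult_right_mono) (auto simp: ennreal_le_1)
  ultimately have "dense_in d {w \<in> Q10. L < u w} (idx j z)" by (simp add: dense_in_def)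
  moreover have "g \<le> j" by (simp add: j_def)
  ultimately show ?thesis by blast
qed

context
  fixes u :: "(real^'n) \<times> real \<Rightarrow> real" and \<theta> \<eta> R K m d B :: real and g0 N :: nat
  assumes uc: "continuous_on Q10 u"
    and g16: "gro 16 \<theta> \<eta> u R K" and gm: "gro ((4 * m + 5) / kap TYPE('n)) 0 \<eta> u R K"
    and \<eta>: "0 < \<eta>" "\<eta> < 1" and m: "0 < m" and d: "0 < d" "d < 1" "d \<le> \<theta> * sqrt (kap TYPE('n)) ^ (CARD('n) + 2)"
    and g0: "(4 * m + 5) / 4 ^ g0 \<le> sg TYPE('n) * R\<^sup>2" and N: "N = nat \<lceil>2 / (3 * (kap TYPE('n) / 4 ^ g0))\<rceil>"
    and B: "K \<le> B" "0 < B" "\<exists>z. (\<forall>l. \<bar>fst z $ l\<bar> < 1) \<and> 9 < snd z \<and> snd z \<le> 10 \<and> u z < B"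
begin

text \<open>A dense cube of generation \<open>g\<close> would force \<open>u \<ge> B\<close> on \<open>J2\<close>: \<open>g - g0\<close> doublings reach the fixed scale, from which
  \<open>N\<close> steps reach \<open>J2\<close>.\<close>

lemma sparse:
  assumes g: "g0 \<le> g" and z: "z \<in> win 2" "snd z + 1 / 4 ^ g \<le> 2" and L: "B \<le> \<eta> ^ (1 + N + (g - g0)) * L"
  shows "\<not> dense_in d {w \<in> Q10. L < u w} (idx g z)"
proof
  assume D: "dense_in d {w \<in> Q10. L < u w} (idx g z)"
  define i where "i = g - g0"
  have L0: "0 < L"
  proof (rule ccontr)
    assume "\<not> 0 < L"
    then have "\<eta> ^ (1 + N + (g - g0)) * L \<le> 0" using \<eta> by (intro mult_nonneg_nonpos) auto
    then show False using L B by linarith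
  qed
  have KL: "K \<le> \<eta> ^ k * L" if "k \<le> 1 + N + (g - g0)" for k
    using pow_level[OF \<eta>(1) _ L0 _ that, of K] \<eta> L B(1) by auto
  have zl: "\<bar>fst z $ l\<bar> \<le> 1" for l using z(1) unfolding win_def mem_Collect_eq by (smt (verit))
  have p: "1 / 2 ^ g \<le> (1::real)" by simp
  have c: "\<bar>ctr (idx g z) $ l\<bar> \<le> 2" for l using idx_ctr[of g z l] zl[of l] p by linarith
  have g4: "4 ^ g = 4 ^ g0 * (4 ^ i :: real)" using g by (simp add: i_def flip: power_add)
  note V = superlevel_borel[OF uc, of L]
  define k where "k = kap TYPE('n)"
  note k = kap[where 'n='n, folded k_def]
  have k16: "16 * (k / 4 ^ g0) \<le> sg TYPE('n) * R\<^sup>2"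
  proof -
    have "16 * (k / 4 ^ g0) \<le> (4 * m + 5) / 4 ^ g0"
      using k(2) m by (simp add: divide_right_mono)
    then show ?thesis using g0 by linarith
  qed
  have kk: "k / 4 ^ g \<le> k / 4 ^ g0" using k(1) g by (intro divide_left_mono power_increasing) auto
  have r0: "0 < roof (idx g z)" using idx_roof(1)[where z = z and j = g] z(1) by (auto simp: win_def)
  have P: "PP u (ctr (idx g z)) (roof (idx g z) - 7 / 8 / 4 ^ g + 2 * (k / 4 ^ g)) (sqrt k / 2 ^ g) (\<eta> * L)"
  proof -
    have 1: "16 * (kap TYPE('n) / 4 ^ fst (idx g z)) \<le> sg TYPE('n) * R\<^sup>2" using kk k16 by (simp add: k_def)
    have 2: "\<bar>ctr (idx g z) $ l\<bar> \<le> 9" for l using c[of l] by linarith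
    have 3: "K \<le> L" using KL[of 0] by simp
    show ?thesis using dense_PP[OF g16 less_imp_le[OF d(1)] less_imp_le[OF d(2)] d(3) 1 r0 2 3 L0 V D] by (simp add: k_def)
  qed
  obtain zb where zb: "\<And>l. \<bar>fst zb $ l\<bar> < 1" "9 < snd zb" "snd zb \<le> 10" "u zb < B" using B(3) by blast
  have rr: "(2 ^ i * (sqrt k / 2 ^ g))\<^sup>2 = k / 4 ^ g0"
  proof -
    have "(2 ^ i * (sqrt k / 2 ^ g))\<^sup>2 = 4 ^ i * k / 4 ^ g"
      using k(1) by (simp add: power_mult_distrib power_divide power2_eq_square[of "2 ^ _"] flip: power_mult_distrib[of 2 2])
    then show ?thesis unfolding g4 by simp
  qed
  have "\<eta> ^ (i + N) * (\<eta> * L) \<le> u zb"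
  proof (rule PP_propagate[OF g16 c _ _ \<eta>(1) _ _ _ _ _ _ _ P zb(1-3)])
    have h: "k / 4 ^ g \<le> 1 / 64 / 4 ^ g" "0 < k / 4 ^ g"
      using divide_right_mono[OF k(2), of "4 ^ g"] k(1) by simp_all
    have "1 / 4 ^ g \<le> roof (idx g z)" using roof_ge[OF r0] by simp
    moreover have e: "7 / 8 / 4 ^ g = 7 / 8 * (1 / 4 ^ g :: real)" "1 / 64 / 4 ^ g = 1 / 64 * (1 / 4 ^ g :: real)" "0 < (1 / 4 ^ g :: real)" by simp_all
    ultimately show "0 < roof (idx g z) - 7 / 8 / 4 ^ g + 2 * (k / 4 ^ g)" using h(2) unfolding e(1) by linarith
    show "roof (idx g z) - 7 / 8 / 4 ^ g + 2 * (k / 4 ^ g) \<le> 2" using idx_roof(2)[where z = z and j = g] z(2) h unfolding e(1,2) using e(3) by linarith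
    show "\<eta> \<le> 1" using \<eta> by simp
    show "0 < sqrt k / 2 ^ g" using k by simp
    show "16 * (2 ^ i * (sqrt k / 2 ^ g))\<^sup>2 \<le> sg TYPE('n) * R\<^sup>2" unfolding rr by (rule k16)
    have "k / 4 ^ g0 \<le> k / 1" using k(1) by (intro divide_left_mono) auto
    then show "(2 ^ i * (sqrt k / 2 ^ g))\<^sup>2 \<le> 1/64" unfolding rr using k(2) by linarith
    show "N = nat \<lceil>2 / (3 * (2 ^ i * (sqrt k / 2 ^ g))\<^sup>2)\<rceil>" unfolding rr by (simp only: N k_def)
    show "K \<le> \<eta> ^ (i + N) * (\<eta> * L)" using KL[of "1 + N + i"] by (simp add: i_def power_add mult_ac)
    show "0 < \<eta> * L" using \<eta> L0 by simp
  qed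
  then have "\<eta> ^ (1 + N + (g - g0)) * L \<le> u zb" by (simp add: i_def power_add mult_ac)
  then show False using zb(4) L by linarith
qed

text \<open>The cube of generation \<open>g\<close> around a point is not dense by
  \<open>sparse\<close>, but small ones are, so in between there is a non-dense cube with a dense
  child. In such cubes the superlevel set has relative measure at most 1 - d; the stacks over them
  have at least the fraction m / (m + 1) of their measure and lie in the lower superlevel
  set.\<close>

lemma gain:
  assumes g: "g0 \<le> g" and \<tau>: "\<tau> + (m + 1) / 4 ^ g \<le> 2" and L: "B \<le> \<eta> ^ (1 + N + (g - g0)) * L"
  shows "vol {z \<in> win \<tau>. L < u z} \<le> ennreal ((1 - d) * (m + 1) / m) * vol {z \<in> win (\<tau> + (m + 1) / 4 ^ g). \<eta> ^ 3 * L < u z}"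
proof -
  let ?V = "{w \<in> Q10. L < u w}"
  let ?E = "{z \<in> win \<tau>. L < u z}"
  let ?E' = "{z \<in> win (\<tau> + (m + 1) / 4 ^ g). \<eta> ^ 3 * L < u z}"
  note Lb = superlevel_borel[OF uc]
  have p4: "0 < (m + 1) / 4 ^ g" "1 / 4 ^ g \<le> (m + 1) / 4 ^ g" using m by (auto intro: divide_right_mono)
  have Eb: "{z \<in> win t. l < u z} \<in> sets borel" if "t \<le> 2" for t l
  proof -
    have "{z \<in> win t. l < u z} = win t \<inter> {w \<in> Q10. l < u w}" using win_Q10[of t] that by auto
    then show ?thesis using sets.Int[OF win_borel Lb] by simp
  qed
  have [measurable]: "?E \<in> sets borel" "?E' \<in> sets borel" using Eb \<tau> p4 by auto
  \<comment> \<open>Stopping cubes: not dense themselves, but with a dense child that contains a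
    point of the superlevel set.\<close>
  define F where "F = {i. \<exists>z\<in>?E. \<exists>j\<ge>g. i = idx j z \<and> \<not> dense_in d ?V i \<and> dense_in d ?V (idx (Suc j) z)}"
  have L0: "0 < L"
  proof (rule ccontr)
    assume "\<not> 0 < L"
    then have "\<eta> ^ (1 + N + (g - g0)) * L \<le> 0" using \<eta> by (intro mult_nonneg_nonpos) auto
    then show False using L B by linarith
  qed
  have KL: "K \<le> \<eta> ^ k * L" if "k \<le> 1" for k
    using pow_level[OF \<eta>(1) _ L0 _, of K "1 + N + (g - g0)" k] that \<eta> L B(1) by auto
  have E2: "z \<in> win 2" "snd z + 1 / 4 ^ g \<le> 2" if "z \<in> ?E" for z using that \<tau> p4 by (auto simp: win_def)
  have cover: "?E \<subseteq> (\<Union>i\<in>F. cube i)"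
  proof
    fix z assume z: "z \<in> ?E"
    obtain j1 where j1: "g \<le> j1" "dense_in d ?V (idx j1 z)" using eventually_dense[OF uc E2(1)[OF z], of L d g] z d by auto
    have "\<exists>j\<ge>g. \<not> dense_in d ?V (idx j z) \<and> dense_in d ?V (idx (Suc j) z)"
    proof (rule ccontr)
      assume n: "\<not> ?thesis"
      have "\<not> dense_in d ?V (idx j z)" if "g \<le> j" for j
        using that
      proof (induction rule: dec_induct)
        case base
        show ?case by (rule sparse[OF g E2[OF z] L])
      next
        case (step j)
        then show ?case using n by blast
      qed
      then show False using j1 by blast
    qed
    then obtain j where "g \<le> j" "\<not> dense_in d ?V (idx j z)" "dense_in d ?V (idx (Suc j) z)" by blast
    then have "idx j z \<in> F" unfolding F_def using z by blast
    then show "z \<in> (\<Union>i\<in>F. cube i)" using idx_cube[of z j] by blast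
  qed
  have stack: "base i \<times> {roof i<..roof i + m / 4 ^ fst i} \<subseteq> ?E'" if i: "i \<in> F" for i
  proof
    obtain z j where z: "z \<in> ?E" and j: "g \<le> j" "i = idx j z" "dense_in d ?V (idx (Suc j) z)" using i unfolding F_def by blast
    fix w assume "w \<in> base i \<times> {roof i<..roof i + m / 4 ^ fst i}"
    then have w: "fst w \<in> base i" "roof i < snd w" "snd w \<le> roof i + m / 4 ^ fst i" by auto
    have zw: "- 1 \<le> fst z $ l" "fst z $ l < 1" "0 < snd z" "snd z \<le> \<tau>" for l using z by (auto simp: win_def)
    have wx: "- 1 \<le> fst w $ l \<and> fst w $ l < 1" for l
    proof -
      have f: "\<lfloor>2 ^ j * fst w $ l\<rfloor> = \<lfloor>2 ^ j * fst z $ l\<rfloor>" using w(1) j(2) by (simp add: base_def idx_def)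
      have "- (2 ^ j) \<le> 2 ^ j * fst z $ l" "2 ^ j * fst z $ l < 2 ^ j"
        using mult_left_mono[OF zw(1)[of l], of "2 ^ j"] zw(2)[of l] by auto
      then have "- (2 ^ j) \<le> \<lfloor>2 ^ j * fst z $ l\<rfloor>" "\<lfloor>2 ^ j * fst z $ l\<rfloor> < 2 ^ j" by (auto simp: le_floor_iff floor_less_iff)
      then have "- (2 ^ j) \<le> 2 ^ j * fst w $ l" "2 ^ j * fst w $ l < 2 ^ j" unfolding f[symmetric] by (auto simp: le_floor_iff floor_less_iff)
      then have "2 ^ j * (- 1) \<le> 2 ^ j * fst w $ l" "2 ^ j * fst w $ l < 2 ^ j * 1" by auto
      then show ?thesis by (simp only: mult_le_cancel_left_pos mult_less_cancel_left_pos zero_less_power zero_less_numeral)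
    qed
    have j4: "(m + 1) / 4 ^ j \<le> (m + 1) / 4 ^ g" using m j(1) by (intro divide_left_mono power_increasing) auto
    have wt: "0 < snd w" "snd w \<le> \<tau> + (m + 1) / 4 ^ g"
      using w(2,3) idx_roof[where z = z and j = j] zw(3,4) j4 unfolding j(2) by (auto simp: add_divide_distrib)
    then have ww: "w \<in> win (\<tau> + (m + 1) / 4 ^ g)" using wx by (auto simp: win_def)
    have wQ: "w \<in> Q10" by (rule win_Q10[OF _ ww]) (use \<tau> in simp)
    have "\<eta> * (\<eta> * L) \<le> u w"
    proof (rule dense_stack[OF g16 gm \<eta>(1) _ _ d(3) _ _ _ m _ _ L0 Lb j(3) _ _ wQ w[unfolded j(2)]])
      have "(4 * m + 5) / 4 ^ Suc j \<le> (4 * m + 5) / 4 ^ g0" using m j(1) g by (intro divide_left_mono power_increasing) auto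
      then show "(4 * m + 5) / 4 ^ fst (idx (Suc j) z) \<le> sg TYPE('n) * R\<^sup>2" using g0 by simp
      show "0 < roof (idx (Suc j) z)" using idx_roof(1)[where z = z and j = "Suc j"] zw(3) by linarith
      have "1 / 2 ^ Suc j \<le> (1::real)" by (simp add: divide_le_eq del: power_Suc)
      then show "\<bar>ctr (idx (Suc j) z) $ l\<bar> \<le> 9" for l using idx_ctr[of "Suc j" z l] zw(1,2)[of l] by linarith
      show "K \<le> L" "K \<le> \<eta> * L" using KL[of 0] KL[of 1] by auto
      show "cube (idx (Suc j) z) \<subseteq> cube (idx j z)" by (rule cube_nested[of z]) (auto intro: idx_cube)
    qed (use d in auto)
    \<comment> \<open>The third factor turns u \<ge> \<eta>^2 L into the strict inequality that
      defines the next superlevel set.\<close>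
    moreover have "\<eta> ^ 3 * L < \<eta> * (\<eta> * L)" using \<eta> L0 by (simp add: power3_eq_cube mult.assoc)
    ultimately show "w \<in> ?E'" using ww by simp
  qed
  \<comment> \<open>Finite exhaustion of the countable family, since the covering estimates are for
    finite unions; continuity from below of the measure removes it at the end.\<close>
  define Fk where "Fk k = {i \<in> F. to_nat i \<le> k}" for k
  have fin: "finite (Fk k)" for k
    by (rule finite_subset[OF _ finite_vimageI[OF finite_atMost[of k] inj_to_nat]]) (auto simp: Fk_def)
  have step: "vol ((\<Union>i\<in>Fk k. cube i) \<inter> ?E) \<le> ennreal ((1 - d) * (m + 1) / m) * vol ?E'" for k
  proof -
    let ?S = "\<Union>i\<in>Fk k. base i \<times> {roof i<..roof i + m / 4 ^ fst i}"
    have "vol ((\<Union>i\<in>Fk k. cube i) \<inter> ?E) \<le> vol ((\<Union>i\<in>Fk k. cube i) \<inter> ?V)"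
    proof (rule emeasure_mono)
      show "(\<Union>i\<in>Fk k. cube i) \<inter> ?E \<subseteq> (\<Union>i\<in>Fk k. cube i) \<inter> ?V" using win_Q10[of \<tau>] \<tau> p4 by auto
      show "(\<Union>i\<in>Fk k. cube i) \<inter> ?V \<in> sets lborel" using fin Lb by (auto intro!: sets.Int sets.finite_UN)
    qed
    also have "\<dots> \<le> ennreal (1 - d) * vol (\<Union>i\<in>Fk k. cube i)"
    proof (rule density_union[OF fin Lb])
      fix i assume "i \<in> Fk k"
      then have "\<not> dense_in d ?V i" by (auto simp: Fk_def F_def)
      then show "vol (cube i \<inter> ?V) \<le> ennreal (1 - d) * vol (cube i)" by (simp add: dense_in_def)
    qed
    also have "vol (\<Union>i\<in>Fk k. cube i) = ennreal ((m + 1) / m) * (ennreal (m / (m + 1)) * vol (\<Union>i\<in>Fk k. cube i))"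
      using m by (simp add: mult.assoc[symmetric] ennreal_mult[symmetric])
    also have "ennreal (1 - d) * \<dots> \<le> ennreal (1 - d) * (ennreal ((m + 1) / m) * vol ?S)"
      by (intro mult_left_mono stack_measure[OF fin m]) auto
    also have "\<dots> \<le> ennreal (1 - d) * (ennreal ((m + 1) / m) * vol ?E')"
    proof (intro mult_left_mono emeasure_mono)
      have "Fk k \<subseteq> F" by (auto simp: Fk_def)
      then show "?S \<subseteq> ?E'" using stack by (intro UN_least) blast
    qed simp_all
    also have "\<dots> = ennreal ((1 - d) * (m + 1) / m) * vol ?E'"
      using d m by (simp add: mult.assoc[symmetric] ennreal_mult[symmetric])
    finally show ?thesis .
  qed
  have "?E = (\<Union>k. (\<Union>i\<in>Fk k. cube i) \<inter> ?E)"
  proof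
    show "?E \<subseteq> (\<Union>k. (\<Union>i\<in>Fk k. cube i) \<inter> ?E)"
    proof
      fix z assume z: "z \<in> ?E"
      then obtain i where "i \<in> F" "z \<in> cube i" using cover by blast
      then have "i \<in> Fk (to_nat i)" by (simp add: Fk_def)
      then show "z \<in> (\<Union>k. (\<Union>i\<in>Fk k. cube i) \<inter> ?E)" using z \<open>z \<in> cube i\<close> by blast
    qed
  qed auto
  then have "vol ?E = vol (\<Union>k. (\<Union>i\<in>Fk k. cube i) \<inter> ?E)" by simp
  also have "\<dots> = (SUP k. vol ((\<Union>i\<in>Fk k. cube i) \<inter> ?E))"
  proof (rule SUP_emeasure_incseq[symmetric])
    show "range (\<lambda>k. (\<Union>i\<in>Fk k. cube i) \<inter> ?E) \<subseteq> sets lborel" using fin by (auto intro!: sets.Int sets.finite_UN)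
    show "incseq (\<lambda>k. (\<Union>i\<in>Fk k. cube i) \<inter> ?E)" by (rule monoI) (auto simp: Fk_def)
  qed
  also have "\<dots> \<le> ennreal ((1 - d) * (m + 1) / m) * vol ?E'" by (intro SUP_least step)
  finally show ?thesis .
qed

text \<open>Raising the generation by one in each round makes the times added to the window shrink
  like 4^(-g), with total 4/3 of the first. The price is one more factor \<eta> per round, because
  \<open>sparse\<close> then needs one more doubling.\<close>

lemma decay_iterate:
  assumes "g0 \<le> g" "\<tau> + 4 / 3 * (m + 1) / 4 ^ g \<le> 2" "B \<le> \<eta> ^ (1 + N + (g - g0) + 4 * k) * L"
  shows "vol {z \<in> win \<tau>. L < u z} \<le> ennreal (((1 - d) * (m + 1) / m) ^ k) * vol (cbox (vec (- 1), 0) (vec 1, 2) :: ((real^'n) \<times> real) set)"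
  using assms
proof (induction k arbitrary: g \<tau> L)
  case 0
  have "0 \<le> 4 / 3 * (m + 1) / 4 ^ g" using m by simp
  then have "{z \<in> win \<tau>. L < u z} \<subseteq> cbox (vec (- 1), 0) (vec 1, 2)" using 0
    by (force simp: win_def cbox_Pair_eq mem_box_cart less_imp_le)
  then show ?case by (simp add: emeasure_mono)
next
  case (Suc k)
  let ?q = "(1 - d) * (m + 1) / m"
  have q: "0 \<le> ?q" using d m by simp
  have L0: "0 < L"
  proof (rule ccontr)
    assume "\<not> 0 < L"
    then have "\<eta> ^ (1 + N + (g - g0) + 4 * Suc k) * L \<le> 0" using \<eta> by (intro mult_nonneg_nonpos) auto
    then show False using Suc.prems(3) B by linarith
  qed
  have e: "4 / 3 * (m + 1) / 4 ^ g = (m + 1) / 4 ^ g + 4 / 3 * (m + 1) / 4 ^ Suc g" by (simp add: field_simps)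
  have p: "0 \<le> 4 / 3 * (m + 1) / 4 ^ Suc g" using m by simp
  have "vol {z \<in> win \<tau>. L < u z} \<le> ennreal ?q * vol {z \<in> win (\<tau> + (m + 1) / 4 ^ g). \<eta> ^ 3 * L < u z}"
  proof (rule gain[OF Suc.prems(1)])
    show "\<tau> + (m + 1) / 4 ^ g \<le> 2" using Suc.prems(2) p unfolding e by linarith
    show "B \<le> \<eta> ^ (1 + N + (g - g0)) * L" by (rule pow_level[OF \<eta>(1) _ L0 Suc.prems(3)]) (use \<eta> in auto)
  qed
  also have "\<dots> \<le> ennreal ?q * (ennreal (?q ^ k) * vol (cbox (vec (- 1), 0) (vec 1, 2) :: 'n pt set))"
  proof (rule mult_left_mono[OF Suc.IH[of "Suc g"]])
    show "\<tau> + (m + 1) / 4 ^ g + 4 / 3 * (m + 1) / 4 ^ Suc g \<le> 2" using Suc.prems(2) unfolding e by simp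
    have "1 + N + (g - g0) + 4 * Suc k = (1 + N + (Suc g - g0) + 4 * k) + 3" using Suc.prems(1) by simp
    then have r: "\<eta> ^ (1 + N + (g - g0) + 4 * Suc k) * L = \<eta> ^ (1 + N + (Suc g - g0) + 4 * k) * (\<eta> ^ 3 * L)" by (simp only: power_add mult.assoc)
    show "B \<le> \<eta> ^ (1 + N + (Suc g - g0) + 4 * k) * (\<eta> ^ 3 * L)" using Suc.prems(3) unfolding r .
  qed (use Suc.prems(1) in auto)
  also have "\<dots> = ennreal (?q ^ Suc k) * vol (cbox (vec (- 1), 0) (vec 1, 2) :: 'n pt set)"
    using q by (simp add: mult.assoc[symmetric] ennreal_mult[symmetric])
  finally show ?case .
qed

end

text \<open>Between consecutive levels u^\<epsilon> is at most the power of the upper one, so its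
  integral is bounded by a geometric series with ratio \<open>q * a powr \<epsilon>\<close>.\<close>

lemma layer_cake:
  fixes u :: "'a \<Rightarrow> real" and \<epsilon> q a C \<Lambda> :: real
  assumes u [measurable]: "u \<in> borel_measurable M" and pos: "\<And>z. z \<in> space M \<Longrightarrow> 0 \<le> u z"
    and C: "0 \<le> C" "emeasure M (space M) \<le> ennreal C"
    and lev: "\<And>k. emeasure M {z \<in> space M. \<Lambda> * a ^ k < u z} \<le> ennreal (q ^ k * C)"
    and \<Lambda>: "0 < \<Lambda>" and a: "1 < a" and q: "0 \<le> q" and \<epsilon>: "0 < \<epsilon>" "q * a powr \<epsilon> < 1"
  defines "S \<equiv> C + a powr \<epsilon> * C / (1 - q * a powr \<epsilon>)"
  shows "integrable M (\<lambda>z. u z powr \<epsilon>)" and "integral\<^sup>L M (\<lambda>z. u z powr \<epsilon>) \<le> \<Lambda> powr \<epsilon> * S"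
proof -
  let ?s = "q * a powr \<epsilon>"
  have s: "0 \<le> ?s" using q by simp
  define A where "A k = {z \<in> space M. \<Lambda> * a ^ k < u z}" for k
  define w where "w k = (\<Lambda> * a ^ Suc k) powr \<epsilon>" for k
  have w: "w k = \<Lambda> powr \<epsilon> * a powr \<epsilon> * (a powr \<epsilon>) ^ k" for k
  proof -
    have "(a ^ Suc k) powr \<epsilon> = (a powr \<epsilon>) ^ Suc k"
      using a by (simp add: powr_realpow[symmetric] powr_powr mult.commute del: power_Suc)
    then show ?thesis using \<Lambda> a by (simp add: w_def powr_mult mult.assoc)
  qed
  have A [measurable]: "A k \<in> sets M" for k unfolding A_def by measurable
  have "(\<integral>\<^sup>+z. ennreal (u z powr \<epsilon>) \<partial>M) \<le> (\<integral>\<^sup>+z. (ennreal (\<Lambda> powr \<epsilon>) + (\<Sum>k. ennreal (w k) * indicator (A k) z)) \<partial>M)"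
  proof (rule nn_integral_mono)
    fix z assume z: "z \<in> space M"
    show "ennreal (u z powr \<epsilon>) \<le> ennreal (\<Lambda> powr \<epsilon>) + (\<Sum>k. ennreal (w k) * indicator (A k) z)"
    proof (cases "u z \<le> \<Lambda>")
      case True
      then have "ennreal (u z powr \<epsilon>) \<le> ennreal (\<Lambda> powr \<epsilon>)" using pos[OF z] \<epsilon> by (intro ennreal_leI powr_mono2) auto
      then show ?thesis by (rule order_trans) simp
    next
      case False
      obtain k0 where "u z / \<Lambda> < a ^ k0" using real_arch_pow[OF a] by blast
      then have ex: "u z \<le> \<Lambda> * a ^ k0" using \<Lambda> by (simp add: field_simps)
      define k where "k = (LEAST k. u z \<le> \<Lambda> * a ^ k)"
      have k: "u z \<le> \<Lambda> * a ^ k" unfolding k_def using ex by (rule LeastI)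
      have "k \<noteq> 0" using k False by (cases k) auto
      then obtain j where j: "k = Suc j" by (cases k) auto
      have "\<not> u z \<le> \<Lambda> * a ^ j" using not_less_Least[of j "\<lambda>k. u z \<le> \<Lambda> * a ^ k"] j unfolding k_def by simp
      then have "z \<in> A j" using z by (simp add: A_def)
      have "ennreal (u z powr \<epsilon>) \<le> ennreal (w j) * indicator (A j) z"
        using k[unfolded j] pos[OF z] \<epsilon> \<open>z \<in> A j\<close> by (auto simp: w_def intro!: ennreal_leI powr_mono2)
      also have "\<dots> \<le> (\<Sum>k. ennreal (w k) * indicator (A k) z)"
        by (rule order_trans[OF _ sum_le_suminf[of "\<lambda>k. ennreal (w k) * indicator (A k) z" "{j}"]])
          (simp_all only: sum.insert sum.empty finite.intros empty_iff not_False_eq_True add_0_right order_refl summableI zero_le)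
      finally show ?thesis by (simp add: add_increasing)
    qed
  qed
  also have "\<dots> = ennreal (\<Lambda> powr \<epsilon>) * emeasure M (space M) + (\<Sum>k. ennreal (w k) * emeasure M (A k))"
    by (subst nn_integral_add, simp, simp, subst nn_integral_suminf, simp) (simp add: nn_integral_cmult)
  also have "\<dots> \<le> ennreal (\<Lambda> powr \<epsilon>) * ennreal C + (\<Sum>k. ennreal (\<Lambda> powr \<epsilon> * a powr \<epsilon> * C * ?s ^ k))"
  proof (intro add_mono mult_left_mono C suminf_le summableI)
    fix k
    have "ennreal (w k) * emeasure M (A k) \<le> ennreal (w k) * ennreal (q ^ k * C)"
      unfolding A_def by (intro mult_left_mono lev) simp
    also have "\<dots> = ennreal (\<Lambda> powr \<epsilon> * a powr \<epsilon> * C * ?s ^ k)"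
      using C q by (simp add: w power_mult_distrib mult_ac flip: ennreal_mult)
    finally show "ennreal (w k) * emeasure M (A k) \<le> ennreal (\<Lambda> powr \<epsilon> * a powr \<epsilon> * C * ?s ^ k)" .
  qed simp
  also have "(\<Sum>k. ennreal (\<Lambda> powr \<epsilon> * a powr \<epsilon> * C * ?s ^ k)) = ennreal (\<Lambda> powr \<epsilon> * a powr \<epsilon> * C * (1 / (1 - ?s)))"
    using C s \<epsilon>(2) by (intro suminf_ennreal_eq sums_mult geometric_sums) auto
  also have "ennreal (\<Lambda> powr \<epsilon>) * ennreal C + \<dots> = ennreal (\<Lambda> powr \<epsilon> * S)"
    using C s \<epsilon>(2) by (simp add: S_def distrib_left ennreal_plus[symmetric] ennreal_mult[symmetric] mult.assoc del: ennreal_plus)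
  finally have le: "(\<integral>\<^sup>+z. ennreal (u z powr \<epsilon>) \<partial>M) \<le> ennreal (\<Lambda> powr \<epsilon> * S)" .
  then have "(\<integral>\<^sup>+z. ennreal (u z powr \<epsilon>) \<partial>M) < top" by (rule le_less_trans) simp
  then show "integrable M (\<lambda>z. u z powr \<epsilon>)" by (intro integrableI_bounded) auto
  have "0 \<le> S" using C s \<epsilon>(2) by (simp add: S_def)
  then show "integral\<^sup>L M (\<lambda>z. u z powr \<epsilon>) \<le> \<Lambda> powr \<epsilon> * S" by (intro integral_real_bounded le) simp
qed

section \<open>The weak Harnack inequality\<close>

abbreviation (input) J1' :: "((real^'n) \<times> real) set" where "J1' \<equiv> box (vec (- 1)) (vec 1) \<times> {0<..1/2}"
abbreviation (input) J2' :: "((real^'n) \<times> real) set" where "J2' \<equiv> box (vec (- 1)) (vec 1) \<times> {9<..10}"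

lemma J1_win: "J1' \<subseteq> win (1/2)"
  by (auto simp: win_def mem_box_cart less_imp_le)

lemma J2_iff: "z \<in> J2' \<longleftrightarrow> (\<forall>l. \<bar>fst z $ l\<bar> < 1) \<and> 9 < snd z \<and> snd z \<le> 10"
  by (cases z) (auto simp: mem_box_cart abs_less_iff)

text \<open>The constants are fixed in the order forced by their dependence: growth with horizon 16
  determines the density defect \<open>d\<close>, hence \<open>m\<close>, hence the horizon of the
  second growth statement, and only then the scale \<open>R\<close> and the first generation
  \<open>g0\<close>.\<close>

lemma weak_harnack_constants:
  fixes lam Lam p q p1 X :: real and dummy :: "'n::finite itself"
  assumes lam: "0 < lam" "lam \<le> Lam" and abp: "ABP_exponent TYPE('n) lam Lam p1" and pp: "p1 < p"
    and pq: "p \<le> q" and q: "hdim TYPE('n) < q" and X: "0 \<le> X"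
  shows "\<exists>\<delta>>0. \<exists>c>0. \<exists>C\<ge>0. \<exists>\<kappa>. \<exists>a. 0 < \<kappa> \<and> \<kappa> < 1 \<and> 1 < a \<and> (\<forall>\<mu> f u B.
    in_Lp q Q10 (\<mu> :: (real^'n) \<times> real \<Rightarrow> real) \<longrightarrow> Lp_norm q Q10 \<mu> \<le> X \<longrightarrow> supersol lam Lam p \<mu> f u \<longrightarrow>
    0 < B \<longrightarrow> Lp_norm p Q10 f / \<delta> \<le> B \<longrightarrow> (\<exists>z\<in>J2'. u z < B) \<longrightarrow>
    vol (J1' :: 'n pt set) \<le> ennreal C \<and> (\<forall>k. vol {z \<in> win (1/2). B / c * a ^ k < u z} \<le> ennreal (\<kappa> ^ k * C)))"
proof -
  have T16: "1 \<le> (16 :: real)" by simp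
  \<comment> \<open>Names the conclusion of \<open>supersolution_gro\<close>, which is used with two
    horizons.\<close>
  define ok where "ok T \<delta> \<eta> \<longleftrightarrow> (\<forall>\<mu> f u R. in_Lp q Q10 (\<mu> :: 'n pt \<Rightarrow> real) \<longrightarrow> supersol lam Lam p \<mu> f u \<longrightarrow>
    0 < R \<longrightarrow> R \<le> 1 \<longrightarrow> R powr (1 - hdim TYPE('n) / q) * Lp_norm q Q10 \<mu> \<le> \<delta> \<longrightarrow>
    gro T (\<delta> powr p) \<eta> u R (Lp_norm p Q10 f / \<delta>))" for T \<delta> \<eta>
  obtain \<delta>1 \<eta>1 where \<delta>1: "0 < \<delta>1" and \<eta>1: "0 < \<eta>1" and gr1: "ok 16 \<delta>1 \<eta>1"
    using supersolution_gro[OF lam abp pp pq q T16, folded ok_def] by (elim exE conjE)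
  define k where "k = kap TYPE('n)"
  note k = kap[where 'n='n, folded k_def]
  define d where "d = min (1/2) (\<delta>1 powr p * sqrt k ^ (CARD('n) + 2))"
  have d: "0 < d" "d < 1" "d \<le> \<delta>1 powr p * sqrt k ^ (CARD('n) + 2)"
    using \<delta>1 k(1) by (auto simp: d_def)
  \<comment> \<open>The ratio (1 - d) (m + 1) / m becomes (1 - d) (1 + d) = 1 - d^2 < 1: stacking
    loses less than sparsity gains.\<close>
  define m where "m = 1 / d"
  have m: "0 < m" using d by (simp add: m_def)
  define T where "T = (4 * m + 5) / k"
  have T: "1 \<le> T" using m k by (simp add: T_def le_divide_eq)
  obtain \<delta>2 \<eta>2 where \<delta>2: "0 < \<delta>2" and \<eta>2: "0 < \<eta>2" and gr2: "ok T \<delta>2 \<eta>2"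
    using supersolution_gro[OF lam abp pp pq q T, folded ok_def] by (elim exE conjE)
  define \<delta> where "\<delta> = min \<delta>1 \<delta>2"
  have \<delta>: "0 < \<delta>" "\<delta> \<le> \<delta>1" "\<delta> \<le> \<delta>2" using \<delta>1 \<delta>2 by (auto simp: \<delta>_def)
  define \<eta> where "\<eta> = min (min \<eta>1 \<eta>2) (1/2)"
  have \<eta>: "0 < \<eta>" "\<eta> < 1" "\<eta> \<le> \<eta>1" "\<eta> \<le> \<eta>2" using \<eta>1 \<eta>2 by (auto simp: \<eta>_def)
  define \<beta> where "\<beta> = 1 - hdim TYPE('n) / q"
  have hq: "0 < q" using q by (simp add: hdim_def)
  have \<beta>: "0 < \<beta>" using q hq by (simp add: \<beta>_def divide_less_eq)
  \<comment> \<open>Solves \<open>R powr \<beta> * (X + 1) = \<delta>\<close> up to the cap at 1, so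
    the scale depends on \<mu> only through the bound X; adding 1 to X avoids division by
    zero.\<close>
  define R where "R = min 1 ((\<delta> / (X + 1)) powr (1 / \<beta>))"
  have R: "0 < R" "R \<le> 1" using \<delta> X by (auto simp: R_def)
  have RX: "R powr \<beta> * X \<le> \<delta>"
  proof -
    have "R powr \<beta> \<le> ((\<delta> / (X + 1)) powr (1 / \<beta>)) powr \<beta>" using R \<beta> by (intro powr_mono2) (auto simp: R_def)
    also have "\<dots> = \<delta> / (X + 1)" using \<beta> \<delta> X by (simp add: powr_powr)
    finally have "R powr \<beta> * X \<le> \<delta> / (X + 1) * X" using X by (intro mult_right_mono) auto
    also have "\<dots> \<le> \<delta>" using X \<delta> by (simp add: divide_le_eq)
    finally show ?thesis .
  qed
  have sR: "0 < sg TYPE('n) * R\<^sup>2" using cc_sg(2)[where 'n='n] R by simp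
  define b where "b = min (sg TYPE('n) * R\<^sup>2) 1"
  have b: "0 < b" "b \<le> sg TYPE('n) * R\<^sup>2" "b \<le> 1" using sR by (auto simp: b_def)
  \<comment> \<open>From this generation on, the growth horizons of the stacks stay below the scale
    R, and the total growth of the time window is at most 1.\<close>
  obtain g0 where g0: "(4 * m + 5) / b < 4 ^ g0" using real_arch_pow[of 4] by auto
  then have g0b: "(4 * m + 5) / 4 ^ g0 \<le> b" using b(1) by (simp add: field_simps)
  then have g0': "(4 * m + 5) / 4 ^ g0 \<le> sg TYPE('n) * R\<^sup>2" using b by linarith
  have "4 / 3 * (m + 1) / 4 ^ g0 \<le> (4 * m + 5) / 4 ^ g0" using m by (intro divide_right_mono) auto
  then have g1: "4 / 3 * (m + 1) / 4 ^ g0 \<le> 1" using g0b b by linarith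
  define N where "N = nat \<lceil>2 / (3 * (k / 4 ^ g0))\<rceil>"
  let ?box = "cbox (vec (- 1), 0) (vec 1, 2) :: 'n pt set"
  define C where "C = measure lborel ?box"
  have C: "vol ?box = ennreal C" "0 \<le> C" unfolding C_def
    using emeasure_lborel_cbox_finite[of "(vec (- 1), 0) :: 'n pt" "(vec 1, 2)"] by (auto simp: emeasure_eq_ennreal_measure)
  define \<kappa> where "\<kappa> = (1 - d) * (m + 1) / m"
  have "\<kappa> = 1 - d * d" using d by (simp add: \<kappa>_def m_def field_simps)
  moreover have "d * d < 1 * 1" using d by (intro mult_strict_mono) auto
  ultimately have \<kappa>: "0 < \<kappa>" "\<kappa> < 1" using d by auto
  \<comment> \<open>One round costs \<eta>^4 in level: three factors in \<open>gain\<close> and one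
    for the raised generation. The fixed cost of reaching J2 goes into \<open>c\<close>
    below.\<close>
  define a where "a = 1 / \<eta> ^ 4"
  have a: "1 < a" using \<eta> by (simp add: a_def power_less_one_iff)
  define c where "c = \<eta> ^ (1 + N)"
  have c: "0 < c" using \<eta> by (simp add: c_def)
  show ?thesis
  proof (rule exI[of _ \<delta>], intro conjI \<delta>(1), rule exI[of _ c], intro conjI c, rule exI[of _ C], intro conjI C(2),
      rule exI[of _ \<kappa>], rule exI[of _ a], intro conjI \<kappa> a allI impI)
    fix \<mu> f u :: "'n pt \<Rightarrow> real" and B
    assume \<mu>: "in_Lp q Q10 \<mu>" "Lp_norm q Q10 \<mu> \<le> X" and ss: "supersol lam Lam p \<mu> f u"
      and B: "0 < B" "Lp_norm p Q10 f / \<delta> \<le> B" "\<exists>z\<in>J2'. u z < B"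
    have "J1' \<subseteq> ?box" by (auto simp: cbox_Pair_eq mem_box_cart less_imp_le)
    then have "vol (J1' :: 'n pt set) \<le> vol ?box" by (intro emeasure_mono) auto
    then show "vol (J1' :: 'n pt set) \<le> ennreal C" using C by simp
    have "R powr \<beta> * Lp_norm q Q10 \<mu> \<le> \<delta>" using mult_left_mono[OF \<mu>(2), of "R powr \<beta>"] RX by simp
    then have R12: "R powr (1 - hdim TYPE('n) / q) * Lp_norm q Q10 \<mu> \<le> \<delta>1" "R powr (1 - hdim TYPE('n) / q) * Lp_norm q Q10 \<mu> \<le> \<delta>2"
      unfolding \<beta>_def using \<delta> by auto
    have fn: "Lp_norm p Q10 f / \<delta>1 \<le> Lp_norm p Q10 f / \<delta>" "Lp_norm p Q10 f / \<delta>2 \<le> Lp_norm p Q10 f / \<delta>"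
      using \<delta> \<delta>1 \<delta>2 by (auto intro!: divide_left_mono simp: Lp_norm_nonneg)
    have uc: "continuous_on Q10 u" using ss by (simp add: supersol_def Lp_viscosity_supersolution_def)
    have g16: "gro 16 (\<delta>1 powr p) \<eta> u R (Lp_norm p Q10 f / \<delta>)"
      by (rule gro_mono[OF gr1[unfolded ok_def, rule_format, OF \<mu>(1) ss R R12(1)] _ \<eta>(3) fn(1)]) auto
    have gm: "gro ((4 * m + 5) / kap TYPE('n)) 0 \<eta> u R (Lp_norm p Q10 f / \<delta>)"
      by (rule gro_mono[OF gr2[unfolded ok_def, rule_format, OF \<mu>(1) ss R R12(2), unfolded T_def k_def] _ \<eta>(4) fn(2)]) auto
    have Bex: "\<exists>z. (\<forall>l. \<bar>fst z $ l\<bar> < 1) \<and> 9 < snd z \<and> snd z \<le> 10 \<and> u z < B" using B(3) unfolding Bex_def J2_iff by blast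
    fix j
    have "vol {z \<in> win (1/2). B / c * a ^ j < u z} \<le> ennreal (((1 - d) * (m + 1) / m) ^ j) * vol ?box"
    proof (rule decay_iterate[OF uc g16 gm \<eta>(1,2) m d(1,2) d(3)[unfolded k_def] g0' N_def[unfolded k_def] B(2,1) Bex])
      show "1/2 + 4 / 3 * (m + 1) / 4 ^ g0 \<le> 2" using g1 by linarith
      show "B \<le> \<eta> ^ (1 + N + (g0 - g0) + 4 * j) * (B / c * a ^ j)"
        using \<eta> by (simp add: c_def a_def power_add power_mult power_divide)
    qed simp
    then show "vol {z \<in> win (1/2). B / c * a ^ j < u z} \<le> ennreal (\<kappa> ^ j * C)"
      using \<kappa> C by (simp add: \<kappa>_def[symmetric] ennreal_mult)
  qed
qed

theorem theorem3p4:
  fixes lam Lam p q p1 :: real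
    and \<Omega> :: "(real ^ 'n) set"
    and Q J1 J2 :: "((real ^ 'n) \<times> real) set"
    and \<mu> :: "(real ^ 'n) \<times> real \<Rightarrow> real"
  defines "\<Omega> \<equiv> box (vec (- 10)) (vec 10)"
    and "Q \<equiv> cylinder \<Omega> 10"
    and "J1 \<equiv> box (vec (- 1)) (vec 1) \<times> {0<..1/2}"
    and "J2 \<equiv> box (vec (- 1)) (vec 1) \<times> {9<..10}"
  assumes "0 < lam" and "lam \<le> Lam"
    and "ABP_exponent TYPE('n) lam Lam p1"
    and "real CARD('n) + 2 < q" and "p1 < p" and "p \<le> q"
    and "in_Lp_plus q Q \<mu>"
  shows "\<exists>\<epsilon>0>0. \<exists>C0>0. \<forall>\<mu>'. in_Lp_plus q Q \<mu>' \<and> Lp_norm q Q \<mu>' \<le> Lp_norm q Q \<mu> \<longrightarrow>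
    (\<forall>f. in_Lp_plus p Q f \<longrightarrow>
      (\<forall>u. (\<forall>z\<in>Q. 0 \<le> u z) \<and>
           Lp_viscosity_supersolution p \<Omega> 10
             (\<lambda>z \<xi> X. pucci_plus lam Lam X + \<mu>' z * norm \<xi> + f z) u \<longrightarrow>
        integrable (lebesgue_on J1) (\<lambda>z. u z powr \<epsilon>0) \<and>
        (integral\<^sup>L (lebesgue_on J1) (\<lambda>z. u z powr \<epsilon>0)) powr (1 / \<epsilon>0)
          \<le> C0 * ((INF z\<in>J2. u z) + Lp_norm p Q f)))"
proof -
  have hq: "hdim TYPE('n) < q" using \<open>real CARD('n) + 2 < q\<close> by (simp add: hdim_def)
  let ?X = "Lp_norm q Q10 \<mu>"
  obtain \<delta> c C \<kappa> a where \<delta>: "0 < \<delta>" and c: "0 < c" and C: "0 \<le> C" and \<kappa>: "0 < \<kappa>" "\<kappa> < 1" and a: "1 < a"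
    and decay: "\<forall>\<mu>' f u B.
    in_Lp q Q10 (\<mu>' :: 'n pt \<Rightarrow> real) \<longrightarrow> Lp_norm q Q10 \<mu>' \<le> ?X \<longrightarrow> supersol lam Lam p \<mu>' f u \<longrightarrow>
    0 < B \<longrightarrow> Lp_norm p Q10 f / \<delta> \<le> B \<longrightarrow> (\<exists>z\<in>J2'. u z < B) \<longrightarrow>
    vol (J1' :: 'n pt set) \<le> ennreal C \<and> (\<forall>k. vol {z \<in> win (1/2). B / c * a ^ k < u z} \<le> ennreal (\<kappa> ^ k * C))"
    using weak_harnack_constants[OF \<open>0 < lam\<close> \<open>lam \<le> Lam\<close> \<open>ABP_exponent TYPE('n) lam Lam p1\<close> \<open>p1 < p\<close> \<open>p \<le> q\<close> hq Lp_norm_nonneg[of q Q10 \<mu>]]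
    by (elim exE conjE)
  \<comment> \<open>Makes the ratio \<kappa> a^\<epsilon> of the layer series equal to the square
    root of \<kappa>.\<close>
  define \<epsilon> where "\<epsilon> = - ln \<kappa> / (2 * ln a)"
  have la: "0 < ln a" "ln \<kappa> < 0" using a \<kappa> by auto
  have \<epsilon>: "0 < \<epsilon>" using la by (simp add: \<epsilon>_def divide_neg_pos)
  have "a powr \<epsilon> = exp (- ln \<kappa> / 2)" using a la by (simp add: powr_def \<epsilon>_def)
  then have "\<kappa> * a powr \<epsilon> = exp (ln \<kappa> / 2)" using \<kappa> exp_add[of "ln \<kappa>" "- ln \<kappa> / 2"] by simp
  then have \<epsilon>1: "\<kappa> * a powr \<epsilon> < 1" using la by simp
  define S where "S = C + a powr \<epsilon> * C / (1 - \<kappa> * a powr \<epsilon>)"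
  have S: "0 \<le> S" using C \<epsilon>1 by (simp add: S_def)
  \<comment> \<open>The added 1 keeps the constant positive even for S = 0.\<close>
  define C1 where "C1 = (S powr (1 / \<epsilon>) + 1) / c"
  have C1: "0 < C1" using c by (simp add: C1_def add_nonneg_pos)
  define C0 where "C0 = C1 * (1 + 1 / \<delta>)"
  have C0: "0 < C0" using C1 \<delta> by (simp add: C0_def add_pos_pos)
  have J1b: "J1' \<in> sets lebesgue" by (intro sets_completionI_sets) (auto intro!: borel_Times)
  show ?thesis
  proof (rule exI[of _ \<epsilon>], intro conjI \<epsilon>, rule exI[of _ C0], intro conjI C0 allI impI; (elim conjE)?)
    fix \<mu>' f u :: "'n pt \<Rightarrow> real"
    assume "in_Lp_plus q Q \<mu>'" "Lp_norm q Q \<mu>' \<le> Lp_norm q Q \<mu>" "in_Lp_plus p Q f" "\<forall>z\<in>Q. 0 \<le> u z"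
      "Lp_viscosity_supersolution p \<Omega> 10 (\<lambda>z \<xi> X. pucci_plus lam Lam X + \<mu>' z * norm \<xi> + f z) u"
    then have \<mu>': "in_Lp q Q10 \<mu>'" "Lp_norm q Q10 \<mu>' \<le> ?X" and ss: "supersol lam Lam p \<mu>' f u" and u: "\<forall>z\<in>Q10. 0 \<le> u z"
      unfolding Q_def \<Omega>_def in_Lp_plus_def supersol_def by auto
    have uc: "continuous_on Q10 u" using ss by (simp add: supersol_def Lp_viscosity_supersolution_def)
    have JQ: "z \<in> Q10" if "z \<in> J1'" for z using win_Q10[of "1/2" z] J1_win that by auto
    have J2Q: "z \<in> Q10" if "z \<in> J2'" for z :: "'n pt"
    proof -
      have "- 10 < fst z $ l \<and> fst z $ l < 10" for l using that[unfolded J2_iff] by (smt (verit))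
      then show ?thesis using that by (auto simp: Q10_iff mem_box_cart)
    qed
    have J2ne: "J2' \<noteq> ({} :: 'n pt set)"
    proof -
      have "(0, 10) \<in> (J2' :: 'n pt set)" by (simp add: mem_box_cart)
      then show ?thesis by blast
    qed
    let ?I = "INF z\<in>J2'. u z"
    let ?K = "Lp_norm p Q10 f / \<delta>"
    have I0: "0 \<le> ?I" by (rule cINF_greatest[OF J2ne]) (use u J2Q in blast)
    have K0: "0 \<le> ?K" using \<delta> by (simp add: Lp_norm_nonneg)
    have mu: "u \<in> borel_measurable (lebesgue_on J1')"
      by (rule continuous_imp_measurable_on_sets_lebesgue[OF continuous_on_subset[OF uc subsetI[OF JQ]] J1b])
    \<comment> \<open>The infimum over J2 need not be attained, and it may vanish together with the
      norm of \<open>f\<close>. The decay is therefore used for every larger B, and B is sent to the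
      limit only in the final estimate.\<close>
    have bound: "integrable (lebesgue_on J1') (\<lambda>z. u z powr \<epsilon>) \<and> integral\<^sup>L (lebesgue_on J1') (\<lambda>z. u z powr \<epsilon>) \<le> (B / c) powr \<epsilon> * S"
      if B: "?I + ?K < B" for B
    proof -
      have B0: "0 < B" "?K \<le> B" using B I0 K0 by auto
      have "\<exists>z\<in>J2'. u z < B"
      proof (rule ccontr)
        assume n: "\<not> ?thesis"
        have "B \<le> ?I" by (rule cINF_greatest[OF J2ne]) (use n in force)
        then show False using B K0 by linarith
      qed
      from decay[rule_format, OF \<mu>' ss B0 this]
      have D: "emeasure lborel (J1' :: 'n pt set) \<le> ennreal C" "\<And>k. vol {z \<in> win (1/2). B / c * a ^ k < u z} \<le> ennreal (\<kappa> ^ k * C)"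
        by auto
      have em: "emeasure (lebesgue_on J1') A = vol A" if "A \<subseteq> J1'" "A \<in> sets borel" for A :: "'n pt set"
      proof -
        have A: "A \<in> sets lborel" using that(2) by simp
        have "emeasure (lebesgue_on J1') A = emeasure lebesgue A" by (rule emeasure_restrict_space) (use J1b that(1) in simp_all)
        also have "\<dots> = vol A" using A by (simp add: emeasure_completion)
        finally show ?thesis .
      qed
      have wb: "{z \<in> win (1/2). l < u z} \<in> sets borel" for l
      proof -
        have "{z \<in> win (1/2). l < u z} = win (1/2) \<inter> {w \<in> Q10. l < u w}" using win_Q10[of "1/2"] by auto
        then show ?thesis using sets.Int[OF win_borel superlevel_borel[OF uc]] by simp
      qed
      have 1: "emeasure (lebesgue_on (J1' :: 'n pt set)) (space (lebesgue_on J1')) \<le> ennreal C"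
        using D(1) em[of J1'] by (simp add: borel_Times)
      have 2: "emeasure (lebesgue_on J1') {z \<in> space (lebesgue_on J1'). B / c * a ^ k < u z} \<le> ennreal (\<kappa> ^ k * C)" for k
      proof -
        have e: "{z \<in> space (lebesgue_on J1'). B / c * a ^ k < u z} = J1' \<inter> {z \<in> win (1/2). B / c * a ^ k < u z}" using J1_win by auto
        have b: "J1' \<inter> {z \<in> win (1/2). B / c * a ^ k < u z} \<in> sets borel" by (intro sets.Int wb borel_Times) auto
        have "emeasure lborel (J1' \<inter> {z \<in> win (1/2). B / c * a ^ k < u z}) \<le> vol {z \<in> win (1/2). B / c * a ^ k < u z}"
          using wb by (intro emeasure_mono) auto
        then show ?thesis unfolding e using D(2)[of k] em[OF _ b] by simp
      qed
      have "0 < B / c" using B0 c by simp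
      from layer_cake[OF mu _ C 1 2 this a less_imp_le[OF \<kappa>(1)] \<epsilon> \<epsilon>1, folded S_def]
      show ?thesis using u JQ by auto
    qed
    let ?Z = "(integral\<^sup>L (lebesgue_on J1') (\<lambda>z. u z powr \<epsilon>)) powr (1 / \<epsilon>)"
    have "?Z \<le> C1 * (?I + ?K) + e" if e: "0 < e" for e
    proof -
      define B where "B = ?I + ?K + e / C1"
      have B: "?I + ?K < B" using e C1 by (simp add: B_def)
      then have B0: "0 < B" using I0 K0 by linarith
      have "?Z \<le> ((B / c) powr \<epsilon> * S) powr (1 / \<epsilon>)" using bound[OF B] \<epsilon> by (intro powr_mono2) auto
      also have "\<dots> = B / c * S powr (1 / \<epsilon>)" using B0 c S \<epsilon> by (subst powr_mult) (auto simp: powr_powr)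
      also have "\<dots> \<le> B / c * (S powr (1 / \<epsilon>) + 1)" using B0 c by (intro mult_left_mono) auto
      also have "\<dots> = C1 * B" by (simp add: C1_def)
      also have "\<dots> = C1 * (?I + ?K) + e" using C1 by (simp add: B_def distrib_left)
      finally show ?thesis .
    qed
    then have "?Z \<le> C1 * (?I + ?K)" by (rule field_le_epsilon)
    also have "\<dots> \<le> C1 * ((1 + 1 / \<delta>) * (?I + Lp_norm p Q10 f))"
      using C1 I0 \<delta> by (intro mult_left_mono) (auto simp: distrib_left distrib_right Lp_norm_nonneg)
    finally have Z: "?Z \<le> C0 * (?I + Lp_norm p Q10 f)" by (simp add: C0_def mult.assoc)
    show "integrable (lebesgue_on J1) (\<lambda>z. u z powr \<epsilon>)" unfolding J1_def using bound[of "?I + ?K + 1"] by simp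
    show "(integral\<^sup>L (lebesgue_on J1) (\<lambda>z. u z powr \<epsilon>)) powr (1 / \<epsilon>) \<le> C0 * ((INF z\<in>J2. u z) + Lp_norm p Q f)"
      unfolding J1_def J2_def Q_def \<Omega>_def by (rule Z)
  qed
qed

end
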